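(* Let $\Omega\subset\mathbb{R}^N$, $N\ge 2$, be a region satisfying (B2), and let $\mathcal{B}=\{b_k:k\ge 1\}$ be a sequence of DBS eigenfunctions constructed by the sequential maximization algorithm described in the context, with corresponding DBS eigenvalues $q_k=1/\beta_k$. Then the DBS eigenvalues $q_j$ each have finite multiplicity and increase to $\infty$, and $\mathcal{B}$ is a $\Delta$-orthonormal basis of the subspace $\mathcal{BH}(\Omega)$ of $H_0(\Delta,\Omega)$.
   Context: A region is a nonempty connected open subset of $\mathbb{R}^N$. All functions are real valued and derivatives are weak. (B1): $\Omega$ is bounded and $\partial\Omega$ is the union of a finite number of disjoint closed Lipschitz surfaces, each having finite surface area. $\sigma$ is $(N-1)$-dimensional Hausdorff measure on $\partial\Omega$, $\nu$ the outward unit normal, $\gamma$ the boundary trace on $H^1(\Omega)$. $H_0(\Delta,\Omega)=\{u\in H_0^1(\Omega):\Delta u\in L^2(\Omega)\}$ ($\Delta$ the weak Laplacian), a Hilbert space with inner product $[u,v]_\Delta:=a(u,v):=\int_\Omega\Delta u\,\Delta v\,dx$ and norm $\|u\|_\Delta$. "$\Delta$-orthogonal/orthonormal" means with respect to $[\cdot,\cdot]_\Delta$. For $u\in H_0(\Delta,\Omega)$, $D_\nu u\in L^2(\partial\Omega,d\sigma)$ is the normal derivative determined by $\int_{\partial\Omega}\gamma(v)D_\nu u\,d\sigma=\int_\Omega(\nabla u\cdot\nabla v+v\Delta u)\,dx$ for all $v\in H^1(\Omega)$. (B2): (B1) holds and $D_\nu$ is a compact mapping of $H_0(\Delta,\Omega)$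 into $L^2(\partial\Omega,d\sigma)$. A DBS (Dirichlet Biharmonic Steklov) eigenvalue/eigenfunction is a pair $(q,b)\in\mathbb{R}\times H_0(\Delta,\Omega)$ with $b\ne 0$ and $\int_\Omega\Delta b\,\Delta v\,dx=q\int_{\partial\Omega}D_\nu b\,D_\nu v\,d\sigma$ for all $v\in H_0(\Delta,\Omega)$. Algorithm: put $\mathcal{M}(u):=\int_{\partial\Omega}|D_\nu u|^2\,d\sigma$. For $k=1,2,\dots$, given $b_1,\dots,b_{k-1}$, let $C_k:=\{u\in H_0(\Delta,\Omega):\|u\|_\Delta\le 1,\ a(u,b_j)=0\text{ for }1\le j\le k-1\}$ and $\beta_k:=\sup_{C_k}\mathcal{M}$, and let $b_k\in C_k$ be a maximizer of $\mathcal{M}$ on $C_k$. Then $b_k$ is a DBS eigenfunction with eigenvalue $q_k=1/\beta_k$. $\mathcal{BH}(\Omega)$ is the closed subspace of all biharmonic functions in $H_0(\Delta,\Omega)$, that is, of all $b\in H_0(\Delta,\Omega)$ with $\int_\Omega\Delta b\,\Delta v\,dx=0$ for all $v\in C_c^2(\Omega)$. "Increase to $\infty$" means $q_1\le q_2\le\cdots$ and $q_j\to\infty$. *)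

theory Defs
  imports "HOL-Analysis.Analysis"
begin

text \<open>
  \<open>\<real>\<^sup>N\<close> is an arbitrary type of class \<^class>\<open>euclidean_space\<close>.  Elements of the function
  spaces below are functions on the whole type; only their values on \<open>\<Omega>\<close> (or on the boundary) up to
  null sets matter.  Weak derivatives, the weak Laplacian and the normal derivative are
  unique only up to null sets, and the operators choose a representative; all integrals in which
  they occur are independent of this choice.
\<close>

section \<open>Hausdorff measure\<close>

definition hausdorff_premeasure :: "nat \<Rightarrow> real \<Rightarrow> 'a::euclidean_space set \<Rightarrow> ennreal" where
  "hausdorff_premeasure m \<delta> A =
     (INF C \<in> {C :: nat \<Rightarrow> 'a set. A \<subseteq> (\<Union>i. C i) \<and> (\<forall>i. bounded (C i) \<and> diameter (C i) \<le> \<delta>)}.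
        \<Sum>i. if C i = {} then 0 else ennreal (unit_ball_vol (real m) * (diameter (C i) / 2) ^ m))"

definition hausdorff_outer :: "nat \<Rightarrow> 'a::euclidean_space set \<Rightarrow> ennreal" where
  "hausdorff_outer m A = (SUP \<delta>\<in>{0<..}. hausdorff_premeasure m \<delta> A)"

text \<open>The measurable sets are those of Caratheodory, which include all Borel sets.\<close>

definition hausdorff_measure :: "nat \<Rightarrow> 'a::euclidean_space measure" where
  "hausdorff_measure m =
     measure_of UNIV (lambda_system UNIV UNIV (hausdorff_outer m)) (hausdorff_outer m)"

definition surface_measure :: "'a::euclidean_space set \<Rightarrow> 'a measure" where
  "surface_measure \<Omega> = restrict_space (hausdorff_measure (DIM('a) - 1)) (frontier \<Omega>)"

section \<open>Smooth functions and test functions\<close>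

definition partial_deriv :: "'a::euclidean_space \<Rightarrow> ('a \<Rightarrow> real) \<Rightarrow> 'a \<Rightarrow> real" where
  "partial_deriv i f x = frechet_derivative f (at x) i"

primrec Ck :: "nat \<Rightarrow> ('a::euclidean_space \<Rightarrow> real) \<Rightarrow> bool" where
  "Ck 0 f \<longleftrightarrow> continuous_on UNIV f"
| "Ck (Suc k) f \<longleftrightarrow> (\<forall>x. f differentiable (at x)) \<and> (\<forall>i\<in>Basis. Ck k (partial_deriv i f))"

definition Cc :: "nat \<Rightarrow> 'a::euclidean_space set \<Rightarrow> ('a \<Rightarrow> real) set" where
  "Cc k \<Omega> = {f. Ck k f \<and> (\<exists>K. compact K \<and> K \<subseteq> \<Omega> \<and> (\<forall>x. x \<notin> K \<longrightarrow> f x = 0))}"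

definition Cc_infinity :: "'a::euclidean_space set \<Rightarrow> ('a \<Rightarrow> real) set" where
  "Cc_infinity \<Omega> = (\<Inter>k. Cc k \<Omega>)"

definition classical_laplacian :: "('a::euclidean_space \<Rightarrow> real) \<Rightarrow> 'a \<Rightarrow> real" where
  "classical_laplacian f x = (\<Sum>i\<in>Basis. partial_deriv i (partial_deriv i f) x)"

section \<open>Lebesgue and Sobolev spaces\<close>

definition L2 :: "'a measure \<Rightarrow> ('a \<Rightarrow> real) set" where
  "L2 M = {u \<in> borel_measurable M. integrable M (\<lambda>x. (u x)\<^sup>2)}"

definition has_weak_gradient ::
  "'a::euclidean_space set \<Rightarrow> ('a \<Rightarrow> real) \<Rightarrow> ('a \<Rightarrow> 'a) \<Rightarrow> bool" where
  "has_weak_gradient \<Omega> u G \<longleftrightarrow>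
     (\<forall>i\<in>Basis. (\<lambda>x. G x \<bullet> i) \<in> L2 (lebesgue_on \<Omega>) \<and>
        (\<forall>\<phi>\<in>Cc_infinity \<Omega>. (\<integral>x. u x * partial_deriv i \<phi> x \<partial>lebesgue_on \<Omega>) =
                          - (\<integral>x. (G x \<bullet> i) * \<phi> x \<partial>lebesgue_on \<Omega>)))"

definition H1 :: "'a::euclidean_space set \<Rightarrow> ('a \<Rightarrow> real) set" where
  "H1 \<Omega> = {u \<in> L2 (lebesgue_on \<Omega>). \<exists>G. has_weak_gradient \<Omega> u G}"

definition weak_gradient :: "'a::euclidean_space set \<Rightarrow> ('a \<Rightarrow> real) \<Rightarrow> 'a \<Rightarrow> 'a" where
  "weak_gradient \<Omega> u = (SOME G. has_weak_gradient \<Omega> u G)"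

definition H1_norm :: "'a::euclidean_space set \<Rightarrow> ('a \<Rightarrow> real) \<Rightarrow> real" where
  "H1_norm \<Omega> u = sqrt (\<integral>x. (u x)\<^sup>2 + (norm (weak_gradient \<Omega> u x))\<^sup>2 \<partial>lebesgue_on \<Omega>)"

definition H10 :: "'a::euclidean_space set \<Rightarrow> ('a \<Rightarrow> real) set" where
  "H10 \<Omega> = {u \<in> H1 \<Omega>. \<exists>\<phi> :: nat \<Rightarrow> 'a \<Rightarrow> real. (\<forall>n. \<phi> n \<in> Cc_infinity \<Omega>) \<and>
                (\<lambda>n. H1_norm \<Omega> (\<lambda>x. \<phi> n x - u x)) \<longlonglongrightarrow> 0}"

definition has_weak_laplacian ::
  "'a::euclidean_space set \<Rightarrow> ('a \<Rightarrow> real) \<Rightarrow> ('a \<Rightarrow> real) \<Rightarrow> bool" where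
  "has_weak_laplacian \<Omega> u f \<longleftrightarrow> f \<in> L2 (lebesgue_on \<Omega>) \<and>
     (\<forall>\<phi>\<in>Cc_infinity \<Omega>. (\<integral>x. u x * classical_laplacian \<phi> x \<partial>lebesgue_on \<Omega>) =
                       (\<integral>x. f x * \<phi> x \<partial>lebesgue_on \<Omega>))"

definition weak_laplacian :: "'a::euclidean_space set \<Rightarrow> ('a \<Rightarrow> real) \<Rightarrow> 'a \<Rightarrow> real" where
  "weak_laplacian \<Omega> u = (SOME f. has_weak_laplacian \<Omega> u f)"

definition H0_Delta :: "'a::euclidean_space set \<Rightarrow> ('a \<Rightarrow> real) set" where
  "H0_Delta \<Omega> = {u \<in> H10 \<Omega>. \<exists>f. has_weak_laplacian \<Omega> u f}"

definition inner_Delta ::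
  "'a::euclidean_space set \<Rightarrow> ('a \<Rightarrow> real) \<Rightarrow> ('a \<Rightarrow> real) \<Rightarrow> real" where
  "inner_Delta \<Omega> u v = (\<integral>x. weak_laplacian \<Omega> u x * weak_laplacian \<Omega> v x \<partial>lebesgue_on \<Omega>)"

definition norm_Delta :: "'a::euclidean_space set \<Rightarrow> ('a \<Rightarrow> real) \<Rightarrow> real" where
  "norm_Delta \<Omega> u = sqrt (inner_Delta \<Omega> u u)"

section \<open>Boundary trace and normal derivative\<close>

text \<open>
  The graph of the boundary trace \<open>\<gamma>\<close>, the continuous extension to \<open>H\<^sup>1\<close> of the restriction
  of functions that are continuously differentiable up to the boundary.
\<close>

definition has_trace ::
  "'a::euclidean_space set \<Rightarrow> ('a \<Rightarrow> real) \<Rightarrow> ('a \<Rightarrow> real) \<Rightarrow> bool" where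
  "has_trace \<Omega> v g \<longleftrightarrow> v \<in> H1 \<Omega> \<and> g \<in> L2 (surface_measure \<Omega>) \<and>
     (\<exists>\<phi> :: nat \<Rightarrow> 'a \<Rightarrow> real. (\<forall>n. Ck 1 (\<phi> n)) \<and>
        (\<lambda>n. H1_norm \<Omega> (\<lambda>x. \<phi> n x - v x)) \<longlonglongrightarrow> 0 \<and>
        (\<lambda>n. \<integral>x. (\<phi> n x - g x)\<^sup>2 \<partial>surface_measure \<Omega>) \<longlonglongrightarrow> 0)"

definition has_normal_derivative ::
  "'a::euclidean_space set \<Rightarrow> ('a \<Rightarrow> real) \<Rightarrow> ('a \<Rightarrow> real) \<Rightarrow> bool" where
  "has_normal_derivative \<Omega> u d \<longleftrightarrow> d \<in> L2 (surface_measure \<Omega>) \<and>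
     (\<forall>v g. has_trace \<Omega> v g \<longrightarrow>
        (\<integral>x. g x * d x \<partial>surface_measure \<Omega>) =
        (\<integral>x. weak_gradient \<Omega> u x \<bullet> weak_gradient \<Omega> v x + v x * weak_laplacian \<Omega> u x
           \<partial>lebesgue_on \<Omega>))"

definition normal_derivative :: "'a::euclidean_space set \<Rightarrow> ('a \<Rightarrow> real) \<Rightarrow> 'a \<Rightarrow> real" where
  "normal_derivative \<Omega> u = (SOME d. has_normal_derivative \<Omega> u d)"

section \<open>Standing assumptions\<close>

definition region :: "'a::euclidean_space set \<Rightarrow> bool" where
  "region \<Omega> \<longleftrightarrow> \<Omega> \<noteq> {} \<and> connected \<Omega> \<and> open \<Omega>"

text \<open>
  A closed (that is, compact and without boundary) surface that is locally, with respect to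
  some unit vector \<open>e\<close>, the graph of a Lipschitz function on the hyperplane orthogonal to \<open>e\<close>.
\<close>

definition closed_Lipschitz_surface :: "'a::euclidean_space set \<Rightarrow> bool" where
  "closed_Lipschitz_surface S \<longleftrightarrow> compact S \<and> connected S \<and>
     (\<forall>p\<in>S. \<exists>U e g L. open U \<and> p \<in> U \<and> norm e = 1 \<and> L-lipschitz_on {y. y \<bullet> e = 0} g \<and>
        S \<inter> U = {x \<in> U. x \<bullet> e = g (x - (x \<bullet> e) *\<^sub>R e)})"

definition B1 :: "'a::euclidean_space set \<Rightarrow> bool" where
  "B1 \<Omega> \<longleftrightarrow> bounded \<Omega> \<and>
     (\<exists>\<S>. finite \<S> \<and> disjoint \<S> \<and> \<Union>\<S> = frontier \<Omega> \<and>
        (\<forall>S\<in>\<S>. closed_Lipschitz_surface S \<and> hausdorff_outer (DIM('a) - 1) S < \<infinity>))"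

definition B2 :: "'a::euclidean_space set \<Rightarrow> bool" where
  "B2 \<Omega> \<longleftrightarrow> B1 \<Omega> \<and>
     (\<forall>u\<in>H0_Delta \<Omega>. \<exists>d. has_normal_derivative \<Omega> u d) \<and>
     (\<forall>u :: nat \<Rightarrow> 'a \<Rightarrow> real. \<forall>R. (\<forall>n. u n \<in> H0_Delta \<Omega> \<and> norm_Delta \<Omega> (u n) \<le> R) \<longrightarrow>
        (\<exists>r d. strict_mono (r :: nat \<Rightarrow> nat) \<and> d \<in> L2 (surface_measure \<Omega>) \<and>
           (\<lambda>n. \<integral>x. (normal_derivative \<Omega> (u (r n)) x - d x)\<^sup>2 \<partial>surface_measure \<Omega>)
             \<longlonglongrightarrow> 0))"

section \<open>Dirichlet biharmonic Steklov eigenproblem\<close>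

definition DBS_eigenspace :: "'a::euclidean_space set \<Rightarrow> real \<Rightarrow> ('a \<Rightarrow> real) set" where
  "DBS_eigenspace \<Omega> q = {b \<in> H0_Delta \<Omega>. \<forall>v\<in>H0_Delta \<Omega>.
     inner_Delta \<Omega> b v =
     q * (\<integral>x. normal_derivative \<Omega> b x * normal_derivative \<Omega> v x \<partial>surface_measure \<Omega>)}"

definition DBS_eigenpair :: "'a::euclidean_space set \<Rightarrow> real \<Rightarrow> ('a \<Rightarrow> real) \<Rightarrow> bool" where
  "DBS_eigenpair \<Omega> q b \<longleftrightarrow> b \<in> DBS_eigenspace \<Omega> q \<and> \<not> (AE x in lebesgue_on \<Omega>. b x = 0)"

definition finite_multiplicity :: "'a::euclidean_space set \<Rightarrow> real \<Rightarrow> bool" where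
  "finite_multiplicity \<Omega> q \<longleftrightarrow>
     (\<exists>F. finite F \<and> F \<subseteq> DBS_eigenspace \<Omega> q \<and>
        (\<forall>u\<in>DBS_eigenspace \<Omega> q. \<exists>c :: ('a \<Rightarrow> real) \<Rightarrow> real.
           AE x in lebesgue_on \<Omega>. u x = (\<Sum>f\<in>F. c f * f x)))"

definition boundary_energy :: "'a::euclidean_space set \<Rightarrow> ('a \<Rightarrow> real) \<Rightarrow> real" where
  "boundary_energy \<Omega> u = (\<integral>x. (normal_derivative \<Omega> u x)\<^sup>2 \<partial>surface_measure \<Omega>)"

text \<open>Sequences \<open>b\<close> are indexed from 1; the value \<open>b 0\<close> is irrelevant.\<close>

definition DBS_constraint ::
  "'a::euclidean_space set \<Rightarrow> (nat \<Rightarrow> 'a \<Rightarrow> real) \<Rightarrow> nat \<Rightarrow> ('a \<Rightarrow> real) set" where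
  "DBS_constraint \<Omega> b k =
     {u \<in> H0_Delta \<Omega>. norm_Delta \<Omega> u \<le> 1 \<and> (\<forall>j\<in>{1..<k}. inner_Delta \<Omega> u (b j) = 0)}"

definition DBS_beta :: "'a::euclidean_space set \<Rightarrow> (nat \<Rightarrow> 'a \<Rightarrow> real) \<Rightarrow> nat \<Rightarrow> real" where
  "DBS_beta \<Omega> b k = (SUP u\<in>DBS_constraint \<Omega> b k. boundary_energy \<Omega> u)"

definition DBS_algorithm :: "'a::euclidean_space set \<Rightarrow> (nat \<Rightarrow> 'a \<Rightarrow> real) \<Rightarrow> bool" where
  "DBS_algorithm \<Omega> b \<longleftrightarrow> (\<forall>k\<ge>1. b k \<in> DBS_constraint \<Omega> b k \<and>
     (\<forall>u\<in>DBS_constraint \<Omega> b k. boundary_energy \<Omega> u \<le> boundary_energy \<Omega> (b k)))"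

definition BH :: "'a::euclidean_space set \<Rightarrow> ('a \<Rightarrow> real) set" where
  "BH \<Omega> = {b \<in> H0_Delta \<Omega>. \<forall>v\<in>Cc 2 \<Omega>. inner_Delta \<Omega> b v = 0}"

text \<open>An orthonormal sequence in the subspace \<open>V\<close> whose linear span is dense in \<open>V\<close>.\<close>

definition Delta_orthonormal_basis ::
  "'a::euclidean_space set \<Rightarrow> (nat \<Rightarrow> 'a \<Rightarrow> real) \<Rightarrow> ('a \<Rightarrow> real) set \<Rightarrow> bool" where
  "Delta_orthonormal_basis \<Omega> b V \<longleftrightarrow>
     (\<forall>k\<ge>1. b k \<in> V) \<and>
     (\<forall>j\<ge>1. \<forall>k\<ge>1. inner_Delta \<Omega> (b j) (b k) = (if j = k then 1 else 0)) \<and>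
     (\<forall>u\<in>V. \<forall>\<epsilon>>0. \<exists>n. \<exists>c :: nat \<Rightarrow> real.
        norm_Delta \<Omega> (\<lambda>x. u x - (\<Sum>k=1..n. c k * b k x)) < \<epsilon>)"

end

theory Submission
  imports Defs
begin

text \<open>
  Write \<open>a\<close> for the inner product \<open>inner_Delta\<close> and \<open>m(u,v)\<close> for the integral of
  \<open>D u * D v\<close> over the boundary, where \<open>D\<close> is the normal derivative.  On the space
  \<open>H0_Delta\<close> both are positive semidefinite, and \<open>m\<close> is compact relative to \<open>a\<close>, because \<open>D\<close> is
  a compact map.  The algorithm maximizes the Rayleigh quotient of \<open>m\<close> by \<open>a\<close> on the
  \<open>a\<close>-orthogonal complement of the earlier maximizers, so it diagonalizes \<open>m\<close> as in the
  spectral theorem for compact symmetric operators; the locale \<open>spectral_pair\<close> is that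
  argument.  A first variation gives \<open>m(b k, v) = \<beta> k * a(b k, v)\<close> for all \<open>v\<close>.  The maximizers
  are orthogonal for both forms, so \<open>m(b j - b k, b j - b k) = \<beta> j + \<beta> k\<close>, and compactness forces
  \<open>\<beta> k\<close> to tend to 0.  An eigenfunction for \<open>q\<close> is orthogonal to every \<open>b k\<close> with
  \<open>q * \<beta> k \<noteq> 1\<close>, hence lies in the span of the finitely many others.

  Two facts about the domain turn this into the assertion.

  The first is that \<open>D\<close> has infinite rank (\<open>infinite_rank\<close>), which makes every \<open>\<beta> k\<close> positive.
  In dimension at least 2 the functions \<open>exp(m x1) cos(m x2)\<close> are harmonic and linearly
  independent.  Each is the Laplacian of some function of \<open>H0_Delta\<close>; a suitable nonzero
  combination \<open>V\<close> of these solutions is orthogonal to given \<open>w 1, \<dots>, w n\<close>, and Green's formula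
  for \<open>V\<close> and the harmonic function \<open>\<Delta> V\<close> shows that the boundary integral of \<open>\<Delta> V * D V\<close>
  is the square of the norm of \<open>\<Delta> V\<close>.

  The second is that a biharmonic \<open>w\<close> in \<open>H0_Delta\<close> with \<open>D w = 0\<close> vanishes
  (\<open>biharmonic_zero_data\<close>).  This gives completeness of the \<open>b k\<close> among the biharmonic
  functions: the remainders of the orthogonal expansion of a biharmonic \<open>u\<close> converge to some
  \<open>w\<close>, since \<open>H0_Delta\<close> is complete by the Poincare inequality, and \<open>w\<close> is biharmonic with
  \<open>D w = 0\<close> because \<open>\<beta> k\<close> tends to 0.  To see that \<open>w = 0\<close>, note that a function with zero
  trace and zero normal derivative, extended by 0, has a square-integrable Laplacian on the whole
  space.  After a localization its support can be translated into the domain along a cone and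
  mollified, so \<open>\<Delta> w\<close> is a limit of Laplacians of test functions, to all of which it is
  orthogonal.

  The cones exist because the boundary is locally a Lipschitz graph and the domain lies, near each
  boundary point, on one side of it only (\<open>region_one_sided\<close>).  This is a global property of
  closed hypersurfaces: the two possible namings of the sides form a two-sheeted covering of the
  space, which is trivial over a cube, so a sign can be given to all points off the boundary that is
  locally constant there and changes across the boundary; the connected domain carries one sign.

  The normal derivative is unique up to null sets (\<open>normal_derivative_unique\<close>) since smooth functions
  determine a function in \<open>L2\<close> of the boundary; this rests on the regularity of Hausdorff measure,
  whose measurable sets of finite measure agree with Borel sets up to null sets.
\<close>

section \<open>Square-integrable functions\<close>

definition l2ip :: "'a measure \<Rightarrow> ('a \<Rightarrow> real) \<Rightarrow> ('a \<Rightarrow> real) \<Rightarrow> real" where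
  "l2ip M f g = (\<integral>x. f x * g x \<partial>M)"

definition l2norm :: "'a measure \<Rightarrow> ('a \<Rightarrow> real) \<Rightarrow> real" where
  "l2norm M f = sqrt (\<integral>x. (f x)\<^sup>2 \<partial>M)"

lemma l2norm_sq: "(l2norm M f)\<^sup>2 = (\<integral>x. (f x)\<^sup>2 \<partial>M)"
  by (simp add: l2norm_def)

lemma l2norm_nonneg [simp]: "0 \<le> l2norm M f"
  by (simp add: l2norm_def)

lemma L2_measurable: "f \<in> L2 M \<Longrightarrow> f \<in> borel_measurable M"
  by (simp add: L2_def)

lemma L2_times_integrable:
  assumes "f \<in> L2 M" "g \<in> L2 M"
  shows "integrable M (\<lambda>x. f x * g x)"
proof (rule Bochner_Integration.integrable_bound)
  show "integrable M (\<lambda>x. (f x)\<^sup>2 + (g x)\<^sup>2)"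
    using assms by (auto simp: L2_def)
  show "(\<lambda>x. f x * g x) \<in> borel_measurable M"
    using assms by (auto simp: L2_def)
  have "\<bar>f x * g x\<bar> \<le> (f x)\<^sup>2 + (g x)\<^sup>2" for x
  proof -
    have "2 * \<bar>f x * g x\<bar> \<le> (f x)\<^sup>2 + (g x)\<^sup>2"
      using sum_squares_bound[of "\<bar>f x\<bar>" "\<bar>g x\<bar>"] by (simp add: abs_mult)
    then show ?thesis by linarith
  qed
  then show "AE x in M. norm (f x * g x) \<le> norm ((f x)\<^sup>2 + (g x)\<^sup>2)"
    by (simp add: AE_I2)
qed

lemma L2_cmult: "f \<in> L2 M \<Longrightarrow> (\<lambda>x. c * f x) \<in> L2 M"
  by (auto simp: L2_def power_mult_distrib)

lemma L2_add:
  assumes "f \<in> L2 M" "g \<in> L2 M"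
  shows "(\<lambda>x. f x + g x) \<in> L2 M"
proof -
  have "integrable M (\<lambda>x. (f x)\<^sup>2 + (g x)\<^sup>2 + 2 * (f x * g x))"
    using assms L2_times_integrable[OF assms] by (auto simp: L2_def)
  then have "integrable M (\<lambda>x. (f x + g x)\<^sup>2)"
    by (simp add: power2_sum mult.assoc)
  then show ?thesis using assms by (auto simp: L2_def)
qed

lemma L2_diff:
  assumes "f \<in> L2 M" "g \<in> L2 M"
  shows "(\<lambda>x. f x - g x) \<in> L2 M"
  using L2_add[OF assms(1) L2_cmult[OF assms(2), of "-1"]] by simp

lemma L2_zero [simp]: "(\<lambda>x. 0) \<in> L2 M"
  by (simp add: L2_def)

lemma L2_sum:
  assumes "\<And>i. i \<in> I \<Longrightarrow> f i \<in> L2 M"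
  shows "(\<lambda>x. \<Sum>i\<in>I. f i x) \<in> L2 M"
  using assms
proof (induction I rule: infinite_finite_induct)
  case (insert i I)
  then have "(\<lambda>x. f i x + (\<Sum>i\<in>I. f i x)) \<in> L2 M" by (intro L2_add) simp_all
  then show ?case using insert by simp
qed simp_all

lemma L2_bounded:
  assumes "f \<in> borel_measurable M" "finite_measure M" "\<And>x. x \<in> space M \<Longrightarrow> \<bar>f x\<bar> \<le> C"
  shows "f \<in> L2 M"
proof -
  interpret finite_measure M by fact
  have "integrable M (\<lambda>x. (f x)\<^sup>2)"
  proof (rule Bochner_Integration.integrable_bound)
    show "integrable M (\<lambda>x. C\<^sup>2)" by simp
    show "AE x in M. norm ((f x)\<^sup>2) \<le> norm (C\<^sup>2)"
      using assms(3) by (auto intro!: AE_I2 simp: abs_le_square_iff [symmetric]) (smt (verit) abs_ge_zero)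
  qed (use assms in auto)
  then show ?thesis using assms by (auto simp: L2_def)
qed

lemma L2_integrable:
  assumes "f \<in> L2 M" "finite_measure M"
  shows "integrable M f"
proof -
  have "(\<lambda>x. 1) \<in> L2 M" using assms L2_bounded[of "\<lambda>x. 1" M 1] by auto
  from L2_times_integrable[OF assms(1) this] show ?thesis by simp
qed

lemma l2ip_sym: "l2ip M f g = l2ip M g f"
  by (simp add: l2ip_def mult.commute)

lemma l2ip_self: "l2ip M f f = (l2norm M f)\<^sup>2"
  unfolding l2norm_sq by (simp add: l2ip_def power2_eq_square)

lemma l2ip_add_left:
  assumes "f \<in> L2 M" "g \<in> L2 M" "h \<in> L2 M"
  shows "l2ip M (\<lambda>x. f x + g x) h = l2ip M f h + l2ip M g h"
  using assms by (simp add: l2ip_def distrib_right L2_times_integrable)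

lemma l2ip_cmult_left: "l2ip M (\<lambda>x. c * f x) h = c * l2ip M f h"
  by (simp add: l2ip_def mult.assoc)

lemma l2ip_diff_left:
  assumes "f \<in> L2 M" "g \<in> L2 M" "h \<in> L2 M"
  shows "l2ip M (\<lambda>x. f x - g x) h = l2ip M f h - l2ip M g h"
  using assms by (simp add: l2ip_def left_diff_distrib L2_times_integrable)

lemma l2norm_cmult: "l2norm M (\<lambda>x. c * f x) = \<bar>c\<bar> * l2norm M f"
  by (simp add: l2norm_def power_mult_distrib real_sqrt_mult)

lemma l2_Cauchy_Schwarz:
  assumes f: "f \<in> L2 M" and g: "g \<in> L2 M"
  shows "\<bar>l2ip M f g\<bar> \<le> l2norm M f * l2norm M g"
proof -
  have *: "0 \<le> (l2norm M f)\<^sup>2 + 2 * t * l2ip M f g + t\<^sup>2 * (l2norm M g)\<^sup>2" for t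
  proof -
    have "0 \<le> (\<integral>x. (f x + t * g x)\<^sup>2 \<partial>M)" by simp
    also have "\<dots> = (\<integral>x. (f x)\<^sup>2 + 2 * t * (f x * g x) + t\<^sup>2 * (g x)\<^sup>2 \<partial>M)"
      by (intro Bochner_Integration.integral_cong) (auto simp: power2_eq_square algebra_simps)
    also have "\<dots> = (l2norm M f)\<^sup>2 + 2 * t * l2ip M f g + t\<^sup>2 * (l2norm M g)\<^sup>2"
      using f g L2_times_integrable[OF f g] unfolding l2norm_sq l2ip_def
      by (simp add: L2_def)
    finally show ?thesis .
  qed
  have "(l2ip M f g)\<^sup>2 \<le> (l2norm M f)\<^sup>2 * (l2norm M g)\<^sup>2"
  proof (cases "l2norm M g = 0")
    case True
    have "l2ip M f g = 0"
    proof (rule ccontr)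
      assume n: "l2ip M f g \<noteq> 0"
      have "0 \<le> (l2norm M f)\<^sup>2 + 2 * (- ((l2norm M f)\<^sup>2 + 1) / (2 * l2ip M f g)) * l2ip M f g"
        using *[of "- ((l2norm M f)\<^sup>2 + 1) / (2 * l2ip M f g)"] True by simp
      then show False using n by (simp add: field_simps)
    qed
    then show ?thesis by simp
  next
    case False
    then have p: "(l2norm M g)\<^sup>2 > 0" by simp
    define G where "G = (l2norm M g)\<^sup>2"
    have "0 \<le> (l2norm M f)\<^sup>2 + 2 * (- l2ip M f g / G) * l2ip M f g + (- l2ip M f g / G)\<^sup>2 * G"
      using *[of "- l2ip M f g / G"] by (simp add: G_def)
    also have "\<dots> = (l2norm M f)\<^sup>2 - (l2ip M f g)\<^sup>2 / G"
      using p by (simp add: G_def [symmetric] power2_eq_square field_simps)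
    finally show ?thesis using p by (simp add: G_def [symmetric] field_simps)
  qed
  then have "\<bar>l2ip M f g\<bar>\<^sup>2 \<le> (l2norm M f * l2norm M g)\<^sup>2"
    by (simp add: power_mult_distrib)
  then show ?thesis by (rule power2_le_imp_le) simp
qed

lemma l2_triangle:
  assumes f: "f \<in> L2 M" and g: "g \<in> L2 M"
  shows "l2norm M (\<lambda>x. f x + g x) \<le> l2norm M f + l2norm M g"
proof (rule power2_le_imp_le)
  have "(l2norm M (\<lambda>x. f x + g x))\<^sup>2 = (l2norm M f)\<^sup>2 + 2 * l2ip M f g + (l2norm M g)\<^sup>2"
    using f g L2_times_integrable[OF f g] unfolding l2norm_sq l2ip_def
    by (simp add: L2_def power2_sum mult.assoc)
  also have "\<dots> \<le> (l2norm M f)\<^sup>2 + 2 * (l2norm M f * l2norm M g) + (l2norm M g)\<^sup>2"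
    using l2_Cauchy_Schwarz[OF f g] by linarith
  finally show "(l2norm M (\<lambda>x. f x + g x))\<^sup>2 \<le> (l2norm M f + l2norm M g)\<^sup>2"
    by (simp add: power2_sum)
qed simp

lemma l2norm_minus_commute: "l2norm M (\<lambda>x. f x - g x) = l2norm M (\<lambda>x. g x - f x)"
proof -
  have "(f x - g x)\<^sup>2 = (g x - f x)\<^sup>2" for x by (rule power2_commute)
  then have "(\<lambda>x. (f x - g x)\<^sup>2) = (\<lambda>x. (g x - f x)\<^sup>2)" by (rule ext)
  then have "(\<integral>x. (f x - g x)\<^sup>2 \<partial>M) = (\<integral>x. (g x - f x)\<^sup>2 \<partial>M)" by (rule arg_cong)
  then show ?thesis unfolding l2norm_def by (rule arg_cong)
qed

lemma l2_triangle_diff: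
  assumes "f \<in> L2 M" "g \<in> L2 M" "h \<in> L2 M"
  shows "l2norm M (\<lambda>x. f x - h x) \<le> l2norm M (\<lambda>x. f x - g x) + l2norm M (\<lambda>x. g x - h x)"
  using l2_triangle[OF L2_diff[OF assms(1,2)] L2_diff[OF assms(2,3)]] by simp

lemma l2norm_cong_AE:
  assumes "f \<in> borel_measurable M" "g \<in> borel_measurable M" "AE x in M. f x = g x"
  shows "l2norm M f = l2norm M g"
  unfolding l2norm_def using assms by (intro arg_cong[where f=sqrt] integral_cong_AE) auto

lemma l2ip_cong_AE:
  assumes "f \<in> borel_measurable M" "g \<in> borel_measurable M" "AE x in M. f x = g x" "h \<in> borel_measurable M"
  shows "l2ip M f h = l2ip M g h"
  unfolding l2ip_def using assms by (intro integral_cong_AE) auto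

lemma l2norm_eq_0_AE:
  assumes "f \<in> L2 M" "l2norm M f = 0"
  shows "AE x in M. f x = 0"
proof -
  have "(\<integral>x. (f x)\<^sup>2 \<partial>M) = 0" using assms(2) by (simp add: l2norm_def)
  then have "AE x in M. (f x)\<^sup>2 = 0"
    using assms(1) by (subst (asm) integral_nonneg_eq_0_iff_AE) (auto simp: L2_def)
  then show ?thesis by simp
qed

lemma l2ip_tendsto:
  assumes "\<And>n. f n \<in> L2 M" "F \<in> L2 M" "g \<in> L2 M"
    and "(\<lambda>n. l2norm M (\<lambda>x. f n x - F x)) \<longlonglongrightarrow> 0"
  shows "(\<lambda>n. l2ip M (f n) g) \<longlonglongrightarrow> l2ip M F g"
proof -
  have "(\<lambda>n. l2ip M (f n) g - l2ip M F g) \<longlonglongrightarrow> 0"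
  proof (rule Lim_null_comparison)
    show "\<forall>\<^sub>F n in sequentially. norm (l2ip M (f n) g - l2ip M F g)
            \<le> l2norm M (\<lambda>x. f n x - F x) * l2norm M g"
      using l2_Cauchy_Schwarz[OF L2_diff[OF assms(1,2)] assms(3)]
      by (intro always_eventually) (simp add: l2ip_diff_left assms(1,2,3))
    show "(\<lambda>n. l2norm M (\<lambda>x. f n x - F x) * l2norm M g) \<longlonglongrightarrow> 0"
      using tendsto_mult_right[OF assms(4), of "l2norm M g"] by simp
  qed
  then show ?thesis by (simp add: LIM_zero_iff)
qed

lemma l2ip_tendsto2:
  assumes "\<And>n. f n \<in> L2 M" "F \<in> L2 M" "\<And>n. g n \<in> L2 M" "G \<in> L2 M"
    and f: "(\<lambda>n. l2norm M (\<lambda>x. f n x - F x)) \<longlonglongrightarrow> 0"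
    and g: "(\<lambda>n. l2norm M (\<lambda>x. g n x - G x)) \<longlonglongrightarrow> 0"
  shows "(\<lambda>n. l2ip M (f n) (g n)) \<longlonglongrightarrow> l2ip M F G"
proof -
  have 1: "(\<lambda>n. l2ip M (\<lambda>x. f n x - F x) (\<lambda>x. g n x - G x)) \<longlonglongrightarrow> 0"
  proof (rule Lim_null_comparison)
    show "\<forall>\<^sub>F n in sequentially. norm (l2ip M (\<lambda>x. f n x - F x) (\<lambda>x. g n x - G x))
            \<le> l2norm M (\<lambda>x. f n x - F x) * l2norm M (\<lambda>x. g n x - G x)"
      using l2_Cauchy_Schwarz[OF L2_diff[OF assms(1,2)] L2_diff[OF assms(3,4)]]
      by (intro always_eventually) simp
    show "(\<lambda>n. l2norm M (\<lambda>x. f n x - F x) * l2norm M (\<lambda>x. g n x - G x)) \<longlonglongrightarrow> 0"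
      using tendsto_mult[OF f g] by simp
  qed
  have eq: "l2ip M (f n) (g n) = l2ip M (\<lambda>x. f n x - F x) (\<lambda>x. g n x - G x)
     + l2ip M (f n) G + l2ip M (g n) F - l2ip M F G" for n
  proof -
    have "l2ip M (\<lambda>x. f n x - F x) (\<lambda>x. g n x - G x)
       = l2ip M (f n) (\<lambda>x. g n x - G x) - l2ip M F (\<lambda>x. g n x - G x)"
      using assms by (intro l2ip_diff_left L2_diff) auto
    also have "\<dots> = (l2ip M (g n) (f n) - l2ip M G (f n)) - (l2ip M (g n) F - l2ip M G F)"
      by (simp add: l2ip_sym[of M _ "\<lambda>x. g n x - G x"] l2ip_diff_left assms)
    finally show ?thesis by (simp add: l2ip_sym)
  qed
  have "(\<lambda>n. l2ip M (f n) (g n)) \<longlonglongrightarrow> 0 + l2ip M F G + l2ip M G F - l2ip M F G"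
    unfolding eq
    by (intro tendsto_add tendsto_diff tendsto_const 1 l2ip_tendsto assms)
  then show ?thesis by (simp add: l2ip_sym)
qed

lemma l2norm_tendsto:
  assumes "\<And>n. f n \<in> L2 M" "F \<in> L2 M"
    and f: "(\<lambda>n. l2norm M (\<lambda>x. f n x - F x)) \<longlonglongrightarrow> 0"
  shows "(\<lambda>n. l2norm M (f n)) \<longlonglongrightarrow> l2norm M F"
proof -
  have "(\<lambda>n. sqrt (l2ip M (f n) (f n))) \<longlonglongrightarrow> sqrt (l2ip M F F)"
    by (intro tendsto_real_sqrt l2ip_tendsto2 assms)
  then show ?thesis by (simp add: l2ip_self)
qed

lemma l2_Cauchy_of_convergent:
  assumes "\<And>n. f n \<in> L2 M" "F \<in> L2 M"
    and f: "(\<lambda>n. l2norm M (\<lambda>x. f n x - F x)) \<longlonglongrightarrow> 0" and e: "e > 0"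
  shows "\<exists>N. \<forall>m\<ge>N. \<forall>n\<ge>N. l2norm M (\<lambda>x. f m x - f n x) < e"
proof -
  from f e have "\<forall>\<^sub>F n in sequentially. l2norm M (\<lambda>x. f n x - F x) < e/2"
    by (auto dest!: order_tendstoD(2)[where a="e/2"])
  then obtain N where N: "\<And>n. n \<ge> N \<Longrightarrow> l2norm M (\<lambda>x. f n x - F x) < e/2"
    by (auto simp: eventually_sequentially)
  have "l2norm M (\<lambda>x. f m x - f n x) < e" if "m \<ge> N" "n \<ge> N" for m n
    using l2_triangle_diff[OF assms(1)[of m] assms(2) assms(1)[of n]] N[OF that(1)] N[OF that(2)]
      l2norm_minus_commute[of M F "f n"] by linarith
  then show ?thesis by blast
qed

text \<open>
  On a finite measure space the Cauchy-Schwarz inequality turns the bounds into summable bounds for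
  the integrals of the absolute increments, so the increments are absolutely summable almost
  everywhere.
\<close>

lemma l2_fast_Cauchy_AE_convergent:
  fixes g :: "nat \<Rightarrow> 'a \<Rightarrow> real"
  assumes M: "finite_measure M" and g: "\<And>k. g k \<in> L2 M"
    and fast: "\<And>k. l2norm M (\<lambda>x. g (Suc k) x - g k x) \<le> (1/2)^k"
  shows "AE x in M. convergent (\<lambda>k. g k x)"
proof -
  interpret finite_measure M by fact
  have one: "(\<lambda>x. 1) \<in> L2 M" using L2_bounded[of "\<lambda>x. 1" M 1] M by auto
  have gm [measurable]: "g k \<in> borel_measurable M" for k using g by (auto simp: L2_def)
  have dl: "(\<lambda>x. \<bar>g (Suc k) x - g k x\<bar>) \<in> L2 M" for k
    using L2_diff[OF g[of "Suc k"] g[of k]] by (auto simp: L2_def)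
  have int: "integrable M (\<lambda>x. \<bar>g (Suc k) x - g k x\<bar>)" for k
    by (rule L2_integrable[OF dl M])
  have le: "(\<integral>x. \<bar>g (Suc k) x - g k x\<bar> \<partial>M) \<le> l2norm M (\<lambda>x. 1) * (1/2)^k" for k
  proof -
    have "l2ip M (\<lambda>x. \<bar>g (Suc k) x - g k x\<bar>) (\<lambda>x. 1)
        \<le> l2norm M (\<lambda>x. \<bar>g (Suc k) x - g k x\<bar>) * l2norm M (\<lambda>x. 1)"
      using l2_Cauchy_Schwarz[OF dl one] by (rule order_trans[OF abs_ge_self])
    also have "\<dots> \<le> (1/2)^k * l2norm M (\<lambda>x. 1)"
      using fast by (intro mult_right_mono) (auto simp: l2norm_def)
    finally show ?thesis by (simp add: l2ip_def mult.commute)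
  qed
  have "(\<integral>\<^sup>+x. (\<Sum>k. ennreal \<bar>g (Suc k) x - g k x\<bar>) \<partial>M)
     = (\<Sum>k. \<integral>\<^sup>+x. ennreal \<bar>g (Suc k) x - g k x\<bar> \<partial>M)"
    by (intro nn_integral_suminf) measurable
  also have "\<dots> = (\<Sum>k. ennreal (\<integral>x. \<bar>g (Suc k) x - g k x\<bar> \<partial>M))"
    using int by (intro suminf_cong nn_integral_eq_integral) auto
  also have "\<dots> \<le> (\<Sum>k. ennreal (l2norm M (\<lambda>x. 1) * (1/2)^k))"
    using le by (intro suminf_le ennreal_leI) auto
  also have "\<dots> = ennreal (\<Sum>k. l2norm M (\<lambda>x. 1) * (1/2)^k)"
    by (intro suminf_ennreal2 summable_mult summable_geometric) auto
  also have "\<dots> < \<infinity>" by simp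
  finally have fin: "(\<integral>\<^sup>+x. (\<Sum>k. ennreal \<bar>g (Suc k) x - g k x\<bar>) \<partial>M) \<noteq> \<infinity>" by simp
  have "AE x in M. (\<Sum>k. ennreal \<bar>g (Suc k) x - g k x\<bar>) \<noteq> \<infinity>"
    by (intro nn_integral_PInf_AE[OF _ fin]) measurable
  then show ?thesis
  proof eventually_elim
    case (elim x)
    then have "summable (\<lambda>k. \<bar>g (Suc k) x - g k x\<bar>)"
      by (intro summable_suminf_not_top) auto
    then have "summable (\<lambda>k. g (Suc k) x - g k x)"
      by (rule summable_rabs_cancel)
    then have "convergent (\<lambda>n. \<Sum>k<n. g (Suc k) x - g k x)"
      by (simp add: summable_iff_convergent)
    then have "convergent (\<lambda>n. g n x - g 0 x)"
      using sum_lessThan_telescope[of "\<lambda>k. g k x"] by simp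
    then have "convergent (\<lambda>n. (g n x - g 0 x) + g 0 x)"
      by (intro convergent_add convergent_const)
    then show ?case by simp
  qed
qed

text \<open>
  A subsequence with geometrically small increments converges almost everywhere, and Fatou's lemma
  turns the Cauchy bounds into bounds for the distance to its limit.
\<close>

theorem L2_complete:
  fixes f :: "nat \<Rightarrow> 'a \<Rightarrow> real"
  assumes M: "finite_measure M" and f: "\<And>n. f n \<in> L2 M"
    and C: "\<And>e. e > 0 \<Longrightarrow> \<exists>N. \<forall>m\<ge>N. \<forall>n\<ge>N. l2norm M (\<lambda>x. f m x - f n x) < e"
  shows "\<exists>F\<in>L2 M. (\<lambda>n. l2norm M (\<lambda>x. f n x - F x)) \<longlonglongrightarrow> 0"
proof -
  interpret finite_measure M by fact
  obtain N where N: "\<And>k m n. m \<ge> N k \<Longrightarrow> n \<ge> N k \<Longrightarrow> l2norm M (\<lambda>x. f m x - f n x) < (1/2)^k"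
  proof -
    have "\<forall>k. \<exists>N. \<forall>m\<ge>N. \<forall>n\<ge>N. l2norm M (\<lambda>x. f m x - f n x) < (1/2::real)^k"
      using C by simp
    then show ?thesis using that by metis
  qed
  \<comment> \<open>Increasing, at least \<open>N k\<close>, and unbounded by virtue of the summand \<open>k\<close>.\<close>
  define r where "r k = (\<Sum>i\<le>k. N i) + k" for k
  have rN: "r k \<ge> N k" for k
    unfolding r_def by (rule trans_le_add1, rule member_le_sum) auto
  have rS: "r (Suc k) \<ge> r k" for k
    by (simp add: r_def)
  have rk: "r k \<ge> k" for k by (simp add: r_def)
  have fm [measurable]: "f k \<in> borel_measurable M" for k using f by (auto simp: L2_def)
  have AEc: "AE x in M. convergent (\<lambda>k. f (r k) x)"
  proof (rule l2_fast_Cauchy_AE_convergent[OF M f])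
    show "l2norm M (\<lambda>x. f (r (Suc k)) x - f (r k) x) \<le> (1/2)^k" for k
      using N[of k "r (Suc k)" "r k"] rN[of k] rS[of k] by simp
  qed
  define F where "F x = lim (\<lambda>k. f (r k) x)" for x
  have Fm: "F \<in> borel_measurable M"
    unfolding F_def using f by (intro borel_measurable_lim_metric) (auto simp: L2_def)
  have conv: "AE x in M. (\<lambda>k. f (r k) x) \<longlonglongrightarrow> F x"
    using AEc by eventually_elim (simp add: F_def convergent_LIMSEQ_iff)
  have key: "(\<integral>\<^sup>+x. ennreal ((f m x - F x)\<^sup>2) \<partial>M) \<le> ennreal (((1/2)^k)\<^sup>2)" if m: "m \<ge> N k" for m k
  proof -
    have "(\<integral>\<^sup>+x. ennreal ((f m x - F x)\<^sup>2) \<partial>M)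
        = (\<integral>\<^sup>+x. liminf (\<lambda>j. ennreal ((f m x - f (r j) x)\<^sup>2)) \<partial>M)"
    proof (rule nn_integral_cong_AE)
      show "AE x in M. ennreal ((f m x - F x)\<^sup>2) = liminf (\<lambda>j. ennreal ((f m x - f (r j) x)\<^sup>2))"
        using conv
      proof eventually_elim
        case (elim x)
        then have "(\<lambda>j. ennreal ((f m x - f (r j) x)\<^sup>2)) \<longlonglongrightarrow> ennreal ((f m x - F x)\<^sup>2)"
          by (intro tendsto_ennrealI tendsto_intros)
        then show ?case by (intro lim_imp_Liminf [symmetric]) auto
      qed
    qed
    also have "\<dots> \<le> liminf (\<lambda>j. \<integral>\<^sup>+x. ennreal ((f m x - f (r j) x)\<^sup>2) \<partial>M)"
      by (intro nn_integral_liminf) measurable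
    also have "\<dots> \<le> limsup (\<lambda>j. \<integral>\<^sup>+x. ennreal ((f m x - f (r j) x)\<^sup>2) \<partial>M)"
      by (rule Liminf_le_Limsup) simp
    also have "\<dots> \<le> ennreal (((1/2)^k)\<^sup>2)"
    proof (rule Limsup_bounded)
      have "(\<integral>\<^sup>+x. ennreal ((f m x - f (r j) x)\<^sup>2) \<partial>M) \<le> ennreal (((1/2)^k)\<^sup>2)" if "j \<ge> N k" for j
      proof -
        have "(\<integral>\<^sup>+x. ennreal ((f m x - f (r j) x)\<^sup>2) \<partial>M) = ennreal ((l2norm M (\<lambda>x. f m x - f (r j) x))\<^sup>2)"
          unfolding l2norm_sq using L2_diff[OF f[of m] f[of "r j"]]
          by (intro nn_integral_eq_integral) (auto simp: L2_def)
        also have "\<dots> \<le> ennreal (((1/2)^k)\<^sup>2)"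
          using N[OF m, of "r j"] rk[of j] that
          by (intro ennreal_leI power_mono) auto
        finally show ?thesis .
      qed
      then show "\<forall>\<^sub>F j in sequentially. (\<integral>\<^sup>+x. ennreal ((f m x - f (r j) x)\<^sup>2) \<partial>M) \<le> ennreal (((1/2)^k)\<^sup>2)"
        by (auto simp: eventually_sequentially)
    qed
    finally show ?thesis .
  qed
  have dL: "(\<lambda>x. f m x - F x) \<in> L2 M" if "m \<ge> N k" for m k
  proof -
    have "integrable M (\<lambda>x. (f m x - F x)\<^sup>2)"
    proof (rule integrableI_bounded)
      have "(\<integral>\<^sup>+x. ennreal (norm ((f m x - F x)\<^sup>2)) \<partial>M) \<le> ennreal (((1/2)^k)\<^sup>2)"
        using key[OF that] by simp
      then show "(\<integral>\<^sup>+x. ennreal (norm ((f m x - F x)\<^sup>2)) \<partial>M) < \<infinity>"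
        using le_less_trans by fastforce
    qed (use f Fm in \<open>auto simp: L2_def\<close>)
    then show ?thesis using f Fm by (auto simp: L2_def)
  qed
  have FL: "F \<in> L2 M"
    using L2_diff[OF f[of "N 0"] dL[of 0 "N 0"]] by simp
  have small: "l2norm M (\<lambda>x. f m x - F x) \<le> (1/2)^k" if "m \<ge> N k" for m k
  proof (rule power2_le_imp_le)
    have "ennreal ((l2norm M (\<lambda>x. f m x - F x))\<^sup>2) = (\<integral>\<^sup>+x. ennreal ((f m x - F x)\<^sup>2) \<partial>M)"
      unfolding l2norm_sq using dL[OF that]
      by (intro nn_integral_eq_integral [symmetric]) (auto simp: L2_def)
    also note key[OF that]
    finally show "(l2norm M (\<lambda>x. f m x - F x))\<^sup>2 \<le> ((1/2)^k)\<^sup>2"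
      by (subst (asm) ennreal_le_iff) auto
  qed simp
  have "(\<lambda>n. l2norm M (\<lambda>x. f n x - F x)) \<longlonglongrightarrow> 0"
  proof (rule LIMSEQ_I)
    fix e :: real assume "0 < e"
    then obtain k where k: "(1/2)^k < e" using real_arch_pow_inv[of e "1/2"] by auto
    have "norm (l2norm M (\<lambda>x. f n x - F x) - 0) < e" if "n \<ge> N k" for n
      using small[OF that] k by simp
    then show "\<exists>no. \<forall>n\<ge>no. norm (l2norm M (\<lambda>x. f n x - F x) - 0) < e" by blast
  qed
  with FL show ?thesis by blast
qed

section \<open>Continuously differentiable functions\<close>

definition smooth :: "('a::euclidean_space \<Rightarrow> real) \<Rightarrow> bool" where
  "smooth f \<longleftrightarrow> (\<forall>k. Ck k f)"

lemma Ck_differentiable: "Ck (Suc k) f \<Longrightarrow> f differentiable (at x)"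
  by simp

lemma partial_deriv_eq: "(f has_derivative f') (at x) \<Longrightarrow> partial_deriv i f x = f' i"
  unfolding partial_deriv_def by (drule frechet_derivative_at) simp

lemma has_derivative_partial:
  assumes "f differentiable (at x)"
  shows "(f has_derivative (\<lambda>h. \<Sum>i\<in>Basis. (h \<bullet> i) * partial_deriv i f x)) (at x)"
proof -
  let ?D = "frechet_derivative f (at x)"
  have D: "(f has_derivative ?D) (at x)" using assms frechet_derivative_works by blast
  then have lin: "linear ?D" by (rule has_derivative_linear)
  have "?D h = (\<Sum>i\<in>Basis. (h \<bullet> i) * partial_deriv i f x)" for h
  proof -
    have "?D h = ?D (\<Sum>i\<in>Basis. (h \<bullet> i) *\<^sub>R i)" by (simp add: euclidean_representation)
    also have "\<dots> = (\<Sum>i\<in>Basis. (h \<bullet> i) * ?D i)"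
      using lin by (simp add: linear_sum linear_scale)
    finally show ?thesis by (simp add: partial_deriv_def)
  qed
  then show ?thesis using D by (metis (no_types, lifting) ext)
qed

lemma Ck_Suc_imp: "Ck (Suc k) f \<Longrightarrow> Ck k f"
proof (induction k arbitrary: f)
  case 0
  then show ?case
    by (auto simp: differentiable_on_def intro!: differentiable_imp_continuous_on differentiable_at_withinI)
qed auto

lemma Ck_mono: "Ck n f \<Longrightarrow> m \<le> n \<Longrightarrow> Ck m f"
proof (induction n)
  case (Suc n)
  then show ?case using Ck_Suc_imp[of n f] by (cases "m = Suc n") auto
qed simp

lemma Ck_continuous: "Ck k f \<Longrightarrow> continuous_on S f"
  using Ck_mono[of k f 0] continuous_on_subset by fastforce

lemma partial_deriv_const [simp]: "partial_deriv i (\<lambda>x. c) = (\<lambda>x. 0)"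
  by (simp add: partial_deriv_def fun_eq_iff)

lemma Ck_const [simp]: "Ck k (\<lambda>x. c)"
  by (induction k arbitrary: c) auto

lemma partial_deriv_add:
  assumes "f differentiable (at x)" "g differentiable (at x)"
  shows "partial_deriv i (\<lambda>x. f x + g x) x = partial_deriv i f x + partial_deriv i g x"
  using has_derivative_add[OF assms[THEN frechet_derivative_works[THEN iffD1]]]
  by (simp add: partial_deriv_eq partial_deriv_def[of i f] partial_deriv_def[of i g])

lemma partial_deriv_mult:
  fixes f g :: "'a::euclidean_space \<Rightarrow> real"
  assumes "f differentiable (at x)" "g differentiable (at x)"
  shows "partial_deriv i (\<lambda>x. f x * g x) x = f x * partial_deriv i g x + partial_deriv i f x * g x"
  using has_derivative_mult[OF assms[THEN frechet_derivative_works[THEN iffD1]]]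
  by (simp add: partial_deriv_eq partial_deriv_def[of i f] partial_deriv_def[of i g])

lemma Ck_add: "Ck k f \<Longrightarrow> Ck k g \<Longrightarrow> Ck k (\<lambda>x. f x + g x)"
proof (induction k arbitrary: f g)
  case (Suc k)
  have "partial_deriv i (\<lambda>x. f x + g x) = (\<lambda>x. partial_deriv i f x + partial_deriv i g x)" for i
    using Suc.prems by (intro ext partial_deriv_add) auto
  then show ?case using Suc by (auto intro!: differentiable_add)
qed (auto intro: continuous_intros)

lemma Ck_mult: "Ck k f \<Longrightarrow> Ck k g \<Longrightarrow> Ck k (\<lambda>x. f x * g x)"
proof (induction k arbitrary: f g)
  case (Suc k)
  have "partial_deriv i (\<lambda>x. f x * g x) = (\<lambda>x. f x * partial_deriv i g x + partial_deriv i f x * g x)" for i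
    using Suc.prems by (intro ext partial_deriv_mult) auto
  moreover have "Ck k f" "Ck k g" using Suc.prems Ck_Suc_imp by auto
  ultimately show ?case using Suc by (auto intro!: differentiable_mult Ck_add)
qed (auto intro: continuous_intros)

lemma Ck_cmult: "Ck k f \<Longrightarrow> Ck k (\<lambda>x. c * f x)"
  by (rule Ck_mult) auto

lemma Ck_diff: "Ck k f \<Longrightarrow> Ck k g \<Longrightarrow> Ck k (\<lambda>x. f x - g x)"
  using Ck_add[OF _ Ck_cmult[of k g "-1"]] by simp

lemma Ck_sum: "(\<And>i. i \<in> I \<Longrightarrow> Ck k (f i)) \<Longrightarrow> Ck k (\<lambda>x. \<Sum>i\<in>I. f i x)"
  by (induction I rule: infinite_finite_induct) (auto intro: Ck_add)

lemma Ck_prod: "(\<And>i. i \<in> I \<Longrightarrow> Ck k (f i)) \<Longrightarrow> Ck k (\<lambda>x. \<Prod>i\<in>I. f i x)"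
  by (induction I rule: infinite_finite_induct) (auto intro: Ck_mult)

lemma partial_deriv_cmult:
  fixes f :: "'a::euclidean_space \<Rightarrow> real"
  assumes "f differentiable (at x)"
  shows "partial_deriv i (\<lambda>x. c * f x) x = c * partial_deriv i f x"
  using partial_deriv_mult[of "\<lambda>x. c" x f i] assms by simp

lemma partial_deriv_diff:
  assumes "f differentiable (at x)" "g differentiable (at x)"
  shows "partial_deriv i (\<lambda>x. f x - g x) x = partial_deriv i f x - partial_deriv i g x"
  using has_derivative_diff[OF assms[THEN frechet_derivative_works[THEN iffD1]]]
  by (simp add: partial_deriv_eq partial_deriv_def[of i f] partial_deriv_def[of i g])

lemma Ck_inverse:
  assumes "\<And>x. f x \<noteq> 0"
  shows "Ck k f \<Longrightarrow> Ck k (\<lambda>x. inverse (f x))"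
proof (induction k)
  case (Suc k)
  have D: "((\<lambda>x. inverse (f x)) has_derivative
      (\<lambda>h. - (inverse (f x) * frechet_derivative f (at x) h * inverse (f x)))) (at x)" for x
    using Suc.prems assms by (intro Deriv.has_derivative_inverse) (auto simp: frechet_derivative_works [symmetric])
  have e: "partial_deriv i (\<lambda>x. inverse (f x)) =
     (\<lambda>x. (-1 * inverse (f x)) * (partial_deriv i f x * inverse (f x)))" for i
    by (intro ext) (simp add: partial_deriv_eq[OF D] partial_deriv_def)
  have inv: "Ck k (\<lambda>x. inverse (f x))" using Suc Ck_Suc_imp by blast
  have "Ck k (partial_deriv i (\<lambda>x. inverse (f x)))" if "i \<in> Basis" for i
    unfolding e using Suc.prems that by (intro Ck_mult Ck_const inv) auto
  moreover have "(\<lambda>x. inverse (f x)) differentiable (at x)" for x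
    using D by (rule differentiableI)
  ultimately show ?case by simp
qed (use assms in \<open>auto intro!: continuous_intros\<close>)

lemma Ck_affine:
  fixes f :: "'b::euclidean_space \<Rightarrow> real" and L :: "'a::euclidean_space \<Rightarrow> 'b"
  assumes L: "bounded_linear L"
  shows "Ck k f \<Longrightarrow> Ck k (\<lambda>x. f (L x + c))"
proof (induction k arbitrary: f)
  case 0
  have "continuous_on UNIV (\<lambda>x. L x + c)"
    by (intro continuous_intros linear_continuous_on L)
  with 0 show ?case
    using continuous_on_compose2[of UNIV f UNIV "\<lambda>x. L x + c"] by simp
next
  case (Suc k)
  have D: "((\<lambda>x. f (L x + c)) has_derivative
       (\<lambda>h. \<Sum>i\<in>Basis. (L h \<bullet> i) * partial_deriv i f (L x + c))) (at x)" for x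
  proof -
    have "((\<lambda>x. L x + c) has_derivative L) (at x)"
      using bounded_linear_imp_has_derivative[OF L] by (auto intro!: derivative_eq_intros)
    moreover have "(f has_derivative (\<lambda>h. \<Sum>i\<in>Basis. (h \<bullet> i) * partial_deriv i f (L x + c))) (at (L x + c))"
      using Suc.prems by (intro has_derivative_partial) auto
    ultimately show ?thesis by (rule has_derivative_compose)
  qed
  have "partial_deriv j (\<lambda>x. f (L x + c)) =
      (\<lambda>x. \<Sum>i\<in>Basis. (L j \<bullet> i) * partial_deriv i f (L x + c))" for j
    by (intro ext) (simp add: partial_deriv_eq[OF D])
  then show ?case
    using Suc D by (auto intro!: Ck_sum Ck_cmult simp: differentiable_def)
qed

lemma partial_deriv_affine_scale:
  fixes f :: "'a::euclidean_space \<Rightarrow> real"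
  assumes "f differentiable (at (c *\<^sub>R x + a))"
  shows "partial_deriv i (\<lambda>x. f (c *\<^sub>R x + a)) x = c * partial_deriv i f (c *\<^sub>R x + a)"
proof -
  have 1: "((\<lambda>x. c *\<^sub>R x + a) has_derivative (\<lambda>h. c *\<^sub>R h)) (at x)"
    by (auto intro!: derivative_eq_intros)
  have 2: "(f has_derivative frechet_derivative f (at (c *\<^sub>R x + a))) (at (c *\<^sub>R x + a))"
    using assms frechet_derivative_works by blast
  have "linear (frechet_derivative f (at (c *\<^sub>R x + a)))" using 2 by (rule has_derivative_linear)
  then show ?thesis
    using partial_deriv_eq[OF has_derivative_compose[OF 1 2]] by (simp add: partial_deriv_def linear_scale)
qed

lemma smooth_differentiable: "smooth f \<Longrightarrow> f differentiable (at x)"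
  unfolding smooth_def using Ck_differentiable by blast

lemma smooth_partial_deriv: "smooth f \<Longrightarrow> i \<in> Basis \<Longrightarrow> smooth (partial_deriv i f)"
  unfolding smooth_def by (metis Ck.simps(2))

lemma smooth_continuous: "smooth f \<Longrightarrow> continuous_on S f"
  unfolding smooth_def using Ck_continuous by blast

lemma smooth_intros:
  "smooth (\<lambda>x. c)"
  "smooth f \<Longrightarrow> smooth g \<Longrightarrow> smooth (\<lambda>x. f x + g x)"
  "smooth f \<Longrightarrow> smooth g \<Longrightarrow> smooth (\<lambda>x. f x - g x)"
  "smooth f \<Longrightarrow> smooth g \<Longrightarrow> smooth (\<lambda>x. f x * g x)"
  unfolding smooth_def by (auto intro: Ck_add Ck_mult Ck_diff)

lemma smooth_sum: "(\<And>i. i \<in> I \<Longrightarrow> smooth (f i)) \<Longrightarrow> smooth (\<lambda>x. \<Sum>i\<in>I. f i x)"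
  unfolding smooth_def by (auto intro: Ck_sum)

lemma smooth_prod: "(\<And>i. i \<in> I \<Longrightarrow> smooth (f i)) \<Longrightarrow> smooth (\<lambda>x. \<Prod>i\<in>I. f i x)"
  unfolding smooth_def by (auto intro: Ck_prod)

lemma smooth_affine: "bounded_linear L \<Longrightarrow> smooth f \<Longrightarrow> smooth (\<lambda>x. f (L x + c))"
  unfolding smooth_def by (auto intro: Ck_affine)

lemma smooth_coordinate: "smooth F \<Longrightarrow> smooth (\<lambda>x. F (n * (x \<bullet> i) + c))"
  using smooth_affine[of "\<lambda>x. n * (x \<bullet> i)" F c]
  by (simp add: bounded_linear_mult_const bounded_linear_inner_left bounded_linear_const_mult bounded_linear_intros)

text \<open>
  A sequence of functions, each the derivative of the one before, is the convenient certificate of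
  smoothness for concrete functions of one variable.
\<close>

lemma Ck_real:
  fixes D :: "nat \<Rightarrow> real \<Rightarrow> real"
  assumes "\<And>n t. (D n has_real_derivative D (Suc n) t) (at t)"
  shows "Ck k (D n)"
proof (induction k arbitrary: n)
  case 0
  have "isCont (D n) t" for t using assms DERIV_isCont by blast
  then show ?case by (simp add: continuous_at_imp_continuous_on)
next
  case (Suc k)
  have "(D n has_derivative (\<lambda>h. D (Suc n) t * h)) (at t)" for t
    using assms[of n t] by (simp add: has_field_derivative_def)
  then have "partial_deriv 1 (D n) t = D (Suc n) t * 1" and "D n differentiable (at t)" for t
    using partial_deriv_eq[of "D n" "\<lambda>h. D (Suc n) t * h" t 1] differentiableI by simp_all blast+
  then have "partial_deriv 1 (D n) = D (Suc n)" and "\<And>t. D n differentiable (at t)" by auto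
  then show ?case using Suc by simp
qed

lemma smooth_real:
  fixes D :: "nat \<Rightarrow> real \<Rightarrow> real"
  assumes "\<And>n t. (D n has_real_derivative D (Suc n) t) (at t)"
  shows "smooth (D 0)"
  using Ck_real[of D _ 0] assms by (auto simp: smooth_def)

lemma partial_deriv_inner: "partial_deriv i (\<lambda>x. x \<bullet> e) = (\<lambda>x. i \<bullet> e)"
  by (rule ext, rule partial_deriv_eq) (auto intro!: derivative_eq_intros)

lemma smooth_inner: "smooth (\<lambda>x. x \<bullet> e)"
proof -
  have "smooth (\<lambda>t::real. t)"
    using smooth_real[of "\<lambda>n t. if n = 0 then t else if n = 1 then 1 else 0"]
    by (auto intro!: derivative_eq_intros)
  from smooth_coordinate[OF this, of 1 e 0] show ?thesis by simp
qed

section \<open>Smooth cutoff functions\<close>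

text \<open>
  With the polynomial 1 this is the classical smooth function that vanishes to infinite order at 0.
  Polynomial factors in \<open>1/t\<close> make the family closed under differentiation.
\<close>

definition flat_exp :: "real poly \<Rightarrow> real \<Rightarrow> real" where
  "flat_exp p t = (if t > 0 then poly p (1/t) * exp (- (1/t)) else 0)"

text \<open>
  From \<open>(p(1/t) exp(-1/t))' = (1/t)\<^sup>2 (p(1/t) - p'(1/t)) exp(-1/t)\<close>.
\<close>

definition flat_exp_deriv :: "real poly \<Rightarrow> real poly" where
  "flat_exp_deriv p = [:0, 0, 1:] * (p - pderiv p)"

lemma poly_div_exp_tendsto_0: "((\<lambda>x. poly p x * exp (- x)) \<longlongrightarrow> (0::real)) at_top"
proof -
  have "((\<lambda>x. \<Sum>i\<le>degree p. coeff p i * (x ^ i / exp x)) \<longlongrightarrow> (\<Sum>i\<le>degree p. coeff p i * 0)) at_top"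
    by (intro tendsto_intros tendsto_power_div_exp_0)
  moreover have "(\<Sum>i\<le>degree p. coeff p i * (x ^ i / exp x)) = poly p x * exp (- x)" for x :: real
    by (simp add: poly_altdef sum_distrib_right exp_minus divide_inverse mult.assoc)
  ultimately show ?thesis by simp
qed

lemma flat_exp_tendsto_0: "(flat_exp p \<longlongrightarrow> 0) (at 0)"
proof -
  have "((\<lambda>t. poly p (inverse t) * exp (- inverse t)) \<longlongrightarrow> 0) (at_right (0::real))"
    by (rule filterlim_compose[OF poly_div_exp_tendsto_0 filterlim_inverse_at_top_right])
  then have "(flat_exp p \<longlongrightarrow> 0) (at_right 0)"
    by (rule Lim_transform_eventually)
       (auto simp: flat_exp_def eventually_at_filter inverse_eq_divide)
  moreover have "(flat_exp p \<longlongrightarrow> 0) (at_left 0)"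
    by (rule Lim_transform_eventually[OF tendsto_const]) (auto simp: flat_exp_def eventually_at_filter)
  ultimately show ?thesis by (simp add: filterlim_at_split)
qed

lemma flat_exp_has_derivative:
  "(flat_exp p has_real_derivative flat_exp (flat_exp_deriv p) t) (at t)"
proof -
  consider "t > 0" | "t < 0" | "t = 0" by linarith
  then show ?thesis
  proof cases
    case 1
    have "((\<lambda>t. poly p (1/t) * exp (- (1/t))) has_real_derivative flat_exp (flat_exp_deriv p) t) (at t)"
    proof -
      have e: "flat_exp (flat_exp_deriv p) t =
          poly (pderiv p) (1/t) * (- 1 / t\<^sup>2) * exp (- (1/t)) + exp (- (1/t)) * (1 / t\<^sup>2) * poly p (1/t)"
        using 1 by (simp add: flat_exp_def flat_exp_deriv_def power2_eq_square field_simps)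
      have d1: "((\<lambda>t. 1/t) has_real_derivative - 1 / t\<^sup>2) (at t)"
        using 1 by (auto intro!: derivative_eq_intros simp: power2_eq_square)
      have d2: "((\<lambda>t. poly p (1/t)) has_real_derivative poly (pderiv p) (1/t) * (- 1 / t\<^sup>2)) (at t)"
        by (rule DERIV_chain2[OF poly_DERIV d1])
      have d3: "((\<lambda>t. exp (- (1/t))) has_real_derivative exp (- (1/t)) * (1 / t\<^sup>2)) (at t)"
        using DERIV_chain2[OF DERIV_exp DERIV_minus[OF d1]] by simp
      show ?thesis unfolding e using DERIV_mult[OF d2 d3] by (simp add: algebra_simps)
    qed
    then show ?thesis
      by (rule has_field_derivative_transform_within_open[where S="{0<..}"])
         (use 1 in \<open>auto simp: flat_exp_def\<close>)
  next
    case 2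
    have "((\<lambda>t. 0) has_real_derivative flat_exp (flat_exp_deriv p) t) (at t)"
      using 2 by (simp add: flat_exp_def)
    then show ?thesis
      by (rule has_field_derivative_transform_within_open[where S="{..<0}"])
         (use 2 in \<open>auto simp: flat_exp_def\<close>)
  next
    case 3
    \<comment> \<open>The factor \<open>1/h\<close> of the difference quotient multiplies the polynomial by its variable.\<close>
    have "((\<lambda>h. (flat_exp p (0 + h) - flat_exp p 0) / h) \<longlongrightarrow> 0) (at 0)"
      by (rule Lim_transform_eventually[OF flat_exp_tendsto_0[of "pCons 0 p"]])
         (auto simp: flat_exp_def eventually_at_filter)
    then show ?thesis using 3 by (simp add: DERIV_def flat_exp_def)
  qed
qed

lemma smooth_flat_exp: "smooth (flat_exp 1)"
  using smooth_real[of "\<lambda>n. flat_exp ((flat_exp_deriv ^^ n) 1)"] flat_exp_has_derivative by simp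

definition smooth_step :: "real \<Rightarrow> real" where
  "smooth_step t = flat_exp 1 t * inverse (flat_exp 1 t + flat_exp 1 (1 - t))"

lemma flat_exp_1_pos: "t > 0 \<Longrightarrow> flat_exp 1 t > 0"
  and flat_exp_1_zero: "t \<le> 0 \<Longrightarrow> flat_exp 1 t = 0"
  and flat_exp_1_nonneg: "flat_exp 1 t \<ge> 0"
  by (auto simp: flat_exp_def)

lemma flat_exp_sum_pos: "flat_exp 1 t + flat_exp 1 (1 - t) > 0"
  using flat_exp_1_pos[of t] flat_exp_1_pos[of "1-t"] flat_exp_1_nonneg[of t] flat_exp_1_nonneg[of "1-t"]
  by (cases "t > 0") auto

lemma smooth_smooth_step: "smooth smooth_step"
proof -
  have "smooth (\<lambda>t. flat_exp 1 (1 - t))"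
    using smooth_affine[OF bounded_linear_minus[OF bounded_linear_ident] smooth_flat_exp, of 1] by simp
  then have "smooth (\<lambda>t. inverse (flat_exp 1 t + flat_exp 1 (1 - t)))"
    using smooth_flat_exp flat_exp_sum_pos unfolding smooth_def
    by (intro allI Ck_inverse Ck_add) (auto simp: less_imp_neq[symmetric] dest: less_imp_neq)
  then show ?thesis
    unfolding smooth_step_def[abs_def] using smooth_flat_exp by (intro smooth_intros)
qed

lemma smooth_step_zero: "t \<le> 0 \<Longrightarrow> smooth_step t = 0"
  by (simp add: smooth_step_def flat_exp_1_zero)

lemma smooth_step_one: "t \<ge> 1 \<Longrightarrow> smooth_step t = 1"
  using flat_exp_1_pos[of t] by (simp add: smooth_step_def flat_exp_1_zero)

lemma smooth_step_nonneg: "0 \<le> smooth_step t" and smooth_step_le_one: "smooth_step t \<le> 1"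
proof -
  have *: "flat_exp 1 t + flat_exp 1 (1 - t) > 0" by (rule flat_exp_sum_pos)
  show "0 \<le> smooth_step t" using * flat_exp_1_nonneg[of t] by (simp add: smooth_step_def)
  show "smooth_step t \<le> 1" using * flat_exp_1_nonneg[of "1-t"]
    by (simp add: smooth_step_def divide_inverse [symmetric])
qed

text \<open>
  The parameter \<open>n\<close> is the steepness: for \<open>n\<close> tending to infinity the cutoffs converge to the
  indicator function of the open box.
\<close>

definition box_cutoff :: "real \<Rightarrow> 'a::euclidean_space \<Rightarrow> 'a \<Rightarrow> 'a \<Rightarrow> real" where
  "box_cutoff n a b x =
     (\<Prod>i\<in>Basis. smooth_step (n * (x \<bullet> i - a \<bullet> i)) * smooth_step (n * (b \<bullet> i - x \<bullet> i)))"

lemma smooth_box_cutoff: "smooth (box_cutoff n a b)"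
proof -
  have "smooth (\<lambda>x. smooth_step (n * (x \<bullet> i - a \<bullet> i)))" for i
    using smooth_coordinate[OF smooth_smooth_step, of n i "- n * (a \<bullet> i)"] by (simp add: algebra_simps)
  moreover have "smooth (\<lambda>x. smooth_step (n * (b \<bullet> i - x \<bullet> i)))" for i
    using smooth_coordinate[OF smooth_smooth_step, of "-n" i "n * (b \<bullet> i)"] by (simp add: algebra_simps)
  ultimately show ?thesis
    unfolding box_cutoff_def[abs_def] by (intro smooth_prod smooth_intros)
qed

lemma box_cutoff_nonneg: "0 \<le> box_cutoff n a b x"
  unfolding box_cutoff_def by (intro prod_nonneg mult_nonneg_nonneg smooth_step_nonneg)

lemma box_cutoff_le_one: "box_cutoff n a b x \<le> 1"
  unfolding box_cutoff_def
  by (intro prod_le_1 conjI mult_nonneg_nonneg smooth_step_nonneg smooth_step_le_one mult_le_one)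

lemma box_cutoff_zero:
  assumes "n \<ge> 0" "x \<notin> box a b"
  shows "box_cutoff n a b x = 0"
proof -
  obtain i where i: "i \<in> Basis" "x \<bullet> i \<le> a \<bullet> i \<or> b \<bullet> i \<le> x \<bullet> i"
    using assms(2) by (auto simp: mem_box not_less)
  then have "smooth_step (n * (x \<bullet> i - a \<bullet> i)) * smooth_step (n * (b \<bullet> i - x \<bullet> i)) = 0"
    using assms(1) by (auto simp: smooth_step_zero mult_nonneg_nonpos)
  then show ?thesis unfolding box_cutoff_def using i(1) by (intro prod_zero) auto
qed

lemma box_cutoff_one:
  assumes "\<And>i. i \<in> Basis \<Longrightarrow> n * (x \<bullet> i - a \<bullet> i) \<ge> 1 \<and> n * (b \<bullet> i - x \<bullet> i) \<ge> 1"
  shows "box_cutoff n a b x = 1"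
  unfolding box_cutoff_def using assms by (intro prod.neutral) (auto simp: smooth_step_one)

lemma box_cutoff_tendsto_indicator:
  "(\<lambda>n. box_cutoff (real n) a b x) \<longlonglongrightarrow> indicator (box a b) x"
proof (cases "x \<in> box a b")
  case True
  have "\<forall>\<^sub>F n in sequentially. \<forall>i\<in>Basis. real n * (x \<bullet> i - a \<bullet> i) \<ge> 1 \<and> real n * (b \<bullet> i - x \<bullet> i) \<ge> 1"
  proof (intro eventually_ball_finite ballI finite_Basis)
    fix i :: 'a assume i: "i \<in> Basis"
    have ev: "\<forall>\<^sub>F n in sequentially. real n * d \<ge> 1" if "d > 0" for d
    proof -
      obtain N where N: "real N \<ge> 1/d" using real_arch_simple by blast
      have "real n * d \<ge> 1" if "n \<ge> N" for n
      proof -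
        have "real n \<ge> 1/d" using N that by linarith
        then show ?thesis using \<open>d > 0\<close> by (simp add: field_simps)
      qed
      then show ?thesis by (auto simp: eventually_sequentially)
    qed
    show "\<forall>\<^sub>F n in sequentially. real n * (x \<bullet> i - a \<bullet> i) \<ge> 1 \<and> real n * (b \<bullet> i - x \<bullet> i) \<ge> 1"
      using True i by (intro eventually_conj ev) (auto simp: mem_box)
  qed
  then have "\<forall>\<^sub>F n in sequentially. box_cutoff (real n) a b x = 1"
    by eventually_elim (auto intro: box_cutoff_one)
  then show ?thesis using True by (simp add: tendsto_eventually)
next
  case False
  then show ?thesis by (simp add: box_cutoff_zero)
qed

lemma smooth_ball_cutoff:
  fixes p :: "'a::euclidean_space"
  assumes "r > 0"
  obtains \<theta> \<rho> where "smooth \<theta>" "\<rho> > 0" "\<And>x. 0 \<le> \<theta> x" "\<And>x. \<theta> x \<le> 1"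
    "\<And>x. x \<notin> ball p r \<Longrightarrow> \<theta> x = 0" "\<And>x. x \<in> ball p \<rho> \<Longrightarrow> \<theta> x = 1"
proof -
  obtain a b where ab: "p \<in> box a b" "box a b \<subseteq> ball p r"
    using rational_boxes[OF assms, of p] by (metis)
  define m where "m = Min ((\<lambda>i. min (p \<bullet> i - a \<bullet> i) (b \<bullet> i - p \<bullet> i)) ` Basis)"
  have m: "m > 0" unfolding m_def using ab(1) by (subst Min_gr_iff) (auto simp: mem_box)
  have mi: "m \<le> p \<bullet> i - a \<bullet> i" "m \<le> b \<bullet> i - p \<bullet> i" if "i \<in> Basis" for i
  proof -
    have "m \<le> min (p \<bullet> i - a \<bullet> i) (b \<bullet> i - p \<bullet> i)" unfolding m_def using that by (intro Min_le) auto
    then show "m \<le> p \<bullet> i - a \<bullet> i" "m \<le> b \<bullet> i - p \<bullet> i" by auto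
  qed
  show ?thesis
  proof (rule that[of "box_cutoff (2/m) a b" "m/2"])
    fix x assume x: "x \<in> ball p (m/2)"
    show "box_cutoff (2/m) a b x = 1"
    proof (rule box_cutoff_one)
      fix i :: 'a assume i: "i \<in> Basis"
      have "\<bar>(x - p) \<bullet> i\<bar> \<le> norm (x - p)" using i by (rule Basis_le_norm)
      also have "\<dots> < m/2" using x by (simp add: dist_norm norm_minus_commute)
      finally have "\<bar>x \<bullet> i - p \<bullet> i\<bar> < m/2" by (simp add: inner_diff_left)
      then have "x \<bullet> i - a \<bullet> i \<ge> m/2 \<and> b \<bullet> i - x \<bullet> i \<ge> m/2"
        using mi[OF i] by linarith
      then show "2 / m * (x \<bullet> i - a \<bullet> i) \<ge> 1 \<and> 2 / m * (b \<bullet> i - x \<bullet> i) \<ge> 1"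
        using m by (simp add: field_simps)
    qed
  qed (use m ab in \<open>auto intro!: smooth_box_cutoff box_cutoff_nonneg box_cutoff_le_one box_cutoff_zero\<close>)
qed

section \<open>Functions with compact support\<close>

lemma compact_support_bounded:
  fixes f :: "'a::euclidean_space \<Rightarrow> real"
  assumes "continuous_on UNIV f" "compact K" "\<And>x. x \<notin> K \<Longrightarrow> f x = 0"
  obtains C where "C > 0" "\<And>x. \<bar>f x\<bar> \<le> C"
proof -
  have "compact (f ` K)" using assms by (intro compact_continuous_image continuous_on_subset[OF assms(1)]) auto
  then obtain C where C: "\<And>x. x \<in> K \<Longrightarrow> \<bar>f x\<bar> \<le> C"
    using compact_imp_bounded by (fastforce simp: bounded_iff)
  have "\<bar>f x\<bar> \<le> max C 1" for x
    using C[of x] assms(3)[of x] by (cases "x \<in> K") (auto simp: le_max_iff_disj)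
  then show ?thesis using that[of "max C 1"] by auto
qed

lemma compact_support_integrable:
  fixes f :: "'a::euclidean_space \<Rightarrow> real"
  assumes "continuous_on UNIV f" "compact K" "\<And>x. x \<notin> K \<Longrightarrow> f x = 0"
  shows "integrable lborel f"
proof -
  have "integrable lborel (\<lambda>x. indicator K x *\<^sub>R f x)"
    using assms by (intro borel_integrable_compact continuous_on_subset[OF assms(1)]) auto
  moreover have "(\<lambda>x. indicator K x *\<^sub>R f x) = f"
  proof
    show "indicator K x *\<^sub>R f x = f x" for x using assms(3)[of x] by (cases "x \<in> K") auto
  qed
  ultimately show ?thesis by simp
qed

lemma partial_deriv_zero_outside:
  assumes "closed K" "\<And>x. x \<notin> K \<Longrightarrow> f x = 0" "x \<notin> K"
  shows "partial_deriv i f x = 0"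
proof -
  have "((\<lambda>x. 0) has_derivative (\<lambda>h. 0)) (at x)" by simp
  then have "(f has_derivative (\<lambda>h. 0)) (at x)"
    by (rule has_derivative_transform_within_open[where s="-K"]) (use assms in auto)
  then show ?thesis by (rule partial_deriv_eq)
qed

lemma lborel_integral_translate:
  fixes f :: "'a::euclidean_space \<Rightarrow> real"
  assumes "f \<in> borel_measurable borel"
  shows "(\<integral>x. f (x + c) \<partial>lborel) = (\<integral>x. f x \<partial>lborel)"
proof -
  have "(\<integral>x. f x \<partial>lborel) = (\<integral>x. f x \<partial>distr lborel borel ((+) c))"
    by (simp add: lborel_distr_plus)
  also have "\<dots> = (\<integral>x. f (c + x) \<partial>lborel)"
    using assms by (intro integral_distr) auto
  finally show ?thesis by (simp add: add.commute)
qed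

text \<open>
  The difference quotients of \<open>f\<close> have integral 0 by translation invariance of Lebesgue measure,
  and they converge boundedly with common compact support.
\<close>

lemma integral_partial_deriv_eq_0:
  fixes f :: "'a::euclidean_space \<Rightarrow> real"
  assumes f: "Ck 1 f" and K: "compact K" and z: "\<And>x. x \<notin> K \<Longrightarrow> f x = 0" and i: "i \<in> Basis"
  shows "(\<integral>x. partial_deriv i f x \<partial>lborel) = 0"
proof -
  let ?D = "partial_deriv i f"
  have cD: "continuous_on UNIV ?D" and df: "\<And>x. f differentiable (at x)" using f i by auto
  have cf: "continuous_on UNIV f" using f Ck_continuous by blast
  have zD: "?D x = 0" if "x \<notin> K" for x
    using partial_deriv_zero_outside[OF compact_imp_closed[OF K] z that] .
  obtain C where C: "C > 0" "\<And>x. \<bar>?D x\<bar> \<le> C" using compact_support_bounded[OF cD K zD] by blast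
  obtain R where R: "\<And>x. x \<in> K \<Longrightarrow> norm x \<le> R" using compact_imp_bounded[OF K] by (auto simp: bounded_iff)
  define t :: "nat \<Rightarrow> real" where "t n = inverse (real (Suc n))" for n
  have t: "0 < t n" "t n \<le> 1" for n by (auto simp: t_def inverse_le_1_iff)
  have tl: "t \<longlonglongrightarrow> 0" unfolding t_def[abs_def] by (rule LIMSEQ_inverse_real_of_nat)
  have der: "((\<lambda>s. f (x + s *\<^sub>R i)) has_real_derivative ?D (x + s *\<^sub>R i)) (at s)" for x s
  proof -
    let ?F = "frechet_derivative f (at (x + s *\<^sub>R i))"
    have 1: "((\<lambda>s. x + s *\<^sub>R i) has_derivative (\<lambda>h. h *\<^sub>R i)) (at s)" by (auto intro!: derivative_eq_intros)
    have 2: "(f has_derivative ?F) (at (x + s *\<^sub>R i))" using df frechet_derivative_works by blast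
    have "?F (h *\<^sub>R i) = ?F i * h" for h
      using has_derivative_linear[OF 2] by (simp add: linear_scale)
    then show ?thesis
      using has_derivative_compose[OF 1 2] by (simp add: has_field_derivative_def partial_deriv_def)
  qed
  let ?q = "\<lambda>n x. (f (x + t n *\<^sub>R i) - f x) / t n"
  have lim: "(\<lambda>n. ?q n x) \<longlonglongrightarrow> ?D x" for x
  proof -
    have "((\<lambda>h. (f (x + h *\<^sub>R i) - f x) / h) \<longlongrightarrow> ?D x) (at 0)"
      using der[of x 0] by (simp add: DERIV_def)
    moreover have "filterlim t (at 0) sequentially"
      using tl t(1) by (auto simp: filterlim_at less_imp_neq[symmetric])
    ultimately show ?thesis by (rule filterlim_compose)
  qed
  have bd: "\<bar>?q n x\<bar> \<le> C * indicator (cball 0 (R + 1)) x" for n x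
  proof (cases "x \<in> cball 0 (R + 1)")
    case True
    obtain \<xi> where "f (x + t n *\<^sub>R i) - f (x + 0 *\<^sub>R i) = (t n - 0) * ?D (x + \<xi> *\<^sub>R i)"
      using MVT2[of 0 "t n" "\<lambda>s. f (x + s *\<^sub>R i)" "\<lambda>s. ?D (x + s *\<^sub>R i)"] t[of n] der by blast
    then have "?q n x = ?D (x + \<xi> *\<^sub>R i)" using t[of n] by simp
    then show ?thesis using C True by simp
  next
    case False
    then have "norm x > R + 1" by simp
    moreover have "norm (x + t n *\<^sub>R i) \<ge> norm x - norm (t n *\<^sub>R i)"
      using norm_triangle_ineq4[of "x + t n *\<^sub>R i" "t n *\<^sub>R i"] by simp
    moreover have "norm (t n *\<^sub>R i) \<le> 1" using t[of n] i by simp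
    ultimately have "x \<notin> K" "x + t n *\<^sub>R i \<notin> K" using R[of x] R[of "x + t n *\<^sub>R i"] by auto
    then show ?thesis using False z by simp
  qed
  have fm: "f \<in> borel_measurable borel" using cf by (rule borel_measurable_continuous_onI)
  have Dm: "?D \<in> borel_measurable borel" using cD by (rule borel_measurable_continuous_onI)
  have fi: "integrable lborel f" by (rule compact_support_integrable[OF cf K z])
  have fti: "integrable lborel (\<lambda>x. f (x + c))" for c
  proof -
    have "integrable (distr lborel borel ((+) c)) f" using fi by (simp add: lborel_distr_plus)
    then show ?thesis using fm by (subst (asm) integrable_distr_eq) (auto simp: add.commute)
  qed
  have L: "(\<lambda>n. \<integral>x. ?q n x \<partial>lborel) \<longlonglongrightarrow> (\<integral>x. ?D x \<partial>lborel)"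
  proof (rule integral_dominated_convergence[where w="\<lambda>x. C * indicator (cball 0 (R + 1)) x"])
    show "integrable lborel (\<lambda>x::'a. C * indicator (cball 0 (R + 1)) x)"
      by (intro integrable_mult_right integrable_real_indicator) (auto simp: emeasure_bounded_finite[unfolded infinity_ennreal_def])
  qed (use fm Dm lim bd in auto)
  have z: "(\<integral>x. ?q n x \<partial>lborel) = 0" for n
    using fi fti lborel_integral_translate[OF fm] by simp
  have "(\<lambda>n. 0) \<longlonglongrightarrow> (\<integral>x. ?D x \<partial>lborel)" using L unfolding z .
  then show ?thesis using LIMSEQ_unique[OF _ tendsto_const] by metis
qed

section \<open>Functions with vanishing integrals against test functions\<close>

text \<open>
  Boxes form a generator of the Borel sets that is stable under intersections, so the integral of \<open>f\<close>
  over every Borel set is 0.  By the last hypothesis the sets where \<open>f\<close> is positive or negative may be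
  replaced by Borel sets.  Lebesgue measure and surface measure both satisfy that hypothesis.
\<close>

lemma AE_zero_if_box_integrals_zero:
  fixes f :: "'a::euclidean_space \<Rightarrow> real"
  assumes f: "integrable M f" and id: "(\<lambda>x. x) \<in> M \<rightarrow>\<^sub>M borel"
    and zero: "\<And>a b. (\<integral>x. f x * indicator (box a b) x \<partial>M) = 0"
    and reg: "\<And>A. A \<in> sets M \<Longrightarrow> \<exists>B\<in>sets borel. AE x in M. x \<in> A \<longleftrightarrow> x \<in> B"
  shows "AE x in M. f x = 0"
proof -
  let ?G = "range (\<lambda>(a, b). box a b :: 'a set)"
  have sb: "sets (borel :: 'a measure) = sigma_sets UNIV ?G"
    unfolding borel_eq_box by (simp add: sets_measure_of)
  have fm [measurable]: "f \<in> borel_measurable M" using f by simp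
  have ind [measurable]: "(\<lambda>x. indicator B x :: real) \<in> borel_measurable M" if "B \<in> sets borel" for B :: "'a set"
    using measurable_compose[OF id borel_measurable_indicator[OF that]] by simp
  have int: "integrable M (\<lambda>x. f x * indicator B x)" if "B \<in> sets borel" for B
    using f ind[OF that] by (intro Bochner_Integration.integrable_bound[OF f]) (auto simp: indicator_def)
  have lim0: "(\<integral>x. f x * indicator B x \<partial>M) = 0"
    if B: "\<And>n. A n \<in> sets borel" "B \<in> sets borel" "\<And>n. (\<integral>x. f x * indicator (A n) x \<partial>M) = 0"
      and c: "\<And>x. (\<lambda>n. indicator (A n) x :: real) \<longlonglongrightarrow> indicator B x" for A :: "nat \<Rightarrow> 'a set" and B
  proof -
    have "(\<lambda>n. \<integral>x. f x * indicator (A n) x \<partial>M) \<longlonglongrightarrow> (\<integral>x. f x * indicator B x \<partial>M)"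
    proof (rule integral_dominated_convergence[where w="\<lambda>x. \<bar>f x\<bar>"])
      show "AE x in M. (\<lambda>n. f x * indicator (A n) x) \<longlonglongrightarrow> f x * indicator B x"
        by (intro AE_I2 tendsto_mult tendsto_const c)
      show "AE x in M. norm (f x * indicator (A n) x) \<le> \<bar>f x\<bar>" for n
        by (intro AE_I2) (auto simp: indicator_def)
    qed (use f int[OF B(1)] int[OF B(2)] in auto)
    then have "(\<lambda>n. 0) \<longlonglongrightarrow> (\<integral>x. f x * indicator B x \<partial>M)" unfolding B(3) .
    then show ?thesis using LIMSEQ_unique[OF _ tendsto_const] by metis
  qed
  have int0: "(\<integral>x. f x \<partial>M) = 0"
  proof -
    have "(\<integral>x. f x * indicator UNIV x \<partial>M) = 0"
    proof (rule lim0[of "\<lambda>n. box (- real n *\<^sub>R One) (real n *\<^sub>R One)"])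
      fix x :: 'a
      obtain N where N: "norm x < real N" using reals_Archimedean2 by blast
      have "x \<in> box (- real n *\<^sub>R One) (real n *\<^sub>R One)" if "n \<ge> N" for n
      proof -
        have "\<bar>x \<bullet> i\<bar> < real n" if "i \<in> Basis" for i
          using Basis_le_norm[OF that, of x] N \<open>n \<ge> N\<close> by linarith
        then show ?thesis by (auto simp: mem_box abs_less_iff minus_less_iff)
      qed
      then have "\<forall>\<^sub>F n in sequentially. indicator (box (- real n *\<^sub>R One) (real n *\<^sub>R One)) x = (1::real)"
        by (auto simp: eventually_sequentially intro!: exI[of _ N])
      then show "(\<lambda>n. indicator (box (- real n *\<^sub>R One) (real n *\<^sub>R One)) x :: real) \<longlonglongrightarrow> indicator UNIV x"
        by (simp add: tendsto_eventually)
    qed (auto simp: zero)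
    then show ?thesis by simp
  qed
  have borel0: "(\<integral>x. f x * indicator B x \<partial>M) = 0" if "B \<in> sets borel" for B
  proof -
    have "Int_stable ?G" by (auto simp: Int_stable_def box_Int_box)
    moreover have "?G \<subseteq> Pow UNIV" by simp
    moreover have "B \<in> sigma_sets UNIV ?G" using that by (simp add: sb)
    ultimately show ?thesis
  proof (induction B rule: sigma_sets_induct_disjoint)
    case (compl A)
    then have A: "A \<in> sets borel" by (simp add: sb)
    have "(\<integral>x. f x * indicator (UNIV - A) x \<partial>M) = (\<integral>x. f x - f x * indicator A x \<partial>M)"
      by (intro Bochner_Integration.integral_cong) (auto simp: indicator_def)
    also have "\<dots> = 0" using f int[OF A] int0 compl by simp
    finally show ?case .
  next
    case (union A)
    then have A: "A i \<in> sets borel" for i by (auto simp: sb)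
    have D: "disjoint_family_on A {..<n}" for n using union by (auto simp: disjoint_family_on_def)
    show ?case
    proof (rule lim0[of "\<lambda>n. \<Union>i<n. A i"])
      fix n
      have "(\<integral>x. f x * indicator (\<Union>i<n. A i) x \<partial>M) = (\<integral>x. (\<Sum>i<n. f x * indicator (A i) x) \<partial>M)"
        by (simp add: indicator_UN_disjoint[OF _ D] sum_distrib_left)
      also have "\<dots> = (\<Sum>i<n. \<integral>x. f x * indicator (A i) x \<partial>M)"
        using int[OF A] by (intro Bochner_Integration.integral_sum) auto
      finally show "(\<integral>x. f x * indicator (\<Union>i<n. A i) x \<partial>M) = 0" using union by simp
    next
      fix x show "(\<lambda>n. indicator (\<Union>i<n. A i) x :: real) \<longlonglongrightarrow> indicator (\<Union>i. A i) x"
        by (rule LIMSEQ_indicator_UN)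
    qed (use A in auto)
  qed (auto simp: zero)
  qed
  have half: "AE x in M. \<not> c * f x > 0" for c :: real
  proof -
    have "{x \<in> space M. c * f x > 0} \<in> sets M" by measurable
    from reg[OF this] obtain B where B: "B \<in> sets borel"
      and ae: "AE x in M. x \<in> {x \<in> space M. c * f x > 0} \<longleftrightarrow> x \<in> B" by blast
    have ae': "AE x in M. max 0 (c * f x) = c * (f x * indicator B x)"
      using ae AE_space by eventually_elim (auto simp: indicator_def)
    have "(\<integral>x. max 0 (c * f x) \<partial>M) = (\<integral>x. c * (f x * indicator B x) \<partial>M)"
      using ind[OF B] by (intro integral_cong_AE ae' borel_measurable_times borel_measurable_max borel_measurable_const fm)
    also have "\<dots> = 0" using borel0[OF B] by simp
    finally have "AE x in M. max 0 (c * f x) = 0"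
      using f by (subst (asm) integral_nonneg_eq_0_iff_AE) auto
    then show ?thesis by eventually_elim auto
  qed
  show ?thesis using half[of 1] half[of "-1"] by eventually_elim auto
qed

lemma Cc_infinityI:
  assumes "smooth f" "compact K" "K \<subseteq> \<Omega>" "\<And>x. x \<notin> K \<Longrightarrow> f x = 0"
  shows "f \<in> Cc_infinity \<Omega>"
  using assms unfolding Cc_infinity_def Cc_def smooth_def by auto

lemma Cc_infinityE:
  assumes "f \<in> Cc_infinity \<Omega>"
  obtains K where "smooth f" "compact K" "K \<subseteq> \<Omega>" "\<And>x. x \<notin> K \<Longrightarrow> f x = 0"
proof -
  have s: "smooth f" using assms by (auto simp: Cc_infinity_def Cc_def smooth_def)
  have "f \<in> Cc 0 \<Omega>" using assms by (auto simp: Cc_infinity_def)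
  then obtain K where "compact K" "K \<subseteq> \<Omega>" "\<forall>x. x \<notin> K \<longrightarrow> f x = 0" unfolding Cc_def by blast
  then show ?thesis using that s by blast
qed

lemma Cc_infinity_smooth: "f \<in> Cc_infinity \<Omega> \<Longrightarrow> smooth f"
  by (auto elim: Cc_infinityE)

lemma Cc_infinity_subset_Cc: "f \<in> Cc_infinity \<Omega> \<Longrightarrow> f \<in> Cc k \<Omega>"
  by (auto simp: Cc_infinity_def)

lemma Cc_infinity_partial_deriv:
  assumes "f \<in> Cc_infinity \<Omega>" "i \<in> Basis"
  shows "partial_deriv i f \<in> Cc_infinity \<Omega>"
proof -
  obtain K where K: "smooth f" "compact K" "K \<subseteq> \<Omega>" "\<And>x. x \<notin> K \<Longrightarrow> f x = 0"
    using Cc_infinityE[OF assms(1)] by blast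
  show ?thesis
    using K assms(2) partial_deriv_zero_outside[OF compact_imp_closed[OF K(2)] K(4)]
    by (intro Cc_infinityI[of _ K] smooth_partial_deriv) auto
qed

lemma Cc_infinity_lincomb:
  assumes "f \<in> Cc_infinity \<Omega>" "g \<in> Cc_infinity \<Omega>"
  shows "(\<lambda>x. f x + c * g x) \<in> Cc_infinity \<Omega>"
proof -
  obtain K where K: "smooth f" "compact K" "K \<subseteq> \<Omega>" "\<And>x. x \<notin> K \<Longrightarrow> f x = 0"
    using Cc_infinityE[OF assms(1)] by blast
  obtain L where L: "smooth g" "compact L" "L \<subseteq> \<Omega>" "\<And>x. x \<notin> L \<Longrightarrow> g x = 0"
    using Cc_infinityE[OF assms(2)] by blast
  show ?thesis using K L by (intro Cc_infinityI[of _ "K \<union> L"] smooth_intros) auto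
qed

lemma Cc_infinity_zero: "(\<lambda>x. 0) \<in> Cc_infinity \<Omega>"
  by (rule Cc_infinityI[of _ "{}"]) (auto intro: smooth_intros)

definition grad :: "('a::euclidean_space \<Rightarrow> real) \<Rightarrow> 'a \<Rightarrow> 'a" where
  "grad f x = (\<Sum>i\<in>Basis. partial_deriv i f x *\<^sub>R i)"

lemma grad_inner [simp]: "i \<in> Basis \<Longrightarrow> grad f x \<bullet> i = partial_deriv i f x"
  by (simp add: grad_def inner_sum_left_Basis)

lemma partial_deriv_lincomb:
  fixes f g :: "'a::euclidean_space \<Rightarrow> real"
  assumes "Ck 1 f" "Ck 1 g"
  shows "partial_deriv i (\<lambda>x. f x + c * g x) = (\<lambda>x. partial_deriv i f x + c * partial_deriv i g x)"
  using assms by (intro ext) (simp add: partial_deriv_add partial_deriv_cmult)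

lemma smooth_Ck: "smooth f \<Longrightarrow> Ck k f"
  by (simp add: smooth_def)

locale bounded_open_set =
  fixes \<Omega> :: "'a::euclidean_space set"
  assumes open_\<Omega>: "open \<Omega>" and bounded_\<Omega>: "bounded \<Omega>"
begin

abbreviation "\<mu> \<equiv> lebesgue_on \<Omega>"

lemma meas_\<Omega> [measurable, simp]: "\<Omega> \<in> sets lebesgue"
proof -
  have "\<Omega> \<in> sets lborel" using borel_open[OF open_\<Omega>] by simp
  then show ?thesis by (rule sets_completionI_sets)
qed

lemma lmeasurable_\<Omega>: "\<Omega> \<in> lmeasurable"
  using open_\<Omega> bounded_\<Omega> by (simp add: lmeasurable_open)

lemma fin: "finite_measure \<mu>"
  using lmeasurable_\<Omega> by (rule finite_measure_lebesgue_on)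

lemma continuous_measurable: "continuous_on UNIV f \<Longrightarrow> f \<in> borel_measurable \<mu>"
proof -
  assume "continuous_on UNIV f"
  then have "f \<in> borel_measurable borel" by (rule borel_measurable_continuous_onI)
  then have "f \<in> borel_measurable lborel" by simp
  then have "f \<in> borel_measurable lebesgue" by (rule measurable_completion)
  then show ?thesis by (rule measurable_restrict_space1)
qed

lemma continuous_bounded_on:
  fixes f :: "'a \<Rightarrow> real"
  assumes "continuous_on UNIV f"
  obtains C where "C > 0" "\<And>x. x \<in> \<Omega> \<Longrightarrow> \<bar>f x\<bar> \<le> C"
proof -
  have "compact (f ` closure \<Omega>)"
    using assms bounded_\<Omega> by (intro compact_continuous_image continuous_on_subset[OF assms]) auto
  then obtain C where C: "\<And>x. x \<in> closure \<Omega> \<Longrightarrow> \<bar>f x\<bar> \<le> C"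
    using compact_imp_bounded by (fastforce simp: bounded_iff)
  have "\<bar>f x\<bar> \<le> max C 1" if "x \<in> \<Omega>" for x
    using C[of x] closure_subset that by fastforce
  then show ?thesis using that[of "max C 1"] by auto
qed

lemma continuous_L2: "continuous_on UNIV f \<Longrightarrow> f \<in> L2 \<mu>"
  by (metis L2_bounded continuous_bounded_on continuous_measurable fin space_lebesgue_on)

lemma continuous_L2_mult:
  assumes "continuous_on UNIV f" "u \<in> L2 \<mu>"
  shows "(\<lambda>x. f x * u x) \<in> L2 \<mu>"
proof -
  obtain C where C: "C > 0" "\<And>x. x \<in> \<Omega> \<Longrightarrow> \<bar>f x\<bar> \<le> C" using continuous_bounded_on[OF assms(1)] by blast
  have um: "u \<in> borel_measurable \<mu>" "integrable \<mu> (\<lambda>x. (u x)\<^sup>2)" using assms(2) by (auto simp: L2_def)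
  note fm = continuous_measurable[OF assms(1)]
  have "integrable \<mu> (\<lambda>x. (f x * u x)\<^sup>2)"
  proof (rule Bochner_Integration.integrable_bound)
    show "integrable \<mu> (\<lambda>x. C\<^sup>2 * (u x)\<^sup>2)" using um by simp
    show "(\<lambda>x. (f x * u x)\<^sup>2) \<in> borel_measurable \<mu>" using um fm by measurable
    have "(f x * u x)\<^sup>2 \<le> C\<^sup>2 * (u x)\<^sup>2" if "x \<in> \<Omega>" for x
    proof -
      have "\<bar>f x\<bar>\<^sup>2 \<le> C\<^sup>2" using C(2)[OF that] by (intro power_mono) auto
      then show ?thesis by (simp add: power_mult_distrib mult_right_mono)
    qed
    then show "AE x in \<mu>. norm ((f x * u x)\<^sup>2) \<le> norm (C\<^sup>2 * (u x)\<^sup>2)" by (intro AE_I2) simp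
  qed
  moreover have "(\<lambda>x. f x * u x) \<in> borel_measurable \<mu>" using um fm by measurable
  ultimately show ?thesis by (simp add: L2_def)
qed

lemma smooth_L2: "smooth f \<Longrightarrow> f \<in> L2 \<mu>"
  by (intro continuous_L2 smooth_continuous)

lemma test_L2: "f \<in> Cc_infinity \<Omega> \<Longrightarrow> f \<in> L2 \<mu>"
  by (intro smooth_L2 Cc_infinity_smooth)

lemma test_partial_L2: "f \<in> Cc_infinity \<Omega> \<Longrightarrow> i \<in> Basis \<Longrightarrow> partial_deriv i f \<in> L2 \<mu>"
  by (intro test_L2 Cc_infinity_partial_deriv)

lemma integral_\<Omega>_eq_lborel:
  fixes f :: "'a \<Rightarrow> real"
  assumes "f \<in> borel_measurable borel" "\<And>x. x \<notin> \<Omega> \<Longrightarrow> f x = 0"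
  shows "(\<integral>x. f x \<partial>\<mu>) = (\<integral>x. f x \<partial>lborel)"
proof -
  have "(\<integral>x. f x \<partial>\<mu>) = (\<integral>x. indicator \<Omega> x *\<^sub>R f x \<partial>lebesgue)"
    by (rule integral_restrict_space) simp
  also have "\<dots> = (\<integral>x. f x \<partial>lebesgue)"
  proof (rule Bochner_Integration.integral_cong)
    show "indicator \<Omega> x *\<^sub>R f x = f x" for x using assms(2)[of x] by (cases "x \<in> \<Omega>") auto
  qed simp
  also have "\<dots> = (\<integral>x. f x \<partial>lborel)" using assms(1) by (intro integral_completion) simp
  finally show ?thesis .
qed

lemma integration_by_parts:
  fixes f g :: "'a \<Rightarrow> real"
  assumes f: "Ck 1 f" and g: "Ck 1 g" and K: "compact K" "K \<subseteq> \<Omega>" "\<And>x. x \<notin> K \<Longrightarrow> g x = 0" and i: "i \<in> Basis"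
  shows "(\<integral>x. f x * partial_deriv i g x \<partial>\<mu>) = - (\<integral>x. partial_deriv i f x * g x \<partial>\<mu>)"
proof -
  have fg: "Ck 1 (\<lambda>x. f x * g x)" using f g by (rule Ck_mult)
  have z: "partial_deriv i g x = 0" if "x \<notin> K" for x
    using partial_deriv_zero_outside[OF compact_imp_closed[OF K(1)] K(3) that] .
  have c: "continuous_on UNIV f" "continuous_on UNIV g" "continuous_on UNIV (partial_deriv i f)" "continuous_on UNIV (partial_deriv i g)"
    using f g i Ck_continuous by (auto simp: Ck_continuous[OF f] Ck_continuous[OF g])
  have pd: "partial_deriv i (\<lambda>x. f x * g x) = (\<lambda>x. f x * partial_deriv i g x + partial_deriv i f x * g x)"
    using f g by (intro ext partial_deriv_mult) auto
  have "0 = (\<integral>x. f x * partial_deriv i g x + partial_deriv i f x * g x \<partial>lborel)"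
    using integral_partial_deriv_eq_0[OF fg K(1) _ i] K(3) unfolding pd by simp
  also have "\<dots> = (\<integral>x. f x * partial_deriv i g x + partial_deriv i f x * g x \<partial>\<mu>)"
  proof (rule integral_\<Omega>_eq_lborel [symmetric])
    show "(\<lambda>x. f x * partial_deriv i g x + partial_deriv i f x * g x) \<in> borel_measurable borel"
      using c by (intro borel_measurable_continuous_onI continuous_intros)
    show "f x * partial_deriv i g x + partial_deriv i f x * g x = 0" if "x \<notin> \<Omega>" for x
    proof -
      have "x \<notin> K" using that K(2) by blast
      then show ?thesis by (simp add: K(3) z)
    qed
  qed
  also have "\<dots> = (\<integral>x. f x * partial_deriv i g x \<partial>\<mu>) + (\<integral>x. partial_deriv i f x * g x \<partial>\<mu>)"
    using c by (intro Bochner_Integration.integral_add L2_times_integrable continuous_L2)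
  finally show ?thesis by simp
qed

lemma AE_\<mu>: "AE x in lebesgue. P x \<Longrightarrow> AE x in \<mu>. P x"
  by (subst AE_restrict_space_iff) auto

lemma borel_approximation:
  assumes "A \<in> sets \<mu>"
  shows "\<exists>B\<in>sets borel. AE x in \<mu>. x \<in> A \<longleftrightarrow> x \<in> B"
proof -
  have "A \<in> sets lebesgue" using assms by (metis meas_\<Omega> sets_restrict_space_iff sets.Int_space_eq2 space_completion)
  then obtain S N N' where S: "A = S \<union> N" "N \<subseteq> N'" "N' \<in> null_sets lborel" "S \<in> sets lborel"
    by (rule sets_completionE)
  have "AE x in lborel. x \<notin> N'" using S(3) by (rule AE_not_in)
  then have "AE x in lebesgue. x \<notin> N'" by (rule AE_completion)
  then have "AE x in \<mu>. x \<notin> N'" by (rule AE_\<mu>)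
  then have "AE x in \<mu>. x \<in> A \<longleftrightarrow> x \<in> S" by eventually_elim (use S in auto)
  then show ?thesis using S(4) by auto
qed

text \<open>
  For a closed box \<open>cbox c d\<close> inside the domain, the products of cutoffs of \<open>box a b\<close> and \<open>box c d\<close>
  are test functions that converge boundedly to the indicator function of the intersection.  So \<open>f\<close>
  vanishes on \<open>box c d\<close>, and countably many such boxes fill the domain up to a null set.
\<close>

theorem AE_zero_if_test_integrals_zero:
  assumes f: "f \<in> L2 \<mu>" and test: "\<And>\<phi>. \<phi> \<in> Cc_infinity \<Omega> \<Longrightarrow> (\<integral>x. f x * \<phi> x \<partial>\<mu>) = 0"
  shows "AE x in \<mu>. f x = 0"
proof -
  have int: "integrable \<mu> f" by (rule L2_integrable[OF f fin])
  then have fm [measurable]: "f \<in> borel_measurable \<mu>" by simp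
  have bm: "(\<lambda>x. indicator (box c d) x :: real) \<in> borel_measurable \<mu>" for c d :: 'a
    by (intro measurable_restrict_space1 borel_measurable_indicator) simp
  have cont: "continuous_on UNIV (box_cutoff n a b)" for n and a b :: 'a
    by (intro smooth_continuous smooth_box_cutoff)
  have onbox: "AE x in \<mu>. x \<in> box c d \<longrightarrow> f x = 0" if cd: "cbox c d \<subseteq> \<Omega>" for c d
  proof -
    have "AE x in \<mu>. f x * indicator (box c d) x = 0"
    proof (rule AE_zero_if_box_integrals_zero)
      show "integrable \<mu> (\<lambda>x. f x * indicator (box c d) x)"
        using bm by (intro Bochner_Integration.integrable_bound[OF int]) (auto simp: indicator_def)
      show "(\<lambda>x. x) \<in> borel_measurable \<mu>"
        by (intro measurable_restrict_space1 measurable_completion) simp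
      fix a b
      let ?\<phi> = "\<lambda>n x. box_cutoff (real n) a b x * box_cutoff (real n) c d x"
      have "?\<phi> n \<in> Cc_infinity \<Omega>" for n
      proof (rule Cc_infinityI[of _ "cbox c d"])
        show "?\<phi> n x = 0" if "x \<notin> cbox c d" for x
          using that box_cutoff_zero[of "real n" x c d] box_subset_cbox[of c d] by auto
        show "cbox c d \<subseteq> \<Omega>" by (rule cd)
      qed (auto intro: smooth_intros smooth_box_cutoff)
      then have 0: "(\<integral>x. f x * ?\<phi> n x \<partial>\<mu>) = 0" for n by (rule test)
      have "(\<lambda>n. \<integral>x. f x * ?\<phi> n x \<partial>\<mu>) \<longlonglongrightarrow> (\<integral>x. f x * (indicator (box a b) x * indicator (box c d) x) \<partial>\<mu>)"
      proof (rule integral_dominated_convergence[where w="\<lambda>x. \<bar>f x\<bar>"])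
        show "AE x in \<mu>. (\<lambda>n. f x * ?\<phi> n x) \<longlonglongrightarrow> f x * (indicator (box a b) x * indicator (box c d) x)"
          by (intro AE_I2 tendsto_mult tendsto_const box_cutoff_tendsto_indicator)
        have "\<bar>?\<phi> n x\<bar> \<le> 1" for n x
          using box_cutoff_nonneg[of "real n" a b x] box_cutoff_nonneg[of "real n" c d x]
            box_cutoff_le_one[of "real n" a b x] box_cutoff_le_one[of "real n" c d x]
          by (simp add: mult_le_one)
        then show "AE x in \<mu>. norm (f x * ?\<phi> n x) \<le> \<bar>f x\<bar>" for n
          by (intro AE_I2) (simp add: abs_mult mult_left_le del: abs_mult_self_eq)
        show "(\<lambda>x. f x * (indicator (box a b) x * indicator (box c d) x)) \<in> borel_measurable \<mu>"
          by (intro borel_measurable_times fm bm)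
        show "(\<lambda>x. f x * ?\<phi> n x) \<in> borel_measurable \<mu>" for n
          by (intro borel_measurable_times fm continuous_measurable cont)
      qed (use int in auto)
      then have "(\<lambda>n. 0) \<longlonglongrightarrow> (\<integral>x. f x * (indicator (box a b) x * indicator (box c d) x) \<partial>\<mu>)" unfolding 0 .
      then have "(\<integral>x. f x * (indicator (box a b) x * indicator (box c d) x) \<partial>\<mu>) = 0"
        using LIMSEQ_unique[OF _ tendsto_const] by metis
      then show "(\<integral>x. f x * indicator (box c d) x * indicator (box a b) x \<partial>\<mu>) = 0"
        by (simp add: mult.assoc mult.commute[of "indicator (box c d) _"])
    qed (rule borel_approximation)
    then show ?thesis by eventually_elim (auto simp: indicator_def)
  qed
  obtain \<D> where D: "countable \<D>" "\<D> \<subseteq> Pow \<Omega>" "\<And>X. X \<in> \<D> \<Longrightarrow> \<exists>c d. X = cbox c d" "\<Union>\<D> = \<Omega>"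
    using open_countable_Union_open_cbox[OF open_\<Omega>] by metis
  have "AE x in \<mu>. x \<in> X \<longrightarrow> f x = 0" if X: "X \<in> \<D>" for X
  proof -
    obtain c d where cd: "X = cbox c d" using D(3)[OF X] by blast
    have "cbox c d - box c d \<in> null_sets lebesgue"
      using negligible_frontier_interval negligible_iff_null_sets by blast
    then have "AE x in lebesgue. x \<notin> cbox c d - box c d" by (rule AE_not_in)
    then have "AE x in \<mu>. x \<notin> cbox c d - box c d" by (rule AE_\<mu>)
    moreover have "AE x in \<mu>. x \<in> box c d \<longrightarrow> f x = 0" using D(2) X cd by (intro onbox) auto
    ultimately show ?thesis by eventually_elim (use cd in auto)
  qed
  then have all: "AE x in \<mu>. \<forall>X\<in>\<D>. x \<in> X \<longrightarrow> f x = 0"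
    using D(1) by (subst AE_ball_countable) auto
  show ?thesis using all AE_space by eventually_elim (use D(4) in auto)
qed

section \<open>The weak gradient\<close>

lemma weak_gradient_L2: "has_weak_gradient \<Omega> u G \<Longrightarrow> i \<in> Basis \<Longrightarrow> (\<lambda>x. G x \<bullet> i) \<in> L2 \<mu>"
  by (simp add: has_weak_gradient_def)

lemma weak_gradient_ip:
  assumes "has_weak_gradient \<Omega> u G" "i \<in> Basis" "\<phi> \<in> Cc_infinity \<Omega>"
  shows "l2ip \<mu> u (partial_deriv i \<phi>) = - l2ip \<mu> (\<lambda>x. G x \<bullet> i) \<phi>"
  using assms by (simp add: has_weak_gradient_def l2ip_def)

lemma has_weak_gradientI:
  assumes "\<And>i. i \<in> Basis \<Longrightarrow> (\<lambda>x. G x \<bullet> i) \<in> L2 \<mu>"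
    and "\<And>i \<phi>. i \<in> Basis \<Longrightarrow> \<phi> \<in> Cc_infinity \<Omega> \<Longrightarrow>
           l2ip \<mu> u (partial_deriv i \<phi>) = - l2ip \<mu> (\<lambda>x. G x \<bullet> i) \<phi>"
  shows "has_weak_gradient \<Omega> u G"
  using assms by (simp add: has_weak_gradient_def l2ip_def)

lemma AE_eq_if_test_ip_eq:
  assumes "f \<in> L2 \<mu>" "g \<in> L2 \<mu>" "\<And>\<phi>. \<phi> \<in> Cc_infinity \<Omega> \<Longrightarrow> l2ip \<mu> f \<phi> = l2ip \<mu> g \<phi>"
  shows "AE x in \<mu>. f x = g x"
proof -
  have "AE x in \<mu>. f x - g x = 0"
  proof (rule AE_zero_if_test_integrals_zero)
    show "(\<lambda>x. f x - g x) \<in> L2 \<mu>" using assms by (intro L2_diff)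
    fix \<phi> assume "\<phi> \<in> Cc_infinity \<Omega>"
    then show "(\<integral>x. (f x - g x) * \<phi> x \<partial>\<mu>) = 0"
      using l2ip_diff_left[OF assms(1,2), of \<phi>] assms(3) test_L2 by (simp add: l2ip_def)
  qed
  then show ?thesis by simp
qed

lemma weak_gradient_unique:
  assumes "has_weak_gradient \<Omega> u G" "has_weak_gradient \<Omega> u H"
  shows "AE x in \<mu>. G x = H x"
proof -
  have "AE x in \<mu>. G x \<bullet> i = H x \<bullet> i" if "i \<in> Basis" for i
    using assms that by (intro AE_eq_if_test_ip_eq) (auto simp: weak_gradient_L2 dest!: weak_gradient_ip)
  then have "AE x in \<mu>. \<forall>i\<in>Basis. G x \<bullet> i = H x \<bullet> i"
    by (intro AE_finite_allI) auto
  then show ?thesis by eventually_elim (auto intro: euclidean_eqI)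
qed

lemma has_weak_gradient_weak_gradient:
  "has_weak_gradient \<Omega> u G \<Longrightarrow> has_weak_gradient \<Omega> u (weak_gradient \<Omega> u)"
  unfolding weak_gradient_def by (rule someI[of "has_weak_gradient \<Omega> u"])

lemma weak_gradient_AE: "has_weak_gradient \<Omega> u G \<Longrightarrow> AE x in \<mu>. weak_gradient \<Omega> u x = G x"
  using weak_gradient_unique has_weak_gradient_weak_gradient by blast

lemma L2_lincomb: "f \<in> L2 M \<Longrightarrow> g \<in> L2 M \<Longrightarrow> (\<lambda>x. f x + c * g x) \<in> L2 M"
  by (intro L2_add L2_cmult)

lemma l2ip_lincomb_left:
  assumes "f \<in> L2 M" "g \<in> L2 M" "h \<in> L2 M"
  shows "l2ip M (\<lambda>x. f x + c * g x) h = l2ip M f h + c * l2ip M g h"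
  using assms by (simp add: l2ip_add_left L2_cmult l2ip_cmult_left)

lemma l2ip_lincomb_right:
  assumes "f \<in> L2 M" "g \<in> L2 M" "h \<in> L2 M"
  shows "l2ip M h (\<lambda>x. f x + c * g x) = l2ip M h f + c * l2ip M h g"
  using l2ip_lincomb_left[OF assms] by (simp add: l2ip_sym)

lemma has_weak_gradient_lincomb:
  assumes "u \<in> L2 \<mu>" "v \<in> L2 \<mu>" "has_weak_gradient \<Omega> u G" "has_weak_gradient \<Omega> v H"
  shows "has_weak_gradient \<Omega> (\<lambda>x. u x + c * v x) (\<lambda>x. G x + c *\<^sub>R H x)"
proof (rule has_weak_gradientI)
  fix i :: 'a assume i: "i \<in> Basis"
  note L = weak_gradient_L2[OF assms(3) i] weak_gradient_L2[OF assms(4) i]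
  show "(\<lambda>x. (G x + c *\<^sub>R H x) \<bullet> i) \<in> L2 \<mu>"
    using L2_lincomb[OF L, of c] by (simp add: inner_add_left)
  fix \<phi> assume p: "\<phi> \<in> Cc_infinity \<Omega>"
  show "l2ip \<mu> (\<lambda>x. u x + c * v x) (partial_deriv i \<phi>) = - l2ip \<mu> (\<lambda>x. (G x + c *\<^sub>R H x) \<bullet> i) \<phi>"
    using l2ip_lincomb_left[OF assms(1,2) test_partial_L2[OF p i], of c]
      l2ip_lincomb_left[OF L test_L2[OF p], of c]
      weak_gradient_ip[OF assms(3) i p] weak_gradient_ip[OF assms(4) i p]
    by (simp add: inner_add_left)
qed

lemma has_weak_gradient_classical:
  assumes "Ck 1 f"
  shows "has_weak_gradient \<Omega> f (grad f)"
proof (rule has_weak_gradientI)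
  fix i :: 'a assume i: "i \<in> Basis"
  show "(\<lambda>x. grad f x \<bullet> i) \<in> L2 \<mu>" using assms i by (simp add: continuous_L2)
  fix \<phi> assume p: "\<phi> \<in> Cc_infinity \<Omega>"
  obtain K where K: "smooth \<phi>" "compact K" "K \<subseteq> \<Omega>" "\<And>x. x \<notin> K \<Longrightarrow> \<phi> x = 0"
    using Cc_infinityE[OF p] by blast
  show "l2ip \<mu> f (partial_deriv i \<phi>) = - l2ip \<mu> (\<lambda>x. grad f x \<bullet> i) \<phi>"
    using integration_by_parts[OF assms smooth_Ck[OF K(1)] K(2-4) i] i by (simp add: l2ip_def)
qed

section \<open>The weak Laplacian\<close>

lemma has_weak_laplacianI:
  assumes "f \<in> L2 \<mu>" "\<And>\<phi>. \<phi> \<in> Cc_infinity \<Omega> \<Longrightarrow> l2ip \<mu> u (classical_laplacian \<phi>) = l2ip \<mu> f \<phi>"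
  shows "has_weak_laplacian \<Omega> u f"
  using assms by (simp add: has_weak_laplacian_def l2ip_def)

lemma has_weak_laplacianD:
  assumes "has_weak_laplacian \<Omega> u f"
  shows "f \<in> L2 \<mu>" "\<And>\<phi>. \<phi> \<in> Cc_infinity \<Omega> \<Longrightarrow> l2ip \<mu> u (classical_laplacian \<phi>) = l2ip \<mu> f \<phi>"
  using assms by (simp_all add: has_weak_laplacian_def l2ip_def)

lemma has_weak_laplacian_weak_laplacian:
  "has_weak_laplacian \<Omega> u f \<Longrightarrow> has_weak_laplacian \<Omega> u (weak_laplacian \<Omega> u)"
  unfolding weak_laplacian_def by (rule someI[of "has_weak_laplacian \<Omega> u"])

lemma weak_laplacian_AE:
  assumes "has_weak_laplacian \<Omega> u f"
  shows "AE x in \<mu>. weak_laplacian \<Omega> u x = f x"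
  using has_weak_laplacianD[OF assms] has_weak_laplacianD[OF has_weak_laplacian_weak_laplacian[OF assms]]
  by (intro AE_eq_if_test_ip_eq) auto

lemma smooth_classical_laplacian: "smooth f \<Longrightarrow> smooth (classical_laplacian f)"
  unfolding classical_laplacian_def[abs_def] by (intro smooth_sum smooth_partial_deriv)

lemma has_weak_laplacian_lincomb:
  assumes "u \<in> L2 \<mu>" "v \<in> L2 \<mu>" "has_weak_laplacian \<Omega> u f" "has_weak_laplacian \<Omega> v g"
  shows "has_weak_laplacian \<Omega> (\<lambda>x. u x + c * v x) (\<lambda>x. f x + c * g x)"
proof (rule has_weak_laplacianI)
  note f = has_weak_laplacianD[OF assms(3)] and g = has_weak_laplacianD[OF assms(4)]
  show "(\<lambda>x. f x + c * g x) \<in> L2 \<mu>" using f(1) g(1) by (rule L2_lincomb)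
  fix \<phi> assume p: "\<phi> \<in> Cc_infinity \<Omega>"
  have "classical_laplacian \<phi> \<in> L2 \<mu>"
    by (intro smooth_L2 smooth_classical_laplacian Cc_infinity_smooth[OF p])
  then show "l2ip \<mu> (\<lambda>x. u x + c * v x) (classical_laplacian \<phi>) = l2ip \<mu> (\<lambda>x. f x + c * g x) \<phi>"
    using assms(1,2) f g p test_L2[OF p] by (simp add: l2ip_lincomb_left)
qed

lemma l2ip_sum_right:
  assumes "f \<in> L2 M" "\<And>i. i \<in> I \<Longrightarrow> g i \<in> L2 M"
  shows "l2ip M f (\<lambda>x. \<Sum>i\<in>I. g i x) = (\<Sum>i\<in>I. l2ip M f (g i))"
  using assms by (simp add: l2ip_def sum_distrib_left L2_times_integrable)

lemma laplacian_ip_sum: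
  assumes "u \<in> L2 \<mu>" "smooth \<phi>"
  shows "l2ip \<mu> u (classical_laplacian \<phi>) = (\<Sum>i\<in>Basis. l2ip \<mu> u (partial_deriv i (partial_deriv i \<phi>)))"
  unfolding classical_laplacian_def[abs_def] using assms
  by (intro l2ip_sum_right assms(1) smooth_L2[OF smooth_partial_deriv] smooth_partial_deriv)

lemma weak_laplacian_energy_test:
  assumes "u \<in> L2 \<mu>" "has_weak_gradient \<Omega> u G" "has_weak_laplacian \<Omega> u f" "\<phi> \<in> Cc_infinity \<Omega>"
  shows "(\<Sum>i\<in>Basis. l2ip \<mu> (\<lambda>x. G x \<bullet> i) (partial_deriv i \<phi>)) = - l2ip \<mu> f \<phi>"
proof -
  have "l2ip \<mu> f \<phi> = (\<Sum>i\<in>Basis. l2ip \<mu> u (partial_deriv i (partial_deriv i \<phi>)))"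
    using has_weak_laplacianD(2)[OF assms(3,4)] laplacian_ip_sum[OF assms(1) Cc_infinity_smooth[OF assms(4)]] by simp
  also have "\<dots> = (\<Sum>i\<in>Basis. - l2ip \<mu> (\<lambda>x. G x \<bullet> i) (partial_deriv i \<phi>))"
    using assms by (intro sum.cong refl weak_gradient_ip Cc_infinity_partial_deriv) auto
  finally show ?thesis by (simp add: sum_negf)
qed

lemma has_weak_laplacian_classical:
  assumes v: "Ck 2 v"
  shows "has_weak_laplacian \<Omega> v (classical_laplacian v)"
proof (rule has_weak_laplacianI)
  have C: "Ck 1 (partial_deriv i v)" if "i \<in> Basis" for i
    using v that by (simp add: numeral_2_eq_2)
  have v1: "Ck 1 v" by (rule Ck_mono[OF v]) simp
  have c: "continuous_on UNIV (partial_deriv i (partial_deriv i v))" if "i \<in> Basis" for i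
    using C[OF that] that by simp
  then show "classical_laplacian v \<in> L2 \<mu>"
    unfolding classical_laplacian_def[abs_def] by (intro L2_sum continuous_L2)
  fix \<phi> assume p: "\<phi> \<in> Cc_infinity \<Omega>"
  have vL: "v \<in> L2 \<mu>" using v1 Ck_continuous by (blast intro: continuous_L2)
  have "l2ip \<mu> v (classical_laplacian \<phi>) = (\<Sum>i\<in>Basis. l2ip \<mu> v (partial_deriv i (partial_deriv i \<phi>)))"
    by (rule laplacian_ip_sum[OF vL Cc_infinity_smooth[OF p]])
  also have "\<dots> = (\<Sum>i\<in>Basis. l2ip \<mu> \<phi> (partial_deriv i (partial_deriv i v)))"
  proof (intro sum.cong refl)
    fix i :: 'a assume i: "i \<in> Basis"
    have "l2ip \<mu> v (partial_deriv i (partial_deriv i \<phi>)) = - l2ip \<mu> (\<lambda>x. grad v x \<bullet> i) (partial_deriv i \<phi>)"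
      by (rule weak_gradient_ip[OF has_weak_gradient_classical[OF v1] i Cc_infinity_partial_deriv[OF p i]])
    also have "\<dots> = - l2ip \<mu> (partial_deriv i v) (partial_deriv i \<phi>)" using i by simp
    also have "\<dots> = l2ip \<mu> (\<lambda>x. grad (partial_deriv i v) x \<bullet> i) \<phi>"
      using weak_gradient_ip[OF has_weak_gradient_classical[OF C[OF i]] i p] by simp
    finally show "l2ip \<mu> v (partial_deriv i (partial_deriv i \<phi>)) = l2ip \<mu> \<phi> (partial_deriv i (partial_deriv i v))"
      using i by (simp add: l2ip_sym)
  qed
  also have "\<dots> = l2ip \<mu> \<phi> (classical_laplacian v)"
    unfolding classical_laplacian_def[abs_def] using c
    by (intro l2ip_sum_right [symmetric] test_L2[OF p] continuous_L2)
  finally show "l2ip \<mu> v (classical_laplacian \<phi>) = l2ip \<mu> (classical_laplacian v) \<phi>"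
    by (simp add: l2ip_sym)
qed

section \<open>Limits of test functions in the Sobolev norm\<close>

lemma norm_sq_Basis: "(norm (x::'a))\<^sup>2 = (\<Sum>i\<in>Basis. (x \<bullet> i)\<^sup>2)"
  unfolding power2_norm_eq_inner by (subst euclidean_inner) (simp add: power2_eq_square)

lemma H1_norm_eq:
  assumes u: "u \<in> L2 \<mu>" and G: "has_weak_gradient \<Omega> u G"
  shows "H1_norm \<Omega> u = sqrt ((l2norm \<mu> u)\<^sup>2 + (\<Sum>i\<in>Basis. (l2norm \<mu> (\<lambda>x. G x \<bullet> i))\<^sup>2))"
proof -
  let ?W = "weak_gradient \<Omega> u"
  have W: "has_weak_gradient \<Omega> u ?W" using G by (rule has_weak_gradient_weak_gradient)
  have "(\<integral>x. (u x)\<^sup>2 + (norm (?W x))\<^sup>2 \<partial>\<mu>) = (\<integral>x. (u x)\<^sup>2 + (\<Sum>i\<in>Basis. (?W x \<bullet> i)\<^sup>2) \<partial>\<mu>)"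
    by (simp add: norm_sq_Basis)
  also have "\<dots> = (\<integral>x. (u x)\<^sup>2 \<partial>\<mu>) + (\<Sum>i\<in>Basis. \<integral>x. (?W x \<bullet> i)\<^sup>2 \<partial>\<mu>)"
    using u weak_gradient_L2[OF W] by (simp add: L2_def)
  also have "(\<Sum>i\<in>Basis. \<integral>x. (?W x \<bullet> i)\<^sup>2 \<partial>\<mu>) = (\<Sum>i\<in>Basis. (l2norm \<mu> (\<lambda>x. G x \<bullet> i))\<^sup>2)"
  proof (intro sum.cong refl)
    fix i :: 'a assume i: "i \<in> Basis"
    have "l2norm \<mu> (\<lambda>x. ?W x \<bullet> i) = l2norm \<mu> (\<lambda>x. G x \<bullet> i)"
      using weak_gradient_L2[OF W i] weak_gradient_L2[OF G i] weak_gradient_AE[OF G]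
      by (intro l2norm_cong_AE) (auto simp: L2_def elim: eventually_mono)
    then show "(\<integral>x. (?W x \<bullet> i)\<^sup>2 \<partial>\<mu>) = (l2norm \<mu> (\<lambda>x. G x \<bullet> i))\<^sup>2"
      by (simp add: l2norm_sq [symmetric])
  qed
  finally show ?thesis unfolding H1_norm_def l2norm_sq by simp
qed

lemma l2norm_le_H1_norm:
  assumes u: "u \<in> L2 \<mu>" and G: "has_weak_gradient \<Omega> u G"
  shows "l2norm \<mu> u \<le> H1_norm \<Omega> u" "i \<in> Basis \<Longrightarrow> l2norm \<mu> (\<lambda>x. G x \<bullet> i) \<le> H1_norm \<Omega> u"
proof -
  have s: "(\<Sum>i\<in>Basis. (l2norm \<mu> (\<lambda>x. G x \<bullet> i))\<^sup>2) \<ge> 0" by (intro sum_nonneg) auto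
  show "l2norm \<mu> u \<le> H1_norm \<Omega> u"
    unfolding H1_norm_eq[OF assms] using s by (intro real_le_rsqrt) auto
  assume "i \<in> Basis"
  then have "(l2norm \<mu> (\<lambda>x. G x \<bullet> i))\<^sup>2 \<le> (\<Sum>i\<in>Basis. (l2norm \<mu> (\<lambda>x. G x \<bullet> i))\<^sup>2)"
    by (intro member_le_sum) auto
  then show "l2norm \<mu> (\<lambda>x. G x \<bullet> i) \<le> H1_norm \<Omega> u"
    unfolding H1_norm_eq[OF assms] by (intro real_le_rsqrt) (simp add: add_increasing)
qed

lemma H1_norm_tendsto_0:
  assumes u: "\<And>n. u n \<in> L2 \<mu>" and G: "\<And>n. has_weak_gradient \<Omega> (u n) (G n)"
  shows "(\<lambda>n. H1_norm \<Omega> (u n)) \<longlonglongrightarrow> 0 \<longleftrightarrow>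
    (\<lambda>n. l2norm \<mu> (u n)) \<longlonglongrightarrow> 0 \<and> (\<forall>i\<in>Basis. (\<lambda>n. l2norm \<mu> (\<lambda>x. G n x \<bullet> i)) \<longlonglongrightarrow> 0)" (is "?L \<longleftrightarrow> ?R")
proof
  assume L: ?L
  have "(\<lambda>n. l2norm \<mu> (u n)) \<longlonglongrightarrow> 0"
    by (rule tendsto_sandwich[OF _ _ tendsto_const L])
       (use l2norm_le_H1_norm(1)[OF u G] in auto)
  moreover have "(\<lambda>n. l2norm \<mu> (\<lambda>x. G n x \<bullet> i)) \<longlonglongrightarrow> 0" if "i \<in> Basis" for i
    by (rule tendsto_sandwich[OF _ _ tendsto_const L])
       (use l2norm_le_H1_norm(2)[OF u G that] in auto)
  ultimately show ?R by blast
next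
  assume R: ?R
  have "(\<lambda>n. sqrt ((l2norm \<mu> (u n))\<^sup>2 + (\<Sum>i\<in>Basis. (l2norm \<mu> (\<lambda>x. G n x \<bullet> i))\<^sup>2)))
      \<longlonglongrightarrow> sqrt (0\<^sup>2 + (\<Sum>i\<in>(Basis::'a set). 0\<^sup>2))"
    using R by (intro tendsto_intros) auto
  then show ?L unfolding H1_norm_eq[OF u G] by simp
qed

text \<open>
  Convergence in the norm of \<open>H1\<close>, expressed by the separate convergence of the function and of
  the partial derivatives.
\<close>

definition H10_approx :: "('a \<Rightarrow> real) \<Rightarrow> ('a \<Rightarrow> 'a) \<Rightarrow> (nat \<Rightarrow> 'a \<Rightarrow> real) \<Rightarrow> bool" where
  "H10_approx u G \<phi> \<longleftrightarrow> (\<forall>n. \<phi> n \<in> Cc_infinity \<Omega>) \<and>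
     (\<lambda>n. l2norm \<mu> (\<lambda>x. \<phi> n x - u x)) \<longlonglongrightarrow> 0 \<and>
     (\<forall>i\<in>Basis. (\<lambda>n. l2norm \<mu> (\<lambda>x. partial_deriv i (\<phi> n) x - G x \<bullet> i)) \<longlonglongrightarrow> 0)"

definition H10_grad :: "('a \<Rightarrow> real) \<Rightarrow> ('a \<Rightarrow> 'a) \<Rightarrow> bool" where
  "H10_grad u G \<longleftrightarrow> u \<in> L2 \<mu> \<and> (\<forall>i\<in>Basis. (\<lambda>x. G x \<bullet> i) \<in> L2 \<mu>) \<and> (\<exists>\<phi>. H10_approx u G \<phi>)"

lemma H10_grad_L2: "H10_grad u G \<Longrightarrow> u \<in> L2 \<mu>" "H10_grad u G \<Longrightarrow> i \<in> Basis \<Longrightarrow> (\<lambda>x. G x \<bullet> i) \<in> L2 \<mu>"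
  by (auto simp: H10_grad_def)

text \<open>
  Although \<open>\<eta>\<close> is arbitrary at the boundary, there is no boundary term, because \<open>u\<close> is a limit of test
  functions.
\<close>

lemma H10_grad_ip:
  assumes "H10_grad u G" and \<eta>: "smooth \<eta>" and i: "i \<in> Basis"
  shows "l2ip \<mu> u (partial_deriv i \<eta>) = - l2ip \<mu> (\<lambda>x. G x \<bullet> i) \<eta>"
proof -
  obtain \<phi> where \<phi>: "H10_approx u G \<phi>" using assms by (auto simp: H10_grad_def)
  note L = H10_grad_L2[OF assms(1)]
  have t: "\<phi> n \<in> Cc_infinity \<Omega>" for n using \<phi> by (simp add: H10_approx_def)
  have e: "l2ip \<mu> (\<phi> n) (partial_deriv i \<eta>) = - l2ip \<mu> (partial_deriv i (\<phi> n)) \<eta>" for n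
  proof -
    have "l2ip \<mu> \<eta> (partial_deriv i (\<phi> n)) = - l2ip \<mu> (\<lambda>x. grad \<eta> x \<bullet> i) (\<phi> n)"
      by (rule weak_gradient_ip[OF has_weak_gradient_classical[OF smooth_Ck[OF \<eta>]] i t])
    then show ?thesis using i by (simp add: l2ip_sym)
  qed
  have 1: "(\<lambda>n. l2ip \<mu> (\<phi> n) (partial_deriv i \<eta>)) \<longlonglongrightarrow> l2ip \<mu> u (partial_deriv i \<eta>)"
    using \<phi> unfolding H10_approx_def
    by (intro l2ip_tendsto test_L2[OF t] L(1) smooth_L2[OF smooth_partial_deriv[OF \<eta> i]]) auto
  have 2: "(\<lambda>n. l2ip \<mu> (partial_deriv i (\<phi> n)) \<eta>) \<longlonglongrightarrow> l2ip \<mu> (\<lambda>x. G x \<bullet> i) \<eta>"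
    using \<phi> i unfolding H10_approx_def
    by (intro l2ip_tendsto test_partial_L2[OF t i] L(2)[OF i] smooth_L2[OF \<eta>]) auto
  show ?thesis using 1 tendsto_minus[OF 2] unfolding e by (rule LIMSEQ_unique)
qed

lemma H10_grad_weak: "H10_grad u G \<Longrightarrow> has_weak_gradient \<Omega> u G"
  by (intro has_weak_gradientI H10_grad_L2(2) H10_grad_ip Cc_infinity_smooth)

lemma H10_approx_H1_norm:
  assumes u: "u \<in> L2 \<mu>" and G: "has_weak_gradient \<Omega> u G" and t: "\<And>n. \<phi> n \<in> Cc_infinity \<Omega>"
  shows "(\<lambda>n. H1_norm \<Omega> (\<lambda>x. \<phi> n x - u x)) \<longlonglongrightarrow> 0 \<longleftrightarrow> H10_approx u G \<phi>"
proof -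
  have D: "has_weak_gradient \<Omega> (\<lambda>x. \<phi> n x - u x) (\<lambda>x. grad (\<phi> n) x - G x)" for n
    using has_weak_gradient_lincomb[OF test_L2[OF t] u has_weak_gradient_classical[OF smooth_Ck[OF Cc_infinity_smooth[OF t]]] G, of n "-1"]
    by simp
  have L: "(\<lambda>x. \<phi> n x - u x) \<in> L2 \<mu>" for n by (intro L2_diff test_L2 t u)
  show ?thesis
    using H1_norm_tendsto_0[of "\<lambda>n x. \<phi> n x - u x", OF L D] t
    by (simp add: H10_approx_def inner_diff_left)
qed

lemma H10_grad_H10: "H10_grad u G \<Longrightarrow> u \<in> H10 \<Omega>"
proof -
  assume H: "H10_grad u G"
  then obtain \<phi> where p: "H10_approx u G \<phi>" by (auto simp: H10_grad_def)
  then have "(\<lambda>n. H1_norm \<Omega> (\<lambda>x. \<phi> n x - u x)) \<longlonglongrightarrow> 0"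
    using H10_approx_H1_norm[OF H10_grad_L2(1)[OF H] H10_grad_weak[OF H], of \<phi>] by (simp add: H10_approx_def)
  then show ?thesis
    using p H10_grad_L2(1)[OF H] H10_grad_weak[OF H] unfolding H10_def H1_def H10_approx_def by blast
qed

text \<open>
  The approximation in \<open>H10\<close> uses the chosen weak gradient, which agrees almost everywhere with any
  other one.
\<close>

lemma H10_H10_grad:
  assumes "u \<in> H10 \<Omega>" "has_weak_gradient \<Omega> u G"
  shows "H10_grad u G"
proof -
  have u: "u \<in> L2 \<mu>" using assms by (auto simp: H10_def H1_def)
  obtain \<phi> where "\<And>n. \<phi> n \<in> Cc_infinity \<Omega>" "(\<lambda>n. H1_norm \<Omega> (\<lambda>x. \<phi> n x - u x)) \<longlonglongrightarrow> 0"
    using assms by (auto simp: H10_def)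
  then show ?thesis
    using H10_approx_H1_norm[OF u assms(2)] u weak_gradient_L2[OF assms(2)] by (auto simp: H10_grad_def)
qed

lemma H10_weak_gradient: "u \<in> H10 \<Omega> \<Longrightarrow> H10_grad u (weak_gradient \<Omega> u)"
  using H10_H10_grad has_weak_gradient_weak_gradient by (auto simp: H10_def H1_def)

lemma H10_approx_lincomb:
  assumes u: "u \<in> L2 \<mu>" "\<And>i. i \<in> Basis \<Longrightarrow> (\<lambda>x. G x \<bullet> i) \<in> L2 \<mu>" "H10_approx u G \<phi>"
    and v: "v \<in> L2 \<mu>" "\<And>i. i \<in> Basis \<Longrightarrow> (\<lambda>x. H x \<bullet> i) \<in> L2 \<mu>" "H10_approx v H \<psi>"
  shows "H10_approx (\<lambda>x. u x + c * v x) (\<lambda>x. G x + c *\<^sub>R H x) (\<lambda>n x. \<phi> n x + c * \<psi> n x)"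
proof -
  have p: "\<phi> n \<in> Cc_infinity \<Omega>" and q: "\<psi> n \<in> Cc_infinity \<Omega>" for n using u v by (auto simp: H10_approx_def)
  have key: "(\<lambda>n. l2norm \<mu> (\<lambda>x. (f n x + c * g n x) - (F x + c * G x))) \<longlonglongrightarrow> 0"
    if "\<And>n. f n \<in> L2 \<mu>" "\<And>n. g n \<in> L2 \<mu>" "F \<in> L2 \<mu>" "G \<in> L2 \<mu>"
      "(\<lambda>n. l2norm \<mu> (\<lambda>x. f n x - F x)) \<longlonglongrightarrow> 0" "(\<lambda>n. l2norm \<mu> (\<lambda>x. g n x - G x)) \<longlonglongrightarrow> 0"
    for f g :: "nat \<Rightarrow> 'a \<Rightarrow> real" and F G
  proof (rule tendsto_sandwich[OF _ _ tendsto_const])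
    have "l2norm \<mu> (\<lambda>x. (f n x + c * g n x) - (F x + c * G x))
        \<le> l2norm \<mu> (\<lambda>x. f n x - F x) + \<bar>c\<bar> * l2norm \<mu> (\<lambda>x. g n x - G x)" for n
      using l2_triangle[OF L2_diff[OF that(1,3)] L2_cmult[OF L2_diff[OF that(2,4)]], of n c n]
      by (simp add: l2norm_cmult [symmetric] algebra_simps)
    then show "\<forall>\<^sub>F n in sequentially. l2norm \<mu> (\<lambda>x. (f n x + c * g n x) - (F x + c * G x))
        \<le> l2norm \<mu> (\<lambda>x. f n x - F x) + \<bar>c\<bar> * l2norm \<mu> (\<lambda>x. g n x - G x)" by simp
    show "(\<lambda>n. l2norm \<mu> (\<lambda>x. f n x - F x) + \<bar>c\<bar> * l2norm \<mu> (\<lambda>x. g n x - G x)) \<longlonglongrightarrow> 0"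
      using tendsto_add[OF that(5) tendsto_mult_left[OF that(6), of "\<bar>c\<bar>"]] by simp
  qed simp
  have "partial_deriv i (\<lambda>x. \<phi> n x + c * \<psi> n x) = (\<lambda>x. partial_deriv i (\<phi> n) x + c * partial_deriv i (\<psi> n) x)" for i n
    by (intro partial_deriv_lincomb smooth_Ck Cc_infinity_smooth[OF p] Cc_infinity_smooth[OF q])
  then show ?thesis
    using u v key[OF test_L2[OF p] test_L2[OF q] u(1) v(1)]
      key[OF test_partial_L2[OF p] test_partial_L2[OF q] u(2) v(2)]
    unfolding H10_approx_def by (auto intro!: Cc_infinity_lincomb simp: inner_add_left)
qed

lemma H10_grad_lincomb:
  assumes "H10_grad u G" "H10_grad v H"
  shows "H10_grad (\<lambda>x. u x + c * v x) (\<lambda>x. G x + c *\<^sub>R H x)"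
proof -
  obtain \<phi> \<psi> where "H10_approx u G \<phi>" "H10_approx v H \<psi>" using assms by (auto simp: H10_grad_def)
  then have "H10_approx (\<lambda>x. u x + c * v x) (\<lambda>x. G x + c *\<^sub>R H x) (\<lambda>n x. \<phi> n x + c * \<psi> n x)"
    using assms by (intro H10_approx_lincomb) (auto simp: H10_grad_def)
  moreover have "(\<lambda>x. u x + c * v x) \<in> L2 \<mu>" using assms by (intro L2_lincomb) (auto simp: H10_grad_def)
  moreover have "(\<lambda>x. (G x + c *\<^sub>R H x) \<bullet> i) \<in> L2 \<mu>" if "i \<in> Basis" for i
    using L2_lincomb[OF H10_grad_L2(2)[OF assms(1) that] H10_grad_L2(2)[OF assms(2) that], of c]
    by (simp add: inner_add_left)
  ultimately show ?thesis unfolding H10_grad_def by blast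
qed

lemma test_H10_grad: "\<phi> \<in> Cc_infinity \<Omega> \<Longrightarrow> H10_grad \<phi> (grad \<phi>)"
  unfolding H10_grad_def H10_approx_def
  by (auto simp: l2norm_def test_L2 test_partial_L2 intro!: exI[of _ "\<lambda>_. \<phi>"])

lemma H10_grad_closed:
  assumes un: "\<And>n. H10_grad (u n) (G n)" and u: "u' \<in> L2 \<mu>" and G: "\<And>i. i \<in> Basis \<Longrightarrow> (\<lambda>x. G' x \<bullet> i) \<in> L2 \<mu>"
    and ul: "(\<lambda>n. l2norm \<mu> (\<lambda>x. u n x - u' x)) \<longlonglongrightarrow> 0"
    and Gl: "\<And>i. i \<in> Basis \<Longrightarrow> (\<lambda>n. l2norm \<mu> (\<lambda>x. G n x \<bullet> i - G' x \<bullet> i)) \<longlonglongrightarrow> 0"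
  shows "H10_grad u' G'"
proof -
  have "\<exists>\<phi>\<in>Cc_infinity \<Omega>. l2norm \<mu> (\<lambda>x. \<phi> x - u n x) < inverse (real (Suc n)) \<and>
      (\<forall>i\<in>Basis. l2norm \<mu> (\<lambda>x. partial_deriv i \<phi> x - G n x \<bullet> i) < inverse (real (Suc n)))" for n
  proof -
    obtain \<phi> where p: "H10_approx (u n) (G n) \<phi>" using un by (auto simp: H10_grad_def)
    have "\<forall>\<^sub>F m in sequentially. l2norm \<mu> (\<lambda>x. \<phi> m x - u n x) < inverse (real (Suc n))"
      using p by (intro order_tendstoD(2)[of _ 0]) (auto simp: H10_approx_def)
    moreover have "\<forall>\<^sub>F m in sequentially. \<forall>i\<in>Basis. l2norm \<mu> (\<lambda>x. partial_deriv i (\<phi> m) x - G n x \<bullet> i) < inverse (real (Suc n))"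
      using p by (intro eventually_ball_finite ballI order_tendstoD(2)[of _ 0]) (auto simp: H10_approx_def)
    ultimately have "\<forall>\<^sub>F m in sequentially. l2norm \<mu> (\<lambda>x. \<phi> m x - u n x) < inverse (real (Suc n)) \<and>
       (\<forall>i\<in>Basis. l2norm \<mu> (\<lambda>x. partial_deriv i (\<phi> m) x - G n x \<bullet> i) < inverse (real (Suc n)))"
      by (rule eventually_conj)
    then obtain m where "l2norm \<mu> (\<lambda>x. \<phi> m x - u n x) < inverse (real (Suc n)) \<and>
       (\<forall>i\<in>Basis. l2norm \<mu> (\<lambda>x. partial_deriv i (\<phi> m) x - G n x \<bullet> i) < inverse (real (Suc n)))"
      using eventually_happens trivial_limit_sequentially by blast
    then show ?thesis using p by (intro bexI[of _ "\<phi> m"]) (auto simp: H10_approx_def)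
  qed
  then obtain \<phi> where t: "\<And>n. \<phi> n \<in> Cc_infinity \<Omega>"
    and b: "\<And>n. l2norm \<mu> (\<lambda>x. \<phi> n x - u n x) < inverse (real (Suc n))"
    and c: "\<And>n i. i \<in> Basis \<Longrightarrow> l2norm \<mu> (\<lambda>x. partial_deriv i (\<phi> n) x - G n x \<bullet> i) < inverse (real (Suc n))"
    by metis
  have key: "(\<lambda>n. l2norm \<mu> (\<lambda>x. f n x - H x)) \<longlonglongrightarrow> 0"
    if "\<And>n. f n \<in> L2 \<mu>" "\<And>n. g n \<in> L2 \<mu>" "H \<in> L2 \<mu>" "\<And>n. l2norm \<mu> (\<lambda>x. f n x - g n x) < inverse (real (Suc n))"
      "(\<lambda>n. l2norm \<mu> (\<lambda>x. g n x - H x)) \<longlonglongrightarrow> 0" for f g :: "nat \<Rightarrow> 'a \<Rightarrow> real" and H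
  proof (rule tendsto_sandwich[OF _ _ tendsto_const])
    have "l2norm \<mu> (\<lambda>x. f n x - H x) \<le> inverse (real (Suc n)) + l2norm \<mu> (\<lambda>x. g n x - H x)" for n
      using l2_triangle_diff[OF that(1)[of n] that(2)[of n] that(3)] that(4)[of n] by linarith
    then show "\<forall>\<^sub>F n in sequentially. l2norm \<mu> (\<lambda>x. f n x - H x) \<le> inverse (real (Suc n)) + l2norm \<mu> (\<lambda>x. g n x - H x)"
      by simp
    show "(\<lambda>n. inverse (real (Suc n)) + l2norm \<mu> (\<lambda>x. g n x - H x)) \<longlonglongrightarrow> 0"
      using tendsto_add[OF LIMSEQ_inverse_real_of_nat that(5)] by simp
  qed simp
  have "H10_approx u' G' \<phi>"
    unfolding H10_approx_def
    using key[OF test_L2[OF t] H10_grad_L2(1)[OF un] u b ul]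
      key[OF test_partial_L2[OF t] H10_grad_L2(2)[OF un] G c Gl] t by blast
  then show ?thesis using u G by (auto simp: H10_grad_def)
qed

section \<open>The Poincare inequality\<close>

text \<open>
  Integration by parts of \<open>x\<^sub>i \<phi>\<close> against the partial derivative of \<open>\<phi>\<close> expresses the square of the
  norm of \<open>\<phi>\<close> by minus twice the inner product of \<open>x\<^sub>i \<phi>\<close> with that derivative, and \<open>x\<^sub>i\<close> is
  bounded on the domain.
\<close>

lemma poincare_test:
  obtains P where "P > 0" "\<And>\<phi> i. \<phi> \<in> Cc_infinity \<Omega> \<Longrightarrow> i \<in> Basis \<Longrightarrow> l2norm \<mu> \<phi> \<le> P * l2norm \<mu> (partial_deriv i \<phi>)"
proof -
  obtain R where R: "R > 0" "\<And>x. x \<in> \<Omega> \<Longrightarrow> norm x \<le> R" using bounded_\<Omega> bounded_pos by blast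
  have "l2norm \<mu> \<phi> \<le> 2 * R * l2norm \<mu> (partial_deriv i \<phi>)" if p: "\<phi> \<in> Cc_infinity \<Omega>" and i: "i \<in> Basis" for \<phi> i
  proof -
    obtain K where K: "smooth \<phi>" "compact K" "K \<subseteq> \<Omega>" "\<And>x. x \<notin> K \<Longrightarrow> \<phi> x = 0" using Cc_infinityE[OF p] by blast
    note sx = smooth_inner[of i]
    have pdx: "partial_deriv i (\<lambda>x::'a. x \<bullet> i) x = 1" for x
      using i by (simp add: partial_deriv_inner)
    have xL: "(\<lambda>x. x \<bullet> i * \<phi> x) \<in> L2 \<mu>" by (intro smooth_L2 smooth_intros sx K(1))
    have L: "\<phi> \<in> L2 \<mu>" "partial_deriv i \<phi> \<in> L2 \<mu>" using p i by (auto intro: test_L2 test_partial_L2)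
    have "l2ip \<mu> (\<lambda>x. x \<bullet> i * \<phi> x) (partial_deriv i \<phi>) = - l2ip \<mu> (\<lambda>x. grad (\<lambda>x. x \<bullet> i * \<phi> x) x \<bullet> i) \<phi>"
      by (rule weak_gradient_ip[OF has_weak_gradient_classical i p]) (intro smooth_Ck smooth_intros sx K(1))
    also have "(\<lambda>x. grad (\<lambda>x. x \<bullet> i * \<phi> x) x \<bullet> i) = (\<lambda>x. x \<bullet> i * partial_deriv i \<phi> x + 1 * \<phi> x)"
      using i sx K(1) by (intro ext) (simp add: partial_deriv_mult smooth_differentiable pdx)
    also have "l2ip \<mu> \<dots> \<phi> = l2ip \<mu> (\<lambda>x. x \<bullet> i * partial_deriv i \<phi> x) \<phi> + 1 * l2ip \<mu> \<phi> \<phi>"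
      using L i by (intro l2ip_lincomb_left smooth_L2 smooth_intros sx smooth_partial_deriv K(1)) auto
    also have "l2ip \<mu> (\<lambda>x. x \<bullet> i * partial_deriv i \<phi> x) \<phi> = l2ip \<mu> (\<lambda>x. x \<bullet> i * \<phi> x) (partial_deriv i \<phi>)"
      unfolding l2ip_def by (intro Bochner_Integration.integral_cong) (auto simp: algebra_simps)
    finally have "(l2norm \<mu> \<phi>)\<^sup>2 = - 2 * l2ip \<mu> (\<lambda>x. x \<bullet> i * \<phi> x) (partial_deriv i \<phi>)"
      by (simp add: l2ip_self)
    also have "\<dots> \<le> 2 * (l2norm \<mu> (\<lambda>x. x \<bullet> i * \<phi> x) * l2norm \<mu> (partial_deriv i \<phi>))"
      using l2_Cauchy_Schwarz[OF xL L(2)] by linarith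
    also have "\<dots> \<le> 2 * ((R * l2norm \<mu> \<phi>) * l2norm \<mu> (partial_deriv i \<phi>))"
    proof -
      have "(l2norm \<mu> (\<lambda>x. x \<bullet> i * \<phi> x))\<^sup>2 \<le> (l2norm \<mu> (\<lambda>x. R * \<phi> x))\<^sup>2"
        unfolding l2norm_sq
      proof (rule integral_mono)
        show "integrable \<mu> (\<lambda>x. (x \<bullet> i * \<phi> x)\<^sup>2)" using xL by (simp add: L2_def)
        show "integrable \<mu> (\<lambda>x. (R * \<phi> x)\<^sup>2)" using L2_cmult[OF L(1), of R] by (simp add: L2_def)
        fix x assume "x \<in> space \<mu>"
        then have "\<bar>x \<bullet> i\<bar> \<le> R" using R(2)[of x] Basis_le_norm[OF i, of x] by simp
        then have "(x \<bullet> i)\<^sup>2 \<le> R\<^sup>2" using R(1) by (metis abs_le_square_iff abs_of_pos)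
        then show "(x \<bullet> i * \<phi> x)\<^sup>2 \<le> (R * \<phi> x)\<^sup>2" by (simp add: power_mult_distrib mult_right_mono)
      qed
      then have "l2norm \<mu> (\<lambda>x. x \<bullet> i * \<phi> x) \<le> l2norm \<mu> (\<lambda>x. R * \<phi> x)" by (rule power2_le_imp_le) simp
      then show ?thesis using R(1) by (intro mult_left_mono mult_right_mono) (auto simp: l2norm_cmult)
    qed
    finally have "l2norm \<mu> \<phi> * l2norm \<mu> \<phi> \<le> l2norm \<mu> \<phi> * (2 * R * l2norm \<mu> (partial_deriv i \<phi>))"
      by (simp add: power2_eq_square algebra_simps)
    then show ?thesis
      using R(1) l2norm_nonneg[of \<mu> \<phi>] by (cases "l2norm \<mu> \<phi> = 0") (auto simp: mult_le_cancel_left)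
  qed
  then show ?thesis using that[of "2 * R"] R(1) by auto
qed

definition poincare_const :: real where
  "poincare_const = (SOME P. P > 0 \<and> (\<forall>\<phi> i. \<phi> \<in> Cc_infinity \<Omega> \<longrightarrow> i \<in> Basis \<longrightarrow> l2norm \<mu> \<phi> \<le> P * l2norm \<mu> (partial_deriv i \<phi>)))"

lemma poincare_const:
  "poincare_const > 0" "\<phi> \<in> Cc_infinity \<Omega> \<Longrightarrow> i \<in> Basis \<Longrightarrow> l2norm \<mu> \<phi> \<le> poincare_const * l2norm \<mu> (partial_deriv i \<phi>)"
proof -
  have "\<exists>P. P > 0 \<and> (\<forall>\<phi> i. \<phi> \<in> Cc_infinity \<Omega> \<longrightarrow> i \<in> Basis \<longrightarrow> l2norm \<mu> \<phi> \<le> P * l2norm \<mu> (partial_deriv i \<phi>))"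
    using poincare_test by metis
  from someI_ex[OF this]
  show "poincare_const > 0" "\<phi> \<in> Cc_infinity \<Omega> \<Longrightarrow> i \<in> Basis \<Longrightarrow> l2norm \<mu> \<phi> \<le> poincare_const * l2norm \<mu> (partial_deriv i \<phi>)"
    unfolding poincare_const_def by blast+
qed

theorem poincare:
  assumes H: "H10_grad u G" and i: "i \<in> Basis"
  shows "l2norm \<mu> u \<le> poincare_const * l2norm \<mu> (\<lambda>x. G x \<bullet> i)"
proof -
  obtain \<phi> where p: "H10_approx u G \<phi>" using H by (auto simp: H10_grad_def)
  have t: "\<phi> n \<in> Cc_infinity \<Omega>" for n using p by (simp add: H10_approx_def)
  have "(\<lambda>n. l2norm \<mu> (\<phi> n)) \<longlonglongrightarrow> l2norm \<mu> u"
    using p H10_grad_L2(1)[OF H] test_L2[OF t] unfolding H10_approx_def by (intro l2norm_tendsto) auto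
  moreover have "(\<lambda>n. poincare_const * l2norm \<mu> (partial_deriv i (\<phi> n))) \<longlonglongrightarrow> poincare_const * l2norm \<mu> (\<lambda>x. G x \<bullet> i)"
    using p H10_grad_L2(2)[OF H i] test_partial_L2[OF t i] i unfolding H10_approx_def
    by (intro tendsto_mult_left l2norm_tendsto) auto
  ultimately show ?thesis
    by (rule LIMSEQ_le) (use poincare_const(2)[OF t i] in blast)
qed

end

section \<open>Hausdorff outer measure\<close>

definition hausdorff_weight :: "nat \<Rightarrow> 'a::euclidean_space set \<Rightarrow> ennreal" where
  "hausdorff_weight m A = (if A = {} then 0 else ennreal (unit_ball_vol (real m) * (diameter A / 2) ^ m))"

definition fine_cover :: "real \<Rightarrow> 'a::euclidean_space set \<Rightarrow> (nat \<Rightarrow> 'a set) \<Rightarrow> bool" where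
  "fine_cover \<delta> A C \<longleftrightarrow> A \<subseteq> (\<Union>i. C i) \<and> (\<forall>i. bounded (C i) \<and> diameter (C i) \<le> \<delta>)"

lemma hausdorff_premeasure_eq:
  "hausdorff_premeasure m \<delta> A = (INF C\<in>Collect (fine_cover \<delta> A). \<Sum>i. hausdorff_weight m (C i))"
  by (simp add: hausdorff_premeasure_def hausdorff_weight_def fine_cover_def[abs_def])

lemma hausdorff_premeasure_le:
  "fine_cover \<delta> A C \<Longrightarrow> hausdorff_premeasure m \<delta> A \<le> (\<Sum>i. hausdorff_weight m (C i))"
  unfolding hausdorff_premeasure_eq by (rule INF_lower) simp

lemma hausdorff_premeasure_cover:
  assumes "hausdorff_premeasure m \<delta> A < c"
  obtains C where "fine_cover \<delta> A C" "(\<Sum>i. hausdorff_weight m (C i)) < c"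
  using assms unfolding hausdorff_premeasure_eq by (auto simp: INF_less_iff)

lemma hausdorff_premeasure_mono:
  "A \<subseteq> B \<Longrightarrow> hausdorff_premeasure m \<delta> A \<le> hausdorff_premeasure m \<delta> B"
  unfolding hausdorff_premeasure_eq fine_cover_def[abs_def] by (rule INF_superset_mono) blast+

lemma hausdorff_premeasure_antimono:
  "\<delta> \<le> \<delta>' \<Longrightarrow> hausdorff_premeasure m \<delta>' A \<le> hausdorff_premeasure m \<delta> A"
  unfolding hausdorff_premeasure_eq fine_cover_def[abs_def]
  by (rule INF_superset_mono) (use order_trans in blast)+

lemma ennreal_less_add_pos:
  assumes "x < \<infinity>" "0 < e"
  shows "x < x + ennreal e"
  using assms by (cases x) (auto simp: ennreal_plus [symmetric] ennreal_less_iff simp del: ennreal_plus)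

text \<open>
  Nearly optimal covers of the sets \<open>A n\<close>, with errors that add up to \<open>e\<close>, are enumerated along a
  bijection between numbers and pairs.
\<close>

lemma hausdorff_premeasure_countably_subadditive:
  "hausdorff_premeasure m \<delta> (\<Union>n. A n) \<le> (\<Sum>n. hausdorff_premeasure m \<delta> (A n))"
proof (cases "(\<Sum>n. hausdorff_premeasure m \<delta> (A n)) < \<infinity>")
  case True
  have fin: "hausdorff_premeasure m \<delta> (A n) < \<infinity>" for n
    using True ennreal_suminf_lessD by blast
  show ?thesis
  proof (rule ennreal_le_epsilon)
    fix e :: real assume e: "0 < e"
    have "\<exists>C. fine_cover \<delta> (A n) C \<and>
        (\<Sum>i. hausdorff_weight m (C i)) \<le> hausdorff_premeasure m \<delta> (A n) + ennreal (e * (1/2) ^ Suc n)" for n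
    proof -
      have "hausdorff_premeasure m \<delta> (A n) < hausdorff_premeasure m \<delta> (A n) + ennreal (e * (1/2) ^ Suc n)"
        using fin[of n] e by (intro ennreal_less_add_pos) auto
      then obtain C where "fine_cover \<delta> (A n) C"
        "(\<Sum>i. hausdorff_weight m (C i)) < hausdorff_premeasure m \<delta> (A n) + ennreal (e * (1/2) ^ Suc n)"
        by (rule hausdorff_premeasure_cover)
      then show ?thesis using less_imp_le by blast
    qed
    then obtain C where C: "\<And>n. fine_cover \<delta> (A n) (C n)"
      and w: "\<And>n. (\<Sum>i. hausdorff_weight m (C n i)) \<le> hausdorff_premeasure m \<delta> (A n) + ennreal (e * (1/2) ^ Suc n)"
      by metis
    define D where "D k = (\<lambda>(n, i). C n i) (prod_decode k)" for k
    have "fine_cover \<delta> (\<Union>n. A n) D"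
      unfolding fine_cover_def
    proof safe
      fix x n assume "x \<in> A n"
      then obtain i where "x \<in> C n i" using C[of n] by (auto simp: fine_cover_def)
      then have "x \<in> D (prod_encode (n, i))" by (simp add: D_def)
      then show "x \<in> (\<Union>i. D i)" by blast
    qed (use C in \<open>auto simp: D_def fine_cover_def split: prod.split\<close>)
    then have "hausdorff_premeasure m \<delta> (\<Union>n. A n) \<le> (\<Sum>k. hausdorff_weight m (D k))"
      by (rule hausdorff_premeasure_le)
    also have "\<dots> = (\<Sum>k. (\<lambda>(n, i). hausdorff_weight m (C n i)) (prod_decode k))"
      by (intro suminf_cong) (simp add: D_def split: prod.split)
    also have "\<dots> = (\<Sum>n. \<Sum>i. hausdorff_weight m (C n i))"
      by (intro suminf_ennreal_2dimen) simp
    also have "\<dots> \<le> (\<Sum>n. hausdorff_premeasure m \<delta> (A n) + ennreal (e * (1/2) ^ Suc n))"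
      using w by (intro suminf_le) auto
    also have "\<dots> = (\<Sum>n. hausdorff_premeasure m \<delta> (A n)) + (\<Sum>n. ennreal (e * (1/2) ^ Suc n))"
      by (intro suminf_add [symmetric]) auto
    also have "(\<Sum>n. ennreal (e * (1/2) ^ Suc n)) = ennreal e"
      using e sums_mult[OF power_half_series, of e] by (intro suminf_ennreal_eq) auto
    finally show "hausdorff_premeasure m \<delta> (\<Union>n. A n) \<le> (\<Sum>n. hausdorff_premeasure m \<delta> (A n)) + ennreal e" .
  qed
next
  case False
  then show ?thesis by (simp add: not_less top_unique)
qed

lemma hausdorff_outer_ge: "\<delta> > 0 \<Longrightarrow> hausdorff_premeasure m \<delta> A \<le> hausdorff_outer m A"
  unfolding hausdorff_outer_def by (rule SUP_upper) simp

lemma hausdorff_outer_le: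
  "(\<And>\<delta>. \<delta> > 0 \<Longrightarrow> hausdorff_premeasure m \<delta> A \<le> c) \<Longrightarrow> hausdorff_outer m A \<le> c"
  unfolding hausdorff_outer_def by (rule SUP_least) simp

lemma hausdorff_outer_empty [simp]: "hausdorff_outer m {} = 0"
proof -
  have "hausdorff_premeasure m \<delta> {} \<le> 0" if "\<delta> > 0" for \<delta>
    using that hausdorff_premeasure_le[of \<delta> "{}" "\<lambda>_. {}" m]
    by (simp add: fine_cover_def hausdorff_weight_def)
  then have "hausdorff_outer m ({}::'a set) \<le> 0" by (rule hausdorff_outer_le)
  then show ?thesis by simp
qed

lemma hausdorff_outer_mono: "A \<subseteq> B \<Longrightarrow> hausdorff_outer m A \<le> hausdorff_outer m B"
  by (intro hausdorff_outer_le) (metis hausdorff_premeasure_mono hausdorff_outer_ge order_trans)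

lemma hausdorff_outer_countably_subadditive:
  "hausdorff_outer m (\<Union>n. A n) \<le> (\<Sum>n. hausdorff_outer m (A n))"
proof (rule hausdorff_outer_le)
  fix \<delta> :: real assume "\<delta> > 0"
  have "hausdorff_premeasure m \<delta> (\<Union>n. A n) \<le> (\<Sum>n. hausdorff_premeasure m \<delta> (A n))"
    by (rule hausdorff_premeasure_countably_subadditive)
  also have "\<dots> \<le> (\<Sum>n. hausdorff_outer m (A n))"
    using \<open>\<delta> > 0\<close> by (intro suminf_le hausdorff_outer_ge) auto
  finally show "hausdorff_premeasure m \<delta> (\<Union>n. A n) \<le> (\<Sum>n. hausdorff_outer m (A n))" .
qed

lemma hausdorff_outer_subadditive:
  "hausdorff_outer m (A \<union> B) \<le> hausdorff_outer m A + hausdorff_outer m B"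
proof -
  let ?C = "\<lambda>n::nat. if n = 0 then A else if n = 1 then B else {}"
  have "hausdorff_outer m (A \<union> B) \<le> hausdorff_outer m (\<Union>n. ?C n)"
    by (intro hausdorff_outer_mono) (auto split: if_splits intro: exI[of _ 0] exI[of _ 1])
  also have "\<dots> \<le> (\<Sum>n. hausdorff_outer m (?C n))" by (rule hausdorff_outer_countably_subadditive)
  also have "\<dots> = (\<Sum>n\<in>{0, 1}. hausdorff_outer m (?C n))" by (rule suminf_finite) auto
  finally show ?thesis by simp
qed

lemma outer_measure_space_hausdorff: "outer_measure_space UNIV (hausdorff_outer m)"
  unfolding outer_measure_space_def positive_def increasing_def countably_subadditive_def
  by (auto intro: hausdorff_outer_mono hausdorff_outer_countably_subadditive)

text \<open>
  A set of diameter less than \<open>d\<close> cannot meet both \<open>A\<close> and \<open>B\<close>, so a fine cover of the union splits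
  into a cover of \<open>A\<close> and a cover of \<open>B\<close>.
\<close>

lemma hausdorff_outer_separated:
  fixes A B :: "'a::euclidean_space set"
  assumes d: "d > 0" "\<And>x y. x \<in> A \<Longrightarrow> y \<in> B \<Longrightarrow> d \<le> dist x y"
  shows "hausdorff_outer m A + hausdorff_outer m B \<le> hausdorff_outer m (A \<union> B)"
proof -
  have split: "hausdorff_premeasure m \<delta> A + hausdorff_premeasure m \<delta> B \<le> hausdorff_premeasure m \<delta> (A \<union> B)"
    if \<delta>: "0 < \<delta>" "\<delta> < d" for \<delta>
    unfolding hausdorff_premeasure_eq[of m \<delta> "A \<union> B"]
  proof (rule INF_greatest, simp)
    fix C :: "nat \<Rightarrow> 'a set" assume C: "fine_cover \<delta> (A \<union> B) C"
    \<comment> \<open>Empty sets have weight 0, so the two covers together have the same weights as \<open>C\<close>.\<close>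
    define CA where "CA i = (if C i \<inter> A \<noteq> {} then C i else {})" for i
    define CB where "CB i = (if C i \<inter> A \<noteq> {} then {} else C i)" for i
    have "fine_cover \<delta> A CA"
      unfolding fine_cover_def
    proof safe
      fix x assume x: "x \<in> A"
      then obtain i where "x \<in> C i" using C by (auto simp: fine_cover_def)
      then have "x \<in> CA i" using x by (auto simp: CA_def)
      then show "x \<in> (\<Union>i. CA i)" by blast
    qed (use C \<delta> in \<open>auto simp: fine_cover_def CA_def\<close>)
    moreover have "fine_cover \<delta> B CB"
      unfolding fine_cover_def
    proof safe
      fix x assume x: "x \<in> B"
      then obtain i where i: "x \<in> C i" using C by (auto simp: fine_cover_def)
      have "C i \<inter> A = {}"
      proof (rule ccontr)
        assume "C i \<inter> A \<noteq> {}"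
        then obtain y where y: "y \<in> C i" "y \<in> A" by blast
        have "dist y x \<le> diameter (C i)" using C i y by (intro diameter_bounded_bound) (auto simp: fine_cover_def)
        then have "dist y x < d" using C \<delta> by (auto simp: fine_cover_def dest: spec[of _ i])
        then show False using d(2)[OF y(2) x] by simp
      qed
      then show "x \<in> (\<Union>i. CB i)" using i by (auto simp: CB_def)
    qed (use C \<delta> in \<open>auto simp: fine_cover_def CB_def\<close>)
    ultimately have "hausdorff_premeasure m \<delta> A + hausdorff_premeasure m \<delta> B
        \<le> (\<Sum>i. hausdorff_weight m (CA i)) + (\<Sum>i. hausdorff_weight m (CB i))"
      by (intro add_mono hausdorff_premeasure_le)
    also have "\<dots> = (\<Sum>i. hausdorff_weight m (CA i) + hausdorff_weight m (CB i))"
      by (intro suminf_add) auto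
    also have "\<dots> = (\<Sum>i. hausdorff_weight m (C i))"
      by (intro suminf_cong) (auto simp: CA_def CB_def hausdorff_weight_def)
    finally show "hausdorff_premeasure m \<delta> A + hausdorff_premeasure m \<delta> B \<le> (\<Sum>i. hausdorff_weight m (C i))" .
  qed
  have both: "hausdorff_premeasure m \<delta>1 A + hausdorff_premeasure m \<delta>2 B \<le> hausdorff_outer m (A \<union> B)"
    if \<delta>: "0 < \<delta>1" "0 < \<delta>2" for \<delta>1 \<delta>2
  proof -
    define \<delta> where "\<delta> = min (min \<delta>1 \<delta>2) (d/2)"
    have "hausdorff_premeasure m \<delta>1 A + hausdorff_premeasure m \<delta>2 B
        \<le> hausdorff_premeasure m \<delta> A + hausdorff_premeasure m \<delta> B"
      by (intro add_mono hausdorff_premeasure_antimono) (auto simp: \<delta>_def)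
    also have "\<dots> \<le> hausdorff_premeasure m \<delta> (A \<union> B)" using \<delta> d by (intro split) (auto simp: \<delta>_def min_less_iff_disj)
    also have "\<dots> \<le> hausdorff_outer m (A \<union> B)" using \<delta> d by (intro hausdorff_outer_ge) (auto simp: \<delta>_def)
    finally show ?thesis .
  qed
  have ne: "{0::real<..} \<noteq> {}" using greaterThan_non_empty by blast
  have "hausdorff_outer m A + hausdorff_outer m B
      = (SUP \<delta>1\<in>{0<..}. hausdorff_premeasure m \<delta>1 A + hausdorff_outer m B)"
    unfolding hausdorff_outer_def[of m A] using ne by (intro ennreal_SUP_add_left [symmetric]) auto
  also have "\<dots> = (SUP \<delta>1\<in>{0<..}. SUP \<delta>2\<in>{0<..}. hausdorff_premeasure m \<delta>1 A + hausdorff_premeasure m \<delta>2 B)"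
    unfolding hausdorff_outer_def[of m B] using ne by (intro SUP_cong refl ennreal_SUP_add_right) auto
  also have "\<dots> \<le> hausdorff_outer m (A \<union> B)"
    using both by (intro SUP_least) auto
  finally show ?thesis .
qed

lemma hausdorff_outer_separated_sequence:
  fixes R :: "nat \<Rightarrow> 'a::euclidean_space set"
  assumes sep: "\<And>i. \<exists>d>0. \<forall>x\<in>(\<Union>j<i. R j). \<forall>y\<in>R i. d \<le> dist x y"
  shows "(\<Sum>i<n. hausdorff_outer m (R i)) \<le> hausdorff_outer m (\<Union>i<n. R i)"
proof (induction n)
  case (Suc n)
  obtain d where "d > 0" "\<forall>x\<in>(\<Union>j<n. R j). \<forall>y\<in>R n. d \<le> dist x y" using sep by blast
  then have "hausdorff_outer m (\<Union>i<n. R i) + hausdorff_outer m (R n) \<le> hausdorff_outer m ((\<Union>i<n. R i) \<union> R n)"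
    by (intro hausdorff_outer_separated[of d]) auto
  also have "(\<Union>i<n. R i) \<union> R n = (\<Union>i<Suc n. R i)" by (simp add: lessThan_Suc Un_commute)
  finally have "hausdorff_outer m (\<Union>i<n. R i) + hausdorff_outer m (R n) \<le> hausdorff_outer m (\<Union>i<Suc n. R i)" .
  moreover have "(\<Sum>i<Suc n. hausdorff_outer m (R i)) \<le> hausdorff_outer m (\<Union>i<n. R i) + hausdorff_outer m (R n)"
    using add_right_mono[OF Suc.IH] by simp
  ultimately show ?case by (rule order_trans[rotated])
qed simp

text \<open>
  Caratheodory's criterion for metric outer measures.  The part of \<open>T\<close> outside \<open>F\<close> is exhausted by
  the sets \<open>far n\<close> at positive distance from \<open>F\<close>; what is missing lies in thin layers \<open>R k\<close> around
  \<open>F\<close>.  Layers with indices of the same parity are at positive distance from each other, hence the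
  sum over all layers is at most twice the measure of \<open>T\<close>, and its tails tend to 0.
\<close>

theorem hausdorff_closed_split:
  fixes T :: "'a::euclidean_space set"
  assumes F: "closed F"
  shows "hausdorff_outer m (T \<inter> F) + hausdorff_outer m (T - F) \<le> hausdorff_outer m T"
proof (cases "F = {} \<or> hausdorff_outer m T = \<infinity>")
  case True
  then show ?thesis by auto
next
  case False
  then have ne: "F \<noteq> {}" and fin: "hausdorff_outer m T < \<infinity>" by (auto simp: less_top)
  define a :: "nat \<Rightarrow> real" where "a n = inverse (real (Suc n))" for n
  have a_pos: "a n > 0" for n by (simp add: a_def)
  have a_dec: "a l \<le> a k" if "k \<le> l" for k l using that by (simp add: a_def)
  have a_sdec: "a (Suc k) < a k" for k by (simp add: a_def)
  define far where "far n = {x\<in>T. a n \<le> infdist x F}" for n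
  define R where "R k = {x\<in>T. a (Suc k) \<le> infdist x F \<and> infdist x F < a k}" for k
  have sepR: "a (Suc k) - a (Suc (Suc k)) \<le> dist x y" if "x \<in> R k" "y \<in> R l" "k + 2 \<le> l" for x y k l
    using that infdist_triangle[of x F y] a_dec[of "Suc (Suc k)" l] by (auto simp: R_def)
  have partial: "(\<Sum>i<n. hausdorff_outer m (R (2 * i + c))) \<le> hausdorff_outer m T" for n c
  proof -
    have "(\<Sum>i<n. hausdorff_outer m (R (2 * i + c))) \<le> hausdorff_outer m (\<Union>i<n. R (2 * i + c))"
    proof (rule hausdorff_outer_separated_sequence)
      fix i
      define d where "d = Min (insert 1 ((\<lambda>j. a (Suc (2*j+c)) - a (Suc (Suc (2*j+c)))) ` {..<i}))"
      have "d > 0" unfolding d_def using a_sdec by (subst Min_gr_iff) auto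
      moreover have "d \<le> dist x y" if "j < i" "x \<in> R (2*j+c)" "y \<in> R (2*i+c)" for j x y
      proof -
        have "d \<le> a (Suc (2*j+c)) - a (Suc (Suc (2*j+c)))" unfolding d_def using that by (intro Min_le) auto
        also have "\<dots> \<le> dist x y" using that by (intro sepR[of _ _ _ "2*i+c"]) auto
        finally show ?thesis .
      qed
      ultimately show "\<exists>d>0. \<forall>x\<in>\<Union>j<i. R (2 * j + c). \<forall>y\<in>R (2 * i + c). d \<le> dist x y" by blast
    qed
    also have "\<dots> \<le> hausdorff_outer m T" by (intro hausdorff_outer_mono) (auto simp: R_def)
    finally show ?thesis .
  qed
  have sumR: "(\<Sum>i<n. hausdorff_outer m (R i)) \<le> hausdorff_outer m T + hausdorff_outer m T" for n
  proof -
    have "(\<Sum>i<n. hausdorff_outer m (R i)) \<le> (\<Sum>i<2*n. hausdorff_outer m (R i))"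
      by (intro sum_mono2) auto
    also have "\<dots> = (\<Sum>i<n. hausdorff_outer m (R (2*i+0))) + (\<Sum>i<n. hausdorff_outer m (R (2*i+1)))"
      by (induction n) (auto simp: ac_simps)
    also have "\<dots> \<le> hausdorff_outer m T + hausdorff_outer m T" by (intro add_mono partial)
    finally show ?thesis .
  qed
  have S: "(\<Sum>i. hausdorff_outer m (R i)) \<le> hausdorff_outer m T + hausdorff_outer m T"
    unfolding suminf_eq_SUP using sumR by (intro SUP_least) auto
  then have Sfin: "(\<Sum>i. hausdorff_outer m (R i)) < \<infinity>" using fin
    by (metis ennreal_add_less_top infinity_ennreal_def le_less_trans)
  define r where "r i = enn2real (hausdorff_outer m (R i))" for i
  have r: "hausdorff_outer m (R i) = ennreal (r i)" "r i \<ge> 0" for i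
    unfolding r_def using ennreal_suminf_lessD[OF Sfin, of i] by (auto simp: less_top)
  have sr: "summable r"
    using Sfin r by (intro summable_suminf_not_top) auto
  have tail: "(\<lambda>n. \<Sum>k. r (k + n)) \<longlonglongrightarrow> 0" using sr by (rule suminf_exist_split2)
  have le: "hausdorff_outer m (T \<inter> F) + hausdorff_outer m (T - F) \<le> hausdorff_outer m T + ennreal (\<Sum>k. r (k + n))" for n
  proof -
    have cover: "T - F \<subseteq> far n \<union> (\<Union>k. R (k + n))"
    proof
      fix x assume x: "x \<in> T - F"
      then have pos: "infdist x F > 0" using F ne infdist_pos_not_in_closed by blast
      show "x \<in> far n \<union> (\<Union>k. R (k + n))"
      proof (cases "a n \<le> infdist x F")
        case True then show ?thesis using x by (simp add: far_def)
      next
        case False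
        obtain N where N: "a N < infdist x F" using pos reals_Archimedean unfolding a_def by blast
        define k where "k = (LEAST k. a k \<le> infdist x F)"
        have k1: "a k \<le> infdist x F" unfolding k_def using N by (rule LeastI[of _ N, OF less_imp_le])
        have k2: "\<not> a j \<le> infdist x F" if "j < k" for j using not_less_Least that unfolding k_def by blast
        have "n < k" using False k1 a_dec[of k n] by (cases "n < k") auto
        then obtain j where j: "k = Suc (j + n)" using less_imp_Suc_add by (metis add.commute)
        have "x \<in> R (j + n)" using x k1 k2[of "j + n"] j by (simp add: R_def)
        then show ?thesis by blast
      qed
    qed
    have "hausdorff_outer m (T - F) \<le> hausdorff_outer m (far n) + hausdorff_outer m (\<Union>k. R (k + n))"
      using hausdorff_outer_mono[OF cover] hausdorff_outer_subadditive order_trans by blast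
    also have "\<dots> \<le> hausdorff_outer m (far n) + (\<Sum>k. hausdorff_outer m (R (k + n)))"
      by (intro add_left_mono hausdorff_outer_countably_subadditive)
    also have "(\<Sum>k. hausdorff_outer m (R (k + n))) = ennreal (\<Sum>k. r (k + n))"
      unfolding r(1) using r(2) sr by (intro suminf_ennreal2) (auto simp: summable_iff_shift)
    finally have 1: "hausdorff_outer m (T - F) \<le> hausdorff_outer m (far n) + ennreal (\<Sum>k. r (k + n))" .
    have "hausdorff_outer m (T \<inter> F) + hausdorff_outer m (far n) \<le> hausdorff_outer m ((T \<inter> F) \<union> far n)"
    proof (rule hausdorff_outer_separated[OF a_pos[of n]])
      fix x y assume "x \<in> T \<inter> F" "y \<in> far n"
      then show "a n \<le> dist x y" using infdist_le[of x F y] by (auto simp: far_def dist_commute)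
    qed
    also have "\<dots> \<le> hausdorff_outer m T" by (intro hausdorff_outer_mono) (auto simp: far_def)
    finally have 2: "hausdorff_outer m (T \<inter> F) + hausdorff_outer m (far n) \<le> hausdorff_outer m T" .
    have "hausdorff_outer m (T \<inter> F) + hausdorff_outer m (T - F)
        \<le> (hausdorff_outer m (T \<inter> F) + hausdorff_outer m (far n)) + ennreal (\<Sum>k. r (k + n))"
      using add_left_mono[OF 1] by (simp add: add.assoc)
    also have "\<dots> \<le> hausdorff_outer m T + ennreal (\<Sum>k. r (k + n))" using 2 by (rule add_right_mono)
    finally show ?thesis .
  qed
  show ?thesis
  proof (rule ennreal_le_epsilon)
    fix e :: real assume "0 < e"
    then have "\<forall>\<^sub>F n in sequentially. (\<Sum>k. r (k + n)) < e" using tail by (auto dest: order_tendstoD(2))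
    then obtain n where n: "(\<Sum>k. r (k + n)) < e"
      using eventually_happens trivial_limit_sequentially by blast
    show "hausdorff_outer m (T \<inter> F) + hausdorff_outer m (T - F) \<le> hausdorff_outer m T + ennreal e"
      using le[of n] n by (meson add_left_mono ennreal_leI less_imp_le order_trans)
  qed
qed

abbreviation "hausdorff_sets m \<equiv> lambda_system UNIV UNIV (hausdorff_outer m)"

lemma hausdorff_measure_space: "measure_space UNIV (hausdorff_sets m) (hausdorff_outer m)"
  using sigma_algebra.caratheodory_lemma[OF sigma_algebra_Pow[of UNIV], unfolded Pow_UNIV, OF outer_measure_space_hausdorff] .

lemma sigma_algebra_hausdorff_sets: "sigma_algebra UNIV (hausdorff_sets m)"
  using hausdorff_measure_space unfolding measure_space_def by blast

lemma space_hausdorff_measure [simp]: "space (hausdorff_measure m) = UNIV"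
  by (simp add: hausdorff_measure_def space_measure_of_conv)

lemma sets_hausdorff_measure: "sets (hausdorff_measure m :: 'a::euclidean_space measure) = hausdorff_sets m"
  unfolding hausdorff_measure_def
  by (simp add: sets_measure_of_conv sigma_algebra.sigma_sets_eq[OF sigma_algebra_hausdorff_sets])

lemma emeasure_hausdorff_measure:
  "A \<in> hausdorff_sets m \<Longrightarrow> emeasure (hausdorff_measure m) A = hausdorff_outer m A"
  unfolding hausdorff_measure_def
  by (rule emeasure_measure_of_sigma) (use hausdorff_measure_space[of m] in \<open>auto simp: measure_space_def\<close>)

text \<open>
  Closed sets generate the Borel sets and satisfy Caratheodory's condition by the preceding theorem.
\<close>

theorem borel_hausdorff_sets:
  fixes A :: "'a::euclidean_space set"
  assumes "A \<in> sets borel"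
  shows "A \<in> hausdorff_sets m"
proof -
  have "F \<in> hausdorff_sets m" if "closed F" for F :: "'a set"
  proof -
    have "hausdorff_outer m (F \<inter> T) + hausdorff_outer m (- F \<inter> T) = hausdorff_outer m T" for T
    proof (rule antisym)
      show "hausdorff_outer m (F \<inter> T) + hausdorff_outer m (- F \<inter> T) \<le> hausdorff_outer m T"
        using hausdorff_closed_split[OF that, of m T] by (simp add: Int_commute Diff_eq)
      have "T = (F \<inter> T) \<union> (- F \<inter> T)" by blast
      then show "hausdorff_outer m T \<le> hausdorff_outer m (F \<inter> T) + hausdorff_outer m (- F \<inter> T)"
        using hausdorff_outer_subadditive by metis
    qed
    then show ?thesis by (simp add: lambda_system_def Compl_eq_Diff_UNIV)
  qed
  then have "sigma_sets UNIV (Collect closed :: 'a set set) \<subseteq> hausdorff_sets m"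
    by (intro sigma_algebra.sigma_sets_subset[OF sigma_algebra_hausdorff_sets]) auto
  then show ?thesis using assms by (auto simp: borel_eq_closed sets_measure_of)
qed

text \<open>
  The sets of a cover may be replaced by their closures, which have the same diameters.
\<close>

theorem hausdorff_borel_hull:
  fixes A :: "'a::euclidean_space set"
  assumes fin: "hausdorff_outer m A < \<infinity>"
  shows "\<exists>B\<in>sets borel. A \<subseteq> B \<and> hausdorff_outer m B \<le> hausdorff_outer m A"
proof -
  define a :: "nat \<Rightarrow> real" where "a n = inverse (real (Suc n))" for n
  have a: "a n > 0" for n by (simp add: a_def)
  have "\<exists>C. fine_cover (a n) A C \<and> (\<Sum>i. hausdorff_weight m (C i)) \<le> hausdorff_outer m A + ennreal (a n)" for n
  proof -
    have "hausdorff_premeasure m (a n) A \<le> hausdorff_outer m A" by (rule hausdorff_outer_ge[OF a])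
    also have "\<dots> < hausdorff_outer m A + ennreal (a n)"
      using fin a[of n] by (intro ennreal_less_add_pos) auto
    finally obtain C where "fine_cover (a n) A C"
      "(\<Sum>i. hausdorff_weight m (C i)) < hausdorff_outer m A + ennreal (a n)"
      by (rule hausdorff_premeasure_cover)
    then show ?thesis using less_imp_le by blast
  qed
  then obtain C where C: "\<And>n. fine_cover (a n) A (C n)"
    and w: "\<And>n. (\<Sum>i. hausdorff_weight m (C n i)) \<le> hausdorff_outer m A + ennreal (a n)" by metis
  define B where "B = (\<Inter>n. \<Union>i. closure (C n i))"
  have "B \<in> sets borel" unfolding B_def by (intro sets.countable_INT'' sets.countable_UN) auto
  moreover have "A \<subseteq> B"
  proof
    fix x assume "x \<in> A"
    then have "\<exists>i. x \<in> C n i" for n using C[of n] by (auto simp: fine_cover_def)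
    then show "x \<in> B" unfolding B_def using closure_subset by blast
  qed
  moreover have "hausdorff_outer m B \<le> hausdorff_outer m A"
  proof (rule hausdorff_outer_le)
    fix \<delta> :: real assume \<delta>: "\<delta> > 0"
    show "hausdorff_premeasure m \<delta> B \<le> hausdorff_outer m A"
    proof (rule ennreal_le_epsilon)
      fix e :: real assume "0 < e"
      then obtain n where n: "a n < min \<delta> e" using reals_Archimedean[of "min \<delta> e"] \<delta> by (auto simp: a_def)
      have "fine_cover (a n) B (\<lambda>i. closure (C n i))"
        using C[of n] by (auto simp: fine_cover_def B_def diameter_closure)
      then have "hausdorff_premeasure m (a n) B \<le> (\<Sum>i. hausdorff_weight m (closure (C n i)))"
        by (rule hausdorff_premeasure_le)
      also have "\<dots> = (\<Sum>i. hausdorff_weight m (C n i))"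
        using C[of n] by (intro suminf_cong) (auto simp: hausdorff_weight_def fine_cover_def diameter_closure)
      also note w[of n]
      finally have "hausdorff_premeasure m (a n) B \<le> hausdorff_outer m A + ennreal (a n)" .
      moreover have "hausdorff_premeasure m \<delta> B \<le> hausdorff_premeasure m (a n) B"
        using n by (intro hausdorff_premeasure_antimono) auto
      moreover have "hausdorff_outer m A + ennreal (a n) \<le> hausdorff_outer m A + ennreal e"
        using n by (intro add_left_mono ennreal_leI) auto
      ultimately show "hausdorff_premeasure m \<delta> B \<le> hausdorff_outer m A + ennreal e" by (meson order_trans)
    qed
  qed
  ultimately show ?thesis by blast
qed

section \<open>One-sidedness of Lipschitz boundaries\<close>

text \<open>
  The function \<open>\<eta>\<close> is a signed height over the Lipschitz graph that represents \<open>\<Gamma>\<close> in the ball: it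
  grows at unit speed in the direction \<open>e\<close>.  Describing the graph as a zero set of a function on the
  whole space makes it easy to change the center and the size of the ball and to exchange the sides.
\<close>

definition graph_chart :: "'a::euclidean_space set \<Rightarrow> 'a \<Rightarrow> ('a \<Rightarrow> real) \<Rightarrow> 'a \<Rightarrow> real \<Rightarrow> real \<Rightarrow> bool" where
  "graph_chart \<Gamma> p \<eta> e K r \<longleftrightarrow> K \<ge> 0 \<and> r > 0 \<and> norm e = 1 \<and>
     (\<forall>x y. \<bar>\<eta> x - \<eta> y\<bar> \<le> K * norm (x - y)) \<and> (\<forall>x t. \<eta> (x + t *\<^sub>R e) = \<eta> x + t) \<and>
     (\<forall>x\<in>ball p r. x \<in> \<Gamma> \<longleftrightarrow> \<eta> x = 0)"

text \<open>
  The other boundary surfaces are closed and avoid \<open>p\<close>, so a small ball around \<open>p\<close> meets only the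
  surface through \<open>p\<close>.
\<close>

lemma B1_graph_chart:
  fixes \<Omega> :: "'a::euclidean_space set"
  assumes B1: "B1 \<Omega>" and p: "p \<in> frontier \<Omega>"
  shows "\<exists>\<eta> e K r. graph_chart (frontier \<Omega>) p \<eta> e K r"
proof -
  obtain \<S> where S: "finite \<S>" "disjoint \<S>" "\<Union>\<S> = frontier \<Omega>" "\<And>S. S \<in> \<S> \<Longrightarrow> closed_Lipschitz_surface S"
    using B1 by (auto simp: B1_def)
  obtain S where pS: "p \<in> S" "S \<in> \<S>" using p S(3) by blast
  obtain U e g L where U: "open U" "p \<in> U" "norm e = 1" "L-lipschitz_on {y. y \<bullet> e = 0} g"
    and SU: "S \<inter> U = {x \<in> U. x \<bullet> e = g (x - (x \<bullet> e) *\<^sub>R e)}"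
    using S(4)[OF pS(2)] pS(1) unfolding closed_Lipschitz_surface_def by blast
  have "closed (\<Union>(\<S> - {S}))"
    using S(1,4) by (intro closed_Union) (auto simp: closed_Lipschitz_surface_def compact_imp_closed)
  moreover have "p \<notin> \<Union>(\<S> - {S})" using S(2) pS unfolding disjoint_def by blast
  ultimately have "open (U \<inter> - \<Union>(\<S> - {S}))" "p \<in> U \<inter> - \<Union>(\<S> - {S})" using U by auto
  then obtain r where r: "r > 0" "ball p r \<subseteq> U \<inter> - \<Union>(\<S> - {S})" using open_contains_ball by blast
  have ee: "e \<bullet> e = 1" using U(3) by (simp add: norm_eq_1)
  have L0: "L \<ge> 0" using U(4) by (rule lipschitz_on_nonneg)
  define \<pi> where "\<pi> x = x - (x \<bullet> e) *\<^sub>R e" for x :: 'a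
  define \<eta> where "\<eta> x = x \<bullet> e - g (\<pi> x)" for x :: 'a
  have \<pi>0: "\<pi> x \<bullet> e = 0" for x by (simp add: \<pi>_def inner_diff_left ee)
  \<comment> \<open>The triangle inequality suffices, as only some Lipschitz constant is wanted.\<close>
  have \<pi>L: "norm (\<pi> x - \<pi> y) \<le> 2 * norm (x - y)" for x y
  proof -
    have "\<pi> x - \<pi> y = (x - y) - ((x - y) \<bullet> e) *\<^sub>R e" by (simp add: \<pi>_def algebra_simps)
    also have "norm \<dots> \<le> norm (x - y) + \<bar>(x - y) \<bullet> e\<bar>"
      using norm_triangle_ineq4[of "x - y" "((x - y) \<bullet> e) *\<^sub>R e"] U(3) by simp
    also have "\<bar>(x - y) \<bullet> e\<bar> \<le> norm (x - y)" using Cauchy_Schwarz_ineq2[of "x - y" e] U(3) by simp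
    finally show ?thesis by simp
  qed
  have lip: "\<bar>\<eta> x - \<eta> y\<bar> \<le> (1 + 2 * L) * norm (x - y)" for x y
  proof -
    have "\<bar>g (\<pi> x) - g (\<pi> y)\<bar> \<le> L * norm (\<pi> x - \<pi> y)"
      using lipschitz_onD[OF U(4), of "\<pi> x" "\<pi> y"] \<pi>0 by (simp add: dist_norm)
    also have "\<dots> \<le> L * (2 * norm (x - y))" using \<pi>L L0 by (intro mult_left_mono)
    finally have 1: "\<bar>g (\<pi> x) - g (\<pi> y)\<bar> \<le> L * (2 * norm (x - y))" .
    have 2: "\<bar>x \<bullet> e - y \<bullet> e\<bar> \<le> norm (x - y)"
      using Cauchy_Schwarz_ineq2[of "x - y" e] U(3) by (simp add: inner_diff_left)
    have "\<bar>\<eta> x - \<eta> y\<bar> \<le> \<bar>x \<bullet> e - y \<bullet> e\<bar> + \<bar>g (\<pi> x) - g (\<pi> y)\<bar>"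
      unfolding \<eta>_def by linarith
    then show ?thesis using 1 2 by (simp add: algebra_simps)
  qed
  have shift: "\<eta> (x + t *\<^sub>R e) = \<eta> x + t" for x t
  proof -
    have "\<pi> (x + t *\<^sub>R e) = \<pi> x" by (simp add: \<pi>_def inner_add_left ee algebra_simps)
    then show ?thesis by (simp add: \<eta>_def inner_add_left ee)
  qed
  have zero: "x \<in> frontier \<Omega> \<longleftrightarrow> \<eta> x = 0" if x: "x \<in> ball p r" for x
  proof -
    have "x \<in> U" "x \<notin> \<Union>(\<S> - {S})" using r x by auto
    then have "x \<in> frontier \<Omega> \<longleftrightarrow> x \<in> S \<inter> U" using S(3) pS(2) by auto
    also have "\<dots> \<longleftrightarrow> \<eta> x = 0" using SU \<open>x \<in> U\<close> by (auto simp: \<eta>_def \<pi>_def)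
    finally show ?thesis .
  qed
  have "graph_chart (frontier \<Omega>) p \<eta> e (1 + 2 * L) r"
    unfolding graph_chart_def using L0 r(1) U(3) lip shift zero by auto
  then show ?thesis by blast
qed

lemma graph_chart_minus: "graph_chart \<Gamma> p \<eta> e K r \<Longrightarrow> graph_chart \<Gamma> p (\<lambda>x. - \<eta> x) (- e) K r"
  unfolding graph_chart_def
proof (elim conjE, intro conjI allI)
  fix x t assume "\<forall>x t. \<eta> (x + t *\<^sub>R e) = \<eta> x + t"
  then have "\<eta> (x + (- t) *\<^sub>R e) = \<eta> x + (- t)" by blast
  then show "- \<eta> (x + t *\<^sub>R - e) = - \<eta> x + t" by simp
next
  fix x y assume "\<forall>x y. \<bar>\<eta> x - \<eta> y\<bar> \<le> K * norm (x - y)"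
  then have "\<bar>\<eta> y - \<eta> x\<bar> \<le> K * norm (y - x)" by blast
  then show "\<bar>- \<eta> x - - \<eta> y\<bar> \<le> K * norm (x - y)" by (simp add: norm_minus_commute)
qed auto

lemma graph_chart_continuous:
  assumes "graph_chart \<Gamma> p \<eta> e K r"
  shows "continuous_on UNIV \<eta>"
proof -
  have "K-lipschitz_on UNIV \<eta>"
    using assms unfolding graph_chart_def by (intro lipschitz_onI) (auto simp: dist_norm)
  then show ?thesis by (rule lipschitz_on_continuous_on)
qed

lemma graph_chart_smaller:
  "graph_chart \<Gamma> p \<eta> e K r \<Longrightarrow> 0 < s \<Longrightarrow> s \<le> r \<Longrightarrow> graph_chart \<Gamma> p \<eta> e K s"
  unfolding graph_chart_def by auto

lemma graph_chart_recenter: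
  assumes "graph_chart \<Gamma> p \<eta> e K r" "q \<in> ball p r"
  shows "graph_chart \<Gamma> q \<eta> e K (r - dist p q)"
proof -
  have "ball q (r - dist p q) \<subseteq> ball p r"
  proof
    fix y assume "y \<in> ball q (r - dist p q)"
    then show "y \<in> ball p r" using dist_triangle[of p y q] by simp
  qed
  then show ?thesis using assms unfolding graph_chart_def by auto
qed

text \<open>
  Both points are moved upwards in the direction \<open>e\<close>, to a height where the segment between the
  lifted points lies above the whole graph.  The radius \<open>r / (K + 2)\<close> leaves room in the ball for a
  lift by \<open>(K + 1) r / (K + 2)\<close>.
\<close>

lemma graph_chart_connected_side:
  fixes p :: "'a::euclidean_space"
  assumes ch: "graph_chart \<Gamma> p \<eta> e K r" and p: "\<eta> p = 0"
    and x: "x \<in> ball p (r / (K + 2))" "\<eta> x > 0" and y: "y \<in> ball p (r / (K + 2))" "\<eta> y > 0"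
  obtains C where "connected C" "x \<in> C" "y \<in> C" "C \<subseteq> ball p r" "\<And>z. z \<in> C \<Longrightarrow> \<eta> z > 0"
proof -
  define \<delta> where "\<delta> = r / (K + 2)"
  have K: "K \<ge> 0" and r: "r > 0" and ne: "norm e = 1"
    and lip: "\<And>x y. \<bar>\<eta> x - \<eta> y\<bar> \<le> K * norm (x - y)" and sh: "\<And>x t. \<eta> (x + t *\<^sub>R e) = \<eta> x + t"
    using ch by (auto simp: graph_chart_def)
  have \<delta>: "\<delta> > 0" "(K + 2) * \<delta> = r" using K r by (auto simp: \<delta>_def)
  define s where "s = (K + 1) * \<delta>"
  have s: "s > 0" "s + \<delta> = r"
    using \<delta> K mult_pos_pos[of "K + 1" \<delta>] by (auto simp: s_def algebra_simps)
  have near: "z + t *\<^sub>R e \<in> ball p r" if "z \<in> ball p \<delta>" "0 \<le> t" "t \<le> s" for z t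
  proof -
    have "norm (z + t *\<^sub>R e - p) \<le> norm (z - p) + norm (t *\<^sub>R e)"
      using norm_triangle_ineq[of "z - p" "t *\<^sub>R e"] by (simp add: algebra_simps)
    also have "\<dots> < \<delta> + s" using that ne by (simp add: dist_norm norm_minus_commute)
    finally show ?thesis using s by (simp add: dist_norm norm_minus_commute)
  qed
  have top: "\<eta> (z + s *\<^sub>R e) > 0" if z: "z \<in> ball p \<delta>" for z
  proof -
    have "\<bar>\<eta> z - \<eta> p\<bar> \<le> K * norm (z - p)" by (rule lip)
    also have "\<dots> \<le> K * \<delta>" using z K by (intro mult_left_mono) (auto simp: dist_norm norm_minus_commute)
    finally have "\<eta> z \<ge> - (K * \<delta>)" using p by simp
    then show ?thesis using \<delta>(1) unfolding sh s_def by (simp add: algebra_simps)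
  qed
  have lift: "closed_segment z (z + s *\<^sub>R e) \<subseteq> ball p r \<inter> {w. \<eta> w > 0}" if z: "z \<in> ball p \<delta>" "\<eta> z > 0" for z
  proof
    fix w assume "w \<in> closed_segment z (z + s *\<^sub>R e)"
    then obtain u where u: "0 \<le> u" "u \<le> 1" "w = (1 - u) *\<^sub>R z + u *\<^sub>R (z + s *\<^sub>R e)"
      by (auto simp: closed_segment_def)
    then have w: "w = z + (u * s) *\<^sub>R e" by (simp add: algebra_simps)
    have "0 \<le> u * s" "u * s \<le> s" using u s by (auto simp: mult_left_le_one_le)
    then show "w \<in> ball p r \<inter> {w. \<eta> w > 0}" using near[OF z(1)] z(2) unfolding w by (auto simp: sh)
  qed
  have across: "closed_segment (x + s *\<^sub>R e) (y + s *\<^sub>R e) \<subseteq> ball p r \<inter> {w. \<eta> w > 0}"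
  proof
    fix w assume "w \<in> closed_segment (x + s *\<^sub>R e) (y + s *\<^sub>R e)"
    then obtain u where u: "0 \<le> u" "u \<le> 1" "w = (1 - u) *\<^sub>R (x + s *\<^sub>R e) + u *\<^sub>R (y + s *\<^sub>R e)"
      by (auto simp: closed_segment_def)
    define z where "z = (1 - u) *\<^sub>R x + u *\<^sub>R y"
    have w: "w = z + s *\<^sub>R e" using u(3) by (simp add: z_def algebra_simps)
    have "z \<in> closed_segment x y" using u unfolding z_def closed_segment_def by blast
    then have "z \<in> ball p \<delta>"
      using closed_segment_subset[OF _ _ convex_ball] x(1) y(1) unfolding \<delta>_def by blast
    then show "w \<in> ball p r \<inter> {w. \<eta> w > 0}" using near[of z s] top[of z] s(1) unfolding w by auto
  qed
  let ?C = "closed_segment x (x + s *\<^sub>R e) \<union> closed_segment (x + s *\<^sub>R e) (y + s *\<^sub>R e) \<union> closed_segment y (y + s *\<^sub>R e)"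
  have conn: "connected ?C"
    by (intro connected_Un connected_segment) auto
  have sub: "?C \<subseteq> ball p r \<inter> {w. \<eta> w > 0}"
    using lift[of x] lift[of y] across x y unfolding \<delta>_def by blast
  show ?thesis
  proof (rule that[OF conn])
    show "x \<in> ?C" "y \<in> ?C" by simp_all
    show "?C \<subseteq> ball p r" using sub by blast
    show "\<eta> z > 0" if "z \<in> ?C" for z using sub that by blast
  qed
qed

lemma sgn_constant_on_connected:
  fixes h :: "'a::topological_space \<Rightarrow> real"
  assumes "connected C" "continuous_on C h" "\<And>z. z \<in> C \<Longrightarrow> h z \<noteq> 0" "x \<in> C" "y \<in> C"
  shows "sgn (h x) = sgn (h y)"
proof -
  have conn: "connected (h ` C)" using assms by (intro connected_continuous_image)
  have no: "0 \<notin> h ` C" using assms(3) by auto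
  have "\<not> (h a < 0 \<and> 0 < h b)" if "a \<in> C" "b \<in> C" for a b
    using connectedD_interval[OF conn imageI[OF that(1)] imageI[OF that(2)], of 0] no by auto
  then have "\<not> (h x < 0 \<and> 0 < h y)" "\<not> (h y < 0 \<and> 0 < h x)" using assms(4,5) by blast+
  moreover have "h x \<noteq> 0" "h y \<noteq> 0" using assms by auto
  ultimately show ?thesis by (auto simp: sgn_if)
qed

locale graph_boundary =
  fixes \<Gamma> :: "'a::euclidean_space set"
  assumes closed_\<Gamma>: "closed \<Gamma>" and charts: "\<And>p. p \<in> \<Gamma> \<Longrightarrow> \<exists>\<eta> e K r. graph_chart \<Gamma> p \<eta> e K r"
begin

text \<open>
  The sign of \<open>f\<close> near \<open>q\<close> tells the two sides of \<open>\<Gamma>\<close> apart; away from \<open>\<Gamma>\<close> there is only one side.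
\<close>

definition sign_germ :: "'a \<Rightarrow> ('a \<Rightarrow> real) \<Rightarrow> bool" where
  "sign_germ q f \<longleftrightarrow> continuous_on UNIV f \<and> (if q \<in> \<Gamma> then \<exists>e K r. graph_chart \<Gamma> q f e K r else f q \<noteq> 0)"

lemma sign_germ_exists: "\<exists>f. sign_germ q f"
proof (cases "q \<in> \<Gamma>")
  case True
  then show ?thesis using charts[OF True] graph_chart_continuous unfolding sign_germ_def by metis
next
  case False
  then show ?thesis by (intro exI[of _ "\<lambda>_. 1"]) (simp add: sign_germ_def)
qed

lemma nonzero_near:
  fixes f :: "'a \<Rightarrow> real"
  assumes "continuous_on UNIV f" "f q \<noteq> 0"
  shows "\<forall>\<^sub>F x in nhds q. sgn (f x) = sgn (f q)"
proof -
  have t: "filterlim f (nhds (f q)) (nhds q)"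
    using assms(1) by (simp add: continuous_on_eq_continuous_at continuous_at tendsto_at_iff_tendsto_nhds)
  consider "f q > 0" | "f q < 0" using assms(2) by linarith
  then show ?thesis
  proof cases
    case 1
    then have "\<forall>\<^sub>F x in nhds q. f x > 0" using t by (rule order_tendstoD(1)[rotated])
    then show ?thesis by eventually_elim (use 1 in simp)
  next
    case 2
    then have "\<forall>\<^sub>F x in nhds q. f x < 0" using t by (rule order_tendstoD(2)[rotated])
    then show ?thesis by eventually_elim (use 2 in simp)
  qed
qed

lemma sign_germ_nearby:
  assumes "sign_germ p f"
  shows "\<exists>r>0. \<forall>q\<in>ball p r. sign_germ q f"
proof (cases "p \<in> \<Gamma>")
  case True
  then obtain e K r where c: "graph_chart \<Gamma> p f e K r" using assms by (auto simp: sign_germ_def)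
  have "sign_germ q f" if q: "q \<in> ball p r" for q
  proof -
    have "q \<in> \<Gamma> \<longleftrightarrow> f q = 0" using c q by (simp add: graph_chart_def)
    then show ?thesis
      using graph_chart_recenter[OF c q] graph_chart_continuous[OF c] unfolding sign_germ_def by auto
  qed
  then show ?thesis using c by (auto simp: graph_chart_def)
next
  case False
  then have f: "continuous_on UNIV f" "f p \<noteq> 0" using assms by (auto simp: sign_germ_def)
  have "\<forall>\<^sub>F x in nhds p. x \<notin> \<Gamma>" using closed_\<Gamma> False by (intro eventually_nhds_in_open[of "-\<Gamma>", simplified]) auto
  then have "\<forall>\<^sub>F x in nhds p. sign_germ x f"
    using nonzero_near[OF f]
  proof eventually_elim
    case (elim x)
    then have "f x \<noteq> 0" using f(2) by (metis sgn_0 sgn_0_0)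
    then show ?case using elim f(1) by (simp add: sign_germ_def)
  qed
  then show ?thesis by (auto simp: eventually_nhds_metric dist_commute)
qed

text \<open>
  Near a point of \<open>\<Gamma>\<close>, each side of the graph of \<open>f\<close> is connected within the complement of \<open>\<Gamma>\<close>, so
  \<open>g\<close> has a constant sign on it.  The two constants are opposite, because \<open>g\<close> takes both signs.
\<close>

lemma sign_germ_compatible:
  assumes f: "sign_germ q f" and g: "sign_germ q g"
  shows "\<exists>c\<in>{1, -1}. \<forall>\<^sub>F x in nhds q. x \<notin> \<Gamma> \<longrightarrow> sgn (g x) = c * sgn (f x)"
proof (cases "q \<in> \<Gamma>")
  case False
  then have c: "continuous_on UNIV f" "f q \<noteq> 0" "continuous_on UNIV g" "g q \<noteq> 0"
    using f g by (auto simp: sign_germ_def)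
  have "\<forall>\<^sub>F x in nhds q. x \<notin> \<Gamma> \<longrightarrow> sgn (g x) = (sgn (f q) * sgn (g q)) * sgn (f x)"
    using nonzero_near[OF c(1,2)] nonzero_near[OF c(3,4)]
    by eventually_elim (use c in \<open>auto simp: sgn_if\<close>)
  moreover have "sgn (f q) * sgn (g q) \<in> {1, -1}" using c by (auto simp: sgn_if)
  ultimately show ?thesis by blast
next
  case True
  obtain e K r where cf0: "graph_chart \<Gamma> q f e K r" using f True by (auto simp: sign_germ_def)
  obtain e' K' r' where cg0: "graph_chart \<Gamma> q g e' K' r'" using g True by (auto simp: sign_germ_def)
  define \<rho> where "\<rho> = min r r'"
  have \<rho>: "\<rho> > 0" using cf0 cg0 by (auto simp: \<rho>_def graph_chart_def)
  have cf: "graph_chart \<Gamma> q f e K \<rho>" and cg: "graph_chart \<Gamma> q g e' K' \<rho>"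
    using graph_chart_smaller[OF cf0 \<rho>] graph_chart_smaller[OF cg0 \<rho>] by (auto simp: \<rho>_def)
  have q0: "f q = 0" "g q = 0" using cf cg True \<rho> by (auto simp: graph_chart_def)
  have K: "K \<ge> 0" using cf by (simp add: graph_chart_def)
  define \<delta> where "\<delta> = \<rho> / (K + 2)"
  have \<delta>: "\<delta> > 0" "\<delta> \<le> \<rho>" using \<rho> K by (auto simp: \<delta>_def field_simps)
  have zf: "x \<in> \<Gamma> \<longleftrightarrow> f x = 0" and zg: "x \<in> \<Gamma> \<longleftrightarrow> g x = 0" if "x \<in> ball q \<rho>" for x
    using cf cg that by (auto simp: graph_chart_def)
  have gc: "continuous_on C g" for C using graph_chart_continuous[OF cg] continuous_on_subset by blast
  have pos: "sgn (g x) = sgn (g y)" if xy: "x \<in> ball q \<delta>" "y \<in> ball q \<delta>" "f x > 0" "f y > 0" for x y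
  proof -
    obtain C where C: "connected C" "x \<in> C" "y \<in> C" "C \<subseteq> ball q \<rho>" "\<And>z. z \<in> C \<Longrightarrow> f z > 0"
      using graph_chart_connected_side[OF cf q0(1) xy(1)[unfolded \<delta>_def] xy(3) xy(2)[unfolded \<delta>_def] xy(4)]
      by blast
    show ?thesis
      by (rule sgn_constant_on_connected[OF C(1) gc _ C(2,3)]) (use C(4,5) zf zg in force)
  qed
  have neg: "sgn (g x) = sgn (g y)" if xy: "x \<in> ball q \<delta>" "y \<in> ball q \<delta>" "f x < 0" "f y < 0" for x y
  proof -
    have m: "- f q = 0" "- f x > 0" "- f y > 0" using q0 xy by auto
    obtain C where C: "connected C" "x \<in> C" "y \<in> C" "C \<subseteq> ball q \<rho>" "\<And>z. z \<in> C \<Longrightarrow> - f z > 0"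
      using graph_chart_connected_side[OF graph_chart_minus[OF cf] m(1) xy(1)[unfolded \<delta>_def] m(2)
          xy(2)[unfolded \<delta>_def] m(3)] by blast
    show ?thesis
      by (rule sgn_constant_on_connected[OF C(1) gc _ C(2,3)]) (use C(4,5) zf zg in force)
  qed
  \<comment> \<open>Points on the two sides of the graph of \<open>g\<close>.\<close>
  define xp where "xp = q + (\<delta>/2) *\<^sub>R e'"
  define xm where "xm = q + (-\<delta>/2) *\<^sub>R e'"
  have ne: "norm e' = 1" using cg by (simp add: graph_chart_def)
  have inb: "xp \<in> ball q \<delta>" "xm \<in> ball q \<delta>" using \<delta> ne by (auto simp: xp_def xm_def dist_norm)
  then have inb': "xp \<in> ball q \<rho>" "xm \<in> ball q \<rho>" using \<delta>(2) by auto
  have gv: "g xp > 0" "g xm < 0"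
  proof -
    have sh: "\<And>x t. g (x + t *\<^sub>R e') = g x + t" using cg by (simp add: graph_chart_def)
    show "g xp > 0" "g xm < 0" unfolding xp_def xm_def sh using q0 \<delta> by auto
  qed
  have fv: "f xp \<noteq> 0" "f xm \<noteq> 0" using zf zg inb' gv by force+
  have "\<not> (f xp > 0 \<and> f xm > 0)" "\<not> (f xp < 0 \<and> f xm < 0)"
    using pos[OF inb] neg[OF inb] gv by auto
  then have opp: "(f xp > 0 \<and> f xm < 0) \<or> (f xp < 0 \<and> f xm > 0)" using fv by linarith
  have main: "sgn (g x) = sgn (f xp) * sgn (f x)" if x: "x \<in> ball q \<delta>" "x \<notin> \<Gamma>" for x
  proof -
    have "x \<in> ball q \<rho>" using x(1) \<delta>(2) by auto
    then have fx: "f x > 0 \<or> f x < 0" using zf x(2) by force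
    from opp show ?thesis
    proof
      assume o: "f xp > 0 \<and> f xm < 0"
      show ?thesis
        using fx o gv pos[OF x(1) inb(1)] neg[OF x(1) inb(2)] by auto
    next
      assume o: "f xp < 0 \<and> f xm > 0"
      show ?thesis
        using fx o gv pos[OF x(1) inb(2)] neg[OF x(1) inb(1)] by auto
    qed
  qed
  have "\<forall>\<^sub>F x in nhds q. x \<in> ball q \<delta>" using \<delta> by (intro eventually_nhds_in_open) auto
  then have "\<forall>\<^sub>F x in nhds q. x \<notin> \<Gamma> \<longrightarrow> sgn (g x) = sgn (f xp) * sgn (f x)"
    by eventually_elim (use main in blast)
  moreover have "sgn (f xp) \<in> {1, -1}" using fv by (auto simp: sgn_if)
  ultimately show ?thesis by blast
qed

definition local_sign :: "'a \<Rightarrow> 'a \<Rightarrow> real" where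
  "local_sign q x = sgn ((SOME f. sign_germ q f) x)"

lemma local_signE:
  obtains f where "sign_germ q f" "\<And>x. local_sign q x = sgn (f x)"
  using that[of "SOME f. sign_germ q f"] someI_ex[OF sign_germ_exists[of q]] by (simp add: local_sign_def)

text \<open>
  The complement of \<open>\<Gamma>\<close> accumulates at every point, so a local sign is never vacuous.
\<close>

lemma off_\<Gamma>_nearby: "\<not> (\<forall>\<^sub>F x in nhds q. x \<notin> \<Gamma> \<longrightarrow> local_sign q x = 0)"
proof
  assume ev: "\<forall>\<^sub>F x in nhds q. x \<notin> \<Gamma> \<longrightarrow> local_sign q x = 0"
  obtain f where f: "sign_germ q f" "\<And>x. local_sign q x = sgn (f x)" using local_signE[of q] by blast
  show False
  proof (cases "q \<in> \<Gamma>")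
    case False
    then show False using eventually_nhds_x_imp_x[OF ev] f by (auto simp: sign_germ_def sgn_if split: if_splits)
  next
    case True
    then obtain e K r where c: "graph_chart \<Gamma> q f e K r" using f by (auto simp: sign_germ_def)
    obtain d where d: "d > 0" "\<And>x. dist x q < d \<Longrightarrow> x \<notin> \<Gamma> \<longrightarrow> local_sign q x = 0"
      using ev by (auto simp: eventually_nhds_metric)
    define t where "t = min d r / 2"
    have t: "t > 0" "t < d" "t < r" using d c by (auto simp: t_def graph_chart_def)
    let ?x = "q + t *\<^sub>R e"
    have x: "dist ?x q = t" using c t by (simp add: dist_norm graph_chart_def)
    have "f q = 0" using c True by (auto simp: graph_chart_def)
    then have fx: "f ?x = t" using c by (simp add: graph_chart_def)
    then have "?x \<notin> \<Gamma>" using c x t by (auto simp: graph_chart_def dist_commute)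
    then show False using d(2)[of ?x] x t f(2)[of ?x] fx by (simp add: sgn_if)
  qed
qed

text \<open>
  At each point there are two ways, exchanged by a factor \<open>-1\<close>, to name the local sides of \<open>\<Gamma>\<close>;
  they form a two-sheeted covering of the space.  A coherent \<open>\<epsilon>\<close> is a continuous section over \<open>A\<close>.
\<close>

definition coherent :: "'a set \<Rightarrow> ('a \<Rightarrow> real) \<Rightarrow> bool" where
  "coherent A \<epsilon> \<longleftrightarrow> (\<forall>q. \<epsilon> q \<in> {1, -1}) \<and> (\<forall>p\<in>A. \<exists>\<delta>>0. \<forall>q\<in>A \<inter> ball p \<delta>.
      \<forall>\<^sub>F x in nhds q. x \<notin> \<Gamma> \<longrightarrow> \<epsilon> q * local_sign q x = \<epsilon> p * local_sign p x)"

lemma coherent_mono: "coherent B \<epsilon> \<Longrightarrow> A \<subseteq> B \<Longrightarrow> coherent A \<epsilon>"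
proof -
  assume B: "coherent B \<epsilon>" and AB: "A \<subseteq> B"
  have "\<exists>\<delta>>0. \<forall>q\<in>A \<inter> ball p \<delta>. \<forall>\<^sub>F x in nhds q. x \<notin> \<Gamma> \<longrightarrow> \<epsilon> q * local_sign q x = \<epsilon> p * local_sign p x"
    if "p \<in> A" for p
  proof -
    have "p \<in> B" using that AB by blast
    then obtain d where "d > 0" "\<forall>q\<in>B \<inter> ball p d. \<forall>\<^sub>F x in nhds q. x \<notin> \<Gamma> \<longrightarrow> \<epsilon> q * local_sign q x = \<epsilon> p * local_sign p x"
      using B unfolding coherent_def by blast
    then show ?thesis using AB by (intro exI[of _ d]) auto
  qed
  then show ?thesis using B unfolding coherent_def by blast
qed

text \<open>
  A single sign germ at \<open>p\<close> serves all nearby points, and each local sign there agrees with it up to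
  a factor.
\<close>

lemma coherent_local: "\<exists>\<delta>>0. \<exists>\<epsilon>. coherent (ball p \<delta>) \<epsilon>"
proof -
  obtain f where f: "sign_germ p f" using local_signE[of p] by blast
  obtain r where r: "r > 0" "\<And>q. q \<in> ball p r \<Longrightarrow> sign_germ q f" using sign_germ_nearby[OF f] by blast
  have "\<exists>c\<in>{1, -1}. q \<in> ball p r \<longrightarrow> (\<forall>\<^sub>F x in nhds q. x \<notin> \<Gamma> \<longrightarrow> sgn (f x) = c * local_sign q x)" for q
  proof (cases "q \<in> ball p r")
    case True
    obtain g where g: "sign_germ q g" "\<And>x. local_sign q x = sgn (g x)" using local_signE[of q] by blast
    show ?thesis using sign_germ_compatible[OF g(1) r(2)[OF True]] by (simp add: g(2))
  qed auto
  then obtain \<epsilon> where \<epsilon>: "\<And>q. \<epsilon> q \<in> {1, -1}"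
    and near: "\<And>q. q \<in> ball p r \<Longrightarrow> \<forall>\<^sub>F x in nhds q. x \<notin> \<Gamma> \<longrightarrow> sgn (f x) = \<epsilon> q * local_sign q x" by metis
  have "coherent (ball p r) \<epsilon>"
    unfolding coherent_def
  proof (intro conjI allI ballI)
    fix p' assume p': "p' \<in> ball p r"
    obtain d where d: "d > 0" "\<And>x. dist x p' < d \<Longrightarrow> x \<notin> \<Gamma> \<longrightarrow> sgn (f x) = \<epsilon> p' * local_sign p' x"
      using near[OF p'] by (auto simp: eventually_nhds_metric)
    show "\<exists>\<delta>>0. \<forall>q\<in>ball p r \<inter> ball p' \<delta>. \<forall>\<^sub>F x in nhds q. x \<notin> \<Gamma> \<longrightarrow> \<epsilon> q * local_sign q x = \<epsilon> p' * local_sign p' x"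
    proof (intro exI[of _ d] conjI ballI d(1))
      fix q assume q: "q \<in> ball p r \<inter> ball p' d"
      have "\<forall>\<^sub>F x in nhds q. x \<in> ball p' d" using q by (intro eventually_nhds_in_open) auto
      moreover have "\<forall>\<^sub>F x in nhds q. x \<notin> \<Gamma> \<longrightarrow> sgn (f x) = \<epsilon> q * local_sign q x" using q near by blast
      ultimately show "\<forall>\<^sub>F x in nhds q. x \<notin> \<Gamma> \<longrightarrow> \<epsilon> q * local_sign q x = \<epsilon> p' * local_sign p' x"
        by eventually_elim (use d(2) in \<open>auto simp: dist_commute\<close>)
    qed
  qed (rule \<epsilon>)
  then show ?thesis using r(1) by blast
qed

text \<open>
  On the intersection the two sections differ by a locally constant factor, which is constant by
  connectedness; one section is multiplied by it and then extends the other.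
\<close>

lemma coherent_Un:
  assumes A: "closed A" "coherent A \<epsilon>" and B: "closed B" "coherent B \<zeta>" and conn: "connected (A \<inter> B)"
  shows "\<exists>\<xi>. coherent (A \<union> B) \<xi>"
proof -
  have \<epsilon>: "\<epsilon> q \<in> {1, -1}" and \<zeta>: "\<zeta> q \<in> {1, -1}" for q using A B by (auto simp: coherent_def)
  \<comment> \<open>Signs are their own inverses, so this is the quotient of the two sections.\<close>
  define \<kappa> where "\<kappa> q = \<epsilon> q * \<zeta> q" for q
  have lc: "\<exists>\<delta>>0. \<forall>q\<in>A \<inter> B \<inter> ball p \<delta>. \<kappa> p = \<kappa> q" if p: "p \<in> A \<inter> B" for p
  proof -
    obtain d1 where d1: "d1 > 0" "\<And>q. q \<in> A \<inter> ball p d1 \<Longrightarrow> \<forall>\<^sub>F x in nhds q. x \<notin> \<Gamma> \<longrightarrow> \<epsilon> q * local_sign q x = \<epsilon> p * local_sign p x"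
      using A(2) p unfolding coherent_def by blast
    obtain d2 where d2: "d2 > 0" "\<And>q. q \<in> B \<inter> ball p d2 \<Longrightarrow> \<forall>\<^sub>F x in nhds q. x \<notin> \<Gamma> \<longrightarrow> \<zeta> q * local_sign q x = \<zeta> p * local_sign p x"
      using B(2) p unfolding coherent_def by blast
    have "\<kappa> p = \<kappa> q" if q: "q \<in> A \<inter> B \<inter> ball p (min d1 d2)" for q
    proof (rule ccontr)
      assume ne: "\<kappa> p \<noteq> \<kappa> q"
      have 1: "\<forall>\<^sub>F x in nhds q. x \<notin> \<Gamma> \<longrightarrow> \<epsilon> q * local_sign q x = \<epsilon> p * local_sign p x" using q by (intro d1) auto
      have 2: "\<forall>\<^sub>F x in nhds q. x \<notin> \<Gamma> \<longrightarrow> \<zeta> q * local_sign q x = \<zeta> p * local_sign p x" using q by (intro d2) auto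
      have "\<forall>\<^sub>F x in nhds q. x \<notin> \<Gamma> \<longrightarrow> local_sign q x = 0"
        using 1 2
      proof eventually_elim
        case (elim x)
        show ?case
          using elim ne \<epsilon>[of p] \<epsilon>[of q] \<zeta>[of p] \<zeta>[of q] by (auto simp: \<kappa>_def)
      qed
      then show False using off_\<Gamma>_nearby by blast
    qed
    then show ?thesis using d1 d2 by (intro exI[of _ "min d1 d2"]) auto
  qed
  have const: "\<kappa> p = \<kappa> q" if "p \<in> A \<inter> B" "q \<in> A \<inter> B" for p q
  proof (rule connected_local_const[OF conn that], rule ballI)
    fix a assume "a \<in> A \<inter> B"
    from lc[OF this] obtain d where "d > 0" "\<forall>q\<in>A \<inter> B \<inter> ball a d. \<kappa> a = \<kappa> q" by blast
    then show "\<forall>\<^sub>F b in at a within A \<inter> B. \<kappa> a = \<kappa> b"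
      by (auto simp: eventually_at dist_commute intro!: exI[of _ d])
  qed
  obtain c where c: "c \<in> {1, -1}" "\<And>p. p \<in> A \<inter> B \<Longrightarrow> \<kappa> p = c"
  proof (cases "A \<inter> B = {}")
    case True
    then show ?thesis using that[of 1] by auto
  next
    case False
    then obtain p where p: "p \<in> A \<inter> B" by blast
    show ?thesis
    proof (rule that)
      show "\<kappa> p \<in> {1, -1}" using \<epsilon>[of p] \<zeta>[of p] by (auto simp: \<kappa>_def)
      show "\<kappa> p' = \<kappa> p" if "p' \<in> A \<inter> B" for p' using that p by (rule const)
    qed
  qed
  have ce: "c * \<zeta> p = \<epsilon> p" if "p \<in> A \<inter> B" for p
    using c(2)[OF that] \<epsilon>[of p] \<zeta>[of p] by (auto simp: \<kappa>_def)
  define \<xi> where "\<xi> q = (if q \<in> A then \<epsilon> q else c * \<zeta> q)" for q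
  have \<xi>B: "\<xi> q = c * \<zeta> q" if "q \<in> B" for q using ce[of q] that by (auto simp: \<xi>_def)
  have "coherent (A \<union> B) \<xi>"
    unfolding coherent_def
  proof (intro conjI allI ballI)
    show "\<xi> q \<in> {1, -1}" for q using \<epsilon>[of q] \<zeta>[of q] c(1) by (auto simp: \<xi>_def)
    fix p assume p: "p \<in> A \<union> B"
    have "\<exists>\<delta>>0. \<forall>q\<in>A \<inter> ball p \<delta>. \<forall>\<^sub>F x in nhds q. x \<notin> \<Gamma> \<longrightarrow> \<xi> q * local_sign q x = \<xi> p * local_sign p x"
    proof (cases "p \<in> A")
      case True
      then show ?thesis using A(2) unfolding coherent_def by (auto simp: \<xi>_def)
    next
      case False
      then obtain d where "d > 0" "ball p d \<subseteq> - A" using A(1) by (metis ComplI open_Compl open_contains_ball)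
      then show ?thesis by (intro exI[of _ d]) auto
    qed
    then obtain d1 where d1: "d1 > 0" "\<And>q. q \<in> A \<inter> ball p d1 \<Longrightarrow> \<forall>\<^sub>F x in nhds q. x \<notin> \<Gamma> \<longrightarrow> \<xi> q * local_sign q x = \<xi> p * local_sign p x"
      by blast
    have "\<exists>\<delta>>0. \<forall>q\<in>B \<inter> ball p \<delta>. \<forall>\<^sub>F x in nhds q. x \<notin> \<Gamma> \<longrightarrow> \<xi> q * local_sign q x = \<xi> p * local_sign p x"
    proof (cases "p \<in> B")
      case True
      then obtain d where d: "d > 0" "\<And>q. q \<in> B \<inter> ball p d \<Longrightarrow> \<forall>\<^sub>F x in nhds q. x \<notin> \<Gamma> \<longrightarrow> \<zeta> q * local_sign q x = \<zeta> p * local_sign p x"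
        using B(2) unfolding coherent_def by blast
      show ?thesis
      proof (intro exI[of _ d] conjI ballI d(1))
        fix q assume q: "q \<in> B \<inter> ball p d"
        show "\<forall>\<^sub>F x in nhds q. x \<notin> \<Gamma> \<longrightarrow> \<xi> q * local_sign q x = \<xi> p * local_sign p x"
          using d(2)[OF q] by eventually_elim (use q True in \<open>simp add: \<xi>B mult.assoc\<close>)
      qed
    next
      case False
      then obtain d where "d > 0" "ball p d \<subseteq> - B" using B(1) by (metis ComplI open_Compl open_contains_ball)
      then show ?thesis by (intro exI[of _ d]) auto
    qed
    then obtain d2 where d2: "d2 > 0" "\<And>q. q \<in> B \<inter> ball p d2 \<Longrightarrow> \<forall>\<^sub>F x in nhds q. x \<notin> \<Gamma> \<longrightarrow> \<xi> q * local_sign q x = \<xi> p * local_sign p x"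
      by blast
    show "\<exists>\<delta>>0. \<forall>q\<in>(A \<union> B) \<inter> ball p \<delta>. \<forall>\<^sub>F x in nhds q. x \<notin> \<Gamma> \<longrightarrow> \<xi> q * local_sign q x = \<xi> p * local_sign p x"
      using d1 d2 by (intro exI[of _ "min d1 d2"]) auto
  qed
  then show ?thesis by blast
qed

text \<open>
  A covering of a cube is trivial.  Without homotopies: the section is extended along one coordinate
  direction after the other, by bisection of the interval \<open>[-R, R]\<close>.  In each step the pieces are
  closed boxes whose intersection is convex, hence connected.
\<close>

lemma coherent_slab:
  assumes R: "R \<ge> 0" and "finite J" "J \<subseteq> Basis"
  shows "\<exists>\<delta>>0. \<exists>\<epsilon>. coherent {x. (\<forall>j\<in>J. \<bar>x \<bullet> j\<bar> \<le> R) \<and> (\<forall>j\<in>Basis - J. \<bar>x \<bullet> j - p \<bullet> j\<bar> \<le> \<delta>)} \<epsilon>"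
  using assms(2,3)
proof (induction J arbitrary: p rule: finite_induct)
  case empty
  obtain d \<epsilon> where d: "d > 0" "coherent (ball p d) \<epsilon>" using coherent_local by blast
  define \<delta> where "\<delta> = d / (2 * real DIM('a))"
  have \<delta>: "\<delta> > 0" using d by (simp add: \<delta>_def)
  have "{x. \<forall>j\<in>Basis. \<bar>x \<bullet> j - p \<bullet> j\<bar> \<le> \<delta>} \<subseteq> ball p d"
  proof
    fix x assume x: "x \<in> {x. \<forall>j\<in>Basis. \<bar>x \<bullet> j - p \<bullet> j\<bar> \<le> \<delta>}"
    have "norm (x - p) \<le> (\<Sum>j\<in>Basis. \<bar>(x - p) \<bullet> j\<bar>)" by (rule norm_le_l1)
    also have "\<dots> \<le> (\<Sum>j\<in>(Basis::'a set). \<delta>)" using x by (intro sum_mono) (auto simp: inner_diff_left)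
    also have "\<dots> = d / 2" by (simp add: \<delta>_def)
    finally show "x \<in> ball p d" using d by (simp add: dist_norm norm_minus_commute)
  qed
  then have "coherent {x. \<forall>j\<in>Basis. \<bar>x \<bullet> j - p \<bullet> j\<bar> \<le> \<delta>} \<epsilon>" using d(2) coherent_mono by blast
  then show ?case using \<delta> by auto
next
  case (insert i J)
  \<comment> \<open>The slab for the directions \<open>J\<close>, with the coordinate in direction \<open>i\<close> restricted to \<open>[a, b]\<close>.\<close>
  define W where "W a b \<delta> = {x::'a. (\<forall>j\<in>J. \<bar>x \<bullet> j\<bar> \<le> R) \<and> a \<le> x \<bullet> i \<and> x \<bullet> i \<le> b \<and> (\<forall>j\<in>Basis - insert i J. \<bar>x \<bullet> j - p \<bullet> j\<bar> \<le> \<delta>)}" for a b \<delta>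
  have Wbox: "closed (W a b \<delta>) \<and> convex (W a b \<delta>)" for a b \<delta>
  proof -
    have abs: "\<bar>x \<bullet> j - p \<bullet> j\<bar> \<le> \<delta> \<longleftrightarrow> x \<bullet> j \<le> p \<bullet> j + \<delta> \<and> p \<bullet> j - \<delta> \<le> x \<bullet> j" for x j by linarith
    have abs': "\<bar>x \<bullet> j\<bar> \<le> R \<longleftrightarrow> x \<bullet> j \<le> R \<and> - R \<le> x \<bullet> j" for x j :: 'a by linarith
    have W: "W a b \<delta> = (\<Inter>j\<in>J. {x. x \<bullet> j \<le> R} \<inter> {x. - R \<le> x \<bullet> j}) \<inter> ({x. a \<le> x \<bullet> i} \<inter> {x. x \<bullet> i \<le> b})
       \<inter> (\<Inter>j\<in>Basis - insert i J. {x. x \<bullet> j \<le> p \<bullet> j + \<delta>} \<inter> {x. p \<bullet> j - \<delta> \<le> x \<bullet> j})"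
      unfolding W_def abs abs' by blast
    have cl: "closed {x::'a. x \<bullet> j \<le> c}" "closed {x::'a. c \<le> x \<bullet> j}" for j c
      by (auto intro!: closed_Collect_le continuous_intros)
    have cv: "convex {x::'a. x \<bullet> j \<le> c}" "convex {x::'a. c \<le> x \<bullet> j}" for j c
      using convex_halfspace_le[of j c] convex_halfspace_ge[of c j] by (simp_all add: inner_commute)
    show ?thesis unfolding W by (intro conjI closed_Int closed_INT convex_Int convex_INT ballI cl cv)
  qed
  \<comment> \<open>Bolzano bisection: short intervals around each \<open>c\<close> by the induction hypothesis, and adjacent intervals can be joined.\<close>
  have "\<exists>\<delta>>0. \<exists>\<epsilon>. coherent (W (-R) R \<delta>) \<epsilon>"
  proof (rule Bolzano[where P="\<lambda>a b. \<exists>\<delta>>0. \<exists>\<epsilon>. coherent (W a b \<delta>) \<epsilon>" and a="-R" and b=R])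
    fix a b c
    assume trans: "\<exists>\<delta>>0. \<exists>\<epsilon>. coherent (W a b \<delta>) \<epsilon>" "\<exists>\<delta>>0. \<exists>\<epsilon>. coherent (W b c \<delta>) \<epsilon>" "a \<le> b" "b \<le> c"
    then obtain d1 d2 \<epsilon> \<zeta> where d: "d1 > 0" "coherent (W a b d1) \<epsilon>" "d2 > 0" "coherent (W b c d2) \<zeta>" by blast
    define d where "d = min d1 d2"
    have 1: "coherent (W a b d) \<epsilon>" by (rule coherent_mono[OF d(2)]) (auto simp: W_def d_def)
    have 2: "coherent (W b c d) \<zeta>" by (rule coherent_mono[OF d(4)]) (auto simp: W_def d_def)
    have "connected (W a b d \<inter> W b c d)" using Wbox by (intro convex_connected convex_Int) auto
    then have "\<exists>\<xi>. coherent (W a b d \<union> W b c d) \<xi>" using coherent_Un[OF _ 1 _ 2] Wbox by blast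
    moreover have "W a b d \<union> W b c d = W a c d" using trans by (auto simp: W_def)
    ultimately show "\<exists>\<delta>>0. \<exists>\<epsilon>. coherent (W a c \<delta>) \<epsilon>" using d by (intro exI[of _ d]) (auto simp: d_def)
  next
    fix c
    define pc where "pc = p + (c - p \<bullet> i) *\<^sub>R i"
    have i: "i \<in> Basis" using insert by auto
    have pc: "pc \<bullet> i = c" "\<And>j. j \<in> Basis \<Longrightarrow> j \<noteq> i \<Longrightarrow> pc \<bullet> j = p \<bullet> j"
      using i by (auto simp: pc_def inner_add_left inner_Basis)
    obtain d \<epsilon> where d: "d > 0" "coherent {x. (\<forall>j\<in>J. \<bar>x \<bullet> j\<bar> \<le> R) \<and> (\<forall>j\<in>Basis - J. \<bar>x \<bullet> j - pc \<bullet> j\<bar> \<le> d)} \<epsilon>"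
      using insert.IH[of pc] insert.prems by blast
    have "coherent (W a b d) \<epsilon>" if ab: "a \<le> c \<and> c \<le> b \<and> b - a < d" for a b
    proof (rule coherent_mono[OF d(2)], safe)
      fix x j :: 'a assume x: "x \<in> W a b d" "j \<in> Basis"
      assume "j \<notin> J"
      show "\<bar>x \<bullet> j - pc \<bullet> j\<bar> \<le> d"
      proof (cases "j = i")
        case True
        then show ?thesis using x ab pc(1) by (auto simp: W_def)
      next
        case False
        then show ?thesis using x \<open>j \<notin> J\<close> pc(2)[of j] by (auto simp: W_def)
      qed
    qed (auto simp: W_def)
    then show "\<exists>d>0. \<forall>a b. a \<le> c \<and> c \<le> b \<and> b - a < d \<longrightarrow> (\<exists>\<delta>>0. \<exists>\<epsilon>. coherent (W a b \<delta>) \<epsilon>)"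
      using d(1) by blast
  qed (use R in simp)
  then obtain d \<epsilon> where d: "d > 0" "coherent (W (-R) R d) \<epsilon>" by blast
  have "W (-R) R d = {x. (\<forall>j\<in>insert i J. \<bar>x \<bullet> j\<bar> \<le> R) \<and> (\<forall>j\<in>Basis - insert i J. \<bar>x \<bullet> j - p \<bullet> j\<bar> \<le> d)}"
    unfolding W_def by auto
  then show ?case using d by auto
qed

lemma coherent_bounded:
  assumes "bounded S"
  shows "\<exists>A \<epsilon>. open A \<and> S \<subseteq> A \<and> coherent A \<epsilon>"
proof -
  obtain R where R: "R > 0" "\<And>x. x \<in> S \<Longrightarrow> norm x \<le> R" using assms bounded_pos by blast
  obtain \<epsilon> where "coherent {x. \<forall>j\<in>Basis. \<bar>x \<bullet> j\<bar> \<le> R + 1} \<epsilon>"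
    using coherent_slab[of "R + 1" Basis 0] R by auto
  then have "coherent (ball 0 (R + 1)) \<epsilon>"
    by (rule coherent_mono) (auto intro: order_trans[OF Basis_le_norm] less_imp_le)
  moreover have "S \<subseteq> ball 0 (R + 1)" using R by force
  ultimately show ?thesis by blast
qed

end

text \<open>
  A coherent choice of signs near the closure of the domain yields a function on the complement of the
  boundary that is locally constant, hence constant on the connected domain, and that agrees near
  \<open>p\<close> with the sign of a chart up to a factor.  Local arguments cannot give this: the two sides of
  a surface near \<open>p\<close> could be joined far away from \<open>p\<close>.
\<close>

theorem region_one_sided:
  fixes \<Omega> :: "'a::euclidean_space set"
  assumes conn: "connected \<Omega>" and op: "open \<Omega>" and bd: "bounded \<Omega>"
    and ch: "\<And>p. p \<in> frontier \<Omega> \<Longrightarrow> \<exists>\<eta> e K r. graph_chart (frontier \<Omega>) p \<eta> e K r"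
    and p: "p \<in> frontier \<Omega>"
  shows "\<exists>\<eta> e K r. graph_chart (frontier \<Omega>) p \<eta> e K r \<and> (\<exists>\<delta>>0. \<forall>q\<in>\<Omega> \<inter> ball p \<delta>. \<eta> q > 0)"
proof -
  interpret graph_boundary "frontier \<Omega>" using ch by unfold_locales auto
  have "bounded (closure \<Omega>)" using bd by (rule bounded_closure)
  then obtain A \<epsilon> where A: "open A" "closure \<Omega> \<subseteq> A" "coherent A \<epsilon>" using coherent_bounded by blast
  have \<epsilon>: "\<epsilon> q \<in> {1, -1}" for q using A(3) by (auto simp: coherent_def)
  \<comment> \<open>The corrected local sign, evaluated at the point itself.\<close>
  define s where "s q = \<epsilon> q * local_sign q q" for q
  have near: "\<exists>\<delta>>0. \<forall>q\<in>ball x \<delta> - frontier \<Omega>. s q = \<epsilon> x * local_sign x q" if x: "x \<in> A" for x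
  proof -
    obtain d where d: "d > 0" "\<And>q. q \<in> A \<inter> ball x d \<Longrightarrow>
        \<forall>\<^sub>F y in nhds q. y \<notin> frontier \<Omega> \<longrightarrow> \<epsilon> q * local_sign q y = \<epsilon> x * local_sign x y"
      using A(3) x unfolding coherent_def by blast
    obtain d' where d': "d' > 0" "ball x d' \<subseteq> A" using A(1) x open_contains_ball by blast
    have "s q = \<epsilon> x * local_sign x q" if "q \<in> ball x (min d d') - frontier \<Omega>" for q
    proof -
      have "q \<in> A \<inter> ball x d" using that d' by auto
      from eventually_nhds_x_imp_x[OF d(2)[OF this]] show ?thesis using that by (simp add: s_def)
    qed
    then show ?thesis using d(1) d'(1) by (intro exI[of _ "min d d'"]) auto
  qed
  have off: "x \<notin> frontier \<Omega>" if "x \<in> \<Omega>" for x using op that frontier_disjoint_eq by blast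
  have const: "s x = s y" if "x \<in> \<Omega>" "y \<in> \<Omega>" for x y
  proof (rule connected_local_const[OF conn that], rule ballI)
    fix a assume a: "a \<in> \<Omega>"
    then have "a \<in> A" using A(2) closure_subset by blast
    then obtain d where d: "d > 0" "\<And>q. q \<in> ball a d - frontier \<Omega> \<Longrightarrow> s q = \<epsilon> a * local_sign a q" using near by blast
    obtain f where f: "sign_germ a f" "\<And>x. local_sign a x = sgn (f x)" using local_signE[of a] by blast
    have "continuous_on UNIV f" "f a \<noteq> 0" using f(1) off[OF a] by (auto simp: sign_germ_def)
    then have "\<forall>\<^sub>F q in nhds a. local_sign a q = local_sign a a" unfolding f(2) by (rule nonzero_near)
    then have "\<forall>\<^sub>F q in at a within \<Omega>. local_sign a q = local_sign a a"
      using eventually_at_filter eventually_mono by fastforce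
    moreover have "\<forall>\<^sub>F q in at a within \<Omega>. q \<in> ball a d \<and> q \<in> \<Omega>"
      using d(1) by (auto simp: eventually_at dist_commute)
    ultimately show "\<forall>\<^sub>F q in at a within \<Omega>. s a = s q"
      by eventually_elim (use d(2) off in \<open>auto simp: s_def\<close>)
  qed
  obtain f where f: "sign_germ p f" "\<And>x. local_sign p x = sgn (f x)" using local_signE[of p] by blast
  obtain e K r where c: "graph_chart (frontier \<Omega>) p f e K r" using f(1) p by (auto simp: sign_germ_def)
  have pA: "p \<in> A" using p A(2) by (auto simp: frontier_def)
  obtain d where d: "d > 0" "\<And>q. q \<in> ball p d - frontier \<Omega> \<Longrightarrow> s q = \<epsilon> p * local_sign p q" using near[OF pA] by blast
  define \<rho> where "\<rho> = min d r"
  have r: "r > 0" using c by (simp add: graph_chart_def)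
  have sg: "sgn (f q) = sgn (f q')" and nz: "f q \<noteq> 0" if "q \<in> \<Omega> \<inter> ball p \<rho>" "q' \<in> \<Omega> \<inter> ball p \<rho>" for q q'
  proof -
    have "\<epsilon> p * sgn (f q) = \<epsilon> p * sgn (f q')"
      using d(2)[of q] d(2)[of q'] const[of q q'] off[of q] off[of q'] that by (auto simp: f(2) \<rho>_def)
    then show "sgn (f q) = sgn (f q')" using \<epsilon>[of p] by auto
    show "f q \<noteq> 0" using c that(1) off[of q] by (auto simp: graph_chart_def \<rho>_def)
  qed
  have \<rho>: "\<rho> > 0" using d r by (simp add: \<rho>_def)
  then obtain q0 where q0: "q0 \<in> \<Omega> \<inter> ball p \<rho>"
    using p by (metis Int_iff closure_approachable dist_commute frontier_def DiffD1 mem_ball)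
  show ?thesis
  proof (cases "f q0 > 0")
    case True
    then have "\<forall>q\<in>\<Omega> \<inter> ball p \<rho>. f q > 0" using sg[OF _ q0] by (metis sgn_1_pos sgn_pos)
    then show ?thesis using c \<rho> by blast
  next
    case False
    then have "f q0 < 0" using nz[OF q0 q0] by linarith
    then have "\<forall>q\<in>\<Omega> \<inter> ball p \<rho>. - f q > 0" using sg[OF _ q0] by (metis neg_0_less_iff_less sgn_1_neg sgn_neg)
    then show ?thesis using graph_chart_minus[OF c] \<rho> by blast
  qed
qed

section \<open>Interior cones\<close>

text \<open>
  Small translates of \<open>K\<close> along \<open>e\<close> lie in \<open>\<Omega>\<close> with a margin proportional to the translation.  The
  vector \<open>e\<close> may be 0, which covers compact subsets of an open \<open>\<Omega>\<close>; the interesting case is a part of the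
  closure near a boundary point.
\<close>

definition interior_cone_at :: "'a::euclidean_space set \<Rightarrow> 'a set \<Rightarrow> bool" where
  "interior_cone_at \<Omega> K \<longleftrightarrow> (\<exists>e c t0. norm e \<le> 1 \<and> 0 < c \<and> 0 < t0 \<and>
     (\<forall>x\<in>K. \<forall>t. 0 < t \<longrightarrow> t < t0 \<longrightarrow> ball (x + t *\<^sub>R e) (c * t) \<subseteq> \<Omega>))"

lemma interior_cone_compact:
  assumes "open \<Omega>" "compact K" "K \<subseteq> \<Omega>"
  shows "interior_cone_at \<Omega> K"
proof -
  obtain d where d: "d > 0" "\<And>x y. x \<in> K \<Longrightarrow> dist x y < d \<Longrightarrow> y \<in> \<Omega>"
  proof (cases "K = {}")
    case False
    have "\<exists>d>0. \<forall>x\<in>K. \<forall>y\<in>-\<Omega>. d \<le> dist x y"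
      using assms by (intro separate_compact_closed) auto
    then show ?thesis using that by (meson ComplI not_less)
  qed (use that[of 1] in auto)
  show ?thesis
    unfolding interior_cone_at_def
    using d by (intro exI[of _ 0] exI[of _ 1] exI[of _ d]) auto
qed

text \<open>
  Near a boundary point the domain is the set where \<open>f > 0\<close>: it is contained in this set by
  one-sidedness, and it contains this set because the upper side of the graph is connected and
  avoids the boundary.  On the ball of radius \<open>t / (K + 1)\<close> around \<open>x + t e\<close> the Lipschitz function
  \<open>f\<close> stays above \<open>f x + t - K t / (K + 1) > 0\<close>.
\<close>

theorem B1_interior_cone:
  fixes \<Omega> :: "'a::euclidean_space set"
  assumes reg: "region \<Omega>" and B1: "B1 \<Omega>" and p: "p \<in> closure \<Omega>"
  shows "\<exists>r>0. interior_cone_at \<Omega> (closure \<Omega> \<inter> ball p r)"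
proof (cases "p \<in> \<Omega>")
  case True
  have op: "open \<Omega>" using reg by (simp add: region_def)
  then obtain r where r: "r > 0" "cball p r \<subseteq> \<Omega>" using True open_contains_cball by blast
  have "interior_cone_at \<Omega> (cball p r)" using op r(2) by (intro interior_cone_compact) auto
  then have "interior_cone_at \<Omega> (closure \<Omega> \<inter> ball p r)"
    unfolding interior_cone_at_def by (meson Int_iff ball_subset_cball subsetD)
  then show ?thesis using r(1) by blast
next
  case False
  have op: "open \<Omega>" and conn: "connected \<Omega>" using reg by (auto simp: region_def)
  have bd: "bounded \<Omega>" using B1 by (simp add: B1_def)
  have pf: "p \<in> frontier \<Omega>" using p False op by (simp add: frontier_def interior_open)
  obtain f e K r0 \<delta> where c0: "graph_chart (frontier \<Omega>) p f e K r0" and \<delta>: "\<delta> > 0" "\<And>q. q \<in> \<Omega> \<inter> ball p \<delta> \<Longrightarrow> f q > 0"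
    using region_one_sided[OF conn op bd B1_graph_chart[OF B1] pf] by blast
  define r where "r = min r0 \<delta>"
  have r0: "r0 > 0" using c0 by (simp add: graph_chart_def)
  have c: "graph_chart (frontier \<Omega>) p f e K r" using graph_chart_smaller[OF c0] r0 \<delta> by (simp add: r_def)
  have K: "K \<ge> 0" and r: "r > 0" and ne: "norm e = 1"
    and lip: "\<And>x y. \<bar>f x - f y\<bar> \<le> K * norm (x - y)" and sh: "\<And>x t. f (x + t *\<^sub>R e) = f x + t"
    and zero: "\<And>x. x \<in> ball p r \<Longrightarrow> x \<in> frontier \<Omega> \<longleftrightarrow> f x = 0"
    using c by (auto simp: graph_chart_def)
  have fp: "f p = 0" using zero[of p] pf r by simp
  define d where "d = r / (K + 2)"
  have d: "d > 0" "d \<le> r" using r K by (auto simp: d_def field_simps)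
  obtain a where a: "a \<in> \<Omega>" "a \<in> ball p d"
    using p d by (metis closure_approachable dist_commute mem_ball)
  have fa: "f a > 0" using a d by (intro \<delta>(2)) (auto simp: r_def)
  have inside: "y \<in> \<Omega>" if y: "y \<in> ball p d" "f y > 0" for y
  proof (rule ccontr)
    assume "y \<notin> \<Omega>"
    obtain C where C: "connected C" "a \<in> C" "y \<in> C" "C \<subseteq> ball p r" "\<And>z. z \<in> C \<Longrightarrow> f z > 0"
      using graph_chart_connected_side[OF c fp a(2)[unfolded d_def] fa y(1)[unfolded d_def] y(2)] by blast
    have "C \<inter> frontier \<Omega> \<noteq> {}" using C(1-3) a(1) \<open>y \<notin> \<Omega>\<close> by (intro connected_Int_frontier) auto
    then obtain z where "z \<in> C" "z \<in> frontier \<Omega>" by blast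
    then show False using zero[of z] C(4,5) by force
  qed
  have nonneg: "f x \<ge> 0" if x: "x \<in> closure \<Omega>" "x \<in> ball p d" for x
  proof (rule ccontr)
    assume "\<not> f x \<ge> 0"
    have "open {y. f y < 0}"
      using graph_chart_continuous[OF c] by (intro open_Collect_less) (auto intro: continuous_intros)
    then have "open ({y. f y < 0} \<inter> ball p d)" by blast
    moreover have "x \<in> {y. f y < 0} \<inter> ball p d" using x \<open>\<not> f x \<ge> 0\<close> by auto
    ultimately have "\<Omega> \<inter> ({y. f y < 0} \<inter> ball p d) \<noteq> {}"
      using x(1) by (metis IntI empty_iff open_Int_closure_eq_empty inf_commute)
    then obtain y where "y \<in> \<Omega>" "f y < 0" "y \<in> ball p d" by blast
    then show False using \<delta>(2)[of y] d by (auto simp: r_def)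
  qed
  have "ball (x + t *\<^sub>R e) (1 / (K + 1) * t) \<subseteq> \<Omega>"
    if x: "x \<in> closure \<Omega> \<inter> ball p (d/2)" and t: "0 < t" "t < d/4" for x t
  proof
    fix y assume y: "y \<in> ball (x + t *\<^sub>R e) (1 / (K + 1) * t)"
    have n: "norm (y - (x + t *\<^sub>R e)) < t / (K + 1)" using y by (simp add: dist_norm norm_minus_commute)
    have tK: "t / (K + 1) \<le> t" using t K by (simp add: field_simps)
    have "norm (y - p) \<le> norm (y - (x + t *\<^sub>R e)) + norm (t *\<^sub>R e) + norm (x - p)"
    proof -
      have "y - p = (y - (x + t *\<^sub>R e)) + t *\<^sub>R e + (x - p)" by simp
      then show ?thesis
        using norm_triangle_ineq[of "(y - (x + t *\<^sub>R e)) + t *\<^sub>R e" "x - p"]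
          norm_triangle_ineq[of "y - (x + t *\<^sub>R e)" "t *\<^sub>R e"] by simp
    qed
    also have "\<dots> < d" using n tK t ne x by (simp add: dist_norm norm_minus_commute)
    finally have "y \<in> ball p d" by (simp add: dist_norm norm_minus_commute)
    moreover have "f y > 0"
    proof -
      have "\<bar>f y - f (x + t *\<^sub>R e)\<bar> \<le> K * norm (y - (x + t *\<^sub>R e))" by (rule lip)
      also have "\<dots> \<le> K * (t / (K + 1))" using n K by (intro mult_left_mono) auto
      also have "\<dots> < t" using t K by (simp add: field_simps)
      finally have "\<bar>f y - f (x + t *\<^sub>R e)\<bar> < t" .
      moreover have "f x \<ge> 0" using x d by (intro nonneg) auto
      ultimately show ?thesis unfolding sh by linarith
    qed
    ultimately show "y \<in> \<Omega>" by (rule inside)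
  qed
  then have "interior_cone_at \<Omega> (closure \<Omega> \<inter> ball p (d/2))"
    unfolding interior_cone_at_def using ne K d(1)
    by (intro exI[of _ e] exI[of _ "1 / (K + 1)"] exI[of _ "d/4"]) auto
  then show ?thesis using d(1) by (intro exI[of _ "d/2"]) auto
qed

section \<open>Completeness of the space of functions with square-integrable Laplacian\<close>

context bounded_open_set begin

lemma H0_DeltaD:
  assumes "u \<in> H0_Delta \<Omega>"
  shows "u \<in> L2 \<mu>" "H10_grad u (weak_gradient \<Omega> u)" "has_weak_laplacian \<Omega> u (weak_laplacian \<Omega> u)"
    "weak_laplacian \<Omega> u \<in> L2 \<mu>"
proof -
  show H: "H10_grad u (weak_gradient \<Omega> u)" using assms H10_weak_gradient by (simp add: H0_Delta_def)
  then show "u \<in> L2 \<mu>" by (rule H10_grad_L2)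
  show l: "has_weak_laplacian \<Omega> u (weak_laplacian \<Omega> u)"
    using assms has_weak_laplacian_weak_laplacian by (auto simp: H0_Delta_def)
  then show "weak_laplacian \<Omega> u \<in> L2 \<mu>" by (rule has_weak_laplacianD)
qed

lemma H0_DeltaI: "H10_grad u G \<Longrightarrow> has_weak_laplacian \<Omega> u f \<Longrightarrow> u \<in> H0_Delta \<Omega>"
  using H10_grad_H10 by (auto simp: H0_Delta_def)

lemma H0_Delta_lincomb:
  assumes "u \<in> H0_Delta \<Omega>" "v \<in> H0_Delta \<Omega>"
  shows "(\<lambda>x. u x + c * v x) \<in> H0_Delta \<Omega>"
    "AE x in \<mu>. weak_laplacian \<Omega> (\<lambda>x. u x + c * v x) x = weak_laplacian \<Omega> u x + c * weak_laplacian \<Omega> v x"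
proof -
  note u = H0_DeltaD[OF assms(1)] and v = H0_DeltaD[OF assms(2)]
  have l: "has_weak_laplacian \<Omega> (\<lambda>x. u x + c * v x) (\<lambda>x. weak_laplacian \<Omega> u x + c * weak_laplacian \<Omega> v x)"
    by (rule has_weak_laplacian_lincomb[OF u(1) v(1) u(3) v(3)])
  show "(\<lambda>x. u x + c * v x) \<in> H0_Delta \<Omega>"
    by (rule H0_DeltaI[OF H10_grad_lincomb[OF u(2) v(2)] l])
  show "AE x in \<mu>. weak_laplacian \<Omega> (\<lambda>x. u x + c * v x) x = weak_laplacian \<Omega> u x + c * weak_laplacian \<Omega> v x"
    using l by (rule weak_laplacian_AE)
qed

lemma inner_Delta_eq: "inner_Delta \<Omega> u v = l2ip \<mu> (weak_laplacian \<Omega> u) (weak_laplacian \<Omega> v)"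
  by (simp add: inner_Delta_def l2ip_def)

lemma norm_Delta_eq: "norm_Delta \<Omega> u = l2norm \<mu> (weak_laplacian \<Omega> u)"
  by (simp add: norm_Delta_def inner_Delta_eq l2ip_self)

lemma inner_Delta_lincomb:
  assumes "u \<in> H0_Delta \<Omega>" "v \<in> H0_Delta \<Omega>" "w \<in> H0_Delta \<Omega>"
  shows "inner_Delta \<Omega> (\<lambda>x. u x + c * v x) w = inner_Delta \<Omega> u w + c * inner_Delta \<Omega> v w"
proof -
  note L = H0_DeltaD(4)[OF assms(1)] H0_DeltaD(4)[OF assms(2)] H0_DeltaD(4)[OF assms(3)]
    H0_DeltaD(4)[OF H0_Delta_lincomb(1)[OF assms(1,2)], of c]
  have "inner_Delta \<Omega> (\<lambda>x. u x + c * v x) w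
      = l2ip \<mu> (\<lambda>x. weak_laplacian \<Omega> u x + c * weak_laplacian \<Omega> v x) (weak_laplacian \<Omega> w)"
    unfolding inner_Delta_eq using L
    by (intro l2ip_cong_AE H0_Delta_lincomb(2)[OF assms(1,2)] L2_measurable L2_lincomb)
  also have "\<dots> = inner_Delta \<Omega> u w + c * inner_Delta \<Omega> v w"
    unfolding inner_Delta_eq by (rule l2ip_lincomb_left[OF L(1-3)])
  finally show ?thesis .
qed

lemma weak_laplacian_energy:
  assumes u: "u \<in> L2 \<mu>" "has_weak_gradient \<Omega> u G" "has_weak_laplacian \<Omega> u f" and h: "H10_grad h H"
  shows "(\<Sum>i\<in>Basis. l2ip \<mu> (\<lambda>x. G x \<bullet> i) (\<lambda>x. H x \<bullet> i)) = - l2ip \<mu> f h"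
proof -
  obtain \<phi> where p: "H10_approx h H \<phi>" using h by (auto simp: H10_grad_def)
  have t: "\<phi> n \<in> Cc_infinity \<Omega>" for n using p by (simp add: H10_approx_def)
  have fL: "f \<in> L2 \<mu>" using u(3) by (rule has_weak_laplacianD)
  have "(\<lambda>n. \<Sum>i\<in>Basis. l2ip \<mu> (partial_deriv i (\<phi> n)) (\<lambda>x. G x \<bullet> i))
      \<longlonglongrightarrow> (\<Sum>i\<in>Basis. l2ip \<mu> (\<lambda>x. H x \<bullet> i) (\<lambda>x. G x \<bullet> i))"
    using p unfolding H10_approx_def
    by (intro tendsto_sum l2ip_tendsto test_partial_L2[OF t] H10_grad_L2(2)[OF h] weak_gradient_L2[OF u(2)]) auto
  moreover have "(\<Sum>i\<in>Basis. l2ip \<mu> (partial_deriv i (\<phi> n)) (\<lambda>x. G x \<bullet> i)) = - l2ip \<mu> (\<phi> n) f" for n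
    using weak_laplacian_energy_test[OF u t] by (simp add: l2ip_sym)
  ultimately have 1: "(\<lambda>n. - l2ip \<mu> (\<phi> n) f) \<longlonglongrightarrow> (\<Sum>i\<in>Basis. l2ip \<mu> (\<lambda>x. H x \<bullet> i) (\<lambda>x. G x \<bullet> i))" by simp
  have "(\<lambda>n. l2ip \<mu> (\<phi> n) f) \<longlonglongrightarrow> l2ip \<mu> h f"
    using p unfolding H10_approx_def by (intro l2ip_tendsto test_L2[OF t] H10_grad_L2(1)[OF h] fL) auto
  then have 2: "(\<lambda>n. - l2ip \<mu> (\<phi> n) f) \<longlonglongrightarrow> - l2ip \<mu> h f" by (rule tendsto_minus)
  show ?thesis using LIMSEQ_unique[OF 1 2] by (simp add: l2ip_sym)
qed

text \<open>
  Testing \<open>\<Delta> u = f\<close> with \<open>u\<close> itself bounds the Dirichlet energy by the norms of \<open>f\<close> and \<open>u\<close>, and the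
  Poincare inequality absorbs the norm of \<open>u\<close>.
\<close>

lemma H0_Delta_apriori:
  assumes u: "H10_grad u G" "has_weak_laplacian \<Omega> u f"
  shows "i \<in> Basis \<Longrightarrow> l2norm \<mu> (\<lambda>x. G x \<bullet> i) \<le> poincare_const * l2norm \<mu> f"
    and "l2norm \<mu> u \<le> poincare_const * (poincare_const * l2norm \<mu> f)"
proof -
  define E where "E = sqrt (\<Sum>i\<in>Basis. (l2norm \<mu> (\<lambda>x. G x \<bullet> i))\<^sup>2)"
  have E0: "(\<Sum>i\<in>Basis. (l2norm \<mu> (\<lambda>x. G x \<bullet> i))\<^sup>2) \<ge> 0" by (intro sum_nonneg) auto
  have E2: "E\<^sup>2 = (\<Sum>i\<in>Basis. (l2norm \<mu> (\<lambda>x. G x \<bullet> i))\<^sup>2)" "E \<ge> 0" using E0 by (auto simp: E_def)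
  have Gi: "l2norm \<mu> (\<lambda>x. G x \<bullet> i) \<le> E" if "i \<in> Basis" for i
    unfolding E_def using that by (intro real_le_rsqrt member_le_sum) auto
  obtain i0 :: 'a where i0: "i0 \<in> Basis" using nonempty_Basis by blast
  note uL = H10_grad_L2(1)[OF u(1)] and fL = has_weak_laplacianD(1)[OF u(2)] and P = poincare_const(1)
  have up: "l2norm \<mu> u \<le> poincare_const * E"
  proof -
    have "l2norm \<mu> u \<le> poincare_const * l2norm \<mu> (\<lambda>x. G x \<bullet> i0)" by (rule poincare[OF u(1) i0])
    also have "\<dots> \<le> poincare_const * E" using Gi[OF i0] P by (intro mult_left_mono) auto
    finally show ?thesis .
  qed
  have "E\<^sup>2 = - l2ip \<mu> f u"
    unfolding E2 using weak_laplacian_energy[OF uL H10_grad_weak[OF u(1)] u(2) u(1)] by (simp add: l2ip_self)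
  also have "\<dots> \<le> l2norm \<mu> f * l2norm \<mu> u" using l2_Cauchy_Schwarz[OF fL uL] by linarith
  also have "\<dots> \<le> l2norm \<mu> f * (poincare_const * E)" using up by (intro mult_left_mono) auto
  finally have "E * E \<le> E * (poincare_const * l2norm \<mu> f)" by (simp add: power2_eq_square algebra_simps)
  then have E: "E \<le> poincare_const * l2norm \<mu> f"
    using E2(2) P by (cases "E = 0") (auto simp: mult_le_cancel_left)
  show "i \<in> Basis \<Longrightarrow> l2norm \<mu> (\<lambda>x. G x \<bullet> i) \<le> poincare_const * l2norm \<mu> f" using Gi E by fastforce
  have "poincare_const * E \<le> poincare_const * (poincare_const * l2norm \<mu> f)"
    using E P by (intro mult_left_mono) auto
  then show "l2norm \<mu> u \<le> poincare_const * (poincare_const * l2norm \<mu> f)" using up by simp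
qed

lemma H0_Delta_zero:
  assumes "u \<in> H0_Delta \<Omega>" "inner_Delta \<Omega> u u = 0"
  shows "AE x in \<mu>. u x = 0"
proof (rule l2norm_eq_0_AE[OF H0_DeltaD(1)[OF assms(1)]])
  have "l2norm \<mu> (weak_laplacian \<Omega> u) = 0" using assms(2) by (simp add: inner_Delta_eq l2ip_self)
  then have "l2norm \<mu> u \<le> 0" using H0_Delta_apriori(2)[OF H0_DeltaD(2,3)[OF assms(1)]] by simp
  then show "l2norm \<mu> u = 0" using l2norm_nonneg[of \<mu> u] by linarith
qed

lemma H0_Delta_diff:
  assumes "u \<in> H0_Delta \<Omega>" "v \<in> H0_Delta \<Omega>"
  shows "(\<lambda>x. u x - v x) \<in> H0_Delta \<Omega>"
  using H0_Delta_lincomb(1)[OF assms, of "-1"] by simp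

text \<open>
  By the a priori bounds the functions and their gradients are Cauchy sequences as well, and the weak
  equations pass to the limits.
\<close>

theorem H0_Delta_complete:
  assumes u: "\<And>n. u n \<in> H0_Delta \<Omega>"
    and C: "\<And>e. e > 0 \<Longrightarrow> \<exists>N. \<forall>m\<ge>N. \<forall>n\<ge>N. norm_Delta \<Omega> (\<lambda>x. u m x - u n x) < e"
  shows "\<exists>w\<in>H0_Delta \<Omega>. (\<lambda>n. norm_Delta \<Omega> (\<lambda>x. u n x - w x)) \<longlonglongrightarrow> 0"
proof -
  let ?L = "\<lambda>n. weak_laplacian \<Omega> (u n)" and ?G = "\<lambda>n. weak_gradient \<Omega> (u n)" and ?P = poincare_const
  note D = H0_DeltaD[OF u]
  have dG: "H10_grad (\<lambda>x. u m x - u n x) (\<lambda>x. ?G m x - ?G n x)" for m n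
    using H10_grad_lincomb[OF D(2)[of m] D(2)[of n], of "-1"] by simp
  have dl: "has_weak_laplacian \<Omega> (\<lambda>x. u m x - u n x) (\<lambda>x. ?L m x - ?L n x)" for m n
    using has_weak_laplacian_lincomb[OF D(1)[of m] D(1)[of n] D(3)[of m] D(3)[of n], of "-1"] by simp
  have nd: "norm_Delta \<Omega> (\<lambda>x. u m x - u n x) = l2norm \<mu> (\<lambda>x. ?L m x - ?L n x)" for m n
    unfolding norm_Delta_eq
    using H0_DeltaD(4)[OF H0_Delta_diff[OF u[of m] u[of n]]] L2_diff[OF D(4)[of m] D(4)[of n]]
    by (intro l2norm_cong_AE weak_laplacian_AE[OF dl] L2_measurable)
  have Cs: "\<exists>N. \<forall>m\<ge>N. \<forall>n\<ge>N. g m n < e"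
    if e: "e > 0" and K: "K > 0" and le: "\<And>m n. g m n \<le> K * l2norm \<mu> (\<lambda>x. ?L m x - ?L n x)" for e K :: real and g
  proof -
    obtain N where N: "\<And>m n. m \<ge> N \<Longrightarrow> n \<ge> N \<Longrightarrow> norm_Delta \<Omega> (\<lambda>x. u m x - u n x) < e / K"
      using C[of "e / K"] e K by auto
    have "g m n < e" if "m \<ge> N" "n \<ge> N" for m n
    proof -
      have "g m n \<le> K * l2norm \<mu> (\<lambda>x. ?L m x - ?L n x)" by (rule le)
      also have "\<dots> < K * (e / K)" using N[OF that] K unfolding nd by (intro mult_strict_left_mono) auto
      finally show ?thesis using K by simp
    qed
    then show ?thesis by blast
  qed
  note P = poincare_const(1)
  have cu: "\<exists>N. \<forall>m\<ge>N. \<forall>n\<ge>N. l2norm \<mu> (\<lambda>x. u m x - u n x) < e" if "e > 0" for e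
    by (rule Cs[OF that, of "?P * ?P"]) (use P H0_Delta_apriori(2)[OF dG dl] in \<open>auto simp: mult.assoc\<close>)
  have cG: "\<exists>N. \<forall>m\<ge>N. \<forall>n\<ge>N. l2norm \<mu> (\<lambda>x. ?G m x \<bullet> i - ?G n x \<bullet> i) < e" if "e > 0" "i \<in> Basis" for e i
    by (rule Cs[OF that(1), of ?P]) (use P H0_Delta_apriori(1)[OF dG dl that(2)] in \<open>auto simp: inner_diff_left\<close>)
  have cL: "\<exists>N. \<forall>m\<ge>N. \<forall>n\<ge>N. l2norm \<mu> (\<lambda>x. ?L m x - ?L n x) < e" if "e > 0" for e
    by (rule Cs[OF that, of 1]) auto
  obtain w where w: "w \<in> L2 \<mu>" "(\<lambda>n. l2norm \<mu> (\<lambda>x. u n x - w x)) \<longlonglongrightarrow> 0"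
    using L2_complete[OF fin D(1) cu] by blast
  obtain f where f: "f \<in> L2 \<mu>" "(\<lambda>n. l2norm \<mu> (\<lambda>x. ?L n x - f x)) \<longlonglongrightarrow> 0"
    using L2_complete[OF fin D(4) cL] by blast
  have "\<exists>g\<in>L2 \<mu>. (\<lambda>n. l2norm \<mu> (\<lambda>x. ?G n x \<bullet> i - g x)) \<longlonglongrightarrow> 0" if "i \<in> Basis" for i
    by (rule L2_complete[OF fin H10_grad_L2(2)[OF D(2) that] cG[OF _ that]])
  then have "\<forall>i\<in>Basis. \<exists>g. g \<in> L2 \<mu> \<and> (\<lambda>n. l2norm \<mu> (\<lambda>x. ?G n x \<bullet> i - g x)) \<longlonglongrightarrow> 0" by blast
  from bchoice[OF this] obtain g where
    "\<forall>i\<in>Basis. g i \<in> L2 \<mu> \<and> (\<lambda>n. l2norm \<mu> (\<lambda>x. ?G n x \<bullet> i - g i x)) \<longlonglongrightarrow> 0" by blast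
  then have g: "\<And>i. i \<in> Basis \<Longrightarrow> g i \<in> L2 \<mu>"
    "\<And>i. i \<in> Basis \<Longrightarrow> (\<lambda>n. l2norm \<mu> (\<lambda>x. ?G n x \<bullet> i - g i x)) \<longlonglongrightarrow> 0" by blast+
  define G where "G x = (\<Sum>i\<in>Basis. g i x *\<^sub>R i)" for x
  have Gi: "G x \<bullet> i = g i x" if "i \<in> Basis" for x i
    using that by (simp add: G_def inner_sum_left_Basis)
  have H: "H10_grad w G"
    by (rule H10_grad_closed[OF D(2) w(1) _ w(2)]) (auto simp: Gi g)
  have l: "has_weak_laplacian \<Omega> w f"
  proof (rule has_weak_laplacianI[OF f(1)])
    fix \<phi> assume p: "\<phi> \<in> Cc_infinity \<Omega>"
    have "classical_laplacian \<phi> \<in> L2 \<mu>"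
      by (intro smooth_L2 smooth_classical_laplacian Cc_infinity_smooth[OF p])
    then have 1: "(\<lambda>n. l2ip \<mu> (u n) (classical_laplacian \<phi>)) \<longlonglongrightarrow> l2ip \<mu> w (classical_laplacian \<phi>)"
      by (intro l2ip_tendsto D(1) w)
    have 2: "(\<lambda>n. l2ip \<mu> (?L n) \<phi>) \<longlonglongrightarrow> l2ip \<mu> f \<phi>"
      by (intro l2ip_tendsto D(4) f test_L2[OF p])
    show "l2ip \<mu> w (classical_laplacian \<phi>) = l2ip \<mu> f \<phi>"
      using 1 2 unfolding has_weak_laplacianD(2)[OF D(3) p] by (rule LIMSEQ_unique)
  qed
  have wH: "w \<in> H0_Delta \<Omega>" by (rule H0_DeltaI[OF H l])
  have nw: "norm_Delta \<Omega> (\<lambda>x. u n x - w x) = l2norm \<mu> (\<lambda>x. ?L n x - f x)" for n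
  proof -
    have "has_weak_laplacian \<Omega> (\<lambda>x. u n x - w x) (\<lambda>x. ?L n x - f x)"
      using has_weak_laplacian_lincomb[OF D(1)[of n] w(1) D(3)[of n] l, of "-1"] by simp
    then show ?thesis
      unfolding norm_Delta_eq
      using H0_DeltaD(4)[OF H0_Delta_diff[OF u[of n] wH]] L2_diff[OF D(4)[of n] f(1)]
      by (intro l2norm_cong_AE weak_laplacian_AE L2_measurable)
  qed
  show ?thesis
  proof (rule bexI[OF _ wH])
    show "(\<lambda>n. norm_Delta \<Omega> (\<lambda>x. u n x - w x)) \<longlonglongrightarrow> 0" unfolding nw by (rule f(2))
  qed
qed

section \<open>The Green form\<close>

text \<open>
  The right-hand side of the definition of the normal derivative, that is, the boundary integral of
  \<open>v * D u\<close> without reference to a trace.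
\<close>

definition green_form :: "('a \<Rightarrow> real) \<Rightarrow> ('a \<Rightarrow> real) \<Rightarrow> real" where
  "green_form u v = (\<integral>x. weak_gradient \<Omega> u x \<bullet> weak_gradient \<Omega> v x + v x * weak_laplacian \<Omega> u x \<partial>\<mu>)"

lemma green_form_eq:
  assumes u: "has_weak_gradient \<Omega> u G" "has_weak_laplacian \<Omega> u f" and v: "v \<in> L2 \<mu>" "has_weak_gradient \<Omega> v H"
  shows "green_form u v = (\<Sum>i\<in>Basis. l2ip \<mu> (\<lambda>x. G x \<bullet> i) (\<lambda>x. H x \<bullet> i)) + l2ip \<mu> v f"
proof -
  let ?G = "weak_gradient \<Omega> u" and ?H = "weak_gradient \<Omega> v" and ?f = "weak_laplacian \<Omega> u"
  note uG = has_weak_gradient_weak_gradient[OF u(1)] and vH = has_weak_gradient_weak_gradient[OF v(2)]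
    and uf = has_weak_laplacian_weak_laplacian[OF u(2)]
  have ip: "l2ip \<mu> (\<lambda>x. ?G x \<bullet> i) (\<lambda>x. ?H x \<bullet> i) = l2ip \<mu> (\<lambda>x. G x \<bullet> i) (\<lambda>x. H x \<bullet> i)" if i: "i \<in> Basis" for i
  proof -
    have "AE x in \<mu>. (?G x \<bullet> i) * (?H x \<bullet> i) = (G x \<bullet> i) * (H x \<bullet> i)"
      using weak_gradient_AE[OF u(1)] weak_gradient_AE[OF v(2)] by eventually_elim simp
    then show ?thesis
      unfolding l2ip_def
      using weak_gradient_L2[OF uG i] weak_gradient_L2[OF vH i] weak_gradient_L2[OF u(1) i] weak_gradient_L2[OF v(2) i]
      by (intro integral_cong_AE borel_measurable_times L2_measurable)
  qed
  have il: "l2ip \<mu> v ?f = l2ip \<mu> v f"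
    using l2ip_cong_AE[OF L2_measurable[OF has_weak_laplacianD(1)[OF uf]] L2_measurable[OF has_weak_laplacianD(1)[OF u(2)]]
        weak_laplacian_AE[OF u(2)] L2_measurable[OF v(1)]] by (simp add: l2ip_sym)
  have "green_form u v = (\<integral>x. (\<Sum>i\<in>Basis. (?G x \<bullet> i) * (?H x \<bullet> i)) + v x * ?f x \<partial>\<mu>)"
    unfolding green_form_def by (intro Bochner_Integration.integral_cong refl) (simp add: euclidean_inner[of "?G _" "?H _"])
  also have "\<dots> = (\<Sum>i\<in>Basis. l2ip \<mu> (\<lambda>x. ?G x \<bullet> i) (\<lambda>x. ?H x \<bullet> i)) + l2ip \<mu> v ?f"
    unfolding l2ip_def
    using L2_times_integrable[OF weak_gradient_L2[OF uG] weak_gradient_L2[OF vH]]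
      L2_times_integrable[OF v(1) has_weak_laplacianD(1)[OF uf]]
    by (simp add: Bochner_Integration.integral_sum)
  finally show ?thesis using ip il by simp
qed

lemma green_form_lincomb:
  assumes u: "u \<in> H0_Delta \<Omega>" and w: "w \<in> H0_Delta \<Omega>" and v: "v \<in> H1 \<Omega>"
  shows "green_form (\<lambda>x. u x + c * w x) v = green_form u v + c * green_form w v"
proof -
  note du = H0_DeltaD[OF u] and dw = H0_DeltaD[OF w]
  have vL: "v \<in> L2 \<mu>" and vH: "has_weak_gradient \<Omega> v (weak_gradient \<Omega> v)"
    using v has_weak_gradient_weak_gradient by (auto simp: H1_def)
  let ?U = "weak_gradient \<Omega> u" and ?W = "weak_gradient \<Omega> w" and ?V = "weak_gradient \<Omega> v"
  have "green_form (\<lambda>x. u x + c * w x) v =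
     (\<Sum>i\<in>Basis. l2ip \<mu> (\<lambda>x. (?U x + c *\<^sub>R ?W x) \<bullet> i) (\<lambda>x. ?V x \<bullet> i))
     + l2ip \<mu> v (\<lambda>x. weak_laplacian \<Omega> u x + c * weak_laplacian \<Omega> w x)"
    by (intro green_form_eq vL vH has_weak_laplacian_lincomb du dw H10_grad_weak H10_grad_lincomb)
  also have "(\<Sum>i\<in>Basis. l2ip \<mu> (\<lambda>x. (?U x + c *\<^sub>R ?W x) \<bullet> i) (\<lambda>x. ?V x \<bullet> i))
     = (\<Sum>i\<in>Basis. l2ip \<mu> (\<lambda>x. ?U x \<bullet> i) (\<lambda>x. ?V x \<bullet> i)) + c * (\<Sum>i\<in>Basis. l2ip \<mu> (\<lambda>x. ?W x \<bullet> i) (\<lambda>x. ?V x \<bullet> i))"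
    using l2ip_lincomb_left[OF H10_grad_L2(2)[OF du(2)] H10_grad_L2(2)[OF dw(2)] weak_gradient_L2[OF vH], of _ _ _ c]
    by (simp add: inner_add_left sum.distrib sum_distrib_left)
  also have "l2ip \<mu> v (\<lambda>x. weak_laplacian \<Omega> u x + c * weak_laplacian \<Omega> w x)
     = l2ip \<mu> v (weak_laplacian \<Omega> u) + c * l2ip \<mu> v (weak_laplacian \<Omega> w)"
    by (rule l2ip_lincomb_right[OF du(4) dw(4) vL])
  finally show ?thesis
    using green_form_eq[OF H10_grad_weak[OF du(2)] du(3) vL vH] green_form_eq[OF H10_grad_weak[OF dw(2)] dw(3) vL vH]
    by (simp add: algebra_simps)
qed

lemma test_H0_Delta: "\<phi> \<in> Cc_infinity \<Omega> \<Longrightarrow> \<phi> \<in> H0_Delta \<Omega>"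
  by (rule H0_DeltaI[OF test_H10_grad has_weak_laplacian_classical[OF smooth_Ck[OF Cc_infinity_smooth]]])

text \<open>
  This is the weak definition of the gradient of \<open>v\<close>, applied to the partial derivatives of \<open>\<phi>\<close>.
\<close>

lemma green_form_test:
  assumes p: "\<phi> \<in> Cc_infinity \<Omega>" and v: "v \<in> H1 \<Omega>"
  shows "green_form \<phi> v = 0"
proof -
  have vL: "v \<in> L2 \<mu>" and vH: "has_weak_gradient \<Omega> v (weak_gradient \<Omega> v)"
    using v has_weak_gradient_weak_gradient by (auto simp: H1_def)
  note s = Cc_infinity_smooth[OF p]
  have "green_form \<phi> v = (\<Sum>i\<in>Basis. l2ip \<mu> (\<lambda>x. grad \<phi> x \<bullet> i) (\<lambda>x. weak_gradient \<Omega> v x \<bullet> i)) + l2ip \<mu> v (classical_laplacian \<phi>)"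
    by (rule green_form_eq[OF has_weak_gradient_classical[OF smooth_Ck[OF s]] has_weak_laplacian_classical[OF smooth_Ck[OF s]] vL vH])
  also have "l2ip \<mu> v (classical_laplacian \<phi>) = (\<Sum>i\<in>Basis. - l2ip \<mu> (\<lambda>x. weak_gradient \<Omega> v x \<bullet> i) (partial_deriv i \<phi>))"
    unfolding laplacian_ip_sum[OF vL s]
    by (intro sum.cong refl weak_gradient_ip[OF vH _ Cc_infinity_partial_deriv[OF p]])
  finally show ?thesis by (simp add: l2ip_sym sum_negf)
qed

abbreviation "\<sigma> \<equiv> surface_measure \<Omega>"

lemma has_normal_derivative_iff:
  "has_normal_derivative \<Omega> u d \<longleftrightarrow> d \<in> L2 \<sigma> \<and> (\<forall>v g. has_trace \<Omega> v g \<longrightarrow> l2ip \<sigma> g d = green_form u v)"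
  by (simp add: has_normal_derivative_def l2ip_def green_form_def)

lemma has_normal_derivative_lincomb:
  assumes u: "u \<in> H0_Delta \<Omega>" "has_normal_derivative \<Omega> u d" and w: "w \<in> H0_Delta \<Omega>" "has_normal_derivative \<Omega> w e"
  shows "has_normal_derivative \<Omega> (\<lambda>x. u x + c * w x) (\<lambda>x. d x + c * e x)"
  unfolding has_normal_derivative_iff
proof (intro conjI allI impI)
  have L: "d \<in> L2 \<sigma>" "e \<in> L2 \<sigma>" using u w by (auto simp: has_normal_derivative_iff)
  then show "(\<lambda>x. d x + c * e x) \<in> L2 \<sigma>" by (rule L2_lincomb)
  fix v g assume t: "has_trace \<Omega> v g"
  then have "g \<in> L2 \<sigma>" "v \<in> H1 \<Omega>" by (auto simp: has_trace_def)
  then show "l2ip \<sigma> g (\<lambda>x. d x + c * e x) = green_form (\<lambda>x. u x + c * w x) v"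
    using u w t by (simp add: l2ip_lincomb_right L green_form_lincomb has_normal_derivative_iff)
qed

lemma has_normal_derivative_test:
  "\<phi> \<in> Cc_infinity \<Omega> \<Longrightarrow> has_normal_derivative \<Omega> \<phi> (\<lambda>x. 0)"
  unfolding has_normal_derivative_iff by (auto simp: l2ip_def has_trace_def green_form_test)

end

section \<open>Surface measure and uniqueness of the normal derivative\<close>

locale B1_domain = bounded_open_set +
  assumes B1: "B1 \<Omega>"
begin

lemma surface_outer_finite: "hausdorff_outer (DIM('a) - 1) (frontier \<Omega>) < \<infinity>"
proof -
  obtain \<S> where S: "finite \<S>" "\<Union>\<S> = frontier \<Omega>" "\<And>S. S \<in> \<S> \<Longrightarrow> hausdorff_outer (DIM('a) - 1) S < \<infinity>"
    using B1 unfolding B1_def by metis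
  have "hausdorff_outer (DIM('a) - 1) (\<Union>\<T>) < \<infinity>" if "finite \<T>" "\<T> \<subseteq> \<S>" for \<T>
    using that
  proof (induction \<T> rule: finite_induct)
    case (insert T \<T>)
    have "hausdorff_outer (DIM('a) - 1) (\<Union>(insert T \<T>)) \<le> hausdorff_outer (DIM('a) - 1) T + hausdorff_outer (DIM('a) - 1) (\<Union>\<T>)"
      using hausdorff_outer_subadditive by auto
    also have "\<dots> < \<infinity>" using insert S(3)[of T] by (auto simp: ennreal_add_less_top)
    finally show ?case .
  qed simp
  from this[OF S(1) order_refl] show ?thesis by (simp add: S(2))
qed

lemma frontier_borel: "frontier \<Omega> \<in> sets borel"
  by (intro borel_closed) simp

lemma frontier_sets: "frontier \<Omega> \<in> sets (hausdorff_measure m)"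
  using borel_hausdorff_sets[OF frontier_borel] by (simp add: sets_hausdorff_measure)

lemma space_\<sigma> [simp]: "space \<sigma> = frontier \<Omega>"
  by (simp add: surface_measure_def space_restrict_space)

lemma sets_\<sigma>: "A \<in> sets \<sigma> \<longleftrightarrow> A \<subseteq> frontier \<Omega> \<and> A \<in> hausdorff_sets (DIM('a) - 1)"
proof -
  have f: "frontier \<Omega> \<inter> space (hausdorff_measure (DIM('a) - 1)) \<in> sets (hausdorff_measure (DIM('a) - 1))"
    using frontier_sets by simp
  show ?thesis
    unfolding surface_measure_def sets_restrict_space_iff[OF f] by (simp only: sets_hausdorff_measure)
qed

lemma emeasure_\<sigma>:
  assumes "A \<in> sets \<sigma>"
  shows "emeasure \<sigma> A = hausdorff_outer (DIM('a) - 1) A"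
proof -
  have "emeasure \<sigma> A = emeasure (hausdorff_measure (DIM('a) - 1)) A"
    unfolding surface_measure_def using assms sets_\<sigma> frontier_sets by (intro emeasure_restrict_space) auto
  then show ?thesis using assms emeasure_hausdorff_measure sets_\<sigma> by auto
qed

lemma fin_\<sigma>: "finite_measure \<sigma>"
proof
  have "frontier \<Omega> \<in> sets \<sigma>" using borel_hausdorff_sets[OF frontier_borel] by (simp add: sets_\<sigma>)
  then have "emeasure \<sigma> (space \<sigma>) = hausdorff_outer (DIM('a) - 1) (frontier \<Omega>)" by (simp add: emeasure_\<sigma>)
  then show "emeasure \<sigma> (space \<sigma>) \<noteq> \<infinity>" using surface_outer_finite by simp
qed

lemma id_\<sigma>: "(\<lambda>x. x) \<in> \<sigma> \<rightarrow>\<^sub>M borel"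
  unfolding surface_measure_def
proof (rule measurable_restrict_space1, rule measurableI)
  fix A :: "'a set" assume "A \<in> sets borel"
  then show "(\<lambda>x. x) -` A \<inter> space (hausdorff_measure (DIM('a) - 1)) \<in> sets (hausdorff_measure (DIM('a) - 1))"
    using borel_hausdorff_sets[of A] by (simp add: sets_hausdorff_measure)
qed simp

text \<open>
  A Borel hull has the same finite measure, hence differs from the set by a null set.
\<close>

lemma borel_approximation_\<sigma>:
  assumes A: "A \<in> sets \<sigma>"
  shows "\<exists>B\<in>sets borel. AE x in \<sigma>. x \<in> A \<longleftrightarrow> x \<in> B"
proof -
  interpret \<sigma>: finite_measure \<sigma> by (rule fin_\<sigma>)
  have "hausdorff_outer (DIM('a) - 1) A \<le> hausdorff_outer (DIM('a) - 1) (frontier \<Omega>)"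
    using A sets_\<sigma> by (intro hausdorff_outer_mono) auto
  then have "hausdorff_outer (DIM('a) - 1) A < \<infinity>" using surface_outer_finite by simp
  then obtain B where B: "B \<in> sets borel" "A \<subseteq> B" "hausdorff_outer (DIM('a) - 1) B \<le> hausdorff_outer (DIM('a) - 1) A"
    using hausdorff_borel_hull by blast
  have Bs: "B \<inter> frontier \<Omega> \<in> sets \<sigma>"
    using borel_hausdorff_sets[OF sets.Int[OF B(1) frontier_borel]] by (simp add: sets_\<sigma>)
  have AB: "A \<subseteq> B \<inter> frontier \<Omega>" using A B(2) sets_\<sigma> by auto
  have "emeasure \<sigma> (B \<inter> frontier \<Omega> - A) = emeasure \<sigma> (B \<inter> frontier \<Omega>) - emeasure \<sigma> A"
    using Bs A AB by (intro emeasure_Diff) auto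
  also have "emeasure \<sigma> (B \<inter> frontier \<Omega>) \<le> emeasure \<sigma> A"
    unfolding emeasure_\<sigma>[OF Bs] emeasure_\<sigma>[OF A]
    using B(3) hausdorff_outer_mono[of "B \<inter> frontier \<Omega>" B] order_trans by blast
  then have "emeasure \<sigma> (B \<inter> frontier \<Omega>) - emeasure \<sigma> A = 0" by (simp add: diff_eq_0_iff_ennreal less_top[symmetric])
  finally have "B \<inter> frontier \<Omega> - A \<in> null_sets \<sigma>" using Bs A by auto
  then have "AE x in \<sigma>. x \<notin> B \<inter> frontier \<Omega> - A" by (rule AE_not_in)
  then have "AE x in \<sigma>. x \<in> A \<longleftrightarrow> x \<in> B"
    using AE_space by eventually_elim (use B(2) in auto)
  then show ?thesis using B(1) by blast
qed

lemma continuous_L2_\<sigma>: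
  fixes f :: "'a \<Rightarrow> real"
  assumes "continuous_on UNIV f"
  shows "f \<in> L2 \<sigma>"
proof -
  have "compact (frontier \<Omega>)" using bounded_\<Omega> by (simp add: compact_frontier_bounded)
  then have "compact (f ` frontier \<Omega>)"
    using assms by (intro compact_continuous_image continuous_on_subset[OF assms]) auto
  then obtain C where C: "\<And>x. x \<in> frontier \<Omega> \<Longrightarrow> \<bar>f x\<bar> \<le> C"
    using compact_imp_bounded by (fastforce simp: bounded_iff)
  have "f \<in> borel_measurable \<sigma>"
    using measurable_compose[OF id_\<sigma> borel_measurable_continuous_onI[OF assms]] .
  then show ?thesis using C by (intro L2_bounded fin_\<sigma>) auto
qed

lemma has_trace_classical:
  assumes "Ck 1 \<phi>"
  shows "has_trace \<Omega> \<phi> \<phi>"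
proof -
  have c: "continuous_on UNIV \<phi>" using assms by (rule Ck_continuous)
  have "has_weak_gradient \<Omega> (\<lambda>x. 0) (\<lambda>x. 0)"
    by (rule has_weak_gradientI) (auto simp: l2ip_def)
  then have "H1_norm \<Omega> (\<lambda>x. 0) = 0" by (subst H1_norm_eq) (auto simp: l2norm_def)
  then show ?thesis
    unfolding has_trace_def H1_def
    using assms has_weak_gradient_classical[OF assms] continuous_L2[OF c] continuous_L2_\<sigma>[OF c]
    by (auto intro!: exI[of _ "\<lambda>_. \<phi>"])
qed

text \<open>
  Box cutoffs converge boundedly to indicator functions of boxes.
\<close>

theorem AE_zero_if_trace_integrals_zero:
  assumes f: "f \<in> L2 \<sigma>" and z: "\<And>\<phi>. smooth \<phi> \<Longrightarrow> l2ip \<sigma> \<phi> f = 0"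
  shows "AE x in \<sigma>. f x = 0"
proof (rule AE_zero_if_box_integrals_zero[OF _ id_\<sigma> _ borel_approximation_\<sigma>])
  show int: "integrable \<sigma> f" by (rule L2_integrable[OF f fin_\<sigma>])
  then have fm: "f \<in> borel_measurable \<sigma>" by simp
  fix a b :: 'a
  have bm: "box_cutoff n a b \<in> borel_measurable \<sigma>" for n
    by (intro L2_measurable continuous_L2_\<sigma> smooth_continuous smooth_box_cutoff)
  have "(\<lambda>n. \<integral>x. f x * box_cutoff (real n) a b x \<partial>\<sigma>) \<longlonglongrightarrow> (\<integral>x. f x * indicator (box a b) x \<partial>\<sigma>)"
  proof (rule integral_dominated_convergence[where w="\<lambda>x. \<bar>f x\<bar>"])
    show "AE x in \<sigma>. (\<lambda>n. f x * box_cutoff (real n) a b x) \<longlonglongrightarrow> f x * indicator (box a b) x"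
      by (intro AE_I2 tendsto_mult tendsto_const box_cutoff_tendsto_indicator)
    show "AE x in \<sigma>. norm (f x * box_cutoff (real n) a b x) \<le> \<bar>f x\<bar>" for n
      by (intro AE_I2) (simp add: abs_mult mult_left_le box_cutoff_nonneg box_cutoff_le_one)
    show "(\<lambda>x. f x * indicator (box a b) x) \<in> borel_measurable \<sigma>"
      using measurable_compose[OF id_\<sigma> borel_measurable_indicator[of "box a b"]]
      by (intro borel_measurable_times fm) auto
    show "(\<lambda>x. f x * box_cutoff (real n) a b x) \<in> borel_measurable \<sigma>" for n
      by (intro borel_measurable_times fm bm)
  qed (use int in auto)
  moreover have "(\<integral>x. f x * box_cutoff (real n) a b x \<partial>\<sigma>) = 0" for n
    using z[OF smooth_box_cutoff, of "real n" a b] by (simp add: l2ip_def mult.commute)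
  ultimately have "(\<lambda>n. 0) \<longlonglongrightarrow> (\<integral>x. f x * indicator (box a b) x \<partial>\<sigma>)" by simp
  then show "(\<integral>x. f x * indicator (box a b) x \<partial>\<sigma>) = 0"
    using LIMSEQ_unique[OF _ tendsto_const] by metis
qed

lemma normal_derivative_unique:
  assumes "has_normal_derivative \<Omega> u d" "has_normal_derivative \<Omega> u e"
  shows "AE x in \<sigma>. d x = e x"
proof -
  have L: "d \<in> L2 \<sigma>" "e \<in> L2 \<sigma>" using assms by (auto simp: has_normal_derivative_iff)
  have "AE x in \<sigma>. d x - e x = 0"
  proof (rule AE_zero_if_trace_integrals_zero[OF L2_diff[OF L]])
    fix \<phi> :: "'a \<Rightarrow> real" assume s: "smooth \<phi>"
    then have t: "has_trace \<Omega> \<phi> \<phi>" by (intro has_trace_classical smooth_Ck)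
    have "\<phi> \<in> L2 \<sigma>" using s by (intro continuous_L2_\<sigma> smooth_continuous)
    then show "l2ip \<sigma> \<phi> (\<lambda>x. d x - e x) = 0"
      using assms t l2ip_diff_left[OF L, of \<phi>] by (simp add: has_normal_derivative_iff l2ip_sym)
  qed
  then show ?thesis by simp
qed

end

section \<open>Positive semidefinite forms\<close>

text \<open>
  The forms are only semidefinite, because functions that agree almost everywhere are not identified.
\<close>

locale psd_form =
  fixes W :: "('x \<Rightarrow> real) set" and a :: "('x \<Rightarrow> real) \<Rightarrow> ('x \<Rightarrow> real) \<Rightarrow> real"
  assumes lincomb: "u \<in> W \<Longrightarrow> v \<in> W \<Longrightarrow> (\<lambda>x. u x + c * v x) \<in> W"
    and sym: "u \<in> W \<Longrightarrow> v \<in> W \<Longrightarrow> a u v = a v u"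
    and lin: "u \<in> W \<Longrightarrow> v \<in> W \<Longrightarrow> w \<in> W \<Longrightarrow> a (\<lambda>x. u x + c * v x) w = a u w + c * a v w"
    and nonneg: "u \<in> W \<Longrightarrow> 0 \<le> a u u"
begin

lemma lin_right: "u \<in> W \<Longrightarrow> v \<in> W \<Longrightarrow> w \<in> W \<Longrightarrow> a w (\<lambda>x. u x + c * v x) = a w u + c * a w v"
  by (simp add: sym[of w] lincomb lin)

lemma square: "u \<in> W \<Longrightarrow> v \<in> W \<Longrightarrow> a (\<lambda>x. u x + c * v x) (\<lambda>x. u x + c * v x) = a u u + 2 * c * a u v + c\<^sup>2 * a v v"
  by (simp add: lin_right lin lincomb sym[of v u] algebra_simps power2_eq_square)

lemma diff: "u \<in> W \<Longrightarrow> v \<in> W \<Longrightarrow> (\<lambda>x. u x - v x) \<in> W"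
  using lincomb[of u v "-1"] by simp

lemma diff_left: "u \<in> W \<Longrightarrow> v \<in> W \<Longrightarrow> w \<in> W \<Longrightarrow> a (\<lambda>x. u x - v x) w = a u w - a v w"
  using lin[of u v w "-1"] by simp

lemma zero: "u \<in> W \<Longrightarrow> (\<lambda>x. 0) \<in> W"
  using diff[of u u] by simp

lemma cmult: "u \<in> W \<Longrightarrow> (\<lambda>x. c * u x) \<in> W"
  using lincomb[of "\<lambda>x. 0" u c] zero by simp

lemma zero_left: "w \<in> W \<Longrightarrow> a (\<lambda>x. 0) w = 0"
  using diff_left[of w w w] by simp

lemma cmult_left: "u \<in> W \<Longrightarrow> w \<in> W \<Longrightarrow> a (\<lambda>x. c * u x) w = c * a u w"
  using lin[of "\<lambda>x. 0" u w c] zero[of u] zero_left[of w] by simp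

lemma square_diff: "u \<in> W \<Longrightarrow> v \<in> W \<Longrightarrow> a (\<lambda>x. u x - v x) (\<lambda>x. u x - v x) = a u u - 2 * a u v + a v v"
  using square[of u v "-1"] by simp

lemma square_cmult: "u \<in> W \<Longrightarrow> a (\<lambda>x. c * u x) (\<lambda>x. c * u x) = c\<^sup>2 * a u u"
  using cmult_left[of u "\<lambda>x. c * u x" c] cmult_left[of u u c] sym[of u "\<lambda>x. c * u x"] cmult[of u c]
  by (simp add: power2_eq_square)

lemma null_orthogonal:
  assumes "u \<in> W" "v \<in> W" "a u u = 0"
  shows "a u v = 0"
proof (rule ccontr)
  assume n: "a u v \<noteq> 0"
  define t where "t = - (a v v + 1) / (2 * a u v)"
  have "0 \<le> a (\<lambda>x. v x + t * u x) (\<lambda>x. v x + t * u x)" using assms by (intro nonneg lincomb)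
  also have "\<dots> = a v v + 2 * t * a u v" using assms by (simp add: square sym[of v u])
  also have "\<dots> = -1" using n by (simp add: t_def field_simps)
  finally show False by simp
qed

lemma sum_left:
  assumes w: "w \<in> W" and "finite I" "\<And>i. i \<in> I \<Longrightarrow> f i \<in> W"
  shows "(\<lambda>x. \<Sum>i\<in>I. c i * f i x) \<in> W \<and> a (\<lambda>x. \<Sum>i\<in>I. c i * f i x) w = (\<Sum>i\<in>I. c i * a (f i) w)"
  using assms(2,3)
proof (induction I rule: finite_induct)
  case empty
  then show ?case using zero[OF w] zero_left[OF w] by simp
next
  case (insert i I)
  then have IH: "(\<lambda>x. \<Sum>i\<in>I. c i * f i x) \<in> W" "a (\<lambda>x. \<Sum>i\<in>I. c i * f i x) w = (\<Sum>i\<in>I. c i * a (f i) w)" by auto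
  have "(\<lambda>x. (\<Sum>i\<in>I. c i * f i x) + c i * f i x) \<in> W" using insert IH by (intro lincomb) auto
  moreover have "a (\<lambda>x. (\<Sum>i\<in>I. c i * f i x) + c i * f i x) w = (\<Sum>i\<in>I. c i * a (f i) w) + c i * a (f i) w"
    using insert IH w by (subst lin) auto
  ultimately show ?case using insert by (simp add: add.commute)
qed

text \<open>
  A sequence in \<open>V\<close> that minimizes the distance to \<open>f\<close> is a Cauchy sequence by the parallelogram
  law, and a first variation shows that \<open>f - v n\<close> is asymptotically orthogonal to \<open>V\<close>.  The limit
  is left to the applications, whose spaces \<open>V\<close> of test functions are not complete.
\<close>

theorem projection_sequence:
  assumes VW: "V \<subseteq> W" and V0: "v0 \<in> V" and Vlin: "\<And>u v c. u \<in> V \<Longrightarrow> v \<in> V \<Longrightarrow> (\<lambda>x. u x + c * v x) \<in> V" and f: "f \<in> W"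
  shows "\<exists>v. (\<forall>n. v n \<in> V) \<and>
     (\<forall>e>0. \<exists>N. \<forall>m\<ge>N. \<forall>n\<ge>N. a (\<lambda>x. v m x - v n x) (\<lambda>x. v m x - v n x) < e) \<and>
     (\<forall>\<psi>\<in>V. (\<lambda>n. a (\<lambda>x. f x - v n x) \<psi>) \<longlonglongrightarrow> 0)"
proof -
  define Q where "Q v = a (\<lambda>x. f x - v x) (\<lambda>x. f x - v x)" for v
  have Q0: "Q v \<ge> 0" if "v \<in> V" for v unfolding Q_def using that VW f by (intro nonneg diff) auto
  define d where "d = (INF v\<in>V. Q v)"
  have bb: "bdd_below (Q ` V)" using Q0 by (auto intro!: bdd_belowI[of _ 0])
  have dQ: "d \<le> Q v" if "v \<in> V" for v unfolding d_def using bb that by (rule cINF_lower)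
  define t :: "nat \<Rightarrow> real" where "t n = inverse (real (Suc n))" for n
  have t0: "t n > 0" for n by (simp add: t_def)
  have tl: "t \<longlonglongrightarrow> 0" unfolding t_def[abs_def] by (rule LIMSEQ_inverse_real_of_nat)
  have "\<exists>v\<in>V. Q v < d + t n" for n
  proof -
    have "Inf (Q ` V) < d + t n" using t0[of n] by (simp add: d_def)
    then show ?thesis using cInf_lessD[of "Q ` V" "d + t n"] V0 by blast
  qed
  then obtain v where v: "\<And>n. v n \<in> V" "\<And>n. Q (v n) < d + t n" by metis
  have vW: "v n \<in> W" for n using v VW by auto
  have par: "a (\<lambda>x. v m x - v n x) (\<lambda>x. v m x - v n x) \<le> 2 * t m + 2 * t n" for m n
  proof -
    let ?p = "\<lambda>x. f x - v m x" and ?q = "\<lambda>x. f x - v n x"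
    have pq: "?p \<in> W" "?q \<in> W" using f vW by (auto intro: diff)
    \<comment> \<open>The midpoint of \<open>v m\<close> and \<open>v n\<close>, written with the closure property of \<open>V\<close>.\<close>
    define w where "w = (\<lambda>x. (\<lambda>x. v m x + (-1/2) * v m x) x + (1/2) * v n x)"
    have wV: "w \<in> V" unfolding w_def using v by (intro Vlin)
    have "(\<lambda>x. f x - w x) = (\<lambda>x. (1/2) * (\<lambda>x. ?p x + 1 * ?q x) x)" by (auto simp: w_def field_simps)
    then have "Q w = (1/2)\<^sup>2 * a (\<lambda>x. ?p x + 1 * ?q x) (\<lambda>x. ?p x + 1 * ?q x)"
      unfolding Q_def using square_cmult[OF lincomb[OF pq, of 1], of "1/2"] by simp
    also have "\<dots> = (1/4) * (a ?p ?p + 2 * a ?p ?q + a ?q ?q)"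
      using square[OF pq, of 1] by (simp add: power2_eq_square)
    finally have 1: "4 * Q w = Q (v m) + 2 * a ?p ?q + Q (v n)" unfolding Q_def by simp
    have "(\<lambda>x. v m x - v n x) = (\<lambda>x. ?q x - ?p x)" by auto
    then have "a (\<lambda>x. v m x - v n x) (\<lambda>x. v m x - v n x) = Q (v n) - 2 * a ?p ?q + Q (v m)"
      unfolding Q_def using square_diff[OF pq(2,1)] sym[OF pq] by simp
    then show ?thesis using 1 dQ[OF wV] v(2)[of m] v(2)[of n] by linarith
  qed
  have C: "\<exists>N. \<forall>m\<ge>N. \<forall>n\<ge>N. a (\<lambda>x. v m x - v n x) (\<lambda>x. v m x - v n x) < e" if e: "e > 0" for e
  proof -
    have "\<forall>\<^sub>F n in sequentially. t n < e/4" using tl e by (auto dest: order_tendstoD(2)[of _ _ _ "e/4"])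
    then obtain N where N: "\<And>n. n \<ge> N \<Longrightarrow> t n < e/4" by (auto simp: eventually_sequentially)
    have "a (\<lambda>x. v m x - v n x) (\<lambda>x. v m x - v n x) < e" if "m \<ge> N" "n \<ge> N" for m n
      using par[of m n] N[OF that(1)] N[OF that(2)] by linarith
    then show ?thesis by blast
  qed
  have O: "(\<lambda>n. a (\<lambda>x. f x - v n x) \<psi>) \<longlonglongrightarrow> 0" if \<psi>: "\<psi> \<in> V" for \<psi>
  proof -
    have \<psi>W: "\<psi> \<in> W" using \<psi> VW by auto
    have bd: "\<bar>a (\<lambda>x. f x - v n x) \<psi>\<bar> \<le> sqrt (t n) * (1 + a \<psi> \<psi>)" for n
    proof -
      let ?p = "\<lambda>x. f x - v n x"
      have p: "?p \<in> W" using f vW by (auto intro: diff)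
      have *: "2 * s * a ?p \<psi> \<le> t n + s\<^sup>2 * a \<psi> \<psi>" for s
      proof -
        have "(\<lambda>x. v n x + s * \<psi> x) \<in> V" using v \<psi> by (intro Vlin)
        then have "d \<le> Q (\<lambda>x. v n x + s * \<psi> x)" by (rule dQ)
        also have "\<dots> = a (\<lambda>x. ?p x + (-s) * \<psi> x) (\<lambda>x. ?p x + (-s) * \<psi> x)"
          unfolding Q_def by (simp add: algebra_simps)
        also have "\<dots> = Q (v n) - 2 * s * a ?p \<psi> + s\<^sup>2 * a \<psi> \<psi>"
          using square[OF p \<psi>W, of "-s"] by (simp add: Q_def)
        finally show ?thesis using v(2)[of n] by linarith
      qed
      \<comment> \<open>The step size that balances the two terms on the right-hand side of the preceding inequality.\<close>
      define s where "s = sqrt (t n)"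
      have s: "s > 0" "s\<^sup>2 = t n" using t0[of n] by (auto simp: s_def)
      have "2 * s * \<bar>a ?p \<psi>\<bar> \<le> s\<^sup>2 * (1 + a \<psi> \<psi>)"
        using *[of s] *[of "-s"] s by (cases "a ?p \<psi> \<ge> 0") (auto simp: algebra_simps)
      then have "s * (2 * \<bar>a ?p \<psi>\<bar>) \<le> s * (s * (1 + a \<psi> \<psi>))" by (simp add: power2_eq_square algebra_simps)
      then have "2 * \<bar>a ?p \<psi>\<bar> \<le> s * (1 + a \<psi> \<psi>)" using s(1) by simp
      then show ?thesis unfolding s_def by linarith
    qed
    have L: "(\<lambda>n. sqrt (t n) * (1 + a \<psi> \<psi>)) \<longlonglongrightarrow> sqrt 0 * (1 + a \<psi> \<psi>)"
      by (intro tendsto_intros tl)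
    show ?thesis
    proof (rule Lim_null_comparison)
      show "\<forall>\<^sub>F n in sequentially. norm (a (\<lambda>x. f x - v n x) \<psi>) \<le> sqrt (t n) * (1 + a \<psi> \<psi>)"
        using bd by (intro always_eventually) simp
      show "(\<lambda>n. sqrt (t n) * (1 + a \<psi> \<psi>)) \<longlonglongrightarrow> 0" using L by simp
    qed
  qed
  show ?thesis using v(1) C O by blast
qed

end

section \<open>Density of the test functions\<close>

context bounded_open_set begin

lemma psd_form_L2: "psd_form (L2 \<mu>) (l2ip \<mu>)"
  by unfold_locales (auto intro: L2_lincomb l2ip_sym l2ip_lincomb_left simp: l2ip_self)

text \<open>
  The projections of \<open>f\<close> to the test functions converge to some \<open>p\<close>, and \<open>f - p\<close> is orthogonal to all
  test functions, hence 0.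
\<close>

theorem test_functions_dense:
  assumes f: "f \<in> L2 \<mu>" and e: "e > 0"
  shows "\<exists>\<phi>\<in>Cc_infinity \<Omega>. l2norm \<mu> (\<lambda>x. \<phi> x - f x) < e"
proof -
  interpret psd_form "L2 \<mu>" "l2ip \<mu>" by (rule psd_form_L2)
  obtain v where v: "\<And>n. v n \<in> Cc_infinity \<Omega>"
    and C: "\<And>e. e > 0 \<Longrightarrow> \<exists>N. \<forall>m\<ge>N. \<forall>n\<ge>N. l2ip \<mu> (\<lambda>x. v m x - v n x) (\<lambda>x. v m x - v n x) < e"
    and O: "\<And>\<psi>. \<psi> \<in> Cc_infinity \<Omega> \<Longrightarrow> (\<lambda>n. l2ip \<mu> (\<lambda>x. f x - v n x) \<psi>) \<longlonglongrightarrow> 0"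
    using projection_sequence[of "Cc_infinity \<Omega>" "\<lambda>x. 0" f, OF _ Cc_infinity_zero Cc_infinity_lincomb f] test_L2
    by blast
  have vL: "v n \<in> L2 \<mu>" for n by (rule test_L2[OF v])
  have Ch: "\<exists>N. \<forall>m\<ge>N. \<forall>n\<ge>N. l2norm \<mu> (\<lambda>x. v m x - v n x) < e" if "e > 0" for e
  proof -
    obtain N where N: "\<And>m n. m \<ge> N \<Longrightarrow> n \<ge> N \<Longrightarrow> (l2norm \<mu> (\<lambda>x. v m x - v n x))\<^sup>2 < e\<^sup>2"
      using C[of "e\<^sup>2"] \<open>e > 0\<close> by (auto simp: l2ip_self)
    have "l2norm \<mu> (\<lambda>x. v m x - v n x) < e" if "m \<ge> N" "n \<ge> N" for m n
      using N[OF that] \<open>e > 0\<close> by (rule power2_less_imp_less[OF _ less_imp_le])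
    then show ?thesis by blast
  qed
  obtain p where p: "p \<in> L2 \<mu>" "(\<lambda>n. l2norm \<mu> (\<lambda>x. v n x - p x)) \<longlonglongrightarrow> 0"
    using L2_complete[OF fin vL Ch] by blast
  have "AE x in \<mu>. p x = f x"
  proof (rule AE_eq_if_test_ip_eq[OF p(1) f])
    fix \<psi> assume \<psi>: "\<psi> \<in> Cc_infinity \<Omega>"
    have "(\<lambda>n. l2ip \<mu> (v n) \<psi>) \<longlonglongrightarrow> l2ip \<mu> p \<psi>" by (intro l2ip_tendsto vL p test_L2[OF \<psi>])
    then have "(\<lambda>n. l2ip \<mu> f \<psi> - l2ip \<mu> (v n) \<psi>) \<longlonglongrightarrow> l2ip \<mu> f \<psi> - l2ip \<mu> p \<psi>" by (intro tendsto_intros)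
    moreover have "(\<lambda>n. l2ip \<mu> f \<psi> - l2ip \<mu> (v n) \<psi>) \<longlonglongrightarrow> 0"
      using O[OF \<psi>] by (simp add: l2ip_diff_left[OF f vL test_L2[OF \<psi>]])
    ultimately show "l2ip \<mu> p \<psi> = l2ip \<mu> f \<psi>" using LIMSEQ_unique by fastforce
  qed
  then have eq: "l2norm \<mu> (\<lambda>x. v n x - p x) = l2norm \<mu> (\<lambda>x. v n x - f x)" for n
    using L2_measurable[OF L2_diff[OF vL p(1)]] L2_measurable[OF L2_diff[OF vL f]]
    by (intro l2norm_cong_AE) (auto elim: eventually_mono)
  have "\<forall>\<^sub>F n in sequentially. l2norm \<mu> (\<lambda>x. v n x - f x) < e"
    using p(2) e unfolding eq by (auto dest: order_tendstoD(2))
  then obtain n where "l2norm \<mu> (\<lambda>x. v n x - f x) < e"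
    using eventually_happens trivial_limit_sequentially by blast
  then show ?thesis using v by blast
qed

end

section \<open>Convolution and translated mollifiers\<close>

lemma compact_support_uniformly_continuous:
  fixes f :: "'a::euclidean_space \<Rightarrow> real"
  assumes f: "continuous_on UNIV f" and K: "compact K" "\<And>x. x \<notin> K \<Longrightarrow> f x = 0" and e: "e > 0"
  shows "\<exists>d>0. \<forall>x y. dist x y < d \<longrightarrow> \<bar>f x - f y\<bar> < e"
proof -
  obtain R where R: "\<And>x. x \<in> K \<Longrightarrow> norm x \<le> R" using compact_imp_bounded[OF K(1)] by (auto simp: bounded_iff)
  have "uniformly_continuous_on (cball 0 (R + 1)) f"
    using f by (intro compact_uniformly_continuous continuous_on_subset[OF f]) auto
  then obtain d where d: "d > 0" "\<And>x y. x \<in> cball 0 (R+1) \<Longrightarrow> y \<in> cball 0 (R+1) \<Longrightarrow> dist y x < d \<Longrightarrow> dist (f y) (f x) < e"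
    using e unfolding uniformly_continuous_on_def by metis
  have "\<bar>f x - f y\<bar> < e" if "dist x y < min d 1" for x y
  proof (cases "x \<in> K \<or> y \<in> K")
    case True
    have "norm x \<le> norm y + dist x y" "norm y \<le> norm x + dist x y"
      using norm_triangle_sub[of x y] norm_triangle_sub[of y x] by (auto simp: dist_norm norm_minus_commute)
    then have "x \<in> cball 0 (R+1)" "y \<in> cball 0 (R+1)" using True R[of x] R[of y] that by auto
    then show ?thesis using d(2)[of y x] that by (simp add: dist_norm)
  next
    case False
    then show ?thesis using K(2) e by simp
  qed
  then show ?thesis using d(1) by (intro exI[of _ "min d 1"]) auto
qed

lemma continuous_reflect:
  fixes k :: "'a::euclidean_space \<Rightarrow> real"
  assumes "continuous_on UNIV k"
  shows "continuous_on UNIV (\<lambda>y. k (x - y))"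
  using continuous_on_compose2[OF assms, of UNIV "\<lambda>y. x - y"]
  by (simp add: continuous_on_diff)

text \<open>
  By the mean value theorem along the segment and the uniform continuity of the partial derivatives.
\<close>

lemma Cc_UNIV_uniform_linearization:
  fixes k :: "'a::euclidean_space \<Rightarrow> real"
  assumes k: "k \<in> Cc_infinity UNIV" and e: "e > 0"
  shows "\<exists>d>0. \<forall>z h. norm h < d \<longrightarrow> \<bar>k (z + h) - k z - (\<Sum>i\<in>Basis. (h \<bullet> i) * partial_deriv i k z)\<bar> \<le> e * norm h"
proof -
  define e' where "e' = e / real DIM('a)"
  have e': "e' > 0" using e by (simp add: e'_def)
  have "\<exists>d>0. \<forall>x y. dist x y < d \<longrightarrow> \<bar>partial_deriv i k x - partial_deriv i k y\<bar> < e'" if i: "i \<in> Basis" for i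
  proof -
    obtain K where K: "smooth (partial_deriv i k)" "compact K" "K \<subseteq> UNIV" "\<And>x. x \<notin> K \<Longrightarrow> partial_deriv i k x = 0"
      by (rule Cc_infinityE[OF Cc_infinity_partial_deriv[OF k i]]) (rule that)
    show ?thesis by (rule compact_support_uniformly_continuous[OF smooth_continuous[OF K(1)] K(2,4) e'])
  qed
  then have "\<forall>i\<in>Basis. \<exists>d. d > 0 \<and> (\<forall>x y. dist x y < d \<longrightarrow> \<bar>partial_deriv i k x - partial_deriv i k y\<bar> < e')"
    by blast
  from bchoice[OF this] obtain d where
    "\<forall>i\<in>Basis. d i > 0 \<and> (\<forall>x y. dist x y < d i \<longrightarrow> \<bar>partial_deriv i k x - partial_deriv i k y\<bar> < e')" by blast
  then have d: "\<And>i. i \<in> Basis \<Longrightarrow> d i > 0"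
    "\<And>i x y. i \<in> Basis \<Longrightarrow> dist x y < d i \<Longrightarrow> \<bar>partial_deriv i k x - partial_deriv i k y\<bar> < e'" by blast+
  define D where "D = Min (d ` Basis)"
  have D: "D > 0" "\<And>i. i \<in> Basis \<Longrightarrow> D \<le> d i" unfolding D_def using d(1) by (auto simp: Min_gr_iff)
  have "\<bar>k (z + h) - k z - (\<Sum>i\<in>Basis. (h \<bullet> i) * partial_deriv i k z)\<bar> \<le> e * norm h" if h: "norm h < D" for z h
  proof -
    have der: "((\<lambda>s. k (z + s *\<^sub>R h)) has_real_derivative (\<Sum>i\<in>Basis. (h \<bullet> i) * partial_deriv i k (z + s *\<^sub>R h))) (at s)" for s
    proof -
      have 1: "((\<lambda>s. z + s *\<^sub>R h) has_derivative (\<lambda>t. t *\<^sub>R h)) (at s)" by (auto intro!: derivative_eq_intros)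
      have 2: "(k has_derivative (\<lambda>w. \<Sum>i\<in>Basis. (w \<bullet> i) * partial_deriv i k (z + s *\<^sub>R h))) (at (z + s *\<^sub>R h))"
        by (rule has_derivative_partial[OF smooth_differentiable[OF Cc_infinity_smooth[OF k]]])
      have 3: "(\<lambda>t. \<Sum>i\<in>Basis. ((t *\<^sub>R h) \<bullet> i) * partial_deriv i k (z + s *\<^sub>R h))
          = (*) (\<Sum>i\<in>Basis. (h \<bullet> i) * partial_deriv i k (z + s *\<^sub>R h))"
        by (rule ext) (simp add: sum_distrib_right sum_distrib_left ac_simps)
      show ?thesis
        using has_derivative_compose[OF 1 2] unfolding has_field_derivative_def 3 .
    qed
    obtain s where s: "0 < s" "s < 1" "k (z + 1 *\<^sub>R h) - k (z + 0 *\<^sub>R h) = (1 - 0) * (\<Sum>i\<in>Basis. (h \<bullet> i) * partial_deriv i k (z + s *\<^sub>R h))"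
      using MVT2[of 0 1 "\<lambda>s. k (z + s *\<^sub>R h)" "\<lambda>s. \<Sum>i\<in>Basis. (h \<bullet> i) * partial_deriv i k (z + s *\<^sub>R h)"] der by auto
    have "k (z + h) - k z - (\<Sum>i\<in>Basis. (h \<bullet> i) * partial_deriv i k z)
        = (\<Sum>i\<in>Basis. (h \<bullet> i) * (partial_deriv i k (z + s *\<^sub>R h) - partial_deriv i k z))"
      using s(3) by (simp add: right_diff_distrib sum_subtractf)
    also have "\<bar>\<dots>\<bar> \<le> (\<Sum>i\<in>(Basis::'a set). norm h * e')"
    proof (rule order_trans[OF sum_abs sum_mono])
      fix i :: 'a assume i: "i \<in> Basis"
      have "dist (z + s *\<^sub>R h) z < d i"
      proof -
        have "dist (z + s *\<^sub>R h) z = s * norm h" using s by (simp add: dist_norm)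
        also have "\<dots> \<le> norm h" using s by (intro mult_left_le_one_le) auto
        finally show ?thesis using h D(2)[OF i] by linarith
      qed
      then show "\<bar>(h \<bullet> i) * (partial_deriv i k (z + s *\<^sub>R h) - partial_deriv i k z)\<bar> \<le> norm h * e'"
        unfolding abs_mult using d(2)[OF i] Basis_le_norm[OF i, of h] by (intro mult_mono) (auto intro: less_imp_le)
    qed
    also have "\<dots> = e * norm h" by (simp add: e'_def)
    finally show ?thesis .
  qed
  then show ?thesis using D(1) by blast
qed

context bounded_open_set begin

text \<open>
  The integral extends over \<open>\<Omega>\<close> only, so this is the convolution with the extension of \<open>u\<close> by 0.
\<close>

definition conv :: "('a \<Rightarrow> real) \<Rightarrow> ('a \<Rightarrow> real) \<Rightarrow> 'a \<Rightarrow> real" where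
  "conv u k x = (\<integral>y. u y * k (x - y) \<partial>\<mu>)"

lemma conv_integrable:
  assumes u: "u \<in> L2 \<mu>" and k: "k \<in> Cc_infinity UNIV"
  shows "integrable \<mu> (\<lambda>y. u y * k (x - y))"
proof -
  have "(\<lambda>y. k (x - y)) \<in> L2 \<mu>"
    by (intro continuous_L2 continuous_reflect smooth_continuous Cc_infinity_smooth[OF k])
  then show ?thesis using u by (rule L2_times_integrable[rotated])
qed

lemma conv_has_derivative:
  assumes u: "u \<in> L2 \<mu>" and k: "k \<in> Cc_infinity UNIV"
  shows "(conv u k has_derivative (\<lambda>h. \<Sum>i\<in>Basis. (h \<bullet> i) * conv u (partial_deriv i k) x)) (at x)"
  unfolding has_derivative_at_alt
proof (intro conjI allI impI)
  show "bounded_linear (\<lambda>h. \<Sum>i\<in>Basis. (h \<bullet> i) * conv u (partial_deriv i k) x)"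
    by (intro bounded_linear_sum bounded_linear_mult_const bounded_linear_inner_left)
  fix e :: real assume e: "0 < e"
  have ui: "integrable \<mu> u" by (rule L2_integrable[OF u fin])
  define A where "A = (\<integral>y. \<bar>u y\<bar> \<partial>\<mu>) + 1"
  have A: "A > 0" "(\<integral>y. \<bar>u y\<bar> \<partial>\<mu>) \<le> A" unfolding A_def by (auto intro: add_nonneg_pos)
  obtain d where d: "d > 0" "\<And>z h. norm h < d \<Longrightarrow>
      \<bar>k (z + h) - k z - (\<Sum>i\<in>Basis. (h \<bullet> i) * partial_deriv i k z)\<bar> \<le> e / A * norm h"
    using Cc_UNIV_uniform_linearization[OF k, of "e / A"] e A by auto
  have "norm (conv u k y - conv u k x - (\<Sum>i\<in>Basis. ((y - x) \<bullet> i) * conv u (partial_deriv i k) x)) \<le> e * norm (y - x)"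
    if y: "norm (y - x) < d" for y
  proof -
    define h where "h = y - x"
    let ?r = "\<lambda>w. k (y - w) - k (x - w) - (\<Sum>i\<in>Basis. (h \<bullet> i) * partial_deriv i k (x - w))"
    note I = conv_integrable[OF u k] conv_integrable[OF u Cc_infinity_partial_deriv[OF k]]
    have i3: "integrable \<mu> (\<lambda>w. \<Sum>i\<in>Basis. (h \<bullet> i) * (u w * partial_deriv i k (x - w)))"
      using I(2) by (intro Bochner_Integration.integrable_sum integrable_mult_right) auto
    have e1: "(\<lambda>w. u w * ?r w) = (\<lambda>w. u w * k (y - w) - u w * k (x - w) - (\<Sum>i\<in>Basis. (h \<bullet> i) * (u w * partial_deriv i k (x - w))))"
      by (simp add: algebra_simps sum_distrib_left)
    have int: "integrable \<mu> (\<lambda>w. u w * ?r w)"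
      unfolding e1 using I(1) i3 by (intro Bochner_Integration.integrable_diff)
    have E: "conv u k y - conv u k x - (\<Sum>i\<in>Basis. (h \<bullet> i) * conv u (partial_deriv i k) x) = (\<integral>w. u w * ?r w \<partial>\<mu>)"
      unfolding e1 conv_def using I i3 by (simp add: Bochner_Integration.integral_sum)
    have "\<bar>\<integral>w. u w * ?r w \<partial>\<mu>\<bar> \<le> (\<integral>w. \<bar>u w * ?r w\<bar> \<partial>\<mu>)" by (rule integral_abs_bound)
    also have "\<dots> \<le> (\<integral>w. (e / A * norm h) * \<bar>u w\<bar> \<partial>\<mu>)"
    proof (rule integral_mono)
      show "integrable \<mu> (\<lambda>w. \<bar>u w * ?r w\<bar>)" using int by (rule integrable_abs)
      show "integrable \<mu> (\<lambda>w. (e / A * norm h) * \<bar>u w\<bar>)"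
        by (intro integrable_mult_right integrable_abs ui)
      fix w
      have yw: "x - w + h = y - w" by (simp add: h_def)
      have "norm h < d" using y by (simp add: h_def)
      from d(2)[OF this, of "x - w"] have "\<bar>?r w\<bar> \<le> e / A * norm h" unfolding yw .
      then have "\<bar>?r w\<bar> * \<bar>u w\<bar> \<le> (e / A * norm h) * \<bar>u w\<bar>"
        by (rule mult_right_mono) (rule abs_ge_zero)
      then show "\<bar>u w * ?r w\<bar> \<le> (e / A * norm h) * \<bar>u w\<bar>"
        by (simp only: abs_mult mult.commute[of "\<bar>u w\<bar>"])
    qed
    also have "\<dots> = (e / A * norm h) * (\<integral>w. \<bar>u w\<bar> \<partial>\<mu>)" by simp
    also have "\<dots> \<le> (e / A * norm h) * A" using A e by (intro mult_left_mono) auto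
    also have "\<dots> = e * norm h" using A by simp
    finally have "norm (conv u k y - conv u k x - (\<Sum>i\<in>Basis. (h \<bullet> i) * conv u (partial_deriv i k) x)) \<le> e * norm h"
      unfolding E real_norm_def .
    then show ?thesis unfolding h_def .
  qed
  then show "\<exists>d>0. \<forall>y. norm (y - x) < d \<longrightarrow>
      norm (conv u k y - conv u k x - (\<Sum>i\<in>Basis. ((y - x) \<bullet> i) * conv u (partial_deriv i k) x)) \<le> e * norm (y - x)"
    using d(1) by blast
qed

lemma partial_deriv_conv:
  assumes "u \<in> L2 \<mu>" "k \<in> Cc_infinity UNIV" "j \<in> Basis"
  shows "partial_deriv j (conv u k) = conv u (partial_deriv j k)"
proof
  fix x
  have "partial_deriv j (conv u k) x = (\<Sum>i\<in>Basis. (j \<bullet> i) * conv u (partial_deriv i k) x)"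
    by (rule partial_deriv_eq[OF conv_has_derivative[OF assms(1,2)]])
  also have "\<dots> = (\<Sum>i\<in>Basis. if i = j then conv u (partial_deriv i k) x else 0)"
    using assms(3) by (intro sum.cong refl) (simp add: inner_Basis)
  also have "\<dots> = conv u (partial_deriv j k) x" using assms(3) by simp
  finally show "partial_deriv j (conv u k) x = conv u (partial_deriv j k) x" .
qed

lemma smooth_conv:
  assumes u: "u \<in> L2 \<mu>" and k: "k \<in> Cc_infinity UNIV"
  shows "smooth (conv u k)"
  unfolding smooth_def
proof
  fix n show "Ck n (conv u k)"
    using k
  proof (induction n arbitrary: k)
    case 0
    have "conv u k differentiable (at x)" for x
      using conv_has_derivative[OF u 0] by (rule differentiableI)
    then show ?case by (auto simp: differentiable_on_def intro!: differentiable_imp_continuous_on differentiable_at_withinI)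
  next
    case (Suc n)
    have "conv u k differentiable (at x)" for x
      using conv_has_derivative[OF u Suc.prems] by (rule differentiableI)
    then show ?case
      using Suc by (simp add: partial_deriv_conv[OF u Suc.prems] Cc_infinity_partial_deriv)
  qed
qed

text \<open>
  The hypothesis admits all smooth functions, not only those with compact support in \<open>\<Omega>\<close>: it says that
  \<open>g\<close>, extended by 0, is the Laplacian of the extension of \<open>u\<close> on the whole space.
\<close>

lemma conv_laplacian:
  assumes u: "u \<in> L2 \<mu>" and g: "\<And>\<phi>. smooth \<phi> \<Longrightarrow> l2ip \<mu> u (classical_laplacian \<phi>) = l2ip \<mu> g \<phi>"
    and k: "k \<in> Cc_infinity UNIV"
  shows "classical_laplacian (conv u k) = conv g k"
proof
  fix x
  let ?\<phi> = "\<lambda>y. k ((-1) *\<^sub>R y + x)"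
  have s: "smooth k" by (rule Cc_infinity_smooth[OF k])
  have s\<phi>: "smooth ?\<phi>" by (rule smooth_affine[OF bounded_linear_scaleR_right s])
  have pd: "partial_deriv i ?\<phi> = (\<lambda>y. (-1) * partial_deriv i k ((-1) *\<^sub>R y + x))" if "i \<in> Basis" for i
    using s by (intro ext partial_deriv_affine_scale smooth_differentiable)
  have pd2: "partial_deriv i (partial_deriv i ?\<phi>) y = partial_deriv i (partial_deriv i k) (x - y)" if i: "i \<in> Basis" for i y
  proof -
    have s1: "smooth (partial_deriv i k)" by (rule smooth_partial_deriv[OF s i])
    have s2: "smooth (\<lambda>y. partial_deriv i k ((-1) *\<^sub>R y + x))" by (rule smooth_affine[OF bounded_linear_scaleR_right s1])
    have "partial_deriv i (partial_deriv i ?\<phi>) y = (-1) * partial_deriv i (\<lambda>y. partial_deriv i k ((-1) *\<^sub>R y + x)) y"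
      unfolding pd[OF i] by (rule partial_deriv_cmult[OF smooth_differentiable[OF s2]])
    also have "\<dots> = (-1) * ((-1) * partial_deriv i (partial_deriv i k) ((-1) *\<^sub>R y + x))"
      using s1 by (subst partial_deriv_affine_scale) (auto intro: smooth_differentiable)
    finally show ?thesis by (simp add: algebra_simps)
  qed
  have "classical_laplacian (conv u k) x = (\<Sum>i\<in>Basis. conv u (partial_deriv i (partial_deriv i k)) x)"
    unfolding classical_laplacian_def
    by (intro sum.cong refl) (simp add: partial_deriv_conv u k Cc_infinity_partial_deriv)
  also have "\<dots> = (\<Sum>i\<in>Basis. l2ip \<mu> u (partial_deriv i (partial_deriv i ?\<phi>)))"
  proof (intro sum.cong refl)
    fix i :: 'a assume i: "i \<in> Basis"
    show "conv u (partial_deriv i (partial_deriv i k)) x = l2ip \<mu> u (partial_deriv i (partial_deriv i ?\<phi>))"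
      unfolding conv_def l2ip_def by (simp only: pd2[OF i])
  qed
  also have "\<dots> = l2ip \<mu> u (classical_laplacian ?\<phi>)" by (rule laplacian_ip_sum[OF u s\<phi>, symmetric])
  also have "\<dots> = l2ip \<mu> g ?\<phi>" by (rule g[OF s\<phi>])
  also have "\<dots> = conv g k x" by (simp add: conv_def l2ip_def)
  finally show "classical_laplacian (conv u k) x = conv g k x" .
qed

end

text \<open>
  The center \<open>z\<close> need not be 0, so that the convolution with \<open>k\<close> combines smoothing with a translation
  by \<open>z\<close>.
\<close>

definition mollifier :: "'a::euclidean_space \<Rightarrow> real \<Rightarrow> ('a \<Rightarrow> real) \<Rightarrow> bool" where
  "mollifier z r k \<longleftrightarrow> k \<in> Cc_infinity UNIV \<and> (\<forall>x. 0 \<le> k x) \<and> (\<forall>x. x \<notin> ball z r \<longrightarrow> k x = 0) \<and>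
     (\<integral>\<^sup>+x. ennreal (k x) \<partial>lborel) = 1"

lemma mollifier_exists:
  fixes z :: "'a::euclidean_space"
  assumes r: "r > 0"
  shows "\<exists>k. mollifier z r k"
proof -
  obtain \<theta> \<rho> where \<theta>: "smooth \<theta>" "\<rho> > 0" "\<And>x. 0 \<le> \<theta> x" "\<And>x. x \<notin> ball z r \<Longrightarrow> \<theta> x = 0" "\<And>x. x \<in> ball z \<rho> \<Longrightarrow> \<theta> x = 1"
    using smooth_ball_cutoff[OF r] by metis
  have z: "\<theta> x = 0" if "x \<notin> cball z r" for x using that by (intro \<theta>(4)) auto
  have int: "integrable lborel \<theta>" by (rule compact_support_integrable[OF smooth_continuous[OF \<theta>(1)] compact_cball z])
  define I where "I = (\<integral>x. \<theta> x \<partial>lborel)"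
  have "0 < measure lborel (ball z \<rho>)"
    using \<theta>(2) by (simp add: content_ball_pos)
  also have "\<dots> = (\<integral>x. indicator (ball z \<rho>) x \<partial>lborel)" by simp
  also have "\<dots> \<le> I"
    unfolding I_def
  proof (rule integral_mono[OF _ int])
    show "integrable lborel (indicator (ball z \<rho>) :: 'a \<Rightarrow> real)"
      by (intro integrable_real_indicator) (auto simp: emeasure_bounded_finite[unfolded infinity_ennreal_def])
    show "indicator (ball z \<rho>) x \<le> \<theta> x" for x using \<theta>(3,5)[of x] by (auto simp: indicator_def)
  qed
  finally have I: "I > 0" .
  have "mollifier z r (\<lambda>x. (1 / I) * \<theta> x)"
    unfolding mollifier_def
  proof (intro conjI allI impI)
    show "(\<lambda>x. (1 / I) * \<theta> x) \<in> Cc_infinity UNIV"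
    proof (rule Cc_infinityI)
      show "smooth (\<lambda>x. (1 / I) * \<theta> x)" by (rule smooth_intros(4)[OF smooth_intros(1) \<theta>(1)])
      show "(1 / I) * \<theta> x = 0" if "x \<notin> cball z r" for x using z[OF that] by simp
    qed auto
    have "(\<integral>\<^sup>+x. ennreal ((1 / I) * \<theta> x) \<partial>lborel) = ennreal (\<integral>x. (1 / I) * \<theta> x \<partial>lborel)"
      using int \<theta>(3) I by (intro nn_integral_eq_integral) auto
    also have "(\<integral>x. (1 / I) * \<theta> x \<partial>lborel) = 1" using I by (simp add: I_def)
    finally show "(\<integral>\<^sup>+x. ennreal ((1 / I) * \<theta> x) \<partial>lborel) = 1" by simp
  qed (use \<theta> I in auto)
  then show ?thesis by blast
qed

lemma nn_integral_lborel_reflect: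
  fixes f :: "'a::euclidean_space \<Rightarrow> ennreal"
  assumes [measurable]: "f \<in> borel_measurable borel"
  shows "(\<integral>\<^sup>+y. f (x - y) \<partial>lborel) = (\<integral>\<^sup>+y. f y \<partial>lborel)"
proof -
  have L: "(lborel :: 'a measure) = distr lborel borel (\<lambda>y. x - y)"
    using lborel_affine[of "-1" x] by (simp add: density_1)
  have "(\<integral>\<^sup>+y. f y \<partial>lborel) = (\<integral>\<^sup>+y. f y \<partial>distr lborel borel (\<lambda>y. x - y))"
    by (rule arg_cong[OF L, where f="\<lambda>M. integral\<^sup>N M f"])
  also have "\<dots> = (\<integral>\<^sup>+y. f (x - y) \<partial>lborel)"
    by (simp add: nn_integral_distr)
  finally show ?thesis by simp
qed

context bounded_open_set begin

lemma nn_integral_\<Omega>_le_lborel: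
  assumes "f \<in> borel_measurable borel"
  shows "(\<integral>\<^sup>+x. f x \<partial>\<mu>) \<le> (\<integral>\<^sup>+x. f x \<partial>lborel)"
proof -
  have "(\<integral>\<^sup>+x. f x \<partial>\<mu>) = (\<integral>\<^sup>+x. f x * indicator \<Omega> x \<partial>lebesgue)"
    by (subst nn_integral_restrict_space) auto
  also have "\<dots> \<le> (\<integral>\<^sup>+x. f x \<partial>lebesgue)" by (intro nn_integral_mono) (auto simp: indicator_def)
  also have "\<dots> = (\<integral>\<^sup>+x. f x \<partial>lborel)" using assms by (intro nn_integral_completion)
  finally show ?thesis .
qed

lemma mollifier_mass:
  assumes k: "mollifier z r k"
  shows "(\<integral>\<^sup>+y. ennreal (k (x - y)) \<partial>\<mu>) \<le> 1" "(\<integral>\<^sup>+y. ennreal (k (y - x)) \<partial>\<mu>) \<le> 1"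
proof -
  have c: "continuous_on UNIV k" using k by (auto simp: mollifier_def intro: smooth_continuous Cc_infinity_smooth)
  have [measurable]: "k \<in> borel_measurable borel" by (rule borel_measurable_continuous_onI[OF c])
  have "(\<integral>\<^sup>+y. ennreal (k (x - y)) \<partial>\<mu>) \<le> (\<integral>\<^sup>+y. ennreal (k (x - y)) \<partial>lborel)"
    by (rule nn_integral_\<Omega>_le_lborel) measurable
  also have "\<dots> = (\<integral>\<^sup>+y. ennreal (k y) \<partial>lborel)" by (rule nn_integral_lborel_reflect) measurable
  finally show "(\<integral>\<^sup>+y. ennreal (k (x - y)) \<partial>\<mu>) \<le> 1" using k by (simp add: mollifier_def)
  have "(\<integral>\<^sup>+y. ennreal (k (y - x)) \<partial>\<mu>) \<le> (\<integral>\<^sup>+y. ennreal (k (y - x)) \<partial>lborel)"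
    by (rule nn_integral_\<Omega>_le_lborel) measurable
  also have "\<dots> = (\<integral>\<^sup>+y. ennreal (k ((0 - y) - x)) \<partial>lborel)"
    using nn_integral_lborel_reflect[of "\<lambda>y. ennreal (k (y - x))" 0] by simp
  also have "\<dots> = (\<integral>\<^sup>+y. ennreal (k (- x - y)) \<partial>lborel)"
    by (intro nn_integral_cong arg_cong[where f="\<lambda>t. ennreal (k t)"]) simp
  also have "\<dots> = (\<integral>\<^sup>+y. ennreal (k y) \<partial>lborel)" by (rule nn_integral_lborel_reflect) measurable
  finally show "(\<integral>\<^sup>+y. ennreal (k (y - x)) \<partial>\<mu>) \<le> 1" using k by (simp add: mollifier_def)
qed

text \<open>
  The Cauchy-Schwarz inequality for \<open>sqrt k * g\<close> and \<open>sqrt k\<close>, where \<open>k\<close> has mass at most 1.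
\<close>

lemma conv_sq_le:
  assumes g: "g \<in> L2 \<mu>" and k: "mollifier z r k"
  shows "ennreal ((conv g k x)\<^sup>2) \<le> (\<integral>\<^sup>+y. ennreal ((g y)\<^sup>2 * k (x - y)) \<partial>\<mu>)"
proof -
  have kC: "k \<in> Cc_infinity UNIV" and k0: "\<And>x. 0 \<le> k x" using k by (auto simp: mollifier_def)
  have c: "continuous_on UNIV k" by (intro smooth_continuous Cc_infinity_smooth[OF kC])
  have cx: "continuous_on UNIV (\<lambda>y. sqrt (k (x - y)))"
    by (intro continuous_on_real_sqrt continuous_reflect c)
  let ?s = "\<lambda>y. sqrt (k (x - y))"
  have sL: "?s \<in> L2 \<mu>" by (rule continuous_L2[OF cx])
  have gsL: "(\<lambda>y. ?s y * g y) \<in> L2 \<mu>" by (rule continuous_L2_mult[OF cx g])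
  have "conv g k x = l2ip \<mu> (\<lambda>y. ?s y * g y) ?s"
    unfolding conv_def l2ip_def by (intro Bochner_Integration.integral_cong) (auto simp: k0 algebra_simps real_sqrt_mult_self)
  then have "\<bar>conv g k x\<bar> \<le> l2norm \<mu> (\<lambda>y. ?s y * g y) * l2norm \<mu> ?s" using l2_Cauchy_Schwarz[OF gsL sL] by simp
  also have "\<dots> \<le> l2norm \<mu> (\<lambda>y. ?s y * g y) * 1"
  proof (rule mult_left_mono)
    have "ennreal (\<integral>y. k (x - y) \<partial>\<mu>) = (\<integral>\<^sup>+y. ennreal (k (x - y)) \<partial>\<mu>)"
      using sL k0 by (intro nn_integral_eq_integral [symmetric]) (auto simp: L2_def)
    also have "\<dots> \<le> 1" by (rule mollifier_mass(1)[OF k])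
    finally have "(\<integral>y. k (x - y) \<partial>\<mu>) \<le> 1" by (simp add: ennreal_le_1)
    then show "l2norm \<mu> ?s \<le> 1" using k0 by (simp add: l2norm_def)
  qed simp
  finally have "\<bar>conv g k x\<bar>\<^sup>2 \<le> (l2norm \<mu> (\<lambda>y. ?s y * g y))\<^sup>2" by (intro power_mono) auto
  then have "ennreal ((conv g k x)\<^sup>2) \<le> ennreal (\<integral>y. (?s y * g y)\<^sup>2 \<partial>\<mu>)" by (simp add: l2norm_sq ennreal_leI)
  also have "\<dots> = (\<integral>\<^sup>+y. ennreal ((?s y * g y)\<^sup>2) \<partial>\<mu>)"
    using gsL by (intro nn_integral_eq_integral [symmetric]) (auto simp: L2_def)
  also have "\<dots> = (\<integral>\<^sup>+y. ennreal ((g y)\<^sup>2 * k (x - y)) \<partial>\<mu>)"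
    using k0 by (intro nn_integral_cong) (simp add: power_mult_distrib mult.commute)
  finally show ?thesis .
qed

lemma conv_L2: "u \<in> L2 \<mu> \<Longrightarrow> k \<in> Cc_infinity UNIV \<Longrightarrow> conv u k \<in> L2 \<mu>"
  by (rule smooth_L2[OF smooth_conv])

lemma id_measurable: "(\<lambda>x. x) \<in> \<mu> \<rightarrow>\<^sub>M borel"
  by (intro measurable_restrict_space1 measurable_completion) simp

theorem young_inequality:
  assumes g: "g \<in> L2 \<mu>" and k: "mollifier z r k"
  shows "l2norm \<mu> (conv g k) \<le> l2norm \<mu> g"
proof -
  interpret \<mu>: finite_measure \<mu> by (rule fin)
  interpret pair_sigma_finite \<mu> \<mu> by unfold_locales
  have kC: "k \<in> Cc_infinity UNIV" and k0: "\<And>x. 0 \<le> k x" using k by (auto simp: mollifier_def)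
  have km [measurable]: "k \<in> borel_measurable borel"
    by (intro borel_measurable_continuous_onI smooth_continuous Cc_infinity_smooth[OF kC])
  have gm [measurable]: "g \<in> borel_measurable \<mu>" using g by (rule L2_measurable)
  have id [measurable]: "(\<lambda>x. x) \<in> \<mu> \<rightarrow>\<^sub>M borel" by (rule id_measurable)
  have km2 [measurable]: "(\<lambda>p. k (fst p - snd p)) \<in> borel_measurable (\<mu> \<Otimes>\<^sub>M \<mu>)"
  proof -
    have "fst \<in> (\<mu> \<Otimes>\<^sub>M \<mu>) \<rightarrow>\<^sub>M borel" "snd \<in> (\<mu> \<Otimes>\<^sub>M \<mu>) \<rightarrow>\<^sub>M borel"
      using measurable_compose[OF measurable_fst id] measurable_compose[OF measurable_snd id] by auto
    then have "(\<lambda>p. fst p - snd p) \<in> borel_measurable (\<mu> \<Otimes>\<^sub>M \<mu>)" by (rule borel_measurable_diff)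
    then show ?thesis using km by (rule measurable_compose)
  qed
  have fm: "(\<lambda>(x, y). ennreal ((g y)\<^sup>2 * k (x - y))) \<in> borel_measurable (\<mu> \<Otimes>\<^sub>M \<mu>)"
    unfolding split_beta by measurable
  have "ennreal ((l2norm \<mu> (conv g k))\<^sup>2) = (\<integral>\<^sup>+x. ennreal ((conv g k x)\<^sup>2) \<partial>\<mu>)"
    unfolding l2norm_sq using conv_L2[OF g kC] by (intro nn_integral_eq_integral [symmetric]) (auto simp: L2_def)
  also have "\<dots> \<le> (\<integral>\<^sup>+x. \<integral>\<^sup>+y. ennreal ((g y)\<^sup>2 * k (x - y)) \<partial>\<mu> \<partial>\<mu>)"
    by (intro nn_integral_mono conv_sq_le[OF g k])
  also have "\<dots> = (\<integral>\<^sup>+y. \<integral>\<^sup>+x. ennreal ((g y)\<^sup>2 * k (x - y)) \<partial>\<mu> \<partial>\<mu>)"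
    using Fubini'[OF fm] by simp
  also have "\<dots> \<le> (\<integral>\<^sup>+y. ennreal ((g y)\<^sup>2) \<partial>\<mu>)"
  proof (rule nn_integral_mono)
    fix y
    have m: "(\<lambda>x. ennreal (k (x - y))) \<in> borel_measurable \<mu>"
      using id km by measurable
    have "(\<integral>\<^sup>+x. ennreal ((g y)\<^sup>2 * k (x - y)) \<partial>\<mu>) = (\<integral>\<^sup>+x. ennreal ((g y)\<^sup>2) * ennreal (k (x - y)) \<partial>\<mu>)"
      using k0 by (intro nn_integral_cong) (simp add: ennreal_mult)
    also have "\<dots> = ennreal ((g y)\<^sup>2) * (\<integral>\<^sup>+x. ennreal (k (x - y)) \<partial>\<mu>)"
      using m by (rule nn_integral_cmult)
    also have "\<dots> \<le> ennreal ((g y)\<^sup>2) * 1" by (intro mult_left_mono mollifier_mass(2)[OF k]) auto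
    finally show "(\<integral>\<^sup>+x. ennreal ((g y)\<^sup>2 * k (x - y)) \<partial>\<mu>) \<le> ennreal ((g y)\<^sup>2)" by simp
  qed
  also have "\<dots> = ennreal ((l2norm \<mu> g)\<^sup>2)"
    unfolding l2norm_sq using g by (intro nn_integral_eq_integral) (auto simp: L2_def)
  finally have "(l2norm \<mu> (conv g k))\<^sup>2 \<le> (l2norm \<mu> g)\<^sup>2" by (subst (asm) ennreal_le_iff) auto
  then show ?thesis by (rule power2_le_imp_le) simp
qed

lemma conv_test_close:
  assumes \<phi>: "\<phi> \<in> Cc_infinity \<Omega>" and k: "mollifier z r k" and r: "norm z + r \<le> d"
    and d: "\<And>x y. dist x y < d \<Longrightarrow> \<bar>\<phi> x - \<phi> y\<bar> < e"
  shows "\<bar>conv \<phi> k x - \<phi> x\<bar> \<le> e"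
proof -
  obtain K where K: "smooth \<phi>" "compact K" "K \<subseteq> \<Omega>" "\<And>x. x \<notin> K \<Longrightarrow> \<phi> x = 0" using Cc_infinityE[OF \<phi>] by blast
  have kC: "k \<in> Cc_infinity UNIV" and k0: "\<And>x. 0 \<le> k x" and kz: "\<And>x. x \<notin> ball z r \<Longrightarrow> k x = 0"
    and k1: "(\<integral>\<^sup>+x. ennreal (k x) \<partial>lborel) = 1" using k by (auto simp: mollifier_def)
  have ck: "continuous_on UNIV k" by (intro smooth_continuous Cc_infinity_smooth[OF kC])
  have c\<phi>: "continuous_on UNIV \<phi>" by (rule smooth_continuous[OF K(1)])
  have ckx: "continuous_on UNIV (\<lambda>y. k (x - y))" by (rule continuous_reflect[OF ck])
  have [measurable]: "k \<in> borel_measurable borel" by (rule borel_measurable_continuous_onI[OF ck])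
  have kxz: "k (x - y) = 0" if "y \<notin> cball (x - z) r" for y
  proof (rule kz)
    show "x - y \<notin> ball z r" using that by (simp add: dist_norm algebra_simps norm_minus_commute)
  qed
  have ik: "integrable lborel (\<lambda>y. k (x - y))" by (rule compact_support_integrable[OF ckx compact_cball kxz])
  have i1: "integrable lborel (\<lambda>y. \<phi> y * k (x - y))"
    by (rule compact_support_integrable[of _ K]) (use K(2,4) in \<open>auto intro!: continuous_intros c\<phi> ckx\<close>)
  have I1: "(\<integral>y. k (x - y) \<partial>lborel) = 1"
  proof -
    have "ennreal (\<integral>y. k (x - y) \<partial>lborel) = (\<integral>\<^sup>+y. ennreal (k (x - y)) \<partial>lborel)"
      using ik k0 by (intro nn_integral_eq_integral [symmetric]) auto
    also have "\<dots> = 1" using nn_integral_lborel_reflect[of "\<lambda>y. ennreal (k y)" x] k1 by simp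
    finally show ?thesis by (metis ennreal_eq_1)
  qed
  have "conv \<phi> k x = (\<integral>y. \<phi> y * k (x - y) \<partial>lborel)"
    unfolding conv_def
  proof (rule integral_\<Omega>_eq_lborel)
    show "(\<lambda>y. \<phi> y * k (x - y)) \<in> borel_measurable borel"
      by (intro borel_measurable_continuous_onI continuous_intros c\<phi> ckx)
    show "\<phi> y * k (x - y) = 0" if "y \<notin> \<Omega>" for y
    proof -
      have "y \<notin> K" using that K(3) by blast
      then show ?thesis by (simp add: K(4))
    qed
  qed
  then have "conv \<phi> k x - \<phi> x = (\<integral>y. \<phi> y * k (x - y) \<partial>lborel) - \<phi> x * (\<integral>y. k (x - y) \<partial>lborel)" by (simp add: I1)
  also have "\<dots> = (\<integral>y. \<phi> y * k (x - y) - \<phi> x * k (x - y) \<partial>lborel)" using i1 ik by simp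
  finally have E: "conv \<phi> k x - \<phi> x = (\<integral>y. \<phi> y * k (x - y) - \<phi> x * k (x - y) \<partial>lborel)" .
  have "\<bar>\<integral>y. \<phi> y * k (x - y) - \<phi> x * k (x - y) \<partial>lborel\<bar> \<le> (\<integral>y. \<bar>\<phi> y * k (x - y) - \<phi> x * k (x - y)\<bar> \<partial>lborel)" by (rule integral_abs_bound)
  also have "\<dots> \<le> (\<integral>y. e * k (x - y) \<partial>lborel)"
  proof (rule integral_mono)
    show "integrable lborel (\<lambda>y. \<bar>\<phi> y * k (x - y) - \<phi> x * k (x - y)\<bar>)" using i1 ik by simp
    show "integrable lborel (\<lambda>y. e * k (x - y))" using ik by simp
    fix y
    show "\<bar>\<phi> y * k (x - y) - \<phi> x * k (x - y)\<bar> \<le> e * k (x - y)"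
    proof (cases "x - y \<in> ball z r")
      case True
      have "dist y x < d"
      proof -
        have "norm (x - y) \<le> norm z + norm (x - y - z)" using norm_triangle_sub[of "x - y" z] by simp
        then show ?thesis using True r by (simp add: dist_norm norm_minus_commute)
      qed
      then have "\<bar>\<phi> y - \<phi> x\<bar> \<le> e" using d less_imp_le by blast
      then have "\<bar>\<phi> y - \<phi> x\<bar> * k (x - y) \<le> e * k (x - y)" using k0 by (rule mult_right_mono)
      moreover have "\<bar>\<phi> y * k (x - y) - \<phi> x * k (x - y)\<bar> = \<bar>\<phi> y - \<phi> x\<bar> * k (x - y)"
        using k0[of "x - y"] by (simp add: left_diff_distrib [symmetric] abs_mult)
      ultimately show ?thesis by simp
    qed (simp add: kz)
  qed
  also have "\<dots> = e" by (simp add: I1)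
  finally show ?thesis unfolding E .
qed

text \<open>
  For a test function the convergence is uniform (\<open>conv_test_close\<close>); test functions are dense, and the
  convolutions do not increase the norm.
\<close>

theorem mollification_tendsto:
  assumes g: "g \<in> L2 \<mu>" and k: "\<And>n. mollifier (z n) (r n) (k n)" and zr: "(\<lambda>n. norm (z n) + r n) \<longlonglongrightarrow> 0"
  shows "(\<lambda>n. l2norm \<mu> (\<lambda>x. conv g (k n) x - g x)) \<longlonglongrightarrow> 0"
proof (rule LIMSEQ_I)
  fix e :: real assume e: "0 < e"
  obtain \<phi> where \<phi>: "\<phi> \<in> Cc_infinity \<Omega>" "l2norm \<mu> (\<lambda>x. \<phi> x - g x) < e/3"
    using test_functions_dense[OF g, of "e/3"] e by auto
  obtain K where K: "smooth \<phi>" "compact K" "K \<subseteq> \<Omega>" "\<And>x. x \<notin> K \<Longrightarrow> \<phi> x = 0" using Cc_infinityE[OF \<phi>(1)] by blast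
  define M where "M = l2norm \<mu> (\<lambda>x. 1) + 1"
  have M: "M > 0" "l2norm \<mu> (\<lambda>x. 1) < M" unfolding M_def using l2norm_nonneg[of \<mu> "\<lambda>x. 1"] by linarith+
  define e' where "e' = e / 3 / M"
  have e': "e' > 0" using e M by (simp add: e'_def)
  obtain d where d: "d > 0" "\<And>x y. dist x y < d \<Longrightarrow> \<bar>\<phi> x - \<phi> y\<bar> < e'"
    using compact_support_uniformly_continuous[OF smooth_continuous[OF K(1)] K(2,4) e'] by blast
  have "\<forall>\<^sub>F n in sequentially. norm (z n) + r n < d" using zr d(1) by (auto dest: order_tendstoD(2))
  then obtain N where N: "\<And>n. n \<ge> N \<Longrightarrow> norm (z n) + r n < d" by (auto simp: eventually_sequentially)
  have kC: "k n \<in> Cc_infinity UNIV" for n using k by (simp add: mollifier_def)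
  have "norm (l2norm \<mu> (\<lambda>x. conv g (k n) x - g x) - 0) < e" if n: "n \<ge> N" for n
  proof -
    note \<phi>L = test_L2[OF \<phi>(1)]
    have gc: "conv g (k n) \<in> L2 \<mu>" "conv \<phi> (k n) \<in> L2 \<mu>" using g \<phi>L kC by (auto intro: conv_L2)
    have "(\<lambda>x. conv g (k n) x - conv \<phi> (k n) x) = conv (\<lambda>x. g x - \<phi> x) (k n)"
      unfolding conv_def using conv_integrable[OF g kC] conv_integrable[OF \<phi>L kC]
      by (intro ext) (simp add: left_diff_distrib)
    then have 1: "l2norm \<mu> (\<lambda>x. conv g (k n) x - conv \<phi> (k n) x) < e/3"
      using young_inequality[OF L2_diff[OF g \<phi>L] k, of n] \<phi>(2) l2norm_minus_commute[of \<mu> g \<phi>] by simp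
    have 2: "l2norm \<mu> (\<lambda>x. conv \<phi> (k n) x - \<phi> x) \<le> e/3"
    proof -
      have "(l2norm \<mu> (\<lambda>x. conv \<phi> (k n) x - \<phi> x))\<^sup>2 \<le> (l2norm \<mu> (\<lambda>x. e' * 1))\<^sup>2"
        unfolding l2norm_sq
      proof (rule integral_mono)
        show "integrable \<mu> (\<lambda>x. (conv \<phi> (k n) x - \<phi> x)\<^sup>2)" using L2_diff[OF gc(2) \<phi>L] by (simp add: L2_def)
        show "integrable \<mu> (\<lambda>x. (e' * 1)\<^sup>2)" using continuous_L2[of "\<lambda>x. e' * 1"] by (simp add: L2_def)
        fix x
        have "\<bar>conv \<phi> (k n) x - \<phi> x\<bar> \<le> e'" using N[OF n] d(2) by (intro conv_test_close[OF \<phi>(1) k, of n d]) auto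
        then have "\<bar>conv \<phi> (k n) x - \<phi> x\<bar>\<^sup>2 \<le> e'\<^sup>2" by (intro power_mono) auto
        then show "(conv \<phi> (k n) x - \<phi> x)\<^sup>2 \<le> (e' * 1)\<^sup>2" by simp
      qed
      then have "l2norm \<mu> (\<lambda>x. conv \<phi> (k n) x - \<phi> x) \<le> l2norm \<mu> (\<lambda>x. e' * 1)" by (rule power2_le_imp_le) simp
      also have "\<dots> = e' * l2norm \<mu> (\<lambda>x. 1)" using e' l2norm_cmult[of \<mu> e' "\<lambda>x. 1"] by simp
      also have "\<dots> \<le> e' * M" using e' M by (intro mult_left_mono) auto
      also have "\<dots> = e/3" using M by (simp add: e'_def)
      finally show ?thesis .
    qed
    have "l2norm \<mu> (\<lambda>x. conv g (k n) x - g x) \<le> l2norm \<mu> (\<lambda>x. conv g (k n) x - conv \<phi> (k n) x)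
        + (l2norm \<mu> (\<lambda>x. conv \<phi> (k n) x - \<phi> x) + l2norm \<mu> (\<lambda>x. \<phi> x - g x))"
      using l2_triangle_diff[OF gc g] l2_triangle_diff[OF gc(2) \<phi>L g] by linarith
    then show ?thesis using 1 2 \<phi>(2) by simp
  qed
  then show "\<exists>no. \<forall>n\<ge>no. norm (l2norm \<mu> (\<lambda>x. conv g (k n) x - g x) - 0) < e" by blast
qed

text \<open>
  The function \<open>u\<close>, extended by 0, is supported in \<open>K\<close> and has the Laplacian \<open>g\<close> on the whole space.
  Convolution with mollifiers around \<open>t e\<close> of radius \<open>c t / 2\<close> moves the support into \<open>\<Omega>\<close>, and the Laplacians
  converge to \<open>g\<close> for \<open>t\<close> tending to 0.
\<close>

theorem test_approximation:
  assumes u: "u \<in> L2 \<mu>" and g: "g \<in> L2 \<mu>" and ug: "\<And>\<phi>. smooth \<phi> \<Longrightarrow> l2ip \<mu> u (classical_laplacian \<phi>) = l2ip \<mu> g \<phi>"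
    and K: "compact K" "\<And>x. x \<in> \<Omega> \<Longrightarrow> x \<notin> K \<Longrightarrow> u x = 0" and cone: "interior_cone_at \<Omega> K"
  shows "\<exists>v. (\<forall>n. v n \<in> Cc_infinity \<Omega>) \<and> (\<lambda>n. l2norm \<mu> (\<lambda>x. classical_laplacian (v n) x - g x)) \<longlonglongrightarrow> 0"
proof -
  obtain e c t0 where e: "norm e \<le> 1" and c: "0 < c" and t0: "0 < t0"
    and in\<Omega>: "\<And>x t. x \<in> K \<Longrightarrow> 0 < t \<Longrightarrow> t < t0 \<Longrightarrow> ball (x + t *\<^sub>R e) (c * t) \<subseteq> \<Omega>"
    using cone unfolding interior_cone_at_def by blast
  define t where "t n = (t0 / 2) * inverse (real (Suc n))" for n
  have t: "0 < t n" "t n < t0" for n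
  proof -
    have "inverse (real (Suc n)) \<le> 1" by (simp add: inverse_le_1_iff)
    then have "t n \<le> t0 / 2" unfolding t_def using t0 by (intro mult_left_le) auto
    then show "t n < t0" using t0 by simp
  qed (use t0 in \<open>simp add: t_def\<close>)
  have tl: "t \<longlonglongrightarrow> 0"
    unfolding t_def[abs_def] using tendsto_mult_right_zero[OF LIMSEQ_inverse_real_of_nat] by blast
  have "\<exists>k. mollifier (t n *\<^sub>R e) (c * t n / 2) k" for n using c t by (intro mollifier_exists) auto
  then obtain k where k: "\<And>n. mollifier (t n *\<^sub>R e) (c * t n / 2) (k n)" by metis
  have kC: "k n \<in> Cc_infinity UNIV" for n using k by (simp add: mollifier_def)
  have "(\<lambda>n. norm (t n *\<^sub>R e) + c * t n / 2) \<longlonglongrightarrow> 0"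
  proof -
    have "(\<lambda>n. norm (t n *\<^sub>R e) + c * t n / 2) \<longlonglongrightarrow> norm (0 *\<^sub>R e) + c * 0 / 2" by (intro tendsto_intros tl) auto
    then show ?thesis by simp
  qed
  then have lim: "(\<lambda>n. l2norm \<mu> (\<lambda>x. conv g (k n) x - g x)) \<longlonglongrightarrow> 0"
    by (rule mollification_tendsto[OF g k])
  have "conv u (k n) \<in> Cc_infinity \<Omega>" for n
  proof (rule Cc_infinityI)
    let ?S = "{x + y |x y. x \<in> K \<and> y \<in> cball (t n *\<^sub>R e) (c * t n / 2)}"
    show "smooth (conv u (k n))" by (rule smooth_conv[OF u kC])
    show "compact ?S" using K(1) by (intro compact_sums) auto
    show "?S \<subseteq> \<Omega>"
    proof safe
      fix x y assume xy: "x \<in> K" "y \<in> cball (t n *\<^sub>R e) (c * t n / 2)"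
      have "dist (x + t n *\<^sub>R e) (x + y) < c * t n"
      proof -
        have "dist (x + t n *\<^sub>R e) (x + y) = dist (t n *\<^sub>R e) y" by (simp add: dist_norm)
        also have "\<dots> \<le> c * t n / 2" using xy(2) by simp
        also have "\<dots> < c * t n" using c t(1)[of n] by simp
        finally show ?thesis .
      qed
      then have "x + y \<in> ball (x + t n *\<^sub>R e) (c * t n)" by (simp only: mem_ball)
      then show "x + y \<in> \<Omega>" using in\<Omega>[OF xy(1) t] by blast
    qed
    fix x assume x: "x \<notin> ?S"
    have "u y * k n (x - y) = 0" if "y \<in> \<Omega>" for y
    proof (cases "y \<in> K")
      case True
      have "x - y \<notin> ball (t n *\<^sub>R e) (c * t n / 2)"
      proof
        assume "x - y \<in> ball (t n *\<^sub>R e) (c * t n / 2)"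
        then have "y + (x - y) \<in> ?S" using True by (intro CollectI exI[of _ y] exI[of _ "x - y"]) auto
        then show False using x by simp
      qed
      then show ?thesis using k[of n] by (simp add: mollifier_def)
    qed (use K(2) that in simp)
    then have "conv u (k n) x = (\<integral>y. 0 \<partial>\<mu>)"
      unfolding conv_def by (intro Bochner_Integration.integral_cong) auto
    then show "conv u (k n) x = 0" by simp
  qed
  moreover have "(\<lambda>n. l2norm \<mu> (\<lambda>x. classical_laplacian (conv u (k n)) x - g x)) \<longlonglongrightarrow> 0"
    using lim by (simp add: conv_laplacian[OF u ug kC])
  ultimately show ?thesis by (intro exI[of _ "\<lambda>n. conv u (k n)"] conjI allI)
qed

end

section \<open>Biharmonic functions with vanishing boundary data\<close>

lemma second_partial_product:
  fixes \<theta> \<phi> :: "'a::euclidean_space \<Rightarrow> real"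
  assumes \<theta>: "smooth \<theta>" and \<phi>: "smooth \<phi>" and i: "i \<in> Basis"
  shows "partial_deriv i (partial_deriv i (\<lambda>x. \<theta> x * \<phi> x)) x =
    \<theta> x * partial_deriv i (partial_deriv i \<phi>) x + 2 * (partial_deriv i \<theta> x * partial_deriv i \<phi> x)
      + \<phi> x * partial_deriv i (partial_deriv i \<theta>) x"
proof -
  have e: "partial_deriv i (\<lambda>x. \<theta> x * \<phi> x) = (\<lambda>x. \<theta> x * partial_deriv i \<phi> x + partial_deriv i \<theta> x * \<phi> x)"
    using \<theta> \<phi> by (intro ext partial_deriv_mult smooth_differentiable)
  note s = smooth_partial_deriv[OF \<theta> i] smooth_partial_deriv[OF \<phi> i]
  have "partial_deriv i (partial_deriv i (\<lambda>x. \<theta> x * \<phi> x)) x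
      = partial_deriv i (\<lambda>x. \<theta> x * partial_deriv i \<phi> x) x + partial_deriv i (\<lambda>x. partial_deriv i \<theta> x * \<phi> x) x"
    unfolding e by (intro partial_deriv_add smooth_differentiable smooth_intros \<theta> \<phi> s)
  also have "partial_deriv i (\<lambda>x. \<theta> x * partial_deriv i \<phi> x) x
      = \<theta> x * partial_deriv i (partial_deriv i \<phi>) x + partial_deriv i \<theta> x * partial_deriv i \<phi> x"
    by (intro partial_deriv_mult smooth_differentiable \<theta> s)
  also have "partial_deriv i (\<lambda>x. partial_deriv i \<theta> x * \<phi> x) x
      = partial_deriv i \<theta> x * partial_deriv i \<phi> x + partial_deriv i (partial_deriv i \<theta>) x * \<phi> x"
    by (intro partial_deriv_mult smooth_differentiable \<phi> s)
  finally show ?thesis by (simp add: algebra_simps)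
qed

lemma laplacian_product:
  fixes \<theta> \<phi> :: "'a::euclidean_space \<Rightarrow> real"
  assumes \<theta>: "smooth \<theta>" and \<phi>: "smooth \<phi>"
  shows "classical_laplacian (\<lambda>x. \<theta> x * \<phi> x) x =
    \<theta> x * classical_laplacian \<phi> x + 2 * (\<Sum>i\<in>Basis. partial_deriv i \<theta> x * partial_deriv i \<phi> x)
      + \<phi> x * classical_laplacian \<theta> x"
  unfolding classical_laplacian_def
  by (simp add: second_partial_product[OF assms] sum.distrib sum_distrib_left)

context bounded_open_set begin

text \<open>
  The Laplacian of \<open>\<theta> w\<close> by the product rule, if \<open>w\<close> has gradient \<open>G\<close> and Laplacian \<open>f\<close>.
\<close>

definition localized_laplacian :: "('a \<Rightarrow> real) \<Rightarrow> ('a \<Rightarrow> 'a) \<Rightarrow> ('a \<Rightarrow> real) \<Rightarrow> ('a \<Rightarrow> real) \<Rightarrow> 'a \<Rightarrow> real" where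
  "localized_laplacian w G f \<theta> x = \<theta> x * f x + (\<Sum>i\<in>Basis. (2 * partial_deriv i \<theta> x) * (G x \<bullet> i)) + classical_laplacian \<theta> x * w x"

lemma smooth_L2_mult: "smooth \<theta> \<Longrightarrow> u \<in> L2 \<mu> \<Longrightarrow> (\<lambda>x. \<theta> x * u x) \<in> L2 \<mu>"
  by (intro continuous_L2_mult smooth_continuous)

lemma l2ip_mult_shift: "l2ip \<mu> (\<lambda>x. \<theta> x * u x) v = l2ip \<mu> u (\<lambda>x. \<theta> x * v x)"
  unfolding l2ip_def by (intro Bochner_Integration.integral_cong refl) simp

lemma localized_laplacian_L2:
  assumes "w \<in> L2 \<mu>" "\<And>i. i \<in> Basis \<Longrightarrow> (\<lambda>x. G x \<bullet> i) \<in> L2 \<mu>" "f \<in> L2 \<mu>" "smooth \<theta>"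
  shows "localized_laplacian w G f \<theta> \<in> L2 \<mu>"
  unfolding localized_laplacian_def[abs_def]
  by (intro L2_add L2_sum smooth_L2_mult smooth_intros smooth_partial_deriv smooth_classical_laplacian assms)

lemma localized_laplacian_add:
  assumes "smooth \<theta>" "smooth \<eta>"
  shows "localized_laplacian w G f (\<lambda>x. \<theta> x + \<eta> x) x = localized_laplacian w G f \<theta> x + localized_laplacian w G f \<eta> x"
proof -
  have 1: "partial_deriv i (\<lambda>x. \<theta> x + \<eta> x) = (\<lambda>x. partial_deriv i \<theta> x + partial_deriv i \<eta> x)" for i
    using assms by (intro ext partial_deriv_add smooth_differentiable)
  have 2: "partial_deriv i (partial_deriv i (\<lambda>x. \<theta> x + \<eta> x)) x
      = partial_deriv i (partial_deriv i \<theta>) x + partial_deriv i (partial_deriv i \<eta>) x" if "i \<in> Basis" for i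
    unfolding 1 using assms that by (intro partial_deriv_add smooth_differentiable smooth_partial_deriv)
  have 3: "classical_laplacian (\<lambda>x. \<theta> x + \<eta> x) x = classical_laplacian \<theta> x + classical_laplacian \<eta> x"
    unfolding classical_laplacian_def by (simp add: 2 sum.distrib)
  show ?thesis unfolding localized_laplacian_def 3 unfolding 1 by (simp add: algebra_simps sum.distrib)
qed

lemma localized_laplacian_zero:
  assumes "\<And>x. x \<in> \<Omega> \<Longrightarrow> \<theta> x = 0" "x \<in> \<Omega>"
  shows "localized_laplacian w G f \<theta> x = 0"
proof -
  have cl: "closed (- \<Omega>)" by (rule closed_Compl[OF open_\<Omega>])
  have 1: "partial_deriv i \<theta> x = 0" if "x \<in> \<Omega>" for i x
  proof (rule partial_deriv_zero_outside[OF cl])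
    show "\<theta> y = 0" if "y \<notin> - \<Omega>" for y using that assms(1) by simp
  qed (use that in simp)
  have 2: "partial_deriv i (partial_deriv i \<theta>) x = 0" for i
  proof (rule partial_deriv_zero_outside[OF cl])
    show "partial_deriv i \<theta> y = 0" if "y \<notin> - \<Omega>" for y using that 1 by simp
  qed (use assms(2) in simp)
  show ?thesis using assms 1 2 by (simp add: localized_laplacian_def classical_laplacian_def)
qed

lemma l2ip_sum3:
  assumes A: "A \<in> L2 \<mu>" and B: "\<And>i. i \<in> I \<Longrightarrow> B i \<in> L2 \<mu>" and C: "C \<in> L2 \<mu>" and w: "w \<in> L2 \<mu>"
  shows "l2ip \<mu> w (\<lambda>x. A x + (\<Sum>i\<in>I. B i x) + C x) = l2ip \<mu> w A + (\<Sum>i\<in>I. l2ip \<mu> w (B i)) + l2ip \<mu> w C"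
proof -
  have SB: "(\<lambda>x. \<Sum>i\<in>I. B i x) \<in> L2 \<mu>" using B by (rule L2_sum)
  have "l2ip \<mu> (\<lambda>x. A x + (\<Sum>i\<in>I. B i x) + C x) w = l2ip \<mu> A w + l2ip \<mu> (\<lambda>x. \<Sum>i\<in>I. B i x) w + l2ip \<mu> C w"
    using l2ip_add_left[OF L2_add[OF A SB] C w] l2ip_add_left[OF A SB w] by simp
  then show ?thesis using l2ip_sum_right[OF w B] by (simp add: l2ip_sym[of \<mu> w])
qed

lemma localized_laplacian_weak:
  assumes w: "H10_grad w G" and f: "f \<in> L2 \<mu>"
    and wf: "\<And>\<phi>. smooth \<phi> \<Longrightarrow> l2ip \<mu> w (classical_laplacian \<phi>) = l2ip \<mu> f \<phi>"
    and \<theta>: "smooth \<theta>" and \<phi>: "smooth \<phi>"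
  shows "l2ip \<mu> (\<lambda>x. \<theta> x * w x) (classical_laplacian \<phi>) = l2ip \<mu> (localized_laplacian w G f \<theta>) \<phi>"
proof -
  note wL = H10_grad_L2(1)[OF w] and GL = H10_grad_L2(2)[OF w]
  note s\<theta> = smooth_partial_deriv[OF \<theta>] and s\<phi> = smooth_partial_deriv[OF \<phi>]
  have pt: "\<theta> x * classical_laplacian \<phi> x = classical_laplacian (\<lambda>x. \<theta> x * \<phi> x) x
      + (\<Sum>i\<in>Basis. (-2) * partial_deriv i (\<lambda>x. partial_deriv i \<theta> x * \<phi> x) x) + classical_laplacian \<theta> x * \<phi> x" for x
  proof -
    have e: "(-2) * partial_deriv i (\<lambda>x. partial_deriv i \<theta> x * \<phi> x) x
        = (-2) * (partial_deriv i \<theta> x * partial_deriv i \<phi> x) + (-2) * (partial_deriv i (partial_deriv i \<theta>) x * \<phi> x)"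
      if "i \<in> Basis" for i
      unfolding partial_deriv_mult[OF smooth_differentiable[OF s\<theta>[OF that]] smooth_differentiable[OF \<phi>]]
      by (simp add: algebra_simps)
    have "(\<Sum>i\<in>Basis. (-2) * partial_deriv i (\<lambda>x. partial_deriv i \<theta> x * \<phi> x) x)
        = (-2) * (\<Sum>i\<in>Basis. partial_deriv i \<theta> x * partial_deriv i \<phi> x) + (-2) * (classical_laplacian \<theta> x * \<phi> x)"
      by (simp only: e sum.distrib sum_distrib_left classical_laplacian_def sum_distrib_right cong: sum.cong)
    then show ?thesis using laplacian_product[OF \<theta> \<phi>, of x] by (simp add: algebra_simps)
  qed
  have sp: "smooth (\<lambda>x. partial_deriv i \<theta> x * \<phi> x)" if "i \<in> Basis" for i
    using that by (intro smooth_intros s\<theta> \<phi>)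
  have L1: "classical_laplacian (\<lambda>x. \<theta> x * \<phi> x) \<in> L2 \<mu>"
    by (intro smooth_L2 smooth_classical_laplacian smooth_intros \<theta> \<phi>)
  have L2: "(\<lambda>x. (-2) * partial_deriv i (\<lambda>x. partial_deriv i \<theta> x * \<phi> x) x) \<in> L2 \<mu>" if "i \<in> Basis" for i
    using that by (intro L2_cmult smooth_L2[OF smooth_partial_deriv] sp)
  have L3: "(\<lambda>x. classical_laplacian \<theta> x * \<phi> x) \<in> L2 \<mu>"
    by (rule smooth_L2) (intro smooth_intros smooth_classical_laplacian \<theta> \<phi>)
  have "l2ip \<mu> (\<lambda>x. \<theta> x * w x) (classical_laplacian \<phi>) = l2ip \<mu> w (\<lambda>x. classical_laplacian (\<lambda>x. \<theta> x * \<phi> x) x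
      + (\<Sum>i\<in>Basis. (-2) * partial_deriv i (\<lambda>x. partial_deriv i \<theta> x * \<phi> x) x) + classical_laplacian \<theta> x * \<phi> x)"
    unfolding l2ip_mult_shift by (simp only: pt)
  also have "\<dots> = l2ip \<mu> w (classical_laplacian (\<lambda>x. \<theta> x * \<phi> x))
      + (\<Sum>i\<in>Basis. l2ip \<mu> w (\<lambda>x. (-2) * partial_deriv i (\<lambda>x. partial_deriv i \<theta> x * \<phi> x) x))
      + l2ip \<mu> w (\<lambda>x. classical_laplacian \<theta> x * \<phi> x)"
    by (rule l2ip_sum3[OF L1 L2 L3 wL])
  also have "l2ip \<mu> w (classical_laplacian (\<lambda>x. \<theta> x * \<phi> x)) = l2ip \<mu> (\<lambda>x. \<theta> x * f x) \<phi>"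
    using wf[OF smooth_intros(4)[OF \<theta> \<phi>]] by (simp add: l2ip_mult_shift)
  also have "(\<Sum>i\<in>Basis. l2ip \<mu> w (\<lambda>x. (-2) * partial_deriv i (\<lambda>x. partial_deriv i \<theta> x * \<phi> x) x))
      = (\<Sum>i\<in>Basis. l2ip \<mu> (\<lambda>x. (2 * partial_deriv i \<theta> x) * (G x \<bullet> i)) \<phi>)"
  proof (intro sum.cong refl)
    fix i :: 'a assume i: "i \<in> Basis"
    have "l2ip \<mu> w (\<lambda>x. (-2) * partial_deriv i (\<lambda>x. partial_deriv i \<theta> x * \<phi> x) x)
        = (-2) * l2ip \<mu> w (partial_deriv i (\<lambda>x. partial_deriv i \<theta> x * \<phi> x))"
      using l2ip_cmult_left[of \<mu> "-2" _ w] by (simp only: l2ip_sym[of \<mu> w])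
    also have "\<dots> = 2 * l2ip \<mu> (\<lambda>x. G x \<bullet> i) (\<lambda>x. partial_deriv i \<theta> x * \<phi> x)"
      by (simp add: H10_grad_ip[OF w sp[OF i] i])
    also have "\<dots> = 2 * l2ip \<mu> (\<lambda>x. partial_deriv i \<theta> x * (G x \<bullet> i)) \<phi>" by (simp only: l2ip_mult_shift)
    also have "\<dots> = l2ip \<mu> (\<lambda>x. (2 * partial_deriv i \<theta> x) * (G x \<bullet> i)) \<phi>"
      by (simp only: l2ip_cmult_left[symmetric] mult.assoc)
    finally show "l2ip \<mu> w (\<lambda>x. (-2) * partial_deriv i (\<lambda>x. partial_deriv i \<theta> x * \<phi> x) x)
        = l2ip \<mu> (\<lambda>x. (2 * partial_deriv i \<theta> x) * (G x \<bullet> i)) \<phi>" .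
  qed
  also have "l2ip \<mu> w (\<lambda>x. classical_laplacian \<theta> x * \<phi> x) = l2ip \<mu> (\<lambda>x. classical_laplacian \<theta> x * w x) \<phi>"
    by (simp only: l2ip_mult_shift)
  also have "l2ip \<mu> (\<lambda>x. \<theta> x * f x) \<phi> + (\<Sum>i\<in>Basis. l2ip \<mu> (\<lambda>x. (2 * partial_deriv i \<theta> x) * (G x \<bullet> i)) \<phi>)
      + l2ip \<mu> (\<lambda>x. classical_laplacian \<theta> x * w x) \<phi> = l2ip \<mu> (localized_laplacian w G f \<theta>) \<phi>"
  proof -
    have m1: "(\<lambda>x. \<theta> x * f x) \<in> L2 \<mu>" by (rule smooth_L2_mult[OF \<theta> f])
    have m2: "(\<lambda>x. (2 * partial_deriv i \<theta> x) * (G x \<bullet> i)) \<in> L2 \<mu>" if "i \<in> Basis" for i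
      using that by (intro smooth_L2_mult smooth_intros s\<theta> GL)
    have m3: "(\<lambda>x. classical_laplacian \<theta> x * w x) \<in> L2 \<mu>"
      by (intro smooth_L2_mult smooth_classical_laplacian \<theta> wL)
    have p: "\<phi> \<in> L2 \<mu>" by (rule smooth_L2[OF \<phi>])
    show ?thesis
      unfolding localized_laplacian_def[abs_def]
      unfolding l2ip_sym[of \<mu> _ \<phi>] by (rule l2ip_sum3[OF m1 m2 m3 p, symmetric])
  qed
  finally show ?thesis .
qed

text \<open>
  The linear functional \<open>\<Lambda> \<theta>\<close>, the inner product of \<open>\<Delta> w\<close> with \<open>\<Delta>(\<theta> w)\<close>, vanishes whenever \<open>\<theta>\<close> is
  supported where an interior cone exists: there \<open>\<Delta>(\<theta> w)\<close> is a limit of Laplacians of test functions.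
  A covering of the closure by such neighborhoods gives \<open>\<Lambda> 1 = 0\<close>, which is the claim.  The product of the
  functions \<open>1 - \<theta> p\<close> over a finite cover replaces a partition of unity: it vanishes on \<open>\<Omega>\<close>, and
  expanding it one factor at a time does not change \<open>\<Lambda>\<close>.
\<close>

theorem biharmonic_zero_data:
  assumes cone: "\<And>p. p \<in> closure \<Omega> \<Longrightarrow> \<exists>r>0. interior_cone_at \<Omega> (closure \<Omega> \<inter> ball p r)"
    and w: "w \<in> H0_Delta \<Omega>"
    and neumann: "\<And>\<phi>. smooth \<phi> \<Longrightarrow> green_form w \<phi> = 0"
    and biharm: "\<And>v. v \<in> Cc_infinity \<Omega> \<Longrightarrow> inner_Delta \<Omega> w v = 0"
  shows "inner_Delta \<Omega> w w = 0"
proof -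
  define f where "f = weak_laplacian \<Omega> w"
  define G where "G = weak_gradient \<Omega> w"
  have wL: "w \<in> L2 \<mu>" and wG: "H10_grad w G" and wl: "has_weak_laplacian \<Omega> w f" and fL: "f \<in> L2 \<mu>"
    using H0_DeltaD[OF w] by (auto simp: f_def G_def)
  note GL = H10_grad_L2(2)[OF wG]
  \<comment> \<open>Both boundary terms vanish, so the weak equation \<open>\<Delta> w = f\<close> may be tested with functions that do not vanish at the boundary.\<close>
  have wf: "l2ip \<mu> w (classical_laplacian \<phi>) = l2ip \<mu> f \<phi>" if s: "smooth \<phi>" for \<phi>
  proof -
    have "0 = (\<Sum>i\<in>Basis. l2ip \<mu> (\<lambda>x. G x \<bullet> i) (\<lambda>x. grad \<phi> x \<bullet> i)) + l2ip \<mu> \<phi> f"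
      using neumann[OF s] green_form_eq[OF H10_grad_weak[OF wG] wl smooth_L2[OF s] has_weak_gradient_classical[OF smooth_Ck[OF s]]]
      by simp
    also have "(\<Sum>i\<in>Basis. l2ip \<mu> (\<lambda>x. G x \<bullet> i) (\<lambda>x. grad \<phi> x \<bullet> i)) = (\<Sum>i\<in>Basis. - l2ip \<mu> w (partial_deriv i (partial_deriv i \<phi>)))"
    proof (intro sum.cong refl)
      fix i :: 'a assume i: "i \<in> Basis"
      show "l2ip \<mu> (\<lambda>x. G x \<bullet> i) (\<lambda>x. grad \<phi> x \<bullet> i) = - l2ip \<mu> w (partial_deriv i (partial_deriv i \<phi>))"
        using H10_grad_ip[OF wG smooth_partial_deriv[OF s i] i] i by simp
    qed
    also have "\<dots> = - l2ip \<mu> w (classical_laplacian \<phi>)" by (simp add: laplacian_ip_sum[OF wL s] sum_negf)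
    finally show ?thesis by (simp add: l2ip_sym)
  qed
  let ?g = "localized_laplacian w G f"
  define \<Lambda> where "\<Lambda> \<theta> = l2ip \<mu> f (?g \<theta>)" for \<theta>
  have gL: "?g \<theta> \<in> L2 \<mu>" if "smooth \<theta>" for \<theta> by (rule localized_laplacian_L2[OF wL GL fL that])
  have \<Lambda>_add: "\<Lambda> (\<lambda>x. \<theta> x + \<eta> x) = \<Lambda> \<theta> + \<Lambda> \<eta>" if "smooth \<theta>" "smooth \<eta>" for \<theta> \<eta>
  proof -
    have "?g (\<lambda>x. \<theta> x + \<eta> x) = (\<lambda>x. ?g \<theta> x + ?g \<eta> x)"
      by (intro ext localized_laplacian_add that)
    then show ?thesis unfolding \<Lambda>_def using l2ip_add_left[OF gL[OF that(1)] gL[OF that(2)] fL] by (simp add: l2ip_sym[of \<mu> f])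
  qed
  have \<Lambda>_local: "\<Lambda> \<theta> = 0"
    if s: "smooth \<theta>" and K: "compact K" "\<And>x. x \<in> \<Omega> \<Longrightarrow> x \<notin> K \<Longrightarrow> \<theta> x = 0" "interior_cone_at \<Omega> K" for \<theta> K
  proof -
    obtain v where v: "\<And>n. v n \<in> Cc_infinity \<Omega>"
      and lim: "(\<lambda>n. l2norm \<mu> (\<lambda>x. classical_laplacian (v n) x - ?g \<theta> x)) \<longlonglongrightarrow> 0"
      using test_approximation[of "\<lambda>x. \<theta> x * w x" "?g \<theta>" K, OF smooth_L2_mult[OF s wL] gL[OF s]
          localized_laplacian_weak[OF wG fL wf s] K(1) _ K(3)] K(2) by auto
    have lL: "classical_laplacian (v n) \<in> L2 \<mu>" for n
      by (intro smooth_L2 smooth_classical_laplacian Cc_infinity_smooth[OF v])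
    have "(\<lambda>n. l2ip \<mu> (classical_laplacian (v n)) f) \<longlonglongrightarrow> l2ip \<mu> (?g \<theta>) f"
      by (rule l2ip_tendsto[OF lL gL[OF s] fL lim])
    moreover have "l2ip \<mu> (classical_laplacian (v n)) f = 0" for n
    proof -
      have hl: "has_weak_laplacian \<Omega> (v n) (classical_laplacian (v n))"
        by (intro has_weak_laplacian_classical smooth_Ck Cc_infinity_smooth[OF v])
      have "l2ip \<mu> (weak_laplacian \<Omega> (v n)) f = l2ip \<mu> (classical_laplacian (v n)) f"
        using has_weak_laplacianD(1)[OF has_weak_laplacian_weak_laplacian[OF hl]] lL[of n] fL
        by (intro l2ip_cong_AE weak_laplacian_AE[OF hl] L2_measurable)
      then show ?thesis using biharm[OF v, of n] by (simp add: inner_Delta_eq f_def l2ip_sym)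
    qed
    ultimately have "(\<lambda>n::nat. 0) \<longlonglongrightarrow> l2ip \<mu> (?g \<theta>) f" by simp
    then show ?thesis unfolding \<Lambda>_def using LIMSEQ_unique[OF _ tendsto_const] by (metis l2ip_sym)
  qed
  have "\<exists>\<theta> \<rho>. smooth \<theta> \<and> \<rho> > 0 \<and> (\<forall>x\<in>ball p \<rho>. \<theta> x = 1) \<and> (\<forall>\<xi>. smooth \<xi> \<longrightarrow> \<Lambda> (\<lambda>x. \<theta> x * \<xi> x) = 0)"
    if p: "p \<in> closure \<Omega>" for p
  proof -
    obtain r where r: "r > 0" "interior_cone_at \<Omega> (closure \<Omega> \<inter> ball p r)" using cone[OF p] by blast
    have "r/2 > 0" using r by simp
    then obtain \<theta> \<rho> where \<theta>: "smooth \<theta>" "\<rho> > 0" "\<And>x. x \<notin> ball p (r/2) \<Longrightarrow> \<theta> x = 0" "\<And>x. x \<in> ball p \<rho> \<Longrightarrow> \<theta> x = 1"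
      by (rule smooth_ball_cutoff) (rule that)
    have cc: "interior_cone_at \<Omega> (closure \<Omega> \<inter> cball p (r/2))"
    proof -
      have "closure \<Omega> \<inter> cball p (r/2) \<subseteq> closure \<Omega> \<inter> ball p r" using r(1) by auto
      then show ?thesis using r(2) unfolding interior_cone_at_def by (meson subsetD)
    qed
    have ck: "compact (closure \<Omega> \<inter> cball p (r/2))" by (intro closed_Int_compact) auto
    have "\<Lambda> (\<lambda>x. \<theta> x * \<xi> x) = 0" if "smooth \<xi>" for \<xi>
    proof (rule \<Lambda>_local[OF smooth_intros(4)[OF \<theta>(1) that] ck _ cc])
      fix x assume "x \<in> \<Omega>" "x \<notin> closure \<Omega> \<inter> cball p (r/2)"
      then have "x \<notin> ball p (r/2)" using closure_subset by auto
      then show "\<theta> x * \<xi> x = 0" by (simp add: \<theta>(3))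
    qed
    then show ?thesis using \<theta>(1,2,4) by blast
  qed
  then have "\<forall>p\<in>closure \<Omega>. \<exists>\<theta>. smooth \<theta> \<and> (\<exists>\<rho>>0. \<forall>x\<in>ball p \<rho>. \<theta> x = 1) \<and> (\<forall>\<xi>. smooth \<xi> \<longrightarrow> \<Lambda> (\<lambda>x. \<theta> x * \<xi> x) = 0)"
    by blast
  from bchoice[OF this] obtain \<theta> where
    "\<forall>p\<in>closure \<Omega>. smooth (\<theta> p) \<and> (\<exists>\<rho>>0. \<forall>x\<in>ball p \<rho>. \<theta> p x = 1) \<and> (\<forall>\<xi>. smooth \<xi> \<longrightarrow> \<Lambda> (\<lambda>x. \<theta> p x * \<xi> x) = 0)" by blast
  then have \<theta>: "\<And>p. p \<in> closure \<Omega> \<Longrightarrow> smooth (\<theta> p)" "\<And>p. p \<in> closure \<Omega> \<Longrightarrow> \<exists>\<rho>>0. \<forall>x\<in>ball p \<rho>. \<theta> p x = 1"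
    "\<And>p \<xi>. p \<in> closure \<Omega> \<Longrightarrow> smooth \<xi> \<Longrightarrow> \<Lambda> (\<lambda>x. \<theta> p x * \<xi> x) = 0" by blast+
  from \<theta>(2) have "\<forall>p\<in>closure \<Omega>. \<exists>\<rho>. \<rho> > 0 \<and> (\<forall>x\<in>ball p \<rho>. \<theta> p x = 1)" by blast
  from bchoice[OF this] obtain \<rho> where \<rho>: "\<forall>p\<in>closure \<Omega>. \<rho> p > 0 \<and> (\<forall>x\<in>ball p (\<rho> p). \<theta> p x = 1)" by blast
  have comp: "compact (closure \<Omega>)" using bounded_\<Omega> by (simp add: compact_closure)
  have cov: "closure \<Omega> \<subseteq> (\<Union>p\<in>closure \<Omega>. ball p (\<rho> p))" using \<rho> by force
  obtain T where T: "T \<subseteq> closure \<Omega>" "finite T" "closure \<Omega> \<subseteq> (\<Union>p\<in>T. ball p (\<rho> p))"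
    by (rule compactE_image[OF comp open_ball cov]) (rule that)
  \<comment> \<open>Since \<open>\<Lambda>\<close> vanishes on multiples of \<open>\<theta> q\<close>, a factor \<open>1 - \<theta> q\<close> may be added.\<close>
  have reduce: "smooth (\<lambda>x. \<Prod>p\<in>S. 1 - \<theta> p x) \<and> \<Lambda> (\<lambda>x. \<Prod>p\<in>S. 1 - \<theta> p x) = \<Lambda> (\<lambda>x. 1)"
    if "finite S" "S \<subseteq> closure \<Omega>" for S
    using that
  proof (induction S rule: finite_induct)
    case empty
    then show ?case by (simp add: smooth_intros)
  next
    case (insert q S)
    define \<xi> where "\<xi> x = (\<Prod>p\<in>S. 1 - \<theta> p x)" for x
    have q: "q \<in> closure \<Omega>" using insert by auto
    have s\<xi>: "smooth \<xi>" and \<Lambda>\<xi>: "\<Lambda> \<xi> = \<Lambda> (\<lambda>x. 1)" using insert unfolding \<xi>_def[abs_def] by auto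
    have prod: "(\<Prod>p\<in>insert q S. 1 - \<theta> p x) = (1 - \<theta> q x) * \<xi> x" for x using insert by (simp add: \<xi>_def)
    have s1: "smooth (\<lambda>x. (1 - \<theta> q x) * \<xi> x)" by (intro smooth_intros \<theta>(1) q s\<xi>)
    have s2: "smooth (\<lambda>x. \<theta> q x * \<xi> x)" by (intro smooth_intros \<theta>(1) q s\<xi>)
    have "\<xi> = (\<lambda>x. (1 - \<theta> q x) * \<xi> x + \<theta> q x * \<xi> x)" by (rule ext) (simp add: algebra_simps)
    then have "\<Lambda> \<xi> = \<Lambda> (\<lambda>x. (1 - \<theta> q x) * \<xi> x + \<theta> q x * \<xi> x)" by (rule arg_cong)
    also have "\<dots> = \<Lambda> (\<lambda>x. (1 - \<theta> q x) * \<xi> x) + \<Lambda> (\<lambda>x. \<theta> q x * \<xi> x)" by (rule \<Lambda>_add[OF s1 s2])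
    finally show ?case unfolding prod using s1 \<Lambda>\<xi> \<theta>(3)[OF q s\<xi>] by simp
  qed
  have zero: "(\<Prod>p\<in>T. 1 - \<theta> p x) = 0" if "x \<in> \<Omega>" for x
  proof -
    obtain p where p: "p \<in> T" "x \<in> ball p (\<rho> p)" using T(3) \<open>x \<in> \<Omega>\<close> closure_subset by blast
    then have "1 - \<theta> p x = 0" using \<rho> T(1) by auto
    then show ?thesis using p(1) T(2) by (intro prod_zero) auto
  qed
  have "\<Lambda> (\<lambda>x. \<Prod>p\<in>T. 1 - \<theta> p x) = (\<integral>x. 0 \<partial>\<mu>)"
    unfolding \<Lambda>_def l2ip_def
    by (intro Bochner_Integration.integral_cong refl) (simp add: localized_laplacian_zero[of "\<lambda>x. \<Prod>p\<in>T. 1 - \<theta> p x", OF zero])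
  then have "\<Lambda> (\<lambda>x. 1) = 0" using reduce[OF T(2,1)] by simp
  moreover have "?g (\<lambda>x. 1) = f" by (rule ext) (simp add: localized_laplacian_def classical_laplacian_def)
  ultimately show ?thesis unfolding \<Lambda>_def inner_Delta_eq f_def[symmetric] by simp
qed

end

section \<open>The normal derivative has infinite rank\<close>

text \<open>
  Gaussian elimination: the last equation is either trivial or used to eliminate one unknown.
\<close>

lemma underdetermined_system:
  fixes a :: "'i \<Rightarrow> nat \<Rightarrow> real"
  assumes "finite I" "card I = Suc n"
  shows "\<exists>c. (\<exists>m\<in>I. c m \<noteq> 0) \<and> (\<forall>j\<in>{1..n}. (\<Sum>m\<in>I. c m * a m j) = 0)"
  using assms
proof (induction n arbitrary: I a)
  case 0
  then obtain i where "I = {i}" using card_1_singletonE by (metis One_nat_def)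
  then show ?case by (intro exI[of _ "\<lambda>_. 1"]) auto
next
  case (Suc n)
  show ?case
  proof (cases "\<forall>m\<in>I. a m (Suc n) = 0")
    case True
    obtain i where i: "i \<in> I" using Suc.prems by fastforce
    have "card (I - {i}) = Suc n" using Suc.prems i by simp
    then obtain c where c: "\<exists>m\<in>I - {i}. c m \<noteq> 0" "\<forall>j\<in>{1..n}. (\<Sum>m\<in>I - {i}. c m * a m j) = 0"
      using Suc.IH[of "I - {i}" a] Suc.prems by auto
    define c' where "c' m = (if m = i then 0 else c m)" for m
    have "(\<Sum>m\<in>I. c' m * a m j) = 0" if j: "j \<in> {1..Suc n}" for j
    proof (cases "j = Suc n")
      case True
      then show ?thesis using \<open>\<forall>m\<in>I. a m (Suc n) = 0\<close> by simp
    next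
      case False
      have "(\<Sum>m\<in>I. c' m * a m j) = c' i * a i j + (\<Sum>m\<in>I - {i}. c' m * a m j)"
        using Suc.prems i by (intro sum.remove) auto
      also have "(\<Sum>m\<in>I - {i}. c' m * a m j) = (\<Sum>m\<in>I - {i}. c m * a m j)"
        by (intro sum.cong) (auto simp: c'_def)
      finally show ?thesis using c(2) j False by (simp add: c'_def)
    qed
    moreover have "\<exists>m\<in>I. c' m \<noteq> 0" using c(1) by (auto simp: c'_def)
    ultimately show ?thesis by blast
  next
    case False
    then obtain p where p: "p \<in> I" "a p (Suc n) \<noteq> 0" by blast
    define r where "r m = a m (Suc n) / a p (Suc n)" for m
    have "card (I - {p}) = Suc n" using Suc.prems p by simp
    then obtain c where c: "\<exists>m\<in>I - {p}. c m \<noteq> 0"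
      "\<forall>j\<in>{1..n}. (\<Sum>m\<in>I - {p}. c m * (a m j - r m * a p j)) = 0"
      using Suc.IH[of "I - {p}" "\<lambda>m j. a m j - r m * a p j"] Suc.prems by auto
    define c' where "c' m = (if m = p then - (\<Sum>m\<in>I - {p}. c m * r m) else c m)" for m
    have key: "(\<Sum>m\<in>I. c' m * a m j) = (\<Sum>m\<in>I - {p}. c m * (a m j - r m * a p j))" for j
    proof -
      have "(\<Sum>m\<in>I. c' m * a m j) = c' p * a p j + (\<Sum>m\<in>I - {p}. c' m * a m j)"
        using Suc.prems p by (intro sum.remove) auto
      also have "(\<Sum>m\<in>I - {p}. c' m * a m j) = (\<Sum>m\<in>I - {p}. c m * a m j)"
        by (intro sum.cong) (auto simp: c'_def)
      finally show ?thesis by (simp add: c'_def right_diff_distrib sum_subtractf sum_distrib_right mult.assoc)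
    qed
    have "(\<Sum>m\<in>I. c' m * a m j) = 0" if j: "j \<in> {1..Suc n}" for j
    proof (cases "j = Suc n")
      case True
      then show ?thesis unfolding key using p(2) by (simp add: r_def)
    next
      case False
      then show ?thesis unfolding key using c(2) j by auto
    qed
    moreover have "\<exists>m\<in>I. c' m \<noteq> 0" using c(1) by (auto simp: c'_def)
    ultimately show ?thesis by blast
  qed
qed

text \<open>
  The real part of \<open>exp(m (x1 + i x2))\<close> in the coordinates along \<open>e1\<close> and \<open>e2\<close>.
\<close>

definition harmonic_exp :: "'a::euclidean_space \<Rightarrow> 'a \<Rightarrow> nat \<Rightarrow> 'a \<Rightarrow> real" where
  "harmonic_exp e1 e2 m x = exp (real m * (x \<bullet> e1)) * cos (real m * (x \<bullet> e2))"

lemma smooth_exp: "smooth (exp :: real \<Rightarrow> real)"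
  using smooth_real[of "\<lambda>n. exp"] by auto

lemma smooth_cos: "smooth (cos :: real \<Rightarrow> real)"
proof -
  have "((\<lambda>t. cos (t + real n * (pi/2))) has_real_derivative cos (t + real (Suc n) * (pi/2))) (at t)" for n t
  proof -
    have "t + real (Suc n) * (pi/2) = (t + real n * (pi/2)) + pi/2" by (simp add: algebra_simps)
    moreover have "cos (y + pi/2) = - sin y" for y :: real by (simp add: cos_add)
    ultimately have "cos (t + real (Suc n) * (pi/2)) = - sin (t + real n * (pi/2))" by (simp only:)
    then show ?thesis by (auto intro!: derivative_eq_intros)
  qed
  from smooth_real[of "\<lambda>n t. cos (t + real n * (pi/2))", OF this] show ?thesis by simp
qed

lemma smooth_harmonic_exp: "smooth (harmonic_exp e1 e2 m)"
proof -
  have "smooth (\<lambda>x. exp (real m * (x \<bullet> e1)))" "smooth (\<lambda>x. cos (real m * (x \<bullet> e2)))"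
    using smooth_coordinate[OF smooth_exp, of "real m" e1 0] smooth_coordinate[OF smooth_cos, of "real m" e2 0] by auto
  then show ?thesis unfolding harmonic_exp_def[abs_def] by (rule smooth_intros(4))
qed

lemma partial_deriv_harmonic_exp:
  "partial_deriv i (harmonic_exp e1 e2 m) x = real m * (i \<bullet> e1) * harmonic_exp e1 e2 m x
     - real m * (i \<bullet> e2) * (exp (real m * (x \<bullet> e1)) * sin (real m * (x \<bullet> e2)))"
  unfolding harmonic_exp_def[abs_def]
  by (subst partial_deriv_eq[of _ "\<lambda>h. (exp (real m * (x \<bullet> e1)) * (real m * (h \<bullet> e1))) * cos (real m * (x \<bullet> e2))
      + exp (real m * (x \<bullet> e1)) * (- sin (real m * (x \<bullet> e2)) * (real m * (h \<bullet> e2)))"])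
     (auto intro!: derivative_eq_intros ext simp: algebra_simps)

lemma harmonic_harmonic_exp:
  fixes e1 e2 :: "'a::euclidean_space"
  assumes e: "e1 \<in> Basis" "e2 \<in> Basis" "e1 \<noteq> e2"
  shows "classical_laplacian (harmonic_exp e1 e2 m) x = 0"
proof -
  let ?h = "harmonic_exp e1 e2 m" and ?s = "\<lambda>x. exp (real m * (x \<bullet> e1)) * sin (real m * (x \<bullet> e2))"
  have ds: "(?s has_derivative (\<lambda>h. (exp (real m * (x \<bullet> e1)) * (real m * (h \<bullet> e1))) * sin (real m * (x \<bullet> e2))
      + exp (real m * (x \<bullet> e1)) * (cos (real m * (x \<bullet> e2)) * (real m * (h \<bullet> e2))))) (at x)"
    by (auto intro!: derivative_eq_intros ext simp: algebra_simps)
  have "partial_deriv i (partial_deriv i ?h) x = (real m)\<^sup>2 * ((i \<bullet> e1) * (i \<bullet> e1) - (i \<bullet> e2) * (i \<bullet> e2)) * ?h x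
      - 2 * (real m)\<^sup>2 * ((i \<bullet> e1) * (i \<bullet> e2)) * ?s x" for i
  proof -
    have "partial_deriv i ?h = (\<lambda>x. (real m * (i \<bullet> e1)) * ?h x - (real m * (i \<bullet> e2)) * ?s x)"
      by (rule ext) (rule partial_deriv_harmonic_exp)
    moreover have "?s differentiable (at x)" using ds by (rule differentiableI)
    moreover have "?h differentiable (at x)" by (rule smooth_differentiable[OF smooth_harmonic_exp])
    ultimately have "partial_deriv i (partial_deriv i ?h) x
        = (real m * (i \<bullet> e1)) * partial_deriv i ?h x - (real m * (i \<bullet> e2)) * partial_deriv i ?s x"
      by (simp add: partial_deriv_diff partial_deriv_cmult)
    then show ?thesis
      unfolding partial_deriv_eq[OF ds] partial_deriv_harmonic_exp by (simp add: harmonic_exp_def power2_eq_square algebra_simps)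
  qed
  then have F: "classical_laplacian ?h x = (real m)\<^sup>2 * ((\<Sum>i\<in>Basis. (i \<bullet> e1) * (i \<bullet> e1)) - (\<Sum>i\<in>Basis. (i \<bullet> e2) * (i \<bullet> e2))) * ?h x
      - 2 * (real m)\<^sup>2 * (\<Sum>i\<in>Basis. (i \<bullet> e1) * (i \<bullet> e2)) * ?s x"
    unfolding classical_laplacian_def
    by (simp add: sum_subtractf sum_distrib_left sum_distrib_right right_diff_distrib left_diff_distrib)
  have S: "(\<Sum>i\<in>Basis. (i \<bullet> u) * (i \<bullet> v)) = u \<bullet> v" for u v :: 'a
    by (simp add: euclidean_inner[of u v] inner_commute)
  show ?thesis unfolding F S using e by (simp add: inner_Basis)
qed

text \<open>
  Thus, up to a factor, the harmonic exponentials are themselves Laplacians of smooth functions, to which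
  \<open>dirichlet_solution\<close> below applies.
\<close>

lemma laplacian_inner_times_harmonic_exp:
  fixes e1 e2 :: "'a::euclidean_space"
  assumes e: "e1 \<in> Basis" "e2 \<in> Basis" "e1 \<noteq> e2"
  shows "classical_laplacian (\<lambda>x. (x \<bullet> e1) * harmonic_exp e1 e2 m x) x = 2 * real m * harmonic_exp e1 e2 m x"
proof -
  have "(\<Sum>i\<in>Basis. (i \<bullet> e1) * partial_deriv i (harmonic_exp e1 e2 m) x)
      = (\<Sum>i\<in>Basis. if i = e1 then partial_deriv i (harmonic_exp e1 e2 m) x else 0)"
    using e by (intro sum.cong refl) (simp add: inner_Basis)
  also have "\<dots> = real m * harmonic_exp e1 e2 m x"
    using e by (simp add: partial_deriv_harmonic_exp inner_Basis)
  finally show ?thesis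
    by (simp add: laplacian_product[OF smooth_inner smooth_harmonic_exp] partial_deriv_inner
        harmonic_harmonic_exp[OF e] classical_laplacian_def[of "\<lambda>x. x \<bullet> e1"])
qed

text \<open>
  With \<open>x2\<close> fixed, the combination is a polynomial in \<open>exp x1\<close> with coefficients \<open>c m cos(m x2)\<close>, which
  vanishes on an interval and hence identically.  So \<open>cos(m x2)\<close> would vanish for all \<open>x2\<close> in an interval.
\<close>

lemma harmonic_exp_independent:
  fixes e1 e2 :: "'a::euclidean_space"
  assumes e: "e1 \<in> Basis" "e2 \<in> Basis" "e1 \<noteq> e2" and \<Omega>: "open \<Omega>" "x0 \<in> \<Omega>"
    and z: "\<And>x. x \<in> \<Omega> \<Longrightarrow> (\<Sum>m=1..N. c m * harmonic_exp e1 e2 m x) = 0" and m: "m \<in> {1..N}"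
  shows "c m = 0"
proof (rule ccontr)
  assume cm: "c m \<noteq> 0"
  have ee: "e1 \<bullet> e1 = 1" "e2 \<bullet> e2 = 1" "e1 \<bullet> e2 = 0" "e2 \<bullet> e1 = 0" using e by (auto simp: inner_Basis)
  obtain d where d: "d > 0" "ball x0 d \<subseteq> \<Omega>" using \<Omega> open_contains_ball by blast
  define a b where "a = x0 \<bullet> e1" and "b = x0 \<bullet> e2"
  have zero: "(\<Sum>k=1..N. c k * (exp (real k * (a + s)) * cos (real k * (b + t)))) = 0" if st: "\<bar>s\<bar> < d/2" "\<bar>t\<bar> < d/2" for s t
  proof -
    let ?x = "x0 + (s *\<^sub>R e1 + t *\<^sub>R e2)"
    have "norm (s *\<^sub>R e1 + t *\<^sub>R e2) \<le> \<bar>s\<bar> + \<bar>t\<bar>"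
      using norm_triangle_ineq[of "s *\<^sub>R e1" "t *\<^sub>R e2"] e by simp
    then have "dist ?x x0 < d" using st by (simp add: dist_norm)
    then have "?x \<in> ball x0 d" by (simp only: mem_ball dist_commute)
    then have "?x \<in> \<Omega>" using d(2) by blast
    from z[OF this] show ?thesis by (simp add: harmonic_exp_def inner_add_left ee a_def b_def)
  qed
  have cosz: "cos (real m * (b + t)) = 0" if t: "\<bar>t\<bar> < d/2" for t
  proof (rule ccontr)
    assume n: "cos (real m * (b + t)) \<noteq> 0"
    define C where "C k = (if k = 0 then 0 else c k * cos (real k * (b + t)))" for k
    have "C m \<noteq> 0" using n cm m by (simp add: C_def)
    then have fin: "finite {y::real. (\<Sum>k\<le>N. C k * y ^ k) = 0}"
      using m by (intro polyfun_roots_finite[of C m]) auto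
    have "(\<lambda>s. exp (a + s)) ` {-d/2<..<d/2} \<subseteq> {y::real. (\<Sum>k\<le>N. C k * y ^ k) = 0}"
    proof safe
      fix s assume "s \<in> {-d/2<..<d/2}"
      then have s: "\<bar>s\<bar> < d/2" by auto
      have "(\<Sum>k\<le>N. C k * exp (a + s) ^ k) = (\<Sum>k=1..N. C k * exp (a + s) ^ k)"
        by (intro sum.mono_neutral_right) (auto simp: C_def)
      also have "\<dots> = (\<Sum>k=1..N. c k * (exp (real k * (a + s)) * cos (real k * (b + t))))"
        by (intro sum.cong refl) (auto simp: C_def exp_of_nat_mult)
      also have "\<dots> = 0" by (rule zero[OF s t])
      finally show "(\<Sum>k\<le>N. C k * exp (a + s) ^ k) = 0" .
    qed
    then have "finite ((\<lambda>s. exp (a + s)) ` {-d/2<..<d/2})" using fin finite_subset by blast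
    moreover have "inj_on (\<lambda>s. exp (a + s)) {-d/2<..<d/2}" by (auto simp: inj_on_def)
    ultimately have "finite {-d/2<..<d/2}" by (rule finite_imageD)
    then show False using infinite_Ioo[of "-d/2" "d/2"] d(1) by simp
  qed
  define t where "t = min (d/4) (1 / real m)"
  have m1: "real m \<ge> 1" using m by auto
  have t: "0 < t" "t < d/2" "real m * t \<le> 1"
  proof -
    show "0 < t" "t < d/2" using d m1 by (auto simp: t_def)
    have "real m * t \<le> real m * (1 / real m)" using m1 by (intro mult_left_mono) (auto simp: t_def)
    then show "real m * t \<le> 1" using m1 by simp
  qed
  have c0: "cos (real m * b) = 0" using cosz[of 0] d by simp
  have "cos (real m * b + real m * t) = 0" using cosz[of t] t by (simp add: distrib_left)
  then have "sin (real m * b) * sin (real m * t) = 0" using c0 by (simp add: cos_add)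
  moreover have "sin (real m * t) > 0" using t m1 pi_gt3 by (intro sin_gt_zero) auto
  ultimately have "sin (real m * b) = 0" by simp
  then show False using c0 sin_cos_squared_add[of "real m * b"] by simp
qed

context bounded_open_set begin

text \<open>
  The Dirichlet projections \<open>v n\<close> of \<open>\<phi>\<close> to the test functions converge to the solution: their gradients
  form a Cauchy sequence, the functions do so by the Poincare inequality, and orthogonality of
  \<open>\<phi> - v n\<close> to test functions in the limit is the weak equation.
\<close>

lemma dirichlet_solution:
  assumes \<phi>: "smooth \<phi>"
  shows "\<exists>u\<in>H0_Delta \<Omega>. has_weak_laplacian \<Omega> u (classical_laplacian \<phi>)"
proof -
  define a where "a u v = (\<Sum>i\<in>Basis. l2ip \<mu> (partial_deriv i u) (partial_deriv i v))" for u v :: "'a \<Rightarrow> real"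
  have pL: "partial_deriv i u \<in> L2 \<mu>" if "smooth u" "i \<in> Basis" for u i
    using that by (intro smooth_L2[OF smooth_partial_deriv])
  interpret psd_form "{u :: 'a \<Rightarrow> real. smooth u}" a
  proof
    fix u v w :: "'a \<Rightarrow> real" and c :: real
    assume uv: "u \<in> {u. smooth u}" "v \<in> {u. smooth u}"
    then show "(\<lambda>x. u x + c * v x) \<in> {u. smooth u}" by (simp add: smooth_intros)
    show "a u v = a v u" unfolding a_def by (intro sum.cong refl l2ip_sym)
    assume w: "w \<in> {u. smooth u}"
    have "partial_deriv i (\<lambda>x. u x + c * v x) = (\<lambda>x. partial_deriv i u x + c * partial_deriv i v x)" for i
      using uv by (intro partial_deriv_lincomb smooth_Ck) auto
    then show "a (\<lambda>x. u x + c * v x) w = a u w + c * a v w"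
      unfolding a_def using uv w by (simp add: l2ip_lincomb_left pL sum.distrib sum_distrib_left)
  qed (auto simp: a_def l2ip_self intro: sum_nonneg)
  have sub: "Cc_infinity \<Omega> \<subseteq> {u. smooth u}" using Cc_infinity_smooth by blast
  obtain v where v: "\<And>n. v n \<in> Cc_infinity \<Omega>"
    and C: "\<And>e. e > 0 \<Longrightarrow> \<exists>N. \<forall>m\<ge>N. \<forall>n\<ge>N. a (\<lambda>x. v m x - v n x) (\<lambda>x. v m x - v n x) < e"
    and O: "\<And>\<psi>. \<psi> \<in> Cc_infinity \<Omega> \<Longrightarrow> (\<lambda>n. a (\<lambda>x. \<phi> x - v n x) \<psi>) \<longlonglongrightarrow> 0"
    using projection_sequence[of "Cc_infinity \<Omega>" "\<lambda>x. 0" \<phi>, OF sub Cc_infinity_zero Cc_infinity_lincomb] \<phi> by blast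
  have sv: "smooth (v n)" for n by (rule Cc_infinity_smooth[OF v])
  have vd: "(\<lambda>x. v m x - v n x) \<in> Cc_infinity \<Omega>" for m n
    using Cc_infinity_lincomb[OF v[of m] v[of n], of "-1"] by simp
  have pdd: "partial_deriv i (\<lambda>x. v m x - v n x) = (\<lambda>x. partial_deriv i (v m) x - partial_deriv i (v n) x)" for i m n
    by (intro ext partial_deriv_diff smooth_differentiable sv)
  have Cd: "\<exists>N. \<forall>m\<ge>N. \<forall>n\<ge>N. l2norm \<mu> (\<lambda>x. partial_deriv i (v m) x - partial_deriv i (v n) x) < e"
    if e: "e > 0" and i: "i \<in> Basis" for e i
  proof -
    obtain N where N: "\<And>m n. m \<ge> N \<Longrightarrow> n \<ge> N \<Longrightarrow> a (\<lambda>x. v m x - v n x) (\<lambda>x. v m x - v n x) < e\<^sup>2"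
      using C[of "e\<^sup>2"] e by auto
    have "l2norm \<mu> (\<lambda>x. partial_deriv i (v m) x - partial_deriv i (v n) x) < e" if mn: "m \<ge> N" "n \<ge> N" for m n
    proof -
      have "(l2norm \<mu> (partial_deriv i (\<lambda>x. v m x - v n x)))\<^sup>2 \<le> a (\<lambda>x. v m x - v n x) (\<lambda>x. v m x - v n x)"
        unfolding a_def l2ip_self using i by (intro member_le_sum) auto
      also have "\<dots> < e\<^sup>2" by (rule N[OF mn])
      finally show ?thesis unfolding pdd using e by (intro power2_less_imp_less[of _ e]) auto
    qed
    then show ?thesis by blast
  qed
  obtain i0 :: 'a where i0: "i0 \<in> Basis" using nonempty_Basis by blast
  have Cv: "\<exists>N. \<forall>m\<ge>N. \<forall>n\<ge>N. l2norm \<mu> (\<lambda>x. v m x - v n x) < e" if e: "e > 0" for e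
  proof -
    have P: "poincare_const > 0" by (rule poincare_const)
    obtain N where N: "\<And>m n. m \<ge> N \<Longrightarrow> n \<ge> N \<Longrightarrow> l2norm \<mu> (\<lambda>x. partial_deriv i0 (v m) x - partial_deriv i0 (v n) x) < e / poincare_const"
      using Cd[OF _ i0, of "e / poincare_const"] e P by auto
    have "l2norm \<mu> (\<lambda>x. v m x - v n x) < e" if mn: "m \<ge> N" "n \<ge> N" for m n
    proof -
      have "l2norm \<mu> (\<lambda>x. v m x - v n x) \<le> poincare_const * l2norm \<mu> (\<lambda>x. partial_deriv i0 (v m) x - partial_deriv i0 (v n) x)"
        using poincare_const(2)[OF vd i0, of m n] unfolding pdd .
      also have "\<dots> < poincare_const * (e / poincare_const)" using N[OF mn] P by (intro mult_strict_left_mono)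
      finally show ?thesis using P by simp
    qed
    then show ?thesis by blast
  qed
  obtain u where u: "u \<in> L2 \<mu>" "(\<lambda>n. l2norm \<mu> (\<lambda>x. v n x - u x)) \<longlonglongrightarrow> 0"
    using L2_complete[OF fin test_L2[OF v] Cv] by blast
  have "\<forall>i\<in>Basis. \<exists>g. g \<in> L2 \<mu> \<and> (\<lambda>n. l2norm \<mu> (\<lambda>x. partial_deriv i (v n) x - g x)) \<longlonglongrightarrow> 0"
  proof
    fix i :: 'a assume i: "i \<in> Basis"
    show "\<exists>g. g \<in> L2 \<mu> \<and> (\<lambda>n. l2norm \<mu> (\<lambda>x. partial_deriv i (v n) x - g x)) \<longlonglongrightarrow> 0"
      using L2_complete[OF fin test_partial_L2[OF v i] Cd[OF _ i]] by blast
  qed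
  from bchoice[OF this] obtain g where
    gg: "\<forall>i\<in>Basis. g i \<in> L2 \<mu> \<and> (\<lambda>n. l2norm \<mu> (\<lambda>x. partial_deriv i (v n) x - g i x)) \<longlonglongrightarrow> 0" by blast
  define G where "G x = (\<Sum>i\<in>Basis. g i x *\<^sub>R i)" for x
  have Gi: "(\<lambda>x. G x \<bullet> i) = g i" if "i \<in> Basis" for i
    using that by (simp add: G_def inner_sum_left_Basis)
  have Gx: "G x \<bullet> i = g i x" if "i \<in> Basis" for i x using fun_cong[OF Gi[OF that]] .
  have H: "H10_grad u G"
    unfolding H10_grad_def H10_approx_def using u v gg by (auto simp: Gx intro!: exI[of _ v])
  have l: "has_weak_laplacian \<Omega> u (classical_laplacian \<phi>)"
  proof (rule has_weak_laplacianI)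
    show "classical_laplacian \<phi> \<in> L2 \<mu>" by (rule smooth_L2[OF smooth_classical_laplacian[OF \<phi>]])
    fix \<psi> assume \<psi>: "\<psi> \<in> Cc_infinity \<Omega>"
    note s\<psi> = Cc_infinity_smooth[OF \<psi>]
    have "l2ip \<mu> u (classical_laplacian \<psi>) = - (\<Sum>i\<in>Basis. l2ip \<mu> (g i) (partial_deriv i \<psi>))"
    proof -
      have "l2ip \<mu> u (partial_deriv i (partial_deriv i \<psi>)) = - l2ip \<mu> (g i) (partial_deriv i \<psi>)" if i: "i \<in> Basis" for i
        using H10_grad_ip[OF H smooth_partial_deriv[OF s\<psi> i] i] unfolding Gi[OF i] .
      then show ?thesis by (simp add: laplacian_ip_sum[OF u(1) s\<psi>] sum_negf)
    qed
    moreover have "(\<Sum>i\<in>Basis. l2ip \<mu> (g i) (partial_deriv i \<psi>)) = a \<phi> \<psi>"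
    proof -
      have "(\<lambda>n. a (v n) \<psi>) \<longlonglongrightarrow> (\<Sum>i\<in>Basis. l2ip \<mu> (g i) (partial_deriv i \<psi>))"
        unfolding a_def using gg by (intro tendsto_sum l2ip_tendsto test_partial_L2[OF v] test_partial_L2[OF \<psi>]) auto
      then have 1: "(\<lambda>n. a \<phi> \<psi> - a (v n) \<psi>) \<longlonglongrightarrow> a \<phi> \<psi> - (\<Sum>i\<in>Basis. l2ip \<mu> (g i) (partial_deriv i \<psi>))"
        by (intro tendsto_intros)
      have 2: "(\<lambda>n. a \<phi> \<psi> - a (v n) \<psi>) \<longlonglongrightarrow> 0"
        using O[OF \<psi>] diff_left[of \<phi> "v _" \<psi>] \<phi> sv s\<psi> by simp
      show ?thesis using LIMSEQ_unique[OF 1 2] by simp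
    qed
    moreover have "a \<phi> \<psi> = - l2ip \<mu> (classical_laplacian \<phi>) \<psi>"
      using weak_laplacian_energy_test[OF smooth_L2[OF \<phi>] has_weak_gradient_classical[OF smooth_Ck[OF \<phi>]]
          has_weak_laplacian_classical[OF smooth_Ck[OF \<phi>]] \<psi>] by (simp add: a_def)
    ultimately show "l2ip \<mu> u (classical_laplacian \<psi>) = l2ip \<mu> (classical_laplacian \<phi>) \<psi>" by simp
  qed
  show ?thesis using H0_DeltaI[OF H l] l by blast
qed

lemma continuous_AE_zero:
  fixes h :: "'a \<Rightarrow> real"
  assumes h: "continuous_on UNIV h" and z: "AE x in \<mu>. h x = 0" and x: "x \<in> \<Omega>"
  shows "h x = 0"
proof (rule ccontr)
  assume n: "h x \<noteq> 0"
  have "open {x. h x \<noteq> 0}" using h by (intro open_Collect_neq) (auto intro: continuous_intros)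
  then have op: "open (\<Omega> \<inter> {x. h x \<noteq> 0})" using open_\<Omega> by blast
  have "AE x in lebesgue. x \<in> \<Omega> \<longrightarrow> h x = 0"
    using z by (subst (asm) AE_restrict_space_iff) auto
  then have "\<Omega> \<inter> {x. h x \<noteq> 0} \<in> null_sets lebesgue"
    using op by (subst AE_iff_null_sets) (auto elim!: eventually_mono simp: lborelD)
  then have "negligible (\<Omega> \<inter> {x. h x \<noteq> 0})" by (simp add: negligible_iff_null_sets)
  then show False using open_not_negligible[OF op] x n by blast
qed

text \<open>
  Among the \<open>n + 1\<close> solutions \<open>u m\<close> with Laplacians \<open>harmonic_exp e1 e2 m\<close>, a nontrivial combination \<open>V\<close> is
  orthogonal to all \<open>w j\<close>.  Its Laplacian \<open>H\<close> is harmonic, and since \<open>V\<close> vanishes on the boundary, the Green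
  form of \<open>V\<close> and \<open>H\<close> is the square of the norm of \<open>H\<close>.
\<close>

theorem infinite_rank:
  fixes w :: "nat \<Rightarrow> 'a \<Rightarrow> real" and n :: nat
  assumes dim: "DIM('a) \<ge> 2" and ne: "\<Omega> \<noteq> {}" and w: "\<And>j. j \<in> {1..n} \<Longrightarrow> w j \<in> H0_Delta \<Omega>"
  shows "\<exists>u\<in>H0_Delta \<Omega>. (\<forall>j\<in>{1..n}. inner_Delta \<Omega> u (w j) = 0) \<and> (\<exists>\<phi>. smooth \<phi> \<and> green_form u \<phi> \<noteq> 0)"
proof -
  have "\<exists>e1 e2 :: 'a. e1 \<in> Basis \<and> e2 \<in> Basis \<and> e1 \<noteq> e2"
  proof (rule ccontr)
    assume "\<not> ?thesis"
    then have "card (Basis :: 'a set) \<le> Suc 0" by (subst card_le_Suc0_iff_eq) auto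
    then show False using dim by simp
  qed
  then obtain e1 e2 :: 'a where e: "e1 \<in> Basis" "e2 \<in> Basis" "e1 \<noteq> e2" by blast
  let ?h = "harmonic_exp e1 e2"
  have "\<forall>m\<in>{1..Suc n}. \<exists>u. u \<in> H0_Delta \<Omega> \<and> has_weak_laplacian \<Omega> u (?h m)"
  proof
    fix m assume m: "m \<in> {1..Suc n}"
    let ?\<phi> = "\<lambda>x. (x \<bullet> e1) * ?h m x"
    obtain u where u: "u \<in> H0_Delta \<Omega>" "has_weak_laplacian \<Omega> u (classical_laplacian ?\<phi>)"
      using dirichlet_solution[OF smooth_intros(4)[OF smooth_inner smooth_harmonic_exp], of e1 e1 e2 m] by blast
    have z: "(\<lambda>x. 0) \<in> H0_Delta \<Omega>" by (rule test_H0_Delta[OF Cc_infinity_zero])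
    have lz: "has_weak_laplacian \<Omega> (\<lambda>x. 0) (\<lambda>x. 0)" by (rule has_weak_laplacianI) (auto simp: l2ip_def)
    have uL: "u \<in> L2 \<mu>" by (rule H0_DeltaD[OF u(1)])
    have "(\<lambda>x. 0 + (1 / (2 * real m)) * classical_laplacian ?\<phi> x) = ?h m"
      using m by (intro ext) (simp add: laplacian_inner_times_harmonic_exp[OF e])
    then have "has_weak_laplacian \<Omega> (\<lambda>x. 0 + (1 / (2 * real m)) * u x) (?h m)"
      using has_weak_laplacian_lincomb[OF L2_zero uL lz u(2), of "1 / (2 * real m)"] by simp
    then show "\<exists>u. u \<in> H0_Delta \<Omega> \<and> has_weak_laplacian \<Omega> u (?h m)"
      using H0_Delta_lincomb(1)[OF z u(1), of "1 / (2 * real m)"] by blast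
  qed
  from bchoice[OF this] obtain u where u: "\<forall>m\<in>{1..Suc n}. u m \<in> H0_Delta \<Omega> \<and> has_weak_laplacian \<Omega> (u m) (?h m)" by blast
  obtain c where c: "\<exists>m\<in>{1..Suc n}. c m \<noteq> 0"
    "\<forall>j\<in>{1..n}. (\<Sum>m\<in>{1..Suc n}. c m * inner_Delta \<Omega> (u m) (w j)) = 0"
    using underdetermined_system[of "{1..Suc n}" n "\<lambda>m j. inner_Delta \<Omega> (u m) (w j)"] by auto
  define U where "U M x = (\<Sum>m\<in>{1..M}. c m * u m x)" for M x
  define h where "h M x = (\<Sum>m\<in>{1..M}. c m * ?h m x)" for M x
  have Uh: "U M \<in> H0_Delta \<Omega> \<and> has_weak_laplacian \<Omega> (U M) (h M) \<and>
      (\<forall>v\<in>H0_Delta \<Omega>. inner_Delta \<Omega> (U M) v = (\<Sum>m\<in>{1..M}. c m * inner_Delta \<Omega> (u m) v))" if "M \<le> Suc n" for M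
    using that
  proof (induction M)
    case 0
    have z: "(\<lambda>x. 0) \<in> H0_Delta \<Omega>" by (rule test_H0_Delta[OF Cc_infinity_zero])
    have lz: "has_weak_laplacian \<Omega> (\<lambda>x. 0) (\<lambda>x. 0)" by (rule has_weak_laplacianI) (auto simp: l2ip_def)
    have "inner_Delta \<Omega> (\<lambda>x. 0) v = 0" if "v \<in> H0_Delta \<Omega>" for v
      using inner_Delta_lincomb[OF z z that, of "-1"] by simp
    then show ?case using z lz by (simp add: U_def[abs_def] h_def[abs_def])
  next
    case (Suc M)
    then have IH: "U M \<in> H0_Delta \<Omega>" "has_weak_laplacian \<Omega> (U M) (h M)"
      "\<And>v. v \<in> H0_Delta \<Omega> \<Longrightarrow> inner_Delta \<Omega> (U M) v = (\<Sum>m\<in>{1..M}. c m * inner_Delta \<Omega> (u m) v)"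
      and uM: "u (Suc M) \<in> H0_Delta \<Omega>" "has_weak_laplacian \<Omega> (u (Suc M)) (?h (Suc M))" using u by auto
    have eU: "U (Suc M) = (\<lambda>x. U M x + c (Suc M) * u (Suc M) x)" and eh: "h (Suc M) = (\<lambda>x. h M x + c (Suc M) * ?h (Suc M) x)"
      by (auto simp: U_def h_def)
    show ?case
      unfolding eU eh
      using H0_Delta_lincomb(1)[OF IH(1) uM(1)] IH(3) inner_Delta_lincomb[OF IH(1) uM(1)]
        has_weak_laplacian_lincomb[OF H0_DeltaD(1)[OF IH(1)] H0_DeltaD(1)[OF uM(1)] IH(2) uM(2)] by auto
  qed
  define V where "V = U (Suc n)"
  define H where "H = h (Suc n)"
  have V: "V \<in> H0_Delta \<Omega>" "has_weak_laplacian \<Omega> V H" and orth: "\<And>j. j \<in> {1..n} \<Longrightarrow> inner_Delta \<Omega> V (w j) = 0"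
    using Uh[of "Suc n"] c(2) w unfolding V_def H_def by auto
  have sH: "smooth H" unfolding H_def h_def[abs_def] by (intro smooth_sum smooth_intros smooth_harmonic_exp)
  have lapH: "classical_laplacian (h M) x = 0" for M x
  proof (induction M)
    case 0
    then show ?case by (simp add: h_def[abs_def] classical_laplacian_def)
  next
    case (Suc M)
    have sh: "smooth (h M)" unfolding h_def[abs_def] by (intro smooth_sum smooth_intros smooth_harmonic_exp)
    have eh: "h (Suc M) = (\<lambda>x. h M x + c (Suc M) * ?h (Suc M) x)" by (auto simp: h_def)
    have "partial_deriv i (partial_deriv i (h (Suc M))) x
        = partial_deriv i (partial_deriv i (h M)) x + c (Suc M) * partial_deriv i (partial_deriv i (?h (Suc M))) x" if i: "i \<in> Basis" for i
      unfolding eh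
      using partial_deriv_lincomb[OF smooth_Ck[OF sh] smooth_Ck[OF smooth_harmonic_exp]]
        partial_deriv_lincomb[OF smooth_Ck[OF smooth_partial_deriv[OF sh i]] smooth_Ck[OF smooth_partial_deriv[OF smooth_harmonic_exp i]]]
      by simp
    then have "classical_laplacian (h (Suc M)) x = classical_laplacian (h M) x + c (Suc M) * classical_laplacian (?h (Suc M)) x"
      by (simp add: classical_laplacian_def sum.distrib sum_distrib_left)
    then show ?case using Suc harmonic_harmonic_exp[OF e] by simp
  qed
  let ?G = "weak_gradient \<Omega> V"
  note VG = H0_DeltaD(2)[OF V(1)] and VL = H0_DeltaD(1)[OF V(1)]
  have "green_form V H = (\<Sum>i\<in>Basis. l2ip \<mu> (\<lambda>x. ?G x \<bullet> i) (\<lambda>x. grad H x \<bullet> i)) + l2ip \<mu> H H"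
    by (rule green_form_eq[OF H10_grad_weak[OF VG] V(2) smooth_L2[OF sH] has_weak_gradient_classical[OF smooth_Ck[OF sH]]])
  also have "(\<Sum>i\<in>Basis. l2ip \<mu> (\<lambda>x. ?G x \<bullet> i) (\<lambda>x. grad H x \<bullet> i)) = (\<Sum>i\<in>Basis. - l2ip \<mu> V (partial_deriv i (partial_deriv i H)))"
  proof (intro sum.cong refl)
    fix i :: 'a assume i: "i \<in> Basis"
    show "l2ip \<mu> (\<lambda>x. ?G x \<bullet> i) (\<lambda>x. grad H x \<bullet> i) = - l2ip \<mu> V (partial_deriv i (partial_deriv i H))"
      using H10_grad_ip[OF VG smooth_partial_deriv[OF sH i] i] i by simp
  qed
  also have "\<dots> = - l2ip \<mu> V (classical_laplacian H)" by (simp add: laplacian_ip_sum[OF VL sH] sum_negf)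
  also have "\<dots> = 0" using lapH by (simp add: H_def l2ip_def)
  finally have gf: "green_form V H = (l2norm \<mu> H)\<^sup>2" by (simp add: l2ip_self)
  have "l2norm \<mu> H \<noteq> 0"
  proof
    assume "l2norm \<mu> H = 0"
    then have ae: "AE x in \<mu>. H x = 0" by (rule l2norm_eq_0_AE[OF smooth_L2[OF sH]])
    have z: "(\<Sum>m=1..Suc n. c m * ?h m x) = 0" if "x \<in> \<Omega>" for x
      using continuous_AE_zero[OF smooth_continuous[OF sH] ae that] by (simp add: H_def h_def)
    obtain x0 where "x0 \<in> \<Omega>" using ne by blast
    then have "c m = 0" if "m \<in> {1..Suc n}" for m
      using harmonic_exp_independent[OF e open_\<Omega> _ z that] by blast
    then show False using c(1) by blast
  qed
  then show ?thesis using V(1) orth sH gf by (intro bexI[of _ V]) auto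
qed

end

section \<open>Sequential maximization for a pair of forms\<close>

text \<open>
  Sequential maximization of \<open>m\<close> on the unit ball of \<open>a\<close>.  The assumption \<open>infinite_dim\<close> prevents the
  maxima from reaching 0, and \<open>compactness\<close> says that \<open>m\<close> is compact relative to \<open>a\<close>.
\<close>

locale spectral_pair = A: psd_form V a + M: psd_form V m
  for V :: "('x \<Rightarrow> real) set" and a m :: "('x \<Rightarrow> real) \<Rightarrow> ('x \<Rightarrow> real) \<Rightarrow> real" +
  fixes b :: "nat \<Rightarrow> 'x \<Rightarrow> real"
  assumes feasible: "k \<ge> 1 \<Longrightarrow> b k \<in> V \<and> a (b k) (b k) \<le> 1 \<and> (\<forall>j\<in>{1..<k}. a (b k) (b j) = 0)"
    and maximal: "k \<ge> 1 \<Longrightarrow> u \<in> V \<Longrightarrow> a u u \<le> 1 \<Longrightarrow> (\<And>j. j \<in> {1..<k} \<Longrightarrow> a u (b j) = 0) \<Longrightarrow> m u u \<le> m (b k) (b k)"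
    and infinite_dim: "\<exists>u\<in>V. (\<forall>j\<in>{1..n}. a u (b j) = 0) \<and> m u u \<noteq> 0"
    and compactness: "(\<And>n. s n \<in> V \<and> a (s n) (s n) \<le> 1) \<Longrightarrow>
       \<exists>r. strict_mono (r :: nat \<Rightarrow> nat) \<and> (\<forall>e>0. \<exists>N. \<forall>i\<ge>N. \<forall>j\<ge>N. m (\<lambda>x. s (r i) x - s (r j) x) (\<lambda>x. s (r i) x - s (r j) x) < e)"
begin

definition \<beta> :: "nat \<Rightarrow> real" where "\<beta> k = m (b k) (b k)"

lemma bV: "k \<ge> 1 \<Longrightarrow> b k \<in> V" using feasible by blast

text \<open>
  Scaling of \<open>u\<close>; if \<open>a u u = 0\<close>, all multiples of \<open>u\<close> are feasible, which forces \<open>m u u = 0\<close>.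
\<close>

lemma rayleigh:
  assumes k: "k \<ge> 1" and u: "u \<in> V" and orth: "\<And>j. j \<in> {1..<k} \<Longrightarrow> a u (b j) = 0"
  shows "m u u \<le> \<beta> k * a u u"
proof -
  have scaled: "c\<^sup>2 * m u u \<le> \<beta> k" if "c\<^sup>2 * a u u \<le> 1" for c
  proof -
    have "m (\<lambda>x. c * u x) (\<lambda>x. c * u x) \<le> m (b k) (b k)"
    proof (rule maximal[OF k A.cmult[OF u]])
      show "a (\<lambda>x. c * u x) (\<lambda>x. c * u x) \<le> 1" using that by (simp add: A.square_cmult[OF u])
      fix j assume j: "j \<in> {1..<k}"
      then have "b j \<in> V" using bV by simp
      then show "a (\<lambda>x. c * u x) (b j) = 0" using orth[OF j] by (simp add: A.cmult_left[OF u])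
    qed
    then show ?thesis by (simp add: \<beta>_def M.square_cmult[OF u])
  qed
  have a0: "a u u \<ge> 0" and m0: "m u u \<ge> 0" using A.nonneg[OF u] M.nonneg[OF u] by auto
  show ?thesis
  proof (cases "a u u = 0")
    case True
    have "m u u = 0"
    proof (rule ccontr)
      assume "m u u \<noteq> 0"
      then have mp: "m u u > 0" using m0 by simp
      have bk: "\<beta> k \<ge> 0" unfolding \<beta>_def by (rule M.nonneg[OF bV[OF k]])
      define c where "c = sqrt ((\<beta> k + 1) / m u u)"
      have "c\<^sup>2 = (\<beta> k + 1) / m u u" using bk mp by (simp add: c_def)
      then have "c\<^sup>2 * m u u = \<beta> k + 1" using mp by simp
      then show False using scaled[of c] True by simp
    qed
    then show ?thesis using True by simp
  next
    case False
    then have ap: "a u u > 0" using a0 by simp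
    define c where "c = sqrt (1 / a u u)"
    have c2: "c\<^sup>2 = 1 / a u u" using ap by (simp add: c_def)
    have "m u u / a u u \<le> \<beta> k" using scaled[of c] ap by (simp add: c2)
    then show ?thesis using ap by (simp add: field_simps)
  qed
qed

lemma \<beta>_pos: assumes k: "k \<ge> 1" shows "\<beta> k > 0"
proof -
  obtain u where u: "u \<in> V" "\<forall>j\<in>{1..k - 1}. a u (b j) = 0" "m u u \<noteq> 0" using infinite_dim by blast
  have "m u u \<le> \<beta> k * a u u" using u(2) by (intro rayleigh[OF k u(1)]) auto
  moreover have "m u u > 0" using M.nonneg[OF u(1)] u(3) by simp
  ultimately have "\<beta> k * a u u > 0" by simp
  then show ?thesis using A.nonneg[OF u(1)] by (simp add: zero_less_mult_iff)
qed

lemma normalized: assumes k: "k \<ge> 1" shows "a (b k) (b k) = 1"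
proof -
  have "\<beta> k \<le> \<beta> k * a (b k) (b k)"
    using rayleigh[OF k bV[OF k]] feasible[OF k] by (simp add: \<beta>_def)
  then have "a (b k) (b k) \<ge> 1" using \<beta>_pos[OF k] by simp
  then show ?thesis using feasible[OF k] by simp
qed

lemma orthogonal: assumes "j \<ge> 1" "k \<ge> 1" "j \<noteq> k" shows "a (b j) (b k) = 0"
proof (cases "j < k")
  case True
  then show ?thesis using feasible[of k] assms A.sym[OF bV bV, of j k] by auto
next
  case False
  then show ?thesis using feasible[of j] assms by auto
qed

lemma orthonormal: "j \<ge> 1 \<Longrightarrow> k \<ge> 1 \<Longrightarrow> a (b j) (b k) = (if j = k then 1 else 0)"
  using orthogonal normalized by auto

lemma \<beta>_decreasing: assumes "1 \<le> j" "j \<le> k" shows "\<beta> k \<le> \<beta> j"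
  unfolding \<beta>_def using assms feasible[of k] by (intro maximal) auto

definition residual :: "nat \<Rightarrow> ('x \<Rightarrow> real) \<Rightarrow> 'x \<Rightarrow> real" where
  "residual n u x = u x - (\<Sum>j=1..n. a u (b j) * b j x)"

lemma residual:
  assumes u: "u \<in> V" and v: "v \<in> V"
  shows "residual n u \<in> V"
    and "a (residual n u) v = a u v - (\<Sum>j=1..n. a u (b j) * a (b j) v)"
    and "m (residual n u) v = m u v - (\<Sum>j=1..n. a u (b j) * m (b j) v)"
proof -
  have SA: "(\<lambda>x. \<Sum>j=1..n. a u (b j) * b j x) \<in> V"
      "a (\<lambda>x. \<Sum>j=1..n. a u (b j) * b j x) v = (\<Sum>j=1..n. a u (b j) * a (b j) v)"
    using A.sum_left[OF v, of "{1..n}" b "\<lambda>j. a u (b j)"] bV by auto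
  have SM: "m (\<lambda>x. \<Sum>j=1..n. a u (b j) * b j x) v = (\<Sum>j=1..n. a u (b j) * m (b j) v)"
    using M.sum_left[OF v, of "{1..n}" b "\<lambda>j. a u (b j)"] bV by auto
  show "residual n u \<in> V" unfolding residual_def[abs_def] by (rule A.diff[OF u SA(1)])
  show "a (residual n u) v = a u v - (\<Sum>j=1..n. a u (b j) * a (b j) v)"
    unfolding residual_def[abs_def] A.diff_left[OF u SA(1) v] SA(2) ..
  show "m (residual n u) v = m u v - (\<Sum>j=1..n. a u (b j) * m (b j) v)"
    unfolding residual_def[abs_def] M.diff_left[OF u SA(1) v] SM ..
qed

lemma residual_orthogonal:
  assumes u: "u \<in> V" and i: "i \<in> {1..n}"
  shows "a (residual n u) (b i) = 0"
proof -
  have bi: "b i \<in> V" using i bV by simp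
  have "(\<Sum>j=1..n. a u (b j) * a (b j) (b i)) = (\<Sum>j=1..n. if j = i then a u (b j) else 0)"
    using i by (intro sum.cong refl) (simp add: orthonormal)
  also have "\<dots> = a u (b i)" using i by simp
  finally show ?thesis by (simp add: residual(2)[OF u bi])
qed

text \<open>
  The quadratic form \<open>\<beta> k * a - m\<close> is nonnegative on the \<open>a\<close>-orthogonal complement of the earlier maximizers
  and vanishes at \<open>b k\<close>, so \<open>b k\<close> is in its kernel there.  By induction both \<open>a\<close> and \<open>m\<close> vanish between
  \<open>b k\<close> and the earlier maximizers, so the equation extends to all \<open>v\<close>.
\<close>

theorem eigen_equation:
  assumes "k \<ge> 1" "v \<in> V"
  shows "m (b k) v = \<beta> k * a (b k) v"
  using assms
proof (induction k arbitrary: v rule: less_induct)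
  case (less k)
  note k = less.prems(1) and bk = bV[OF less.prems(1)]
  have on_complement: "m (b k) v = \<beta> k * a (b k) v" if v: "v \<in> V" and vo: "\<And>j. j \<in> {1..<k} \<Longrightarrow> a v (b j) = 0" for v
  proof (rule ccontr)
    define D where "D = \<beta> k * a (b k) v - m (b k) v"
    define Q where "Q = \<beta> k * a v v - m v v"
    assume "m (b k) v \<noteq> \<beta> k * a (b k) v"
    then have D: "D \<noteq> 0" by (simp add: D_def)
    have Q: "Q \<ge> 0" unfolding Q_def using rayleigh[OF k v vo] by simp
    have ineq: "0 \<le> 2 * t * D + t\<^sup>2 * Q" for t
    proof -
      have "m (\<lambda>x. b k x + t * v x) (\<lambda>x. b k x + t * v x) \<le> \<beta> k * a (\<lambda>x. b k x + t * v x) (\<lambda>x. b k x + t * v x)"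
      proof (rule rayleigh[OF k A.lincomb[OF bk v]])
        fix j assume j: "j \<in> {1..<k}"
        then have "b j \<in> V" using bV by simp
        then show "a (\<lambda>x. b k x + t * v x) (b j) = 0"
          using vo[OF j] feasible[OF k] j by (simp add: A.lin[OF bk v])
      qed
      then show ?thesis
        using normalized[OF k] unfolding A.square[OF bk v] M.square[OF bk v] D_def Q_def \<beta>_def
        by (simp add: algebra_simps)
    qed
    \<comment> \<open>Near the minimizer of the quadratic, with the summand 1 to cover \<open>Q = 0\<close>.\<close>
    define t where "t = - D / (Q + 1)"
    have "2 * t * D + t\<^sup>2 * Q = - (D\<^sup>2 * (Q + 2)) / (Q + 1)\<^sup>2"
      using Q by (simp add: t_def power2_eq_square divide_simps) (simp add: algebra_simps)
    also have "\<dots> < 0" using D Q by (simp add: divide_neg_pos)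
    finally show False using ineq[of t] by simp
  qed
  define w where "w = residual (k - 1) v"
  have wV: "w \<in> V" unfolding w_def by (rule residual(1)[OF less.prems(2) bk])
  have rng: "{1..k - 1} = {1..<k}" using k by auto
  have "a w (b j) = 0" if "j \<in> {1..<k}" for j
    using residual_orthogonal[OF less.prems(2), of j "k - 1"] that unfolding w_def rng by simp
  then have mw: "m (b k) w = \<beta> k * a (b k) w" by (rule on_complement[OF wV])
  have mz: "m (b j) (b k) = 0" if "j \<in> {1..k-1}" for j
    using less.IH[of j "b k"] that k bk orthogonal[of j k] by auto
  have az: "a (b j) (b k) = 0" if "j \<in> {1..k-1}" for j
    using that k orthogonal[of j k] by auto
  have "m w (b k) = m v (b k)" unfolding w_def residual(3)[OF less.prems(2) bk] using mz by simp
  moreover have "a w (b k) = a v (b k)" unfolding w_def residual(2)[OF less.prems(2) bk] using az by simp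
  ultimately show ?case
    using mw M.sym[OF bk wV] A.sym[OF bk wV] M.sym[OF bk less.prems(2)] A.sym[OF bk less.prems(2)] by simp
qed

text \<open>
  The \<open>b k\<close> are orthogonal for \<open>m\<close> too, so differences have \<open>m\<close>-square \<open>\<beta> j + \<beta> k\<close>; if the \<open>\<beta> k\<close> had a positive
  lower bound, no subsequence could be Cauchy for \<open>m\<close>.
\<close>

theorem \<beta>_tendsto_0: "\<beta> \<longlonglongrightarrow> 0"
proof (rule LIMSEQ_I)
  fix e :: real assume e: "0 < e"
  have "\<exists>K\<ge>1. \<beta> K < e"
  proof (rule ccontr)
    assume "\<not> ?thesis"
    then have big: "\<beta> k \<ge> e" if "k \<ge> 1" for k using that by force
    have "b (Suc n) \<in> V \<and> a (b (Suc n)) (b (Suc n)) \<le> 1" for n using feasible[of "Suc n"] by simp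
    from compactness[of "\<lambda>n. b (Suc n)", OF this] obtain r N where r: "strict_mono (r :: nat \<Rightarrow> nat)"
      and N: "\<And>i j. i \<ge> N \<Longrightarrow> j \<ge> N \<Longrightarrow> m (\<lambda>x. b (Suc (r i)) x - b (Suc (r j)) x) (\<lambda>x. b (Suc (r i)) x - b (Suc (r j)) x) < e"
      using e by blast
    define p q where "p = Suc (r N)" and "q = Suc (r (Suc N))"
    have pq: "p \<ge> 1" "q \<ge> 1" "p \<noteq> q" using strict_monoD[OF r, of N "Suc N"] by (auto simp: p_def q_def)
    have "m (b p) (b q) = 0" using eigen_equation[OF pq(1) bV[OF pq(2)]] orthogonal[OF pq] by simp
    then have "m (\<lambda>x. b p x - b q x) (\<lambda>x. b p x - b q x) = \<beta> p + \<beta> q"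
      using M.square_diff[OF bV[OF pq(1)] bV[OF pq(2)]] by (simp add: \<beta>_def)
    then show False using N[of N "Suc N"] big[OF pq(1)] big[OF pq(2)] e by (simp add: p_def q_def)
  qed
  then obtain K where K: "K \<ge> 1" "\<beta> K < e" by blast
  have "norm (\<beta> n - 0) < e" if "n \<ge> K" for n
    using \<beta>_decreasing[OF K(1) that] \<beta>_pos[of n] K that by simp
  then show "\<exists>no. \<forall>n\<ge>no. norm (\<beta> n - 0) < e" by blast
qed

lemma null_if_orthogonal_to_all:
  assumes w: "w \<in> V" and orth: "\<And>k. k \<ge> 1 \<Longrightarrow> a w (b k) = 0"
  shows "m w w = 0"
proof -
  have "(\<lambda>k. \<beta> (Suc k) * a w w) \<longlonglongrightarrow> 0 * a w w"
    by (intro tendsto_intros LIMSEQ_Suc \<beta>_tendsto_0)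
  moreover have "m w w \<le> \<beta> (Suc k) * a w w" for k using orth by (intro rayleigh[OF _ w]) auto
  ultimately have "m w w \<le> 0 * a w w" by (intro LIMSEQ_le_const) auto
  then show ?thesis using M.nonneg[OF w] by simp
qed

text \<open>
  Comparing the equations of \<open>u\<close> and of \<open>b j\<close> shows that \<open>u\<close> is orthogonal to \<open>b j\<close> unless \<open>q * \<beta> j = 1\<close>, which
  happens only for \<open>j \<le> n\<close>.  The residual is again an eigenvector and orthogonal to all \<open>b k\<close>, hence null for
  \<open>m\<close>, and then for \<open>a\<close> by its own equation.
\<close>

theorem eigenvector_expansion:
  assumes q: "q > 0"
  shows "\<exists>n. \<forall>u. u \<in> V \<longrightarrow> (\<forall>v\<in>V. a u v = q * m u v) \<longrightarrow>
     a (residual n u) (residual n u) = 0 \<and> (\<forall>j\<in>{1..n}. q * \<beta> j \<noteq> 1 \<longrightarrow> a u (b j) = 0)"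
proof -
  have "\<forall>\<^sub>F k in sequentially. \<beta> k < 1 / q" using \<beta>_tendsto_0 q by (auto dest: order_tendstoD(2)[of _ _ _ "1 / q"])
  then obtain n where n: "\<And>k. k \<ge> n \<Longrightarrow> \<beta> k < 1 / q" by (auto simp: eventually_sequentially)
  have "a (residual n u) (residual n u) = 0 \<and> (\<forall>j\<in>{1..n}. q * \<beta> j \<noteq> 1 \<longrightarrow> a u (b j) = 0)"
    if u: "u \<in> V" and eig: "\<And>v. v \<in> V \<Longrightarrow> a u v = q * m u v" for u
  proof -
    have coeff: "a u (b j) = 0" if j: "j \<ge> 1" "q * \<beta> j \<noteq> 1" for j
    proof -
      have "a u (b j) = q * m (b j) u" using eig[OF bV[OF j(1)]] M.sym[OF u bV[OF j(1)]] by simp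
      also have "\<dots> = (q * \<beta> j) * a u (b j)" using eigen_equation[OF j(1) u] A.sym[OF u bV[OF j(1)]] by simp
      finally show ?thesis using j(2) by simp
    qed
    let ?w = "residual n u"
    have wV: "?w \<in> V" by (rule residual(1)[OF u u])
    have weig: "a ?w v = q * m ?w v" if v: "v \<in> V" for v
    proof -
      have "a u (b j) * a (b j) v = q * (a u (b j) * m (b j) v)" if j: "j \<in> {1..n}" for j
      proof (cases "q * \<beta> j = 1")
        case True
        have "q * (a u (b j) * m (b j) v) = a u (b j) * ((q * \<beta> j) * a (b j) v)"
          using eigen_equation[of j v] j v by simp
        also have "\<dots> = a u (b j) * a (b j) v" by (simp only: True mult_1_left)
        finally show ?thesis by (rule sym)
      next
        case False
        then show ?thesis using coeff[of j] j by simp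
      qed
      then have "(\<Sum>j=1..n. a u (b j) * a (b j) v) = q * (\<Sum>j=1..n. a u (b j) * m (b j) v)"
        unfolding sum_distrib_left by (intro sum.cong refl)
      then show ?thesis using eig[OF v] by (simp add: residual(2,3)[OF u v] right_diff_distrib)
    qed
    have "a ?w (b k) = 0" if k: "k \<ge> 1" for k
    proof (cases "k \<le> n")
      case True
      then show ?thesis using residual_orthogonal[OF u, of k n] k by simp
    next
      case False
      then have "\<beta> k < 1 / q" using n by simp
      then have "q * \<beta> k \<noteq> 1" using q by (auto simp: field_simps)
      then have uk: "a u (b k) = 0" by (rule coeff[OF k])
      have "(\<Sum>j=1..n. a u (b j) * a (b j) (b k)) = 0" using False k by (intro sum.neutral) (auto simp: orthonormal)
      then show ?thesis by (simp add: residual(2)[OF u bV[OF k]] uk)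
    qed
    then have "m ?w ?w = 0" by (rule null_if_orthogonal_to_all[OF wV])
    then have "a ?w ?w = 0" using weig[OF wV] by simp
    then show ?thesis using coeff by auto
  qed
  then show ?thesis by blast
qed

lemma residual_energy:
  assumes u: "u \<in> V" and nk: "n \<le> k"
  shows "a (residual n u) (residual k u) = a (residual k u) (residual k u)"
proof -
  let ?w = "residual k u"
  have wV: "?w \<in> V" by (rule residual(1)[OF u u])
  have "a (b j) ?w = 0" if "j \<in> {1..k}" for j
    using residual_orthogonal[OF u that] A.sym[OF wV bV, of j] that by simp
  then have "a (residual i u) ?w = a u ?w" if "i \<le> k" for i
    using that by (simp add: residual(2)[OF u wV])
  then show ?thesis using nk by simp
qed

text \<open>
  The residuals have decreasing \<open>a\<close>-squares \<open>d n\<close>, and by Pythagoras the square of a difference of residuals is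
  the difference of the corresponding \<open>d\<close>.
\<close>

lemma residual_Cauchy:
  assumes u: "u \<in> V" and e: "e > 0"
  shows "\<exists>N. \<forall>i\<ge>N. \<forall>j\<ge>N. a (\<lambda>x. residual i u x - residual j u x) (\<lambda>x. residual i u x - residual j u x) < e"
proof -
  define d where "d n = a (residual n u) (residual n u)" for n
  have rV: "residual n u \<in> V" for n by (rule residual(1)[OF u u])
  have diff: "a (\<lambda>x. residual i u x - residual j u x) (\<lambda>x. residual i u x - residual j u x) = d i - d j" if "i \<le> j" for i j
    using A.square_diff[OF rV[of i] rV[of j]] residual_energy[OF u that] by (simp add: d_def)
  have d0: "d n \<ge> 0" for n unfolding d_def by (rule A.nonneg[OF rV])
  have dec: "d j \<le> d i" if "i \<le> j" for i j
    using diff[OF that] A.nonneg[OF A.diff[OF rV[of i] rV[of j]]] by simp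
  have "convergent d"
    by (rule decseq_convergent[of d 0]) (auto simp: decseq_def dec d0 convergent_def)
  then have "Cauchy d" by (rule convergent_Cauchy)
  then obtain N where N: "\<And>i j. i \<ge> N \<Longrightarrow> j \<ge> N \<Longrightarrow> \<bar>d i - d j\<bar> < e"
    using CauchyD[OF _ e, of d] unfolding real_norm_def by blast
  have "a (\<lambda>x. residual i u x - residual j u x) (\<lambda>x. residual i u x - residual j u x) < e" if ij: "i \<ge> N" "j \<ge> N" for i j
  proof (cases "i \<le> j")
    case True
    then show ?thesis using diff[OF True] N[OF ij] by simp
  next
    case False
    then have "j \<le> i" by simp
    moreover have "a (\<lambda>x. residual i u x - residual j u x) (\<lambda>x. residual i u x - residual j u x)
        = a (\<lambda>x. residual j u x - residual i u x) (\<lambda>x. residual j u x - residual i u x)"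
      using A.square_diff[OF rV[of i] rV[of j]] A.square_diff[OF rV[of j] rV[of i]] A.sym[OF rV[of i] rV[of j]] by simp
    ultimately show ?thesis using diff[of j i] N[OF ij] by simp
  qed
  then show ?thesis by blast
qed

lemma residual_boundary_tendsto_0:
  assumes u: "u \<in> V"
  shows "(\<lambda>n. m (residual n u) (residual n u)) \<longlonglongrightarrow> 0"
proof (rule tendsto_sandwich[OF _ _ tendsto_const])
  have rV: "residual n u \<in> V" for n by (rule residual(1)[OF u u])
  have "a (residual n u) (residual n u) \<le> a u u" for n
  proof -
    have r0: "residual 0 u = u" by (rule ext) (simp add: residual_def)
    have "0 \<le> a (\<lambda>x. residual 0 u x - residual n u x) (\<lambda>x. residual 0 u x - residual n u x)"
      by (rule A.nonneg[OF A.diff[OF rV rV]])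
    then show ?thesis
      using A.square_diff[OF rV[of 0] rV[of n]] residual_energy[OF u, of 0 n] by (simp add: r0)
  qed
  note small = this
  have "m (residual n u) (residual n u) \<le> \<beta> (Suc n) * a u u" for n
  proof -
    have "m (residual n u) (residual n u) \<le> \<beta> (Suc n) * a (residual n u) (residual n u)"
      by (rule rayleigh[OF _ rV]) (auto intro!: residual_orthogonal[OF u])
    also have "\<dots> \<le> \<beta> (Suc n) * a u u"
      using \<beta>_pos[of "Suc n"] by (intro mult_left_mono small) simp
    finally show ?thesis .
  qed
  then show "\<forall>\<^sub>F n in sequentially. m (residual n u) (residual n u) \<le> \<beta> (Suc n) * a u u" by simp
  have "(\<lambda>n. \<beta> (Suc n) * a u u) \<longlonglongrightarrow> 0 * a u u" by (intro tendsto_intros LIMSEQ_Suc \<beta>_tendsto_0)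
  then show "(\<lambda>n. \<beta> (Suc n) * a u u) \<longlonglongrightarrow> 0" by simp
  show "\<forall>\<^sub>F n in sequentially. 0 \<le> m (residual n u) (residual n u)" using M.nonneg[OF rV] by simp
qed

lemma boundary_bound: "u \<in> V \<Longrightarrow> m u u \<le> \<beta> 1 * a u u"
  by (rule rayleigh) auto

end

section \<open>The form of the Laplacians\<close>

context bounded_open_set begin

lemma psd_form_inner_Delta: "psd_form (H0_Delta \<Omega>) (inner_Delta \<Omega>)"
proof
  fix u v w :: "'a \<Rightarrow> real" and c :: real
  assume u: "u \<in> H0_Delta \<Omega>"
  show "0 \<le> inner_Delta \<Omega> u u" by (simp add: inner_Delta_eq l2ip_self)
  assume v: "v \<in> H0_Delta \<Omega>"
  show "(\<lambda>x. u x + c * v x) \<in> H0_Delta \<Omega>" by (rule H0_Delta_lincomb[OF u v])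
  show "inner_Delta \<Omega> u v = inner_Delta \<Omega> v u" by (simp add: inner_Delta_eq l2ip_sym)
  assume w: "w \<in> H0_Delta \<Omega>"
  show "inner_Delta \<Omega> (\<lambda>x. u x + c * v x) w = inner_Delta \<Omega> u w + c * inner_Delta \<Omega> v w"
    by (rule inner_Delta_lincomb[OF u v w])
qed

lemma norm_Delta_sq: "(norm_Delta \<Omega> u)\<^sup>2 = inner_Delta \<Omega> u u"
  by (simp add: norm_Delta_eq inner_Delta_eq l2ip_self)

lemma inner_Delta_Cauchy_Schwarz:
  "u \<in> H0_Delta \<Omega> \<Longrightarrow> v \<in> H0_Delta \<Omega> \<Longrightarrow> \<bar>inner_Delta \<Omega> u v\<bar> \<le> norm_Delta \<Omega> u * norm_Delta \<Omega> v"
  unfolding inner_Delta_eq norm_Delta_eq by (intro l2_Cauchy_Schwarz H0_DeltaD)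

lemma inner_Delta_AE_zero:
  assumes "AE x in \<mu>. u x = 0"
  shows "inner_Delta \<Omega> u u = 0"
proof -
  have "has_weak_laplacian \<Omega> u (\<lambda>x. 0)"
    unfolding has_weak_laplacian_def
  proof (intro conjI ballI)
    fix \<phi>
    have "(\<integral>x. u x * classical_laplacian \<phi> x \<partial>\<mu>) = 0"
      using assms by (intro integral_eq_zero_AE) (auto elim: eventually_mono)
    then show "(\<integral>x. u x * classical_laplacian \<phi> x \<partial>\<mu>) = (\<integral>x. 0 * \<phi> x \<partial>\<mu>)" by simp
  qed simp
  then have "AE x in \<mu>. weak_laplacian \<Omega> u x = 0" by (rule weak_laplacian_AE)
  then show ?thesis unfolding inner_Delta_def by (intro integral_eq_zero_AE) (auto elim: eventually_mono)
qed

text \<open>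
  The definition of \<open>BH\<close> tests with twice continuously differentiable functions of compact support; their
  Laplacians are limits of Laplacians of smooth test functions.
\<close>

lemma BH_I:
  assumes b: "b \<in> H0_Delta \<Omega>" and test: "\<And>v. v \<in> Cc_infinity \<Omega> \<Longrightarrow> inner_Delta \<Omega> b v = 0"
  shows "b \<in> BH \<Omega>"
  unfolding BH_def
proof (intro CollectI conjI b ballI)
  fix v assume "v \<in> Cc 2 \<Omega>"
  then obtain K where v2: "Ck 2 v" and K: "compact K" "K \<subseteq> \<Omega>" "\<And>x. x \<notin> K \<Longrightarrow> v x = 0"
    unfolding Cc_def by blast
  have v1: "Ck 1 v" by (rule Ck_mono[OF v2]) simp
  have C: "Ck 1 (partial_deriv i v)" if "i \<in> Basis" for i using v2 that by (simp add: numeral_2_eq_2)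
  have hl: "has_weak_laplacian \<Omega> v (classical_laplacian v)" by (rule has_weak_laplacian_classical[OF v2])
  note gL = has_weak_laplacianD(1)[OF hl]
  have vL: "v \<in> L2 \<mu>" by (rule continuous_L2[OF Ck_continuous[OF v1]])
  have green: "l2ip \<mu> v (classical_laplacian \<phi>) = l2ip \<mu> (classical_laplacian v) \<phi>" if s: "smooth \<phi>" for \<phi>
  proof -
    have "l2ip \<mu> v (partial_deriv i (partial_deriv i \<phi>)) = l2ip \<mu> \<phi> (partial_deriv i (partial_deriv i v))" if i: "i \<in> Basis" for i
    proof -
      have z: "partial_deriv i v x = 0" if "x \<notin> K" for x
        by (rule partial_deriv_zero_outside[OF compact_imp_closed[OF K(1)] K(3) that])
      have 1: "(\<integral>x. partial_deriv i \<phi> x * partial_deriv i v x \<partial>\<mu>) = - (\<integral>x. partial_deriv i (partial_deriv i \<phi>) x * v x \<partial>\<mu>)"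
        by (rule integration_by_parts[OF smooth_Ck[OF smooth_partial_deriv[OF s i]] v1 K i])
      have 2: "(\<integral>x. \<phi> x * partial_deriv i (partial_deriv i v) x \<partial>\<mu>) = - (\<integral>x. partial_deriv i \<phi> x * partial_deriv i v x \<partial>\<mu>)"
        by (rule integration_by_parts[OF smooth_Ck[OF s] C[OF i] K(1,2) z i])
      show ?thesis using 1 2 by (simp add: l2ip_def mult.commute)
    qed
    then have "l2ip \<mu> v (classical_laplacian \<phi>) = (\<Sum>i\<in>Basis. l2ip \<mu> \<phi> (partial_deriv i (partial_deriv i v)))"
      by (simp add: laplacian_ip_sum[OF vL s])
    also have "\<dots> = l2ip \<mu> \<phi> (classical_laplacian v)"
      unfolding classical_laplacian_def[abs_def] using C
      by (intro l2ip_sum_right [symmetric] smooth_L2[OF s] continuous_L2) auto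
    finally show ?thesis by (simp add: l2ip_sym)
  qed
  obtain w where w: "\<And>n. w n \<in> Cc_infinity \<Omega>"
    and lim: "(\<lambda>n. l2norm \<mu> (\<lambda>x. classical_laplacian (w n) x - classical_laplacian v x)) \<longlonglongrightarrow> 0"
    using test_approximation[OF vL gL green K(1) _ interior_cone_compact[OF open_\<Omega> K(1,2)]] K(3) by blast
  let ?f = "weak_laplacian \<Omega> b"
  note fL = H0_DeltaD(4)[OF b]
  have repl: "l2ip \<mu> (weak_laplacian \<Omega> z) ?f = l2ip \<mu> (classical_laplacian z) ?f" if z: "Ck 2 z" for z
  proof -
    note hz = has_weak_laplacian_classical[OF z]
    show ?thesis
      using has_weak_laplacianD(1)[OF hz] has_weak_laplacianD(1)[OF has_weak_laplacian_weak_laplacian[OF hz]] fL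
      by (intro l2ip_cong_AE weak_laplacian_AE[OF hz] L2_measurable)
  qed
  have lL: "classical_laplacian (w n) \<in> L2 \<mu>" for n
    by (intro smooth_L2 smooth_classical_laplacian Cc_infinity_smooth[OF w])
  have "(\<lambda>n. l2ip \<mu> (classical_laplacian (w n)) ?f) \<longlonglongrightarrow> l2ip \<mu> (classical_laplacian v) ?f"
    by (rule l2ip_tendsto[OF lL gL fL lim])
  moreover have "l2ip \<mu> (classical_laplacian (w n)) ?f = 0" for n
    using test[OF w, of n] repl[OF smooth_Ck[OF Cc_infinity_smooth[OF w]], of n]
    by (simp add: inner_Delta_eq l2ip_sym[of \<mu> ?f])
  ultimately have "(\<lambda>n::nat. 0) \<longlonglongrightarrow> l2ip \<mu> (classical_laplacian v) ?f" by simp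
  then have "l2ip \<mu> (classical_laplacian v) ?f = 0" using LIMSEQ_unique[OF _ tendsto_const] by metis
  then show "inner_Delta \<Omega> b v = 0" using repl[OF v2] by (simp add: inner_Delta_eq l2ip_sym[of \<mu> ?f])
qed

end

section \<open>The form of the normal derivatives\<close>

locale B2_domain = B1_domain +
  assumes region: "region \<Omega>" and B2: "B2 \<Omega>"
begin

abbreviation "D \<equiv> normal_derivative \<Omega>"

definition boundary_form :: "('a \<Rightarrow> real) \<Rightarrow> ('a \<Rightarrow> real) \<Rightarrow> real" where
  "boundary_form u v = l2ip \<sigma> (D u) (D v)"

lemma has_D: "u \<in> H0_Delta \<Omega> \<Longrightarrow> has_normal_derivative \<Omega> u (D u)"
  unfolding normal_derivative_def using B2 someI_ex[of "has_normal_derivative \<Omega> u"] by (simp add: B2_def)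

lemma D_L2: "u \<in> H0_Delta \<Omega> \<Longrightarrow> D u \<in> L2 \<sigma>"
  using has_D by (simp add: has_normal_derivative_iff)

lemma D_lincomb:
  assumes "u \<in> H0_Delta \<Omega>" "v \<in> H0_Delta \<Omega>"
  shows "AE x in \<sigma>. D (\<lambda>x. u x + c * v x) x = D u x + c * D v x"
  using has_normal_derivative_lincomb[OF assms(1) has_D[OF assms(1)] assms(2) has_D[OF assms(2)], of c]
    has_D[OF H0_Delta_lincomb(1)[OF assms, of c]] by (rule normal_derivative_unique[rotated])

lemma psd_form_boundary_form: "psd_form (H0_Delta \<Omega>) boundary_form"
proof
  fix u v w :: "'a \<Rightarrow> real" and c :: real
  assume u: "u \<in> H0_Delta \<Omega>"
  show "0 \<le> boundary_form u u" by (simp add: boundary_form_def l2ip_self)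
  assume v: "v \<in> H0_Delta \<Omega>"
  show uv: "(\<lambda>x. u x + c * v x) \<in> H0_Delta \<Omega>" by (rule H0_Delta_lincomb[OF u v])
  show "boundary_form u v = boundary_form v u" by (simp add: boundary_form_def l2ip_sym)
  assume w: "w \<in> H0_Delta \<Omega>"
  have "boundary_form (\<lambda>x. u x + c * v x) w = l2ip \<sigma> (\<lambda>x. D u x + c * D v x) (D w)"
    unfolding boundary_form_def
    by (intro l2ip_cong_AE D_lincomb[OF u v] L2_measurable L2_lincomb D_L2 u v w uv)
  then show "boundary_form (\<lambda>x. u x + c * v x) w = boundary_form u w + c * boundary_form v w"
    using l2ip_lincomb_left[OF D_L2[OF u] D_L2[OF v] D_L2[OF w]] by (simp add: boundary_form_def)
qed

lemma boundary_energy_eq: "boundary_energy \<Omega> u = boundary_form u u"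
  by (simp add: boundary_energy_def boundary_form_def l2ip_self l2norm_sq)

lemma green_form_boundary:
  assumes "u \<in> H0_Delta \<Omega>" "smooth \<phi>"
  shows "green_form u \<phi> = l2ip \<sigma> \<phi> (D u)"
  using has_D[OF assms(1)] has_trace_classical[OF smooth_Ck[OF assms(2)]] by (simp add: has_normal_derivative_iff)

lemma green_form_zero:
  assumes u: "u \<in> H0_Delta \<Omega>" and z: "boundary_form u u = 0" and s: "smooth \<phi>"
  shows "green_form u \<phi> = 0"
proof -
  have "l2norm \<sigma> (D u) = 0" using z by (simp add: boundary_form_def l2ip_self)
  then show ?thesis
    using l2_Cauchy_Schwarz[OF continuous_L2_\<sigma>[OF smooth_continuous[OF s]] D_L2[OF u]]
    by (simp add: green_form_boundary[OF u s])
qed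

lemma boundary_form_test:
  assumes v: "v \<in> Cc_infinity \<Omega>"
  shows "boundary_form v v = 0"
proof -
  have "AE x in \<sigma>. D v x = 0"
    by (rule normal_derivative_unique[OF has_D[OF test_H0_Delta[OF v]] has_normal_derivative_test[OF v]])
  then show ?thesis
    unfolding boundary_form_def l2ip_def by (intro integral_eq_zero_AE) (auto elim: eventually_mono)
qed

lemma boundary_form_compact:
  assumes u: "\<And>n::nat. u n \<in> H0_Delta \<Omega> \<and> inner_Delta \<Omega> (u n) (u n) \<le> 1"
  shows "\<exists>r. strict_mono (r :: nat \<Rightarrow> nat) \<and> (\<forall>e>0. \<exists>N. \<forall>i\<ge>N. \<forall>j\<ge>N.
     boundary_form (\<lambda>x. u (r i) x - u (r j) x) (\<lambda>x. u (r i) x - u (r j) x) < e)"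
proof -
  have "\<forall>n. u n \<in> H0_Delta \<Omega> \<and> norm_Delta \<Omega> (u n) \<le> 1" using u by (simp add: norm_Delta_def)
  then obtain r d where r: "strict_mono (r :: nat \<Rightarrow> nat)" and d: "d \<in> L2 \<sigma>"
    and lim: "(\<lambda>n. \<integral>x. (D (u (r n)) x - d x)\<^sup>2 \<partial>\<sigma>) \<longlonglongrightarrow> 0"
    using B2 unfolding B2_def by blast
  have uV: "u n \<in> H0_Delta \<Omega>" for n using u by blast
  have "(\<lambda>n. sqrt (\<integral>x. (D (u (r n)) x - d x)\<^sup>2 \<partial>\<sigma>)) \<longlonglongrightarrow> sqrt 0" by (intro tendsto_intros lim)
  then have lim': "(\<lambda>n. l2norm \<sigma> (\<lambda>x. D (u (r n)) x - d x)) \<longlonglongrightarrow> 0" by (simp add: l2norm_def)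
  have "\<exists>N. \<forall>i\<ge>N. \<forall>j\<ge>N. boundary_form (\<lambda>x. u (r i) x - u (r j) x) (\<lambda>x. u (r i) x - u (r j) x) < e" if e: "e > 0" for e
  proof -
    have "sqrt e > 0" using e by simp
    from l2_Cauchy_of_convergent[OF D_L2[OF uV] d lim' this] obtain N
      where N: "\<And>i j. i \<ge> N \<Longrightarrow> j \<ge> N \<Longrightarrow> l2norm \<sigma> (\<lambda>x. D (u (r i)) x - D (u (r j)) x) < sqrt e" by blast
    have "boundary_form (\<lambda>x. u (r i) x - u (r j) x) (\<lambda>x. u (r i) x - u (r j) x) < e" if ij: "i \<ge> N" "j \<ge> N" for i j
    proof -
      have dV: "(\<lambda>x. u (r i) x - u (r j) x) \<in> H0_Delta \<Omega>" by (rule H0_Delta_diff[OF uV uV])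
      have "AE x in \<sigma>. D (\<lambda>x. u (r i) x - u (r j) x) x = D (u (r i)) x - D (u (r j)) x"
        using D_lincomb[OF uV uV, of "r i" "-1" "r j"] by simp
      then have "l2norm \<sigma> (D (\<lambda>x. u (r i) x - u (r j) x)) = l2norm \<sigma> (\<lambda>x. D (u (r i)) x - D (u (r j)) x)"
        by (intro l2norm_cong_AE L2_measurable D_L2 dV L2_diff uV)
      then have "(l2norm \<sigma> (D (\<lambda>x. u (r i) x - u (r j) x)))\<^sup>2 < (sqrt e)\<^sup>2"
        using N[OF ij] by (intro power_strict_mono) auto
      then show ?thesis using e by (simp add: boundary_form_def l2ip_self)
    qed
    then show ?thesis by blast
  qed
  then show ?thesis using r by blast
qed

lemma spectral_pair:
  assumes dim: "DIM('a) \<ge> 2" and alg: "DBS_algorithm \<Omega> b"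
  shows "spectral_pair (H0_Delta \<Omega>) (inner_Delta \<Omega>) boundary_form b"
proof -
  interpret A: psd_form "H0_Delta \<Omega>" "inner_Delta \<Omega>" by (rule psd_form_inner_Delta)
  interpret M: psd_form "H0_Delta \<Omega>" boundary_form by (rule psd_form_boundary_form)
  have cons: "u \<in> DBS_constraint \<Omega> b k \<longleftrightarrow> u \<in> H0_Delta \<Omega> \<and> inner_Delta \<Omega> u u \<le> 1 \<and> (\<forall>j\<in>{1..<k}. inner_Delta \<Omega> u (b j) = 0)" for u k
    by (simp add: DBS_constraint_def norm_Delta_def)
  have bV: "b k \<in> H0_Delta \<Omega>" if "k \<ge> 1" for k using alg that unfolding DBS_algorithm_def cons by blast
  show ?thesis
  proof
    fix k :: nat assume k: "k \<ge> 1"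
    show "b k \<in> H0_Delta \<Omega> \<and> inner_Delta \<Omega> (b k) (b k) \<le> 1 \<and> (\<forall>j\<in>{1..<k}. inner_Delta \<Omega> (b k) (b j) = 0)"
      using alg k unfolding DBS_algorithm_def cons by blast
    fix u assume "u \<in> H0_Delta \<Omega>" "inner_Delta \<Omega> u u \<le> 1" "\<And>j. j \<in> {1..<k} \<Longrightarrow> inner_Delta \<Omega> u (b j) = 0"
    then have "u \<in> DBS_constraint \<Omega> b k" by (simp add: cons)
    then show "boundary_form u u \<le> boundary_form (b k) (b k)"
      using alg k unfolding DBS_algorithm_def boundary_energy_eq by blast
  next
    fix n :: nat
    have ne: "\<Omega> \<noteq> {}" using region by (simp add: region_def)
    have "b j \<in> H0_Delta \<Omega>" if "j \<in> {1..n}" for j using bV that by simp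
    then obtain u \<phi> where u: "u \<in> H0_Delta \<Omega>" "\<forall>j\<in>{1..n}. inner_Delta \<Omega> u (b j) = 0" and \<phi>: "smooth \<phi>" "green_form u \<phi> \<noteq> 0"
      using infinite_rank[OF dim ne, of n b] by blast
    then show "\<exists>u\<in>H0_Delta \<Omega>. (\<forall>j\<in>{1..n}. inner_Delta \<Omega> u (b j) = 0) \<and> boundary_form u u \<noteq> 0"
      using green_form_zero by blast
  next
    fix u :: "nat \<Rightarrow> 'a \<Rightarrow> real"
    assume "\<And>n. u n \<in> H0_Delta \<Omega> \<and> inner_Delta \<Omega> (u n) (u n) \<le> 1"
    then show "\<exists>r. strict_mono (r :: nat \<Rightarrow> nat) \<and> (\<forall>e>0. \<exists>N. \<forall>i\<ge>N. \<forall>j\<ge>N.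
       boundary_form (\<lambda>x. u (r i) x - u (r j) x) (\<lambda>x. u (r i) x - u (r j) x) < e)"
      by (rule boundary_form_compact)
  qed
qed

lemma zero_boundary_data:
  assumes w: "w \<in> H0_Delta \<Omega>" and z: "boundary_form w w = 0"
    and biharm: "\<And>v. v \<in> Cc_infinity \<Omega> \<Longrightarrow> inner_Delta \<Omega> w v = 0"
  shows "inner_Delta \<Omega> w w = 0"
  using B1_interior_cone[OF region B1] green_form_zero[OF w z] biharm
  by (intro biharmonic_zero_data w) auto

end

section \<open>Dirichlet biharmonic Steklov eigenfunctions\<close>

context
  fixes \<Omega> :: "'a::euclidean_space set" and b :: "nat \<Rightarrow> 'a \<Rightarrow> real"
  assumes dim: "DIM('a) \<ge> 2" and reg: "region \<Omega>" and B2: "B2 \<Omega>" and alg: "DBS_algorithm \<Omega> b"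
begin

interpretation B2_domain \<Omega>
  using reg B2 by unfold_locales (auto simp: region_def B2_def B1_def)

interpretation S: spectral_pair "H0_Delta \<Omega>" "inner_Delta \<Omega>" boundary_form b
  by (rule spectral_pair[OF dim alg])

lemma DBS_beta_eq:
  assumes k: "k \<ge> 1"
  shows "DBS_beta \<Omega> b k = S.\<beta> k"
proof -
  have "b k \<in> DBS_constraint \<Omega> b k" "\<And>u. u \<in> DBS_constraint \<Omega> b k \<Longrightarrow> boundary_energy \<Omega> u \<le> boundary_energy \<Omega> (b k)"
    using alg k by (auto simp: DBS_algorithm_def)
  then have "DBS_beta \<Omega> b k = boundary_energy \<Omega> (b k)"
    unfolding DBS_beta_def by (intro cSup_eq_maximum) auto
  then show ?thesis by (simp add: boundary_energy_eq S.\<beta>_def)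
qed

lemma DBS_eigenspace_iff:
  "u \<in> DBS_eigenspace \<Omega> q \<longleftrightarrow> u \<in> H0_Delta \<Omega> \<and> (\<forall>v\<in>H0_Delta \<Omega>. inner_Delta \<Omega> u v = q * boundary_form u v)"
  by (simp add: DBS_eigenspace_def boundary_form_def l2ip_def)

lemma DBS_eigenspace_b:
  assumes k: "k \<ge> 1" and q: "q * S.\<beta> k = 1"
  shows "b k \<in> DBS_eigenspace \<Omega> q"
  unfolding DBS_eigenspace_iff
proof (intro conjI ballI S.bV[OF k])
  fix v assume "v \<in> H0_Delta \<Omega>"
  then have "q * boundary_form (b k) v = (q * S.\<beta> k) * inner_Delta \<Omega> (b k) v" by (simp add: S.eigen_equation[OF k])
  then show "inner_Delta \<Omega> (b k) v = q * boundary_form (b k) v" by (simp add: q)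
qed

lemma DBS_eigenpair_b:
  assumes k: "k \<ge> 1"
  shows "DBS_eigenpair \<Omega> (1 / S.\<beta> k) (b k)"
  unfolding DBS_eigenpair_def
proof
  show "b k \<in> DBS_eigenspace \<Omega> (1 / S.\<beta> k)" using S.\<beta>_pos[OF k] by (intro DBS_eigenspace_b[OF k]) simp
  show "\<not> (AE x in lebesgue_on \<Omega>. b k x = 0)" using inner_Delta_AE_zero[of "b k"] S.normalized[OF k] by auto
qed

lemma inj_b: "inj_on b {1..n}"
proof (rule inj_onI)
  fix i j assume ij: "i \<in> {1..n}" "j \<in> {1..n}" "b i = b j"
  show "i = j" using S.orthonormal[of i j] S.orthonormal[of i i] ij by (auto split: if_splits)
qed

text \<open>
  The eigenspace is spanned by the functions \<open>b j\<close> with \<open>q * \<beta> j = 1\<close>.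
\<close>

lemma finite_multiplicity_DBS:
  assumes q: "q > 0"
  shows "finite_multiplicity \<Omega> q"
proof -
  obtain n where n: "\<And>u. u \<in> H0_Delta \<Omega> \<Longrightarrow> (\<forall>v\<in>H0_Delta \<Omega>. inner_Delta \<Omega> u v = q * boundary_form u v) \<Longrightarrow>
     inner_Delta \<Omega> (S.residual n u) (S.residual n u) = 0 \<and> (\<forall>j\<in>{1..n}. q * S.\<beta> j \<noteq> 1 \<longrightarrow> inner_Delta \<Omega> u (b j) = 0)"
    using S.eigenvector_expansion[OF q] by blast
  define J where "J = {j\<in>{1..n}. q * S.\<beta> j = 1}"
  have J: "J \<subseteq> {1..n}" "finite J" by (auto simp: J_def)
  have "\<exists>c :: ('a \<Rightarrow> real) \<Rightarrow> real. AE x in lebesgue_on \<Omega>. u x = (\<Sum>f\<in>b ` J. c f * f x)" if u: "u \<in> DBS_eigenspace \<Omega> q" for u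
  proof (rule exI[of _ "inner_Delta \<Omega> u"])
    have uV: "u \<in> H0_Delta \<Omega>" and e: "\<forall>v\<in>H0_Delta \<Omega>. inner_Delta \<Omega> u v = q * boundary_form u v"
      using u by (auto simp: DBS_eigenspace_iff)
    have "AE x in lebesgue_on \<Omega>. S.residual n u x = 0"
      using n[OF uV e] S.residual(1)[OF uV uV] by (intro H0_Delta_zero) auto
    moreover have "(\<Sum>f\<in>b ` J. inner_Delta \<Omega> u f * f x) = (\<Sum>j=1..n. inner_Delta \<Omega> u (b j) * b j x)" for x
    proof -
      have "(\<Sum>f\<in>b ` J. inner_Delta \<Omega> u f * f x) = (\<Sum>j\<in>J. inner_Delta \<Omega> u (b j) * b j x)"
        using inj_on_subset[OF inj_b J(1)] by (simp add: sum.reindex)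
      also have "\<dots> = (\<Sum>j=1..n. inner_Delta \<Omega> u (b j) * b j x)"
        using n[OF uV e] by (intro sum.mono_neutral_left) (auto simp: J_def)
      finally show ?thesis .
    qed
    ultimately show "AE x in lebesgue_on \<Omega>. u x = (\<Sum>f\<in>b ` J. inner_Delta \<Omega> u f * f x)"
      by (auto simp: S.residual_def elim: eventually_mono)
  qed
  moreover have "b ` J \<subseteq> DBS_eigenspace \<Omega> q" using DBS_eigenspace_b by (auto simp: J_def)
  ultimately show ?thesis unfolding finite_multiplicity_def using J(2) by (intro exI[of _ "b ` J"]) auto
qed

text \<open>
  A test function has zero normal derivative, so the right-hand side of the eigenvalue equation vanishes.
\<close>

lemma b_test_orthogonal:
  assumes k: "k \<ge> 1" and v: "v \<in> Cc_infinity \<Omega>"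
  shows "inner_Delta \<Omega> (b k) v = 0"
proof -
  note vV = test_H0_Delta[OF v]
  have "boundary_form (b k) v = 0"
    using S.M.null_orthogonal[OF vV S.bV[OF k] boundary_form_test[OF v]] S.M.sym[OF vV S.bV[OF k]] by simp
  then show ?thesis using S.eigen_equation[OF k vV] S.\<beta>_pos[OF k] by simp
qed

text \<open>
  The residuals of \<open>u\<close> have a limit \<open>w\<close>.  It is biharmonic since all residuals are, and its normal derivative
  vanishes since those of the residuals tend to 0 and \<open>m\<close> is bounded by a multiple of \<open>a\<close>.  Hence \<open>w\<close> has norm 0.
\<close>

lemma residual_small:
  assumes u: "u \<in> BH \<Omega>" and \<epsilon>: "\<epsilon> > 0"
  shows "\<exists>n. norm_Delta \<Omega> (S.residual n u) < \<epsilon>"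
proof -
  have uV: "u \<in> H0_Delta \<Omega>" using u by (simp add: BH_def)
  let ?r = "\<lambda>n. S.residual n u"
  have rV: "?r n \<in> H0_Delta \<Omega>" for n by (rule S.residual(1)[OF uV uV])
  have "\<exists>N. \<forall>m\<ge>N. \<forall>n\<ge>N. norm_Delta \<Omega> (\<lambda>x. ?r m x - ?r n x) < e" if e: "e > 0" for e
  proof -
    obtain N where N: "\<And>i j. i \<ge> N \<Longrightarrow> j \<ge> N \<Longrightarrow> inner_Delta \<Omega> (\<lambda>x. ?r i x - ?r j x) (\<lambda>x. ?r i x - ?r j x) < e\<^sup>2"
      using S.residual_Cauchy[OF uV, of "e\<^sup>2"] e by auto
    have "norm_Delta \<Omega> (\<lambda>x. ?r i x - ?r j x) < e" if "i \<ge> N" "j \<ge> N" for i j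
      using N[OF that] e unfolding norm_Delta_sq[symmetric] by (intro power2_less_imp_less[of _ e]) auto
    then show ?thesis by blast
  qed
  from H0_Delta_complete[of ?r, OF rV this] obtain w where w: "w \<in> H0_Delta \<Omega>"
    and lim: "(\<lambda>n. norm_Delta \<Omega> (\<lambda>x. ?r n x - w x)) \<longlonglongrightarrow> 0" by blast
  have dV: "(\<lambda>x. ?r n x - w x) \<in> H0_Delta \<Omega>" for n by (rule H0_Delta_diff[OF rV w])
  have lim2: "(\<lambda>n. inner_Delta \<Omega> (\<lambda>x. ?r n x - w x) (\<lambda>x. ?r n x - w x)) \<longlonglongrightarrow> 0"
    using tendsto_power[OF lim, of 2] by (simp add: norm_Delta_sq)
  \<comment> \<open>Stated for an arbitrary form, by expanding the square of \<open>2 * v - u'\<close>.\<close>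
  have double: "F u' u' \<le> 2 * F v v + 2 * F (\<lambda>x. v x - u' x) (\<lambda>x. v x - u' x)"
    if F: "psd_form (H0_Delta \<Omega>) F" and uv: "u' \<in> H0_Delta \<Omega>" "v \<in> H0_Delta \<Omega>" for F u' v
  proof -
    interpret F: psd_form "H0_Delta \<Omega>" F by (rule F)
    have "0 \<le> F (\<lambda>x. 2 * v x - u' x) (\<lambda>x. 2 * v x - u' x)" by (intro F.nonneg F.diff F.cmult uv)
    also have "\<dots> = 4 * F v v - 4 * F v u' + F u' u'"
      using F.square_diff[OF F.cmult[OF uv(2), of 2] uv(1)] F.square_cmult[OF uv(2), of 2] F.cmult_left[OF uv(2,1), of 2]
      by simp
    finally show ?thesis using F.square_diff[OF uv(2,1)] by simp
  qed
  have biharm: "inner_Delta \<Omega> w v = 0" if v: "v \<in> Cc_infinity \<Omega>" for v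
  proof -
    note vV = test_H0_Delta[OF v]
    have "inner_Delta \<Omega> u v = 0" using u Cc_infinity_subset_Cc[OF v] by (auto simp: BH_def)
    then have r0: "inner_Delta \<Omega> (?r n) v = 0" for n
      using S.residual(2)[OF uV vV, of n] b_test_orthogonal[OF _ v] by simp
    have "\<bar>inner_Delta \<Omega> w v\<bar> \<le> norm_Delta \<Omega> (\<lambda>x. ?r n x - w x) * norm_Delta \<Omega> v" for n
      using inner_Delta_Cauchy_Schwarz[OF dV vV, of n] S.A.diff_left[OF rV w vV, of n] r0[of n] by simp
    moreover have "(\<lambda>n. norm_Delta \<Omega> (\<lambda>x. ?r n x - w x) * norm_Delta \<Omega> v) \<longlonglongrightarrow> 0"
      using tendsto_mult_right[OF lim, of "norm_Delta \<Omega> v"] by simp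
    ultimately have "\<bar>inner_Delta \<Omega> w v\<bar> \<le> 0" by (intro LIMSEQ_le_const) auto
    then show ?thesis by simp
  qed
  have "boundary_form w w \<le> 2 * boundary_form (?r n) (?r n) + 2 * (S.\<beta> 1 * inner_Delta \<Omega> (\<lambda>x. ?r n x - w x) (\<lambda>x. ?r n x - w x))" for n
    using double[OF psd_form_boundary_form w rV, of n] S.boundary_bound[OF dV, of n] by linarith
  moreover have "(\<lambda>n. 2 * boundary_form (?r n) (?r n) + 2 * (S.\<beta> 1 * inner_Delta \<Omega> (\<lambda>x. ?r n x - w x) (\<lambda>x. ?r n x - w x))) \<longlonglongrightarrow> 2 * 0 + 2 * (S.\<beta> 1 * 0)"
    by (intro tendsto_intros S.residual_boundary_tendsto_0[OF uV] lim2)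
  ultimately have "boundary_form w w \<le> 2 * 0 + 2 * (S.\<beta> 1 * 0)" by (intro LIMSEQ_le_const) auto
  then have "boundary_form w w = 0" using S.M.nonneg[OF w] by simp
  then have w0: "inner_Delta \<Omega> w w = 0" using w biharm by (intro zero_boundary_data)
  have "norm_Delta \<Omega> (?r n) = norm_Delta \<Omega> (\<lambda>x. ?r n x - w x)" for n
  proof -
    have "inner_Delta \<Omega> (?r n) w = 0" using S.A.null_orthogonal[OF w rV w0, of n] S.A.sym[OF w rV, of n] by simp
    then have "inner_Delta \<Omega> (\<lambda>x. ?r n x - w x) (\<lambda>x. ?r n x - w x) = inner_Delta \<Omega> (?r n) (?r n)"
      using S.A.square_diff[OF rV w, of n] w0 by simp
    then show ?thesis by (simp add: norm_Delta_def)
  qed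
  then have "(\<lambda>n. norm_Delta \<Omega> (?r n)) \<longlonglongrightarrow> 0" using lim by simp
  then have "\<forall>\<^sub>F n in sequentially. norm_Delta \<Omega> (?r n) < \<epsilon>" using \<epsilon> by (auto dest: order_tendstoD(2))
  then show ?thesis using eventually_happens trivial_limit_sequentially by blast
qed

lemma DBS_spectral_theorem:
  "(\<forall>k\<ge>1. DBS_eigenpair \<Omega> (1 / DBS_beta \<Omega> b k) (b k) \<and> finite_multiplicity \<Omega> (1 / DBS_beta \<Omega> b k)) \<and>
   (\<forall>j\<ge>1. 1 / DBS_beta \<Omega> b j \<le> 1 / DBS_beta \<Omega> b (Suc j)) \<and>
   filterlim (\<lambda>k. 1 / DBS_beta \<Omega> b k) at_top sequentially \<and>
   Delta_orthonormal_basis \<Omega> b (BH \<Omega>)"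
proof (intro conjI allI impI)
  fix k :: nat assume k: "k \<ge> 1"
  show "DBS_eigenpair \<Omega> (1 / DBS_beta \<Omega> b k) (b k)" unfolding DBS_beta_eq[OF k] by (rule DBS_eigenpair_b[OF k])
  show "finite_multiplicity \<Omega> (1 / DBS_beta \<Omega> b k)"
    unfolding DBS_beta_eq[OF k] using S.\<beta>_pos[OF k] by (intro finite_multiplicity_DBS) simp
  show "1 / DBS_beta \<Omega> b k \<le> 1 / DBS_beta \<Omega> b (Suc k)"
    using k S.\<beta>_pos[of "Suc k"] S.\<beta>_decreasing[of k "Suc k"] by (simp add: DBS_beta_eq frac_le)
next
  have "filterlim S.\<beta> (at_right 0) sequentially"
  proof (rule tendsto_imp_filterlim_at_right[OF S.\<beta>_tendsto_0])
    show "\<forall>\<^sub>F k in sequentially. 0 < S.\<beta> k" using eventually_ge_at_top[of 1] by (rule eventually_mono) (rule S.\<beta>_pos)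
  qed
  then have "filterlim (\<lambda>k. inverse (S.\<beta> k)) at_top sequentially"
    by (rule filterlim_compose[OF filterlim_inverse_at_top_right])
  then show "filterlim (\<lambda>k. 1 / DBS_beta \<Omega> b k) at_top sequentially"
  proof (rule filterlim_mono_eventually[OF _ order_refl order_refl])
    show "\<forall>\<^sub>F k in sequentially. inverse (S.\<beta> k) = 1 / DBS_beta \<Omega> b k"
      using eventually_ge_at_top[of 1] by (rule eventually_mono) (simp add: DBS_beta_eq inverse_eq_divide)
  qed
next
  show "Delta_orthonormal_basis \<Omega> b (BH \<Omega>)"
    unfolding Delta_orthonormal_basis_def
  proof (intro conjI allI impI ballI)
    show "b k \<in> BH \<Omega>" if "k \<ge> 1" for k using S.bV[OF that] b_test_orthogonal[OF that] by (rule BH_I)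
    show "inner_Delta \<Omega> (b j) (b k) = (if j = k then 1 else 0)" if "j \<ge> 1" "k \<ge> 1" for j k
      using that by (rule S.orthonormal)
    fix u :: "'a \<Rightarrow> real" and \<epsilon> :: real assume "u \<in> BH \<Omega>" "\<epsilon> > 0"
    then obtain n where "norm_Delta \<Omega> (S.residual n u) < \<epsilon>" using residual_small by blast
    then have "norm_Delta \<Omega> (\<lambda>x. u x - (\<Sum>k=1..n. inner_Delta \<Omega> u (b k) * b k x)) < \<epsilon>"
      unfolding S.residual_def[abs_def] .
    then have "\<exists>c. norm_Delta \<Omega> (\<lambda>x. u x - (\<Sum>k=1..n. c k * b k x)) < \<epsilon>"
      by (rule exI[of "\<lambda>c. norm_Delta \<Omega> (\<lambda>x. u x - (\<Sum>k=1..n. c k * b k x)) < \<epsilon>"])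
    then show "\<exists>n c. norm_Delta \<Omega> (\<lambda>x. u x - (\<Sum>k=1..n. c k * b k x)) < \<epsilon>" by (rule exI)
  qed
qed

end

theorem theorem5p3:
  fixes \<Omega> :: "'a::euclidean_space set"
    and b :: "nat \<Rightarrow> 'a \<Rightarrow> real"
    and q :: "nat \<Rightarrow> real"
  assumes "DIM('a) \<ge> 2"
    and "region \<Omega>"
    and "B2 \<Omega>"
    and "DBS_algorithm \<Omega> b"
    and "\<And>k. k \<ge> 1 \<Longrightarrow> q k = 1 / DBS_beta \<Omega> b k"
  shows "(\<forall>k\<ge>1. DBS_eigenpair \<Omega> (q k) (b k) \<and> finite_multiplicity \<Omega> (q k)) \<and>
         (\<forall>j\<ge>1. q j \<le> q (Suc j)) \<and>
         filterlim q at_top sequentially \<and>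
         Delta_orthonormal_basis \<Omega> b (BH \<Omega>)"
proof -
  note main = DBS_spectral_theorem[OF assms(1-4)]
  have "filterlim q at_top sequentially"
  proof (rule filterlim_mono_eventually[OF _ order_refl order_refl])
    show "filterlim (\<lambda>k. 1 / DBS_beta \<Omega> b k) at_top sequentially" using main by blast
    show "\<forall>\<^sub>F k in sequentially. 1 / DBS_beta \<Omega> b k = q k"
      using eventually_ge_at_top[of 1] by (rule eventually_mono) (simp add: assms(5))
  qed
  then show ?thesis using main assms(5) by simp
qed

end
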